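(* Let $X(w)$ be a determinantal Schubert variety in $G_{d,N}$, i.e. $w=(t+1,\dots,d,N-t+1,\dots,N)$ for some integer $t$ with $1\le t<\min(d,N-d)$. Then $X(w)$ is a spherical $L_w$-variety.
   Context: Everything is over $\mathbb{C}$; $d,N$ are positive integers with $d<N$. $G_{d,N}$ is the Grassmannian of $d$-dimensional subspaces of $\mathbb{C}^N$ with its left $GL_N$-action, embedded in $\mathbb{P}(\bigwedge^d\mathbb{C}^N)$ by the Plücker embedding. $B\subset GL_N$ is the group of upper triangular matrices. For $w=(\ell_1<\dots<\ell_d)$ with $1\le\ell_1$, $\ell_d\le N$, the Schubert variety is $X(w)=\overline{B[e_{\ell_1}\wedge\cdots\wedge e_{\ell_d}]}$ with reduced structure. $Q_w\supseteq B$ is the stabilizer of $X(w)$ in $GL_N$ under left multiplication, a parabolic subgroup, and $L_w$ is its Levi part (the block diagonal Levi subgroup containing the diagonal torus). For a connected reductive group $G$ with Borel subgroup $B_G$, an irreducible $G$-variety is a spherical $G$-variety if it is normal and has an open dense $B_G$-orbit. *)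

theory Defs
  imports
    "HOL-Analysis.Abstract_Topology"
    "HOL-Algebra.Solvable_Groups"
    "Jordan_Normal_Form.VS_Connect"
    "Jordan_Normal_Form.DL_Submatrix"
begin

section \<open>Projective varieties\<close>

text \<open>Coordinates are indexed by a set \<open>I\<close>. Over the infinite field of complex numbers a
  (homogeneous) polynomial may be identified with the function it defines. The zero function is
  homogeneous of every degree if \<open>I\<close> is nonempty.\<close>

inductive hom_poly :: "'i set \<Rightarrow> nat \<Rightarrow> (('i \<Rightarrow> complex) \<Rightarrow> complex) \<Rightarrow> bool"
  for I :: "'i set" where
  const: "hom_poly I 0 (\<lambda>_. c)"
| coord: "i \<in> I \<Longrightarrow> hom_poly I 1 (\<lambda>x. x i)"
| add: "hom_poly I k f \<Longrightarrow> hom_poly I k g \<Longrightarrow> hom_poly I k (\<lambda>x. f x + g x)"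
| mult: "hom_poly I k f \<Longrightarrow> hom_poly I l g \<Longrightarrow> hom_poly I (k + l) (\<lambda>x. f x * g x)"

text \<open>A point of projective space is the set of all its homogeneous coordinate vectors;
  vectors are extended by zero outside \<open>I\<close>.\<close>

definition proj_point :: "('i \<Rightarrow> complex) \<Rightarrow> ('i \<Rightarrow> complex) set" where
  "proj_point x = {(\<lambda>i. c * x i) | c. c \<noteq> 0}"

definition proj_space :: "'i set \<Rightarrow> ('i \<Rightarrow> complex) set set" where
  "proj_space I = {proj_point x | x. (\<forall>i. i \<notin> I \<longrightarrow> x i = 0) \<and> (\<exists>i\<in>I. x i \<noteq> 0)}"

definition zariski_proj :: "'i set \<Rightarrow> ('i \<Rightarrow> complex) set topology" where
  "zariski_proj I = topology_generated_by
     {{p \<in> proj_space I. \<exists>x\<in>p. f x \<noteq> 0} | f k. hom_poly I k f}"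

definition irreducible_in :: "'a topology \<Rightarrow> 'a set \<Rightarrow> bool" where
  "irreducible_in T S \<longleftrightarrow> S \<subseteq> topspace T \<and> S \<noteq> {} \<and>
     (\<forall>C D. closedin T C \<and> closedin T D \<and> S \<subseteq> C \<union> D \<longrightarrow> S \<subseteq> C \<or> S \<subseteq> D)"

text \<open>An irreducible locally closed subset of projective space (with its reduced structure).\<close>

definition quasi_projective_variety :: "'i set \<Rightarrow> ('i \<Rightarrow> complex) set set \<Rightarrow> bool" where
  "quasi_projective_variety I X \<longleftrightarrow> irreducible_in (zariski_proj I) X \<and>
     openin (subtopology (zariski_proj I) (zariski_proj I closure_of X)) X"

definition regular_on ::
  "'i set \<Rightarrow> ('i \<Rightarrow> complex) set set \<Rightarrow> ('i \<Rightarrow> complex) set set \<Rightarrow> (('i \<Rightarrow> complex) set \<Rightarrow> complex) \<Rightarrow> bool"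
where
  "regular_on I X U f \<longleftrightarrow> openin (subtopology (zariski_proj I) X) U \<and>
     (\<forall>p\<in>U. \<exists>W k g h. hom_poly I k g \<and> hom_poly I k h \<and>
        openin (subtopology (zariski_proj I) X) W \<and> p \<in> W \<and> W \<subseteq> U \<and>
        (\<forall>q\<in>W. \<forall>x\<in>q. h x \<noteq> 0 \<and> f q = g x / h x))"

subsection \<open>Local rings and normality\<close>

type_synonym 'i local_section = "('i \<Rightarrow> complex) set set \<times> (('i \<Rightarrow> complex) set \<Rightarrow> complex)"

definition sections_at ::
  "'i set \<Rightarrow> ('i \<Rightarrow> complex) set set \<Rightarrow> ('i \<Rightarrow> complex) set \<Rightarrow> 'i local_section set" where
  "sections_at I X p = {(U, f). p \<in> U \<and> regular_on I X U f}"

definition germ ::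
  "'i set \<Rightarrow> ('i \<Rightarrow> complex) set set \<Rightarrow> ('i \<Rightarrow> complex) set \<Rightarrow> 'i local_section \<Rightarrow> 'i local_section set"
where
  "germ I X p s = {s' \<in> sections_at I X p.
     \<exists>W. openin (subtopology (zariski_proj I) X) W \<and> p \<in> W \<and> W \<subseteq> fst s \<inter> fst s' \<and>
       (\<forall>q\<in>W. snd s q = snd s' q)}"

text \<open>The ring of germs at \<open>p\<close> of regular functions. The unions in the operations are unions of
  one and the same germ, computed from all choices of representatives.\<close>

definition local_ring ::
  "'i set \<Rightarrow> ('i \<Rightarrow> complex) set set \<Rightarrow> ('i \<Rightarrow> complex) set \<Rightarrow> 'i local_section set ring" where
  "local_ring I X p = \<lparr>
     carrier = germ I X p ` sections_at I X p,
     monoid.mult = (\<lambda>a b. \<Union>(U, f)\<in>a. \<Union>(V, g)\<in>b. germ I X p (U \<inter> V, \<lambda>q. f q * g q)),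
     one = germ I X p (X, \<lambda>_. 1),
     zero = germ I X p (X, \<lambda>_. 0),
     add = (\<lambda>a b. \<Union>(U, f)\<in>a. \<Union>(V, g)\<in>b. germ I X p (U \<inter> V, \<lambda>q. f q + g q))\<rparr>"

text \<open>An integral domain integrally closed in its field of fractions: if the fraction \<open>a / b\<close>
  is a root of a monic polynomial with coefficients \<open>c 0, \<dots>, c (n - 1), 1\<close> in \<open>R\<close>, then it
  belongs to \<open>R\<close>. Both equations are multiplied by a power of \<open>b\<close> to clear denominators.\<close>

definition integrally_closed_domain :: "('a, 'b) ring_scheme \<Rightarrow> bool" where
  "integrally_closed_domain R \<longleftrightarrow> domain R \<and>
     (\<forall>a\<in>carrier R. \<forall>b\<in>carrier R - {\<zero>\<^bsub>R\<^esub>}. \<forall>n::nat. \<forall>c\<in>{..<n} \<rightarrow> carrier R.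
        a [^]\<^bsub>R\<^esub> n \<oplus>\<^bsub>R\<^esub> (\<Oplus>\<^bsub>R\<^esub>i\<in>{..<n}. c i \<otimes>\<^bsub>R\<^esub> (a [^]\<^bsub>R\<^esub> i \<otimes>\<^bsub>R\<^esub> b [^]\<^bsub>R\<^esub> (n - i))) = \<zero>\<^bsub>R\<^esub>
        \<longrightarrow> (\<exists>r\<in>carrier R. a = r \<otimes>\<^bsub>R\<^esub> b))"

definition normal_variety :: "'i set \<Rightarrow> ('i \<Rightarrow> complex) set set \<Rightarrow> bool" where
  "normal_variety I X \<longleftrightarrow> quasi_projective_variety I X \<and>
     (\<forall>p\<in>X. integrally_closed_domain (local_ring I X p))"

section \<open>Linear algebraic groups\<close>

text \<open>Rows and columns of matrices are numbered from 0.\<close>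

definition GL :: "nat \<Rightarrow> complex mat monoid" where
  "GL N = units_of (ring_mat TYPE(complex) N ())"

inductive_set mat_polys :: "nat \<Rightarrow> (complex mat \<Rightarrow> complex) set" for N :: nat where
  const: "(\<lambda>_. c) \<in> mat_polys N"
| entry: "i < N \<Longrightarrow> j < N \<Longrightarrow> (\<lambda>A. A $$ (i, j)) \<in> mat_polys N"
| add: "f \<in> mat_polys N \<Longrightarrow> g \<in> mat_polys N \<Longrightarrow> (\<lambda>A. f A + g A) \<in> mat_polys N"
| mult: "f \<in> mat_polys N \<Longrightarrow> g \<in> mat_polys N \<Longrightarrow> (\<lambda>A. f A * g A) \<in> mat_polys N"

text \<open>Allowing the inverse of the determinant as a further function would not change the
  Zariski topology.\<close>

definition zariski_GL :: "nat \<Rightarrow> complex mat topology" where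
  "zariski_GL N = topology_generated_by {{A \<in> carrier (GL N). f A \<noteq> 0} | f. f \<in> mat_polys N}"

definition linear_algebraic_group :: "nat \<Rightarrow> complex mat set \<Rightarrow> bool" where
  "linear_algebraic_group N G \<longleftrightarrow> subgroup G (GL N) \<and> closedin (zariski_GL N) G"

definition connected_algebraic_group :: "nat \<Rightarrow> complex mat set \<Rightarrow> bool" where
  "connected_algebraic_group N G \<longleftrightarrow> linear_algebraic_group N G \<and> connectedin (zariski_GL N) G"

definition unipotent :: "nat \<Rightarrow> complex mat \<Rightarrow> bool" where
  "unipotent N A \<longleftrightarrow> A \<in> carrier_mat N N \<and> (\<exists>k. (A - 1\<^sub>m N) ^\<^sub>m k = 0\<^sub>m N N)"

text \<open>The largest closed connected normal unipotent subgroup, obtained as the union of all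
  of them.\<close>

definition unipotent_radical :: "nat \<Rightarrow> complex mat set \<Rightarrow> complex mat set" where
  "unipotent_radical N G = \<Union>{U. connected_algebraic_group N U \<and>
     normal U ((GL N)\<lparr>carrier := G\<rparr>) \<and> (\<forall>u\<in>U. unipotent N u)}"

definition connected_reductive :: "nat \<Rightarrow> complex mat set \<Rightarrow> bool" where
  "connected_reductive N G \<longleftrightarrow> connected_algebraic_group N G \<and> unipotent_radical N G = {1\<^sub>m N}"

definition connected_solvable_group :: "nat \<Rightarrow> complex mat set \<Rightarrow> bool" where
  "connected_solvable_group N B \<longleftrightarrow>
     connected_algebraic_group N B \<and> solvable ((GL N)\<lparr>carrier := B\<rparr>)"

definition borel_subgroup :: "nat \<Rightarrow> complex mat set \<Rightarrow> complex mat set \<Rightarrow> bool" where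
  "borel_subgroup N G B \<longleftrightarrow> B \<subseteq> G \<and> connected_solvable_group N B \<and>
     (\<forall>B'. connected_solvable_group N B' \<and> B \<subseteq> B' \<and> B' \<subseteq> G \<longrightarrow> B' = B)"

definition upper_triangular_group :: "nat \<Rightarrow> complex mat set" where
  "upper_triangular_group N = {A \<in> carrier (GL N). upper_triangular A}"

definition diagonal_torus :: "nat \<Rightarrow> complex mat set" where
  "diagonal_torus N = {A \<in> carrier (GL N). diagonal_mat A}"

text \<open>\<open>Q\<close> is the semidirect product of \<open>L\<close> and the unipotent radical of \<open>Q\<close>.\<close>

definition levi_subgroup :: "nat \<Rightarrow> complex mat set \<Rightarrow> complex mat set \<Rightarrow> bool" where
  "levi_subgroup N Q L \<longleftrightarrow> linear_algebraic_group N L \<and> L \<subseteq> Q \<and>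
     L \<inter> unipotent_radical N Q = {1\<^sub>m N} \<and>
     Q = {l * u | l u. l \<in> L \<and> u \<in> unipotent_radical N Q}"

text \<open>If \<open>Q\<close> contains the upper triangular matrices, it consists of block upper triangular
  matrices, and the unique Levi subgroup containing the diagonal torus consists of the block
  diagonal matrices in \<open>Q\<close>.\<close>

definition levi_part :: "nat \<Rightarrow> complex mat set \<Rightarrow> complex mat set" where
  "levi_part N Q = (THE L. levi_subgroup N Q L \<and> diagonal_torus N \<subseteq> L)"

section \<open>Algebraic actions and spherical varieties\<close>

definition semihom_polys ::
  "nat \<Rightarrow> 'i set \<Rightarrow> nat \<Rightarrow> (complex mat \<Rightarrow> ('i \<Rightarrow> complex) \<Rightarrow> complex) set" where
  "semihom_polys N I k = {(\<lambda>A x. \<Sum>m<n. a m A * h m x) | (n::nat) a h.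
     (\<forall>m<n. a m \<in> mat_polys N \<and> hom_poly I k (h m))}"

text \<open>The points of \<open>X\<close> are of an arbitrary type; \<open>e\<close> embeds \<open>X\<close> into projective space. The last
  condition says that \<open>(A, p) \<mapsto> act A p\<close> is a morphism of varieties: locally it is given by
  functions, homogeneous of a common degree in the coordinates of \<open>p\<close>, without common zero.
  Negative powers of the determinant can be cleared in homogeneous coordinates.\<close>

definition algebraic_action ::
  "nat \<Rightarrow> complex mat set \<Rightarrow> 'i set \<Rightarrow> ('p \<Rightarrow> ('i \<Rightarrow> complex) set) \<Rightarrow>
   (complex mat \<Rightarrow> 'p \<Rightarrow> 'p) \<Rightarrow> 'p set \<Rightarrow> bool"
where
  "algebraic_action N G I e act X \<longleftrightarrow>
     (\<forall>A\<in>G. \<forall>p\<in>X. act A p \<in> X) \<and>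
     (\<forall>p\<in>X. act (1\<^sub>m N) p = p) \<and>
     (\<forall>A\<in>G. \<forall>B\<in>G. \<forall>p\<in>X. act (A * B) p = act A (act B p)) \<and>
     (\<forall>A\<^sub>0\<in>G. \<forall>p\<^sub>0\<in>X. \<exists>k F.
        (\<forall>i\<in>I. (\<lambda>A x. F A x i) \<in> semihom_polys N I k) \<and>
        (\<forall>i. i \<notin> I \<longrightarrow> (\<forall>A x. F A x i = 0)) \<and>
        (\<exists>x\<in>e p\<^sub>0. \<exists>i\<in>I. F A\<^sub>0 x i \<noteq> 0) \<and>
        (\<forall>A\<in>G. \<forall>p\<in>X. \<forall>x\<in>e p. (\<exists>i\<in>I. F A x i \<noteq> 0) \<longrightarrow> e (act A p) = proj_point (F A x)))"

text \<open>All Borel subgroups of \<open>G\<close> are conjugate, so it does not matter which one is used.\<close>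

definition spherical_variety ::
  "nat \<Rightarrow> complex mat set \<Rightarrow> 'i set \<Rightarrow> ('p \<Rightarrow> ('i \<Rightarrow> complex) set) \<Rightarrow>
   (complex mat \<Rightarrow> 'p \<Rightarrow> 'p) \<Rightarrow> 'p set \<Rightarrow> bool"
where
  "spherical_variety N G I e act X \<longleftrightarrow>
     connected_reductive N G \<and>
     inj_on e X \<and> quasi_projective_variety I (e ` X) \<and>
     algebraic_action N G I e act X \<and>
     normal_variety I (e ` X) \<and>
     (\<exists>B. borel_subgroup N G B \<and>
        (\<exists>p\<in>X. let orb = (\<lambda>b. act b p) ` B; T = subtopology (zariski_proj I) (e ` X)
               in openin T (e ` orb) \<and> T closure_of (e ` orb) = e ` X))"

section \<open>Grassmannians and Schubert varieties\<close>

definition subspace_vs :: "nat \<Rightarrow> complex vec set \<Rightarrow> (complex, complex vec) module" where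
  "subspace_vs N V = (module_vec TYPE(complex) N)\<lparr>carrier := V\<rparr>"

definition grassmannian :: "nat \<Rightarrow> nat \<Rightarrow> complex vec set set" where
  "grassmannian d N = {V. VectorSpace.subspace class_ring V (module_vec TYPE(complex) N) \<and>
     vectorspace.dim class_ring (subspace_vs N V) = d}"

definition plucker_index :: "nat \<Rightarrow> nat \<Rightarrow> nat set set" where
  "plucker_index d N = {J. J \<subseteq> {..<N} \<and> card J = d}"

text \<open>Coordinates of the exterior product of a list of vectors of dimension \<open>N\<close>, with respect to
  the basis of exterior products of standard basis vectors.\<close>

definition wedge :: "nat \<Rightarrow> complex vec list \<Rightarrow> nat set \<Rightarrow> complex" where
  "wedge N vs = (\<lambda>J. if J \<in> plucker_index (length vs) N
     then det (submatrix (mat_of_cols N vs) J UNIV) else 0)"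

text \<open>The exterior products of all ordered bases of a nonzero subspace form a single point of
  projective space.\<close>

definition plucker :: "nat \<Rightarrow> complex vec set \<Rightarrow> (nat set \<Rightarrow> complex) set" where
  "plucker N V = {wedge N vs | vs. distinct vs \<and>
     vectorspace.basis class_ring (subspace_vs N V) (set vs)}"

definition zariski_grassmannian :: "nat \<Rightarrow> nat \<Rightarrow> complex vec set topology" where
  "zariski_grassmannian d N =
     pullback_topology (grassmannian d N) (plucker N) (zariski_proj (plucker_index d N))"

definition mat_act :: "complex mat \<Rightarrow> complex vec set \<Rightarrow> complex vec set" where
  "mat_act A V = (\<lambda>v. A *\<^sub>v v) ` V"

text \<open>The list \<open>w\<close> is strictly increasing with entries between 1 and \<open>N\<close>; its entry \<open>l\<close> stands
  for the basis vector number \<open>l - 1\<close> when counting from 0.\<close>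

definition coordinate_subspace :: "nat \<Rightarrow> nat list \<Rightarrow> complex vec set" where
  "coordinate_subspace N w = LinearCombinations.module.span class_ring (module_vec TYPE(complex) N)
     ((\<lambda>l. unit_vec N (l - 1)) ` set w)"

definition schubert_variety :: "nat \<Rightarrow> nat list \<Rightarrow> complex vec set set" where
  "schubert_variety N w = zariski_grassmannian (length w) N closure_of
     ((\<lambda>b. mat_act b (coordinate_subspace N w)) ` upper_triangular_group N)"

definition schubert_stabilizer :: "nat \<Rightarrow> nat list \<Rightarrow> complex mat set" where
  "schubert_stabilizer N w =
     {A \<in> carrier (GL N). mat_act A ` schubert_variety N w = schubert_variety N w}"

end

theory Submission
  imports Defs "HOL-Computational_Algebra.Field_as_Ring" "Jordan_Normal_Form.Schur_Decomposition"
begin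

text \<open>Let \<open>m = N - d\<close>. A \<open>d\<close>-dimensional subspace is the column space of a matrix \<open>M\<close> of full rank with \<open>N\<close>
rows and \<open>d\<close> columns. The variety \<open>X(w)\<close> consists of the column spaces of those \<open>M\<close> whose last \<open>m\<close> rows form a
matrix of rank at most \<open>t\<close>, that is, a product of an \<open>m \<times> t\<close> matrix and a \<open>t \<times> d\<close> matrix. So \<open>X(w)\<close> is the
image of an affine space, and near each point it is a determinantal variety times an affine space. Everything
below is derived from this description, \<open>detvar\<close>.

\<^bold>\<open>Normality.\<close> A fraction that is integral over a local ring of \<open>X(w)\<close> pulls back to a fraction on the
affine space, and becomes a polynomial after multiplication with a denominator, because polynomial rings are
integrally closed. This polynomial is invariant under the general linear group acting on the two factors of the product, so by
the first fundamental theorem of invariant theory it is a polynomial in the entries of \<open>M\<close>. These entries are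
quotients of Pluecker coordinates, hence the fraction is regular. The first fundamental theorem is proved with the
Fischer inner product on polynomials, for which partial derivatives are adjoint to multiplications: an
invariant orthogonal to all polynomials in the entries of the product is annihilated by the adjoint operators, and an
identity of Capelli type shows that it is constant.

\<^bold>\<open>Groups.\<close> The stabilizer of \<open>X(w)\<close> is the group of block upper triangular matrices. Its unipotent radical
consists of the matrices with identity blocks on the diagonal, and its Levi part of the block diagonal matrices:
an entry of an element \<open>u\<close> of a normal unipotent subgroup vanishes because its square is a difference of traces of unipotent
matrices. The upper triangular block diagonal matrices form a Borel subgroup, since each larger subgroup of the Levi part
contains both root subgroups of an \<open>SL\<^sub>2\<close> and is not solvable.

\<^bold>\<open>The open orbit.\<close> A matrix of rank at most \<open>t\<close> whose first \<open>t\<close> corner minors, starting in the lower left corner,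
do not vanish has a triangular factorization. So the points of \<open>X(w)\<close> where these minors and the first Pluecker
coordinate do not vanish form a single orbit of the Borel subgroup. The orbit is open, and it is dense because \<open>X(w)\<close> is
irreducible. It also lies in the orbit of the upper triangular group that defines \<open>X(w)\<close>, so this orbit
is dense in \<open>detvar\<close>.\<close>

section \<open>Polynomial functions\<close>

text \<open>Over an infinite field a polynomial is determined by its values, so that functions take the place of polynomials in
several variables.\<close>

inductive poly_fun :: "'v set => (('v => complex) => complex) => bool" for I :: "'v set" where
  const: "poly_fun I (%_. c)"
| coord: "i \<in> I ==> poly_fun I (%x. x i)"
| add: "poly_fun I f ==> poly_fun I g ==> poly_fun I (%x. f x + g x)"
| mult: "poly_fun I f ==> poly_fun I g ==> poly_fun I (%x. f x * g x)"

lemma poly_fun_uminus: "poly_fun I f ==> poly_fun I (%x. - f x)"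
  using poly_fun.mult[OF poly_fun.const[of I "-1"], of f] by simp

lemma poly_fun_diff: "poly_fun I f ==> poly_fun I g ==> poly_fun I (%x. f x - g x)"
  using poly_fun.add[OF _ poly_fun_uminus, of I f g] by simp

lemma poly_fun_sum: "(!!a. a \<in> A ==> poly_fun I (f a)) ==> poly_fun I (%x. \<Sum>a\<in>A. f a x)"
  by (induction A rule: infinite_finite_induct) (auto intro: poly_fun.intros)

lemma poly_fun_prod: "(!!a. a \<in> A ==> poly_fun I (f a)) ==> poly_fun I (%x. \<Prod>a\<in>A. f a x)"
  by (induction A rule: infinite_finite_induct) (auto intro: poly_fun.intros)

lemma poly_fun_power: "poly_fun I f ==> poly_fun I (%x. f x ^ n)"
  by (induction n) (auto intro: poly_fun.intros)

lemma poly_fun_compose: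
  assumes "poly_fun I f" and "!!i. i \<in> I ==> poly_fun J (%x. \<phi> x i)"
  shows "poly_fun J (%x. f (\<phi> x))"
  using assms by (induction rule: poly_fun.induct) (auto intro: poly_fun.intros)

lemma poly_fun_cong:
  assumes "poly_fun I f" and "!!i. i \<in> I ==> x i = y i"
  shows "f x = f y"
  using assms by (induction rule: poly_fun.induct) auto

lemma poly_fun_det:
  assumes "!!i j. i < n ==> j < n ==> poly_fun I (%x. f x i j)"
  shows "poly_fun I (%x. det (mat n n (%(i, j). f x i j)))"
proof -
  have "det (mat n n (%(i, j). f x i j)) =
      (\<Sum>p | p permutes {0..<n}. signof p * (\<Prod>i = 0..<n. f x i (p i)))" for x
    by (subst det_def'[of _ n]) (auto intro!: sum.cong prod.cong simp: permutes_in_image)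
  moreover have "poly_fun I (%x. \<Sum>p | p permutes {0..<n}. signof p * (\<Prod>i = 0..<n. f x i (p i)))"
    by (intro poly_fun_sum poly_fun.mult poly_fun.const poly_fun_prod assms)
      (auto simp: permutes_in_image)
  ultimately show ?thesis by simp
qed

lemma hom_poly_imp_poly_fun: "hom_poly I k f ==> poly_fun I f"
  by (induction rule: hom_poly.induct) (auto intro: poly_fun.intros)

lemma hom_poly_scale: "hom_poly I k f ==> f (%i. c * x i) = c ^ k * f x"
  by (induction rule: hom_poly.induct) (auto simp: algebra_simps power_add)

lemma hom_poly_cmult: "hom_poly I k f ==> hom_poly I k (%x. c * f x)"
  using hom_poly.mult[OF hom_poly.const[of I c], of k f] by simp

lemma hom_poly_diff: "hom_poly I k f ==> hom_poly I k g ==> hom_poly I k (%x. f x - g x)"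
  using hom_poly.add[OF _ hom_poly_cmult[of I k g "-1"], of f] by simp

lemma hom_poly_power: "hom_poly I k f ==> hom_poly I (n * k) (%x. f x ^ n)"
proof (induction n)
  case 0 then show ?case using hom_poly.const[of I 1] by simp
next
  case (Suc n) then show ?case using hom_poly.mult[of I k f "n * k"] by simp
qed

lemma hom_poly_zero: assumes "I ~= {}" shows "hom_poly I k (%_. 0)"
proof -
  obtain i where "i \<in> I" using assms by blast
  then show ?thesis using hom_poly_cmult[OF hom_poly_power[OF hom_poly.coord, of i I k], of 0] by simp
qed

lemma hom_poly_sum:
  assumes "I ~= {}" and "!!a. a \<in> A ==> hom_poly I k (f a)"
  shows "hom_poly I k (%x. \<Sum>a\<in>A. f a x)"
  using assms(2) by (induction A rule: infinite_finite_induct)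
    (auto intro: hom_poly.intros hom_poly_zero[OF assms(1)])

lemma hom_poly_prod:
  assumes "finite A" and "!!a. a \<in> A ==> hom_poly I (k a) (f a)"
  shows "hom_poly I (\<Sum>a\<in>A. k a) (%x. \<Prod>a\<in>A. f a x)"
  using assms by (induction A rule: finite_induct) (auto intro: hom_poly.intros)

lemma hom_poly_det:
  assumes "I ~= {}" and "!!i j. i < n ==> j < n ==> hom_poly I k (%x. f x i j)"
  shows "hom_poly I (n * k) (%x. det (mat n n (%(i, j). f x i j)))"
proof -
  have "det (mat n n (%(i, j). f x i j)) =
      (\<Sum>p | p permutes {0..<n}. signof p * (\<Prod>i = 0..<n. f x i (p i)))" for x
    by (subst det_def'[of _ n]) (auto intro!: sum.cong prod.cong simp: permutes_in_image)
  moreover have "hom_poly I (\<Sum>i=0..<n. k)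
      (%x. \<Sum>p | p permutes {0..<n}. signof p * (\<Prod>i = 0..<n. f x i (p i)))"
    by (intro hom_poly_sum hom_poly_cmult hom_poly_prod assms)
      (auto simp: permutes_in_image)
  ultimately show ?thesis by simp
qed

text \<open>Restriction to the lines through a fixed point \<open>u\<close> reduces questions on polynomials in several variables to
polynomials in one variable: the coefficients depend polynomially on the direction, and the degree is bounded.\<close>

lemma poly_fun_line:
  assumes "poly_fun I f"
  obtains F D where "!!v s. poly (F v) s = f (%i. u i + s * v i)"
    and "!!n. poly_fun I (%v. coeff (F v) n)" and "!!v. degree (F v) \<le> D"
proof -
  have "\<exists>F D. (\<forall>v s. poly (F v) s = f (%i. u i + s * v i)) &
      (\<forall>n. poly_fun I (%v. coeff (F v) n)) & (\<forall>v. degree (F v) \<le> D)"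
    using assms
  proof (induction rule: poly_fun.induct)
    case (const c)
    show ?case by (rule exI[of _ "%_. [:c:]"], rule exI[of _ 0]) (auto intro: poly_fun.const)
  next
    case (coord i)
    have "poly_fun I (%v. coeff [:u i, v i:] n)" for n
      using coord by (cases n; cases "n - 1") (auto simp: coeff_pCons intro: poly_fun.intros split: nat.split)
    then show ?case
      by (intro exI[of _ "%v. [:u i, v i:]"] exI[of _ 1]) (auto simp: algebra_simps)
  next
    case (add f g)
    then obtain F D G E where "\<forall>v s. poly (F v) s = f (%i. u i + s * v i)"
      "\<forall>n. poly_fun I (%v. coeff (F v) n)" "\<forall>v. degree (F v) \<le> D"
      "\<forall>v s. poly (G v) s = g (%i. u i + s * v i)"
      "\<forall>n. poly_fun I (%v. coeff (G v) n)" "\<forall>v. degree (G v) \<le> E" by blast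
    then show ?case
      by (intro exI[of _ "%v. F v + G v"] exI[of _ "max D E"])
        (auto intro!: poly_fun.add degree_add_le intro: max.coboundedI1 max.coboundedI2)
  next
    case (mult f g)
    then obtain F D G E where *: "\<forall>v s. poly (F v) s = f (%i. u i + s * v i)"
      "\<forall>n. poly_fun I (%v. coeff (F v) n)" "\<forall>v. degree (F v) \<le> D"
      "\<forall>v s. poly (G v) s = g (%i. u i + s * v i)"
      "\<forall>n. poly_fun I (%v. coeff (G v) n)" "\<forall>v. degree (G v) \<le> E" by blast
    have "degree (F v * G v) \<le> D + E" for v
      using degree_mult_le[of "F v" "G v"] *(3,6) by (meson add_mono le_trans)
    then show ?case using *
      by (intro exI[of _ "%v. F v * G v"] exI[of _ "D + E"])
        (auto intro!: poly_fun_sum poly_fun.mult simp: coeff_mult)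
  qed
  then show ?thesis using that by blast
qed

text \<open>Restrict to the line through \<open>u\<close> and \<open>x\<close>.\<close>

lemma poly_fun_no_zero_divisors:
  assumes f: "poly_fun I f" and g: "poly_fun I g" and "!!x. f x * g x = 0" and "f u ~= 0"
  shows "g x = 0"
proof -
  obtain F where F: "!!v s. poly (F v) s = f (%i. u i + s * v i)"
    by (rule poly_fun_line[OF f, of u]) blast
  obtain G where G: "!!v s. poly (G v) s = g (%i. u i + s * v i)"
    by (rule poly_fun_line[OF g, of u]) blast
  define v where "v = (%i. x i - u i)"
  have "F v * G v = 0" using assms(3) by (intro poly_eqI_degree poly_all_0_iff_0[THEN iffD1]) (simp add: F G)
  moreover have "F v ~= 0" using F[of v 0] assms(4) by auto
  ultimately have "G v = 0" by simp
  then show ?thesis using G[of v 1] by (simp add: v_def)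
qed

text \<open>The ring of polynomials in one variable is integrally closed: divide by the greatest common divisor, then the
equation shows that the remaining denominator divides a power of a coprime numerator.\<close>

lemma integral_imp_dvd:
  fixes p q :: "complex poly"
  assumes "p ^ n + (\<Sum>i<n. e i * p ^ i * q ^ (n - i)) = 0" and "q ~= 0"
  shows "q dvd p"
proof -
  define g where "g = gcd p q"
  have g0: "g ~= 0" using assms(2) by (simp add: g_def)
  obtain p' q' where pq: "p = g * p'" "q = g * q'" and cop: "coprime p' q'"
    using gcd_coprime_exists[of p q] g0 unfolding g_def by (metis mult.commute)
  have "g ^ n * (p' ^ n + (\<Sum>i<n. e i * p' ^ i * q' ^ (n - i))) =
      p ^ n + (\<Sum>i<n. e i * p ^ i * q ^ (n - i))"
  proof -
    have tm: "g ^ n * (e i * p' ^ i * q' ^ (n - i)) = e i * p ^ i * q ^ (n - i)" if "i < n" for i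
    proof -
      have "g ^ n = g ^ i * g ^ (n - i)" using that by (simp flip: power_add)
      then show ?thesis by (simp add: pq power_mult_distrib algebra_simps)
    qed
    have "(\<Sum>i<n. g ^ n * (e i * p' ^ i * q' ^ (n - i))) = (\<Sum>i<n. e i * p ^ i * q ^ (n - i))"
      by (rule sum.cong[OF refl], rule tm) simp
    moreover have "g ^ n * p' ^ n = p ^ n" unfolding pq(1) by (rule power_mult_distrib[symmetric])
    ultimately show ?thesis unfolding distrib_left sum_distrib_left by argo
  qed
  from trans[OF this assms(1)] have *: "p' ^ n + (\<Sum>i<n. e i * p' ^ i * q' ^ (n - i)) = 0"
    unfolding mult_eq_0_iff using power_not_zero[OF g0] by blast
  have "q' dvd (\<Sum>i<n. e i * p' ^ i * q' ^ (n - i))"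
    by (intro dvd_sum dvd_mult dvd_power) auto
  then have dv: "q' dvd p' ^ n"
    unfolding eq_neg_iff_add_eq_0[THEN iffD2, OF *] by (rule dvd_minus_iff[THEN iffD2])
  have "coprime (p' ^ n) q'" using cop by simp
  then have "q' dvd 1" by (rule coprime_common_divisor[OF _ dv dvd_refl])
  then show ?thesis unfolding pq by (rule mult_dvd_mono[OF dvd_refl unit_imp_dvd])
qed

text \<open>On each line through \<open>u\<close> the quotient \<open>a / b\<close> is a polynomial. Its coefficients are given recursively by those of
\<open>a\<close> and \<open>b\<close>, where only the constant coefficient \<open>b u\<close> occurs in a denominator, so they are polynomials in the direction.
The degrees are bounded, and the value at \<open>1\<close> of the polynomial on the line is the required quotient.\<close>

lemma poly_fun_integrally_closed:
  assumes a: "poly_fun I a" and b: "poly_fun I b" and e: "!!i. i < n ==> poly_fun I (e i)"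
    and eq: "!!x. a x ^ n + (\<Sum>i<n. e i x * a x ^ i * b x ^ (n - i)) = 0" and u: "b u ~= 0"
  obtains G where "poly_fun I G" and "!!x. a x = G x * b x"
proof -
  obtain A D where A: "!!v s. poly (A v) s = a (%i. u i + s * v i)"
    "!!n. poly_fun I (%v. coeff (A v) n)" "!!v. degree (A v) \<le> D"
    using poly_fun_line[OF a] by metis
  obtain B D' where B: "!!v s. poly (B v) s = b (%i. u i + s * v i)"
    "!!n. poly_fun I (%v. coeff (B v) n)" "!!v. degree (B v) \<le> D'"
    using poly_fun_line[OF b] by metis
  have "\<exists>E. \<forall>v s. poly (E v) s = e i (%i. u i + s * v i)" if "i < n" for i
    by (rule poly_fun_line[OF e[OF that], of u]) blast
  then obtain E where E: "!!i v s. i < n ==> poly (E i v) s = e i (%i. u i + s * v i)"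
    by metis
  have B0: "coeff (B v) 0 = b u" for v using B(1)[of v 0] by (simp add: poly_0_coeff_0)
  then have Bn0: "B v ~= 0" for v using u by (metis coeff_0)
  have "A v ^ n + (\<Sum>i<n. E i v * A v ^ i * B v ^ (n - i)) = 0" for v
    using eq by (intro poly_all_0_iff_0[THEN iffD1]) (simp add: poly_sum A B E)
  then have "B v dvd A v" for v by (rule integral_imp_dvd[OF _ Bn0])
  then obtain Q where Q: "A v = B v * Q v" for v unfolding dvd_def by metis
  have degQ: "degree (Q v) \<le> D" for v
  proof (cases "Q v = 0")
    case False
    then have "degree (A v) = degree (B v) + degree (Q v)" by (simp add: Q degree_mult_eq Bn0)
    then show ?thesis using A(3)[of v] by linarith
  qed simp
  have polyQ: "poly_fun I (%v. coeff (Q v) j)" for j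
  proof (induction j rule: less_induct)
    case (less j)
    have "coeff (Q v) j = (1 / b u) * (coeff (A v) j - (\<Sum>i<j. coeff (B v) (j - i) * coeff (Q v) i))" for v
    proof -
      have "coeff (A v) j = (\<Sum>i\<le>j. coeff (B v) (j - i) * coeff (Q v) i)"
        unfolding Q mult.commute[of "B v"] coeff_mult by (simp add: mult.commute)
      also have "\<dots> = (\<Sum>i<j. coeff (B v) (j - i) * coeff (Q v) i) + b u * coeff (Q v) j"
        by (simp add: lessThan_Suc_atMost[symmetric] B0)
      finally show ?thesis using u by (simp add: field_simps)
    qed
    moreover have "poly_fun I (%v. (1 / b u) * (coeff (A v) j - (\<Sum>i<j. coeff (B v) (j - i) * coeff (Q v) i)))"
      by (intro poly_fun.mult poly_fun.const poly_fun_diff poly_fun_sum A(2) B(2) less) auto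
    ultimately show ?case by simp
  qed
  define G where "G = (%x. \<Sum>j\<le>D. coeff (Q (%i. x i - u i)) j)"
  have "poly_fun I G" unfolding G_def
    by (intro poly_fun_sum poly_fun_compose[OF polyQ] poly_fun_diff poly_fun.coord poly_fun.const)
  moreover have "a x = G x * b x" for x
  proof -
    define v where "v = (%i. x i - u i)"
    have "poly (Q v) 1 = (\<Sum>j\<le>D. coeff (Q v) j)"
    proof -
      have "poly (Q v) 1 = (\<Sum>j\<le>degree (Q v). coeff (Q v) j)" by (simp add: poly_altdef)
      also have "\<dots> = (\<Sum>j\<le>D. coeff (Q v) j)"
        using degQ[of v] by (intro sum.mono_neutral_left) (auto simp: coeff_eq_0)
      finally show ?thesis .
    qed
    moreover have "poly (A v) 1 = poly (B v) 1 * poly (Q v) 1" by (simp add: Q)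
    ultimately show ?thesis by (simp add: A B G_def v_def)
  qed
  ultimately show ?thesis using that by blast
qed

section \<open>The Fischer inner product\<close>

text \<open>A polynomial is given here by the function that maps an exponent vector to its coefficient; \<open>evalc\<close> evaluates it.
In this form multiplication with a variable (\<open>mulx\<close>) and partial derivatives (\<open>dvx\<close>) are defined on all functions.\<close>

definition coef_poly :: "'v set => (('v => nat) => complex) => bool" where
  "coef_poly I c \<longleftrightarrow> finite {w. c w ~= 0} & (\<forall>w i. c w ~= 0 --> i \<notin> I --> w i = 0)"

definition mulx :: "'v => (('v => nat) => complex) => ('v => nat) => complex" where
  "mulx i c = (%w. if w i = 0 then 0 else c (w(i := w i - 1)))"

definition dvx :: "'v => (('v => nat) => complex) => ('v => nat) => complex" where
  "dvx i c = (%w. of_nat (w i + 1) * c (w(i := w i + 1)))"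

definition fischer :: "'v set => (('v => nat) => complex) => (('v => nat) => complex) => complex" where
  "fischer I c e = (\<Sum>w | c w ~= 0. (\<Prod>i\<in>I. fact (w i)) * c w * cnj (e w))"

definition evalc :: "'v set => (('v => nat) => complex) => ('v => complex) => complex" where
  "evalc I c y = (\<Sum>w | c w ~= 0. c w * (\<Prod>i\<in>I. y i ^ w i))"

definition constc :: "complex => ('v => nat) => complex" where
  "constc k = (%w. if w = (%_. 0) then k else 0)"

lemma coef_polyD: "coef_poly I c ==> c w ~= 0 ==> i \<notin> I ==> w i = 0"
  by (simp add: coef_poly_def)

lemma coef_poly_zero: "coef_poly I (%_. 0)"
  by (simp add: coef_poly_def)

lemma coef_poly_constc: "coef_poly I (constc k)"
  unfolding coef_poly_def constc_def
  by (auto intro: finite_subset[of _ "{%_. 0}"] split: if_splits)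

lemma coef_poly_add:
  assumes "coef_poly I c" "coef_poly I e" shows "coef_poly I (%w. c w + e w)"
proof -
  have "finite {w. c w + e w ~= 0}"
    by (rule finite_subset[of _ "{w. c w ~= 0} \<union> {w. e w ~= 0}"]) (use assms in \<open>auto simp: coef_poly_def\<close>)
  moreover have "w i = 0" if "c w + e w ~= 0" "i \<notin> I" for w i
  proof -
    have "c w ~= 0 \<or> e w ~= 0" using that by auto
    then show ?thesis using assms that(2) unfolding coef_poly_def by blast
  qed
  ultimately show ?thesis by (auto simp: coef_poly_def)
qed

lemma coef_poly_scale: assumes "coef_poly I c" shows "coef_poly I (%w. k * c w)"
  using assms by (auto simp: coef_poly_def elim: finite_subset[rotated])

lemma coef_poly_sum:
  "(!!a. a \<in> A ==> coef_poly I (f a)) ==> coef_poly I (%w. \<Sum>a\<in>A. f a w)"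
  by (induction A rule: infinite_finite_induct) (auto intro: coef_poly_zero coef_poly_add)

lemma support_mulx: "{w. mulx i c w ~= 0} = (%w. w(i := w i + 1)) ` {w. c w ~= 0}"
proof (intro equalityI subsetI)
  fix w assume "w \<in> {w. mulx i c w ~= 0}"
  then have "w i ~= 0" "c (w(i := w i - 1)) ~= 0" by (auto simp: mulx_def split: if_splits)
  then show "w \<in> (%w. w(i := w i + 1)) ` {w. c w ~= 0}"
    by (intro image_eqI[of _ _ "w(i := w i - 1)"]) auto
qed (auto simp: mulx_def)

lemma inj_shift: "inj_on (%w :: 'v => nat. w(i := w i + 1)) S"
proof (rule inj_onI)
  fix w \<beta> :: "'v => nat" assume *: "w(i := w i + 1) = \<beta>(i := \<beta> i + 1)"
  show "w = \<beta>"
  proof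
    fix j show "w j = \<beta> j" using fun_cong[OF *, of j] by (auto split: if_splits)
  qed
qed

lemma coef_poly_mulx: assumes "coef_poly I c" "i \<in> I" shows "coef_poly I (mulx i c)"
  unfolding coef_poly_def
proof (intro conjI allI impI)
  show "finite {w. mulx i c w ~= 0}"
    unfolding support_mulx using assms by (auto simp: coef_poly_def)
  fix w j assume "mulx i c w ~= 0" "j \<notin> I"
  then have "c (w(i := w i - 1)) ~= 0" by (auto simp: mulx_def split: if_splits)
  then have "(w(i := w i - 1)) j = 0" by (rule coef_polyD[OF assms(1) _ \<open>j \<notin> I\<close>])
  then show "w j = 0" using assms(2) \<open>j \<notin> I\<close> by (auto split: if_splits)
qed

lemma coef_poly_dvx: assumes "coef_poly I c" "i \<in> I" shows "coef_poly I (dvx i c)"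
  unfolding coef_poly_def
proof (intro conjI allI impI)
  have sub: "(%w. w(i := w i + 1)) ` {w. dvx i c w ~= 0} \<subseteq> {w. c w ~= 0}"
    by (auto simp: dvx_def)
  have "finite {w. c w ~= 0}" using assms(1) by (simp add: coef_poly_def)
  then show "finite {w. dvx i c w ~= 0}" by (rule inj_on_finite[OF inj_shift sub])
  fix w j assume "dvx i c w ~= 0" "j \<notin> I"
  then have "c (w(i := w i + 1)) ~= 0" by (auto simp: dvx_def)
  then have "(w(i := w i + 1)) j = 0" by (rule coef_polyD[OF assms(1) _ \<open>j \<notin> I\<close>])
  then show "w j = 0" using assms(2) \<open>j \<notin> I\<close> by (auto split: if_splits)
qed

lemmas coef_poly_intros = coef_poly_zero coef_poly_constc coef_poly_add coef_poly_scale coef_poly_sum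
  coef_poly_mulx coef_poly_dvx

lemma mulx_sum: "mulx i (%w. \<Sum>a\<in>A. f a w) = (%w. \<Sum>a\<in>A. mulx i (f a) w)"
  by (auto simp: mulx_def)

lemma dvx_sum: "dvx i (%w. \<Sum>a\<in>A. f a w) = (%w. \<Sum>a\<in>A. dvx i (f a) w)"
  by (auto simp: dvx_def sum_distrib_left)

lemma mulx_add: "mulx i (%w. c w + e w) = (%w. mulx i c w + mulx i e w)"
  by (auto simp: mulx_def)

lemma dvx_add: "dvx i (%w. c w + e w) = (%w. dvx i c w + dvx i e w)"
  by (auto simp: dvx_def algebra_simps)

lemma mulx_scale: "mulx i (%w. k * c w) = (%w. k * mulx i c w)"
  by (auto simp: mulx_def)

lemma dvx_scale: "dvx i (%w. k * c w) = (%w. k * dvx i c w)"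
  by (auto simp: dvx_def)

lemma mulx_if_zero: "mulx i (%w. if P then c w else 0) = (%w. if P then mulx i c w else 0)"
  by (auto simp: mulx_def)

lemma mulx_mulx: "mulx i (mulx j c) = mulx j (mulx i c)"
  by (cases "i = j") (auto simp: mulx_def fun_upd_twist)

lemma dvx_dvx: "dvx i (dvx j c) = dvx j (dvx i c)"
  by (cases "i = j") (auto simp: dvx_def fun_upd_twist)

lemma dvx_mulx_same: "dvx i (mulx i c) = (%w. mulx i (dvx i c) w + c w)"
  by (auto simp: mulx_def dvx_def algebra_simps)

lemma dvx_mulx_other: "i ~= j ==> dvx i (mulx j c) = mulx j (dvx i c)"
  by (auto simp: mulx_def dvx_def fun_upd_twist)

lemma dvx_mulx: "dvx i (mulx j c) = (%w. mulx j (dvx i c) w + (if i = j then c w else 0))"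
  by (cases "i = j") (auto simp: dvx_mulx_same dvx_mulx_other)

lemma mulx_dvx_same: "mulx i (dvx i c) w = of_nat (w i) * c w"
  by (auto simp: mulx_def dvx_def)

lemma fischer_superset:
  assumes "finite S" "{w. c w ~= 0} \<subseteq> S"
  shows "fischer I c e = (\<Sum>w\<in>S. (\<Prod>i\<in>I. fact (w i)) * c w * cnj (e w))"
  unfolding fischer_def using assms by (intro sum.mono_neutral_left) auto

lemma fischer_hermitian:
  assumes "coef_poly I c" "coef_poly I e" shows "fischer I e c = cnj (fischer I c e)"
proof -
  let ?S = "{w. c w ~= 0} \<union> {w. e w ~= 0}"
  have "finite ?S" using assms by (auto simp: coef_poly_def)
  then have "fischer I c e = (\<Sum>w\<in>?S. (\<Prod>i\<in>I. fact (w i)) * c w * cnj (e w))"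
    "fischer I e c = (\<Sum>w\<in>?S. (\<Prod>i\<in>I. fact (w i)) * e w * cnj (c w))"
    by (intro fischer_superset; auto)+
  then show ?thesis by (simp add: mult_ac)
qed

lemma fischer_add:
  assumes "coef_poly I c" "coef_poly I c'"
  shows "fischer I (%w. c w + c' w) e = fischer I c e + fischer I c' e"
proof -
  let ?S = "{w. c w ~= 0} \<union> {w. c' w ~= 0}"
  have f: "finite ?S" using assms by (auto simp: coef_poly_def)
  have "fischer I x e = (\<Sum>w\<in>?S. (\<Prod>i\<in>I. fact (w i)) * x w * cnj (e w))"
    if "{w. x w ~= 0} \<subseteq> ?S" for x by (rule fischer_superset[OF f that])
  note eq = this
  have "{w. c w + c' w ~= 0} \<subseteq> ?S" by auto
  from eq[of c, OF Un_upper1] eq[of c', OF Un_upper2] eq[OF this] show ?thesis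
    by (simp only: distrib_right distrib_left sum.distrib)
qed

lemma fischer_scale: "fischer I (%w. k * c w) e = k * fischer I c e"
  by (cases "k = 0") (auto simp: fischer_def sum_distrib_left mult_ac)

lemma fischer_zero [simp]: "fischer I (%_. 0) e = 0" "fischer I c (%_. 0) = 0"
  by (auto simp: fischer_def)

lemma fischer_sum:
  assumes "!!a. a \<in> A ==> coef_poly I (f a)"
  shows "fischer I (%w. \<Sum>a\<in>A. f a w) e = (\<Sum>a\<in>A. fischer I (f a) e)"
  using assms by (induction A rule: infinite_finite_induct) (auto simp: fischer_add coef_poly_sum)

lemma fischer_add_right:
  "fischer I c (%w. e w + e' w) = fischer I c e + fischer I c e'"
  by (simp add: fischer_def distrib_left sum.distrib)

lemma fischer_scale_right: "fischer I c (%w. k * e w) = cnj k * fischer I c e"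
  by (simp add: fischer_def sum_distrib_left mult_ac)

lemma fischer_sum_right:
  "fischer I c (%w. \<Sum>a\<in>A. f a w) = (\<Sum>a\<in>A. fischer I c (f a))"
  by (induction A rule: infinite_finite_induct) (auto simp: fischer_add_right)

lemma fischer_self: "fischer I c c = of_real (\<Sum>w | c w ~= 0. (\<Prod>i\<in>I. fact (w i)) * (cmod (c w))\<^sup>2)"
  by (simp add: fischer_def mult.assoc flip: complex_norm_square)

lemma fischer_self_nonneg: "fischer I c c = of_real (Re (fischer I c c))" "Re (fischer I c c) \<ge> 0"
proof -
  show "fischer I c c = of_real (Re (fischer I c c))" by (simp only: fischer_self Re_complex_of_real)
  show "Re (fischer I c c) \<ge> 0" unfolding fischer_self Re_complex_of_real
    by (intro sum_nonneg mult_nonneg_nonneg prod_nonneg) auto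
qed

lemma fischer_definite:
  assumes "coef_poly I c" "fischer I c c = 0" shows "c = (%_. 0)"
proof (rule ccontr)
  assume "c ~= (%_. 0)"
  then obtain w where w: "c w ~= 0" by auto
  have "(\<Prod>i\<in>I. fact (w i)) * (cmod (c w))\<^sup>2 > (0::real)"
    using w by (intro mult_pos_pos prod_pos) auto
  also have "(\<Prod>i\<in>I. fact (w i)) * (cmod (c w))\<^sup>2 \<le> (\<Sum>w | c w ~= 0. (\<Prod>i\<in>I. fact (w i)) * (cmod (c w))\<^sup>2)"
    using assms(1) w by (intro member_le_sum) (auto simp: coef_poly_def intro!: mult_nonneg_nonneg prod_nonneg)
  finally show False using assms(2) unfolding fischer_self by (simp only: of_real_eq_0_iff)
qed

text \<open>The factorials in the inner product compensate the exponent produced by differentiation.\<close>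

lemma fischer_adjoint:
  assumes "finite I" "i \<in> I"
  shows "fischer I (mulx i c) e = fischer I c (dvx i e)"
proof -
  have f: "(\<Prod>j\<in>I. fact ((w(i := w i + 1)) j)) = of_nat (w i + 1) * (\<Prod>j\<in>I. fact (w j) :: complex)" for w
  proof -
    have "(\<Prod>j\<in>I. fact ((w(i := w i + 1)) j)) = fact (w i + 1) * (\<Prod>j\<in>I - {i}. fact (w j) :: complex)"
      using assms by (simp add: prod.remove[of I i])
    also have "\<dots> = of_nat (w i + 1) * (\<Prod>j\<in>I. fact (w j))"
      using assms by (simp add: prod.remove[of I i])
    finally show ?thesis .
  qed
  have m: "mulx i c (w(i := w i + 1)) = c w" for w by (simp add: mulx_def)
  have "fischer I (mulx i c) e =
      (\<Sum>w | c w ~= 0. (\<Prod>j\<in>I. fact ((w(i := w i + 1)) j)) * mulx i c (w(i := w i + 1)) * cnj (e (w(i := w i + 1))))"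
    unfolding fischer_def support_mulx by (subst sum.reindex[OF inj_shift]) simp
  also have "\<dots> = fischer I c (dvx i e)"
    unfolding fischer_def f m dvx_def by (simp add: mult_ac)
  finally show ?thesis .
qed

lemma fischer_adjoint':
  assumes "finite I" "i \<in> I" "coef_poly I c" "coef_poly I e"
  shows "fischer I (dvx i c) e = fischer I c (mulx i e)"
proof -
  have "fischer I (dvx i c) e = cnj (fischer I e (dvx i c))"
    by (rule fischer_hermitian[OF assms(4) coef_poly_dvx[OF assms(3,2)]])
  also have "\<dots> = cnj (fischer I (mulx i e) c)"
    by (rule arg_cong[OF fischer_adjoint[OF assms(1,2), symmetric]])
  also have "\<dots> = fischer I c (mulx i e)"
    by (rule fischer_hermitian[OF coef_poly_mulx[OF assms(4,2)] assms(3), symmetric])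
  finally show ?thesis .
qed

subsection \<open>Polynomial functions and their coefficients\<close>

lemma coef_poly_induct [consumes 2, case_names const add mulx]:
  assumes "finite I" and "coef_poly I c"
    and const: "!!k. P (constc k)"
    and add: "!!c e. coef_poly I c ==> coef_poly I e ==> P c ==> P e ==> P (%w. c w + e w)"
    and mulx: "!!i c. i \<in> I ==> coef_poly I c ==> P c ==> P (mulx i c)"
  shows "P c"
proof -
  define sg where "sg = (%(w::'a => nat) (k::complex) \<beta>. if \<beta> = w then k else 0)"
  have sgc: "coef_poly I (sg w k)" if "!!i. i \<notin> I ==> w i = 0" for w k
    using that unfolding coef_poly_def sg_def
    by (auto intro: finite_subset[of _ "{w}"] split: if_splits)
  have sgP: "P (sg w k)" if "!!i. i \<notin> I ==> w i = 0" for w k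
    using that
  proof (induction "\<Sum>i\<in>I. w i" arbitrary: w)
    case 0
    then have "w = (%_. 0)" using assms(1) by fastforce
    then have "sg w k = constc k" by (auto simp: sg_def constc_def)
    then show ?case using const by simp
  next
    case (Suc n)
    obtain i where i: "i \<in> I" "w i ~= 0"
      using Suc.hyps(2) by (metis nat.distinct(1) sum.neutral)
    let ?\<beta> = "w(i := w i - 1)"
    have "(\<Sum>i\<in>I. w i) = Suc (\<Sum>i\<in>I. ?\<beta> i)"
      using assms(1) i by (simp add: sum.remove[of I i])
    then have n: "n = (\<Sum>i\<in>I. ?\<beta> i)" using Suc.hyps(2) by simp
    have z: "!!j. j \<notin> I ==> ?\<beta> j = 0" using Suc.prems i by auto
    have "P (mulx i (sg ?\<beta> k))" by (rule mulx[OF i(1) sgc[OF z] Suc.hyps(1)[OF n z]])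
    moreover have "mulx i (sg ?\<beta> k) = sg w k"
    proof
      fix \<gamma> show "mulx i (sg ?\<beta> k) \<gamma> = sg w k \<gamma>"
      proof (cases "\<gamma> i = 0")
        case False
        have "\<gamma>(i := \<gamma> i - 1) = ?\<beta> \<longleftrightarrow> \<gamma> = w"
        proof
          assume *: "\<gamma>(i := \<gamma> i - 1) = ?\<beta>"
          show "\<gamma> = w"
          proof
            fix j show "\<gamma> j = w j" using fun_cong[OF *, of j] False i(2) by (auto split: if_splits)
          qed
        qed simp
        then show ?thesis using False by (simp add: mulx_def sg_def)
      qed (use i in \<open>auto simp: mulx_def sg_def\<close>)
    qed
    ultimately show ?case by simp
  qed
  have "P c" if "finite S" "{w. c w ~= 0} \<subseteq> S" "coef_poly I c" for S c
    using that
  proof (induction S arbitrary: c rule: finite_induct)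
    case empty
    then have "c = constc 0" by (auto simp: constc_def)
    then show ?case using const by simp
  next
    case (insert w S)
    show ?case
    proof (cases "c w = 0")
      case True then show ?thesis using insert by blast
    next
      case False
      have z: "!!i. i \<notin> I ==> w i = 0" using coef_polyD[OF insert.prems(2) False] .
      have cp: "coef_poly I (c(w := 0))"
        using insert.prems(2) unfolding coef_poly_def by (auto elim: finite_subset[rotated])
      have "P (c(w := 0))" by (rule insert.IH[OF _ cp]) (use insert.prems in auto)
      then have "P (%\<beta>. sg w (c w) \<beta> + (c(w := 0)) \<beta>)"
        by (intro add sgc sgP z cp)
      moreover have "(%\<beta>. sg w (c w) \<beta> + (c(w := 0)) \<beta>) = c" by (auto simp: sg_def)
      ultimately show ?thesis by simp
    qed
  qed
  from this[OF _ subset_refl assms(2)] show ?thesis using assms(2) by (simp add: coef_poly_def)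
qed

lemma evalc_superset:
  assumes "finite S" "{w. c w ~= 0} \<subseteq> S"
  shows "evalc I c y = (\<Sum>w\<in>S. c w * (\<Prod>i\<in>I. y i ^ w i))"
  unfolding evalc_def using assms by (intro sum.mono_neutral_left) auto

lemma evalc_add:
  assumes "coef_poly I c" "coef_poly I c'"
  shows "evalc I (%w. c w + c' w) y = evalc I c y + evalc I c' y"
proof -
  let ?S = "{w. c w ~= 0} \<union> {w. c' w ~= 0}"
  have f: "finite ?S" using assms by (auto simp: coef_poly_def)
  have "evalc I x y = (\<Sum>w\<in>?S. x w * (\<Prod>i\<in>I. y i ^ w i))"
    if "{w. x w ~= 0} \<subseteq> ?S" for x by (rule evalc_superset[OF f that])
  note eq = this
  have "{w. c w + c' w ~= 0} \<subseteq> ?S" by auto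
  from eq[of c, OF Un_upper1] eq[of c', OF Un_upper2] eq[OF this] show ?thesis
    by (simp only: distrib_right sum.distrib)
qed

lemma evalc_scale: "evalc I (%w. k * c w) y = k * evalc I c y"
  by (cases "k = 0") (auto simp: evalc_def sum_distrib_left mult_ac)

lemma evalc_zero [simp]: "evalc I (%_. 0) y = 0"
  by (simp add: evalc_def)

lemma evalc_sum:
  assumes "!!a. a \<in> A ==> coef_poly I (f a)"
  shows "evalc I (%w. \<Sum>a\<in>A. f a w) y = (\<Sum>a\<in>A. evalc I (f a) y)"
  using assms by (induction A rule: infinite_finite_induct) (auto simp: evalc_add coef_poly_sum)

lemma evalc_constc: "evalc I (constc k) y = k"
  by (subst evalc_superset[of "{%_. 0}"]) (auto simp: constc_def)

lemma evalc_mulx: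
  assumes "finite I" "i \<in> I"
  shows "evalc I (mulx i c) y = y i * evalc I c y"
proof -
  have f: "(\<Prod>j\<in>I. y j ^ ((w(i := w i + 1)) j)) = y i * (\<Prod>j\<in>I. y j ^ w j)" for w
    using assms by (simp add: prod.remove[of I i] mult.assoc)
  have m: "mulx i c (w(i := w i + 1)) = c w" for w by (simp add: mulx_def)
  have "evalc I (mulx i c) y =
      (\<Sum>w | c w ~= 0. mulx i c (w(i := w i + 1)) * (\<Prod>j\<in>I. y j ^ ((w(i := w i + 1)) j)))"
    unfolding evalc_def support_mulx by (subst sum.reindex[OF inj_shift]) simp
  also have "\<dots> = y i * evalc I c y"
    unfolding f m evalc_def by (simp add: sum_distrib_left mult_ac)
  finally show ?thesis .
qed

lemma dvx_constc: "dvx i (constc k) = (%_. 0)"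
  by (auto simp: dvx_def constc_def fun_eq_iff)

text \<open>Differentiation along a curve in a group orbit turns invariance under the group into a differential equation.\<close>

lemma evalc_chain_rule:
  assumes "finite I" "coef_poly I c" and \<gamma>: "!!i. i \<in> I ==> ((%s. \<gamma> s i) has_field_derivative \<gamma>' i) (at s0)"
  shows "((%s. evalc I c (\<gamma> s)) has_field_derivative (\<Sum>i\<in>I. \<gamma>' i * evalc I (dvx i c) (\<gamma> s0))) (at s0)"
  using assms(1,2)
proof (induction rule: coef_poly_induct)
  case (const k)
  then show ?case by (simp add: evalc_constc dvx_constc)
next
  case (add c e)
  have "(\<Sum>i\<in>I. \<gamma>' i * evalc I (dvx i (%w. c w + e w)) (\<gamma> s0)) =
      (\<Sum>i\<in>I. \<gamma>' i * evalc I (dvx i c) (\<gamma> s0)) + (\<Sum>i\<in>I. \<gamma>' i * evalc I (dvx i e) (\<gamma> s0))"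
    unfolding sum.distrib[symmetric]
    by (intro sum.cong refl) (simp add: dvx_add evalc_add coef_poly_dvx add distrib_left)
  then show ?case using DERIV_add[OF add.IH] by (simp add: evalc_add add)
next
  case (mulx j c)
  have "evalc I (dvx i (mulx j c)) (\<gamma> s0) = \<gamma> s0 j * evalc I (dvx i c) (\<gamma> s0) + (if i = j then evalc I c (\<gamma> s0) else 0)"
    if "i \<in> I" for i
    using that by (cases "i = j")
      (simp_all add: dvx_mulx_same dvx_mulx_other evalc_add evalc_mulx assms(1) mulx coef_poly_intros)
  then have "(\<Sum>i\<in>I. \<gamma>' i * evalc I (dvx i (mulx j c)) (\<gamma> s0)) =
      (\<Sum>i\<in>I. \<gamma> s0 j * (\<gamma>' i * evalc I (dvx i c) (\<gamma> s0)) + (if i = j then \<gamma>' j * evalc I c (\<gamma> s0) else 0))"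
    by (intro sum.cong refl) (auto simp: algebra_simps)
  also have "\<dots> = \<gamma>' j * evalc I c (\<gamma> s0) + (\<Sum>i\<in>I. \<gamma>' i * evalc I (dvx i c) (\<gamma> s0)) * \<gamma> s0 j"
    using assms(1) mulx(1) by (simp add: sum.distrib sum.delta sum_distrib_left mult_ac)
  finally show ?case
    using DERIV_mult[OF \<gamma>[OF mulx(1)] mulx.IH] by (simp add: evalc_mulx assms(1) mulx)
qed

lemma evalc_injective:
  assumes "finite I" "coef_poly I c" "!!y. evalc I c y = 0" shows "c = (%_. 0)"
proof
  fix w
  show "c w = 0"
  proof (cases "\<forall>i. i \<notin> I --> w i = 0")
    case False then show ?thesis using coef_polyD[OF assms(2), of w] by metis
  next
    case True
    then show ?thesis using assms(2,3)
    proof (induction "\<Sum>i\<in>I. w i" arbitrary: w c)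
      case 0
      have "\<forall>i\<in>I. w i = 0" using 0(1) assms(1) by simp
      then have w: "w = (%_. 0)" using 0(2) by (intro ext) blast
      have fin: "finite {w. c w ~= 0}" using 0 by (auto simp: coef_poly_def)
      have "0 = evalc I c (%_. 0)" by (rule 0(4)[symmetric])
      also have "\<dots> = (\<Sum>\<beta>\<in>insert w {w. c w ~= 0}. if \<beta> = w then c w else 0)"
        unfolding evalc_superset[of "insert w {w. c w ~= 0}" c, OF finite.insertI[OF fin] subset_insertI]
      proof (rule sum.cong[OF refl])
        fix \<beta> assume \<beta>: "\<beta> \<in> insert w {w. c w ~= 0}"
        show "c \<beta> * (\<Prod>i\<in>I. 0 ^ \<beta> i) = (if \<beta> = w then c w else 0)"
        proof (cases "\<beta> = w")
          case False
          then have cb: "c \<beta> ~= 0" using \<beta> by auto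
          obtain i where i: "\<beta> i ~= 0" using False w by auto
          then have "i \<in> I" using coef_polyD[OF 0(3) cb] by (metis)
          then have "(\<Prod>i\<in>I. 0 ^ \<beta> i) = (0::complex)" using i assms(1) by (intro prod_zero) auto
          then show ?thesis using False by simp
        qed (simp add: w)
      qed
      also have "\<dots> = c w" using fin by simp
      finally show ?case by simp
    next
      case (Suc n)
      obtain i where i: "i \<in> I" "w i ~= 0"
        using Suc.hyps(2) by (metis nat.distinct(1) sum.neutral)
      let ?\<beta> = "w(i := w i - 1)"
      have "(\<Sum>i\<in>I. w i) = Suc (\<Sum>i\<in>I. ?\<beta> i)"
        using assms(1) i by (simp add: sum.remove[of I i])
      then have n: "n = (\<Sum>i\<in>I. ?\<beta> i)" using Suc.hyps(2) by simp
      have z: "\<forall>j. j \<notin> I --> ?\<beta> j = 0" using Suc.prems i by auto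
      have ev: "evalc I (dvx i c) y = 0" for y
      proof -
        have "((%s. (y(i := s)) j) has_field_derivative (if j = i then 1 else 0)) (at (y i))" for j
          by (cases "j = i") auto
        from evalc_chain_rule[OF assms(1) Suc.prems(2) this]
        have "((%s. 0) has_field_derivative
            (\<Sum>j\<in>I. (if j = i then 1 else 0) * evalc I (dvx j c) (y(i := y i)))) (at (y i))"
          by (simp add: Suc.prems(3))
        then have "0 = (\<Sum>j\<in>I. (if j = i then 1 else 0) * evalc I (dvx j c) (y(i := y i)))"
          by (rule DERIV_unique[OF DERIV_const])
        also have "\<dots> = evalc I (dvx i c) y"
          using assms(1) i(1) by (simp add: if_distrib[of "%x. x * _"] sum.delta cong: if_cong)
        finally show ?thesis by simp
      qed
      have "dvx i c ?\<beta> = 0" by (rule Suc.hyps(1)[OF n z coef_poly_dvx[OF Suc.prems(2) i(1)] ev])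
      then have "of_nat (w i) * c w = 0" using i(2) by (simp add: dvx_def fun_upd_idem)
      then show ?case using i(2) by simp
    qed
  qed
qed

lemma poly_fun_imp_evalc:
  assumes "finite I" "poly_fun I f"
  obtains c where "coef_poly I c" "!!y. f y = evalc I c y"
proof -
  have "\<exists>c. coef_poly I c & (\<forall>y. f y = evalc I c y)" using assms(2)
  proof (induction rule: poly_fun.induct)
    case (const k)
    show ?case by (rule exI[of _ "constc k"]) (auto simp: evalc_constc coef_poly_intros)
  next
    case (coord i)
    then show ?case
      by (intro exI[of _ "mulx i (constc 1)"]) (auto simp: evalc_constc evalc_mulx assms(1) coef_poly_intros)
  next
    case (add f g)
    then obtain c e where "coef_poly I c" "\<forall>y. f y = evalc I c y" "coef_poly I e" "\<forall>y. g y = evalc I e y"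
      by blast
    then show ?case by (intro exI[of _ "%w. c w + e w"]) (auto simp: evalc_add coef_poly_intros)
  next
    case (mult f g)
    then obtain c e where c: "coef_poly I c" "\<forall>y. f y = evalc I c y" and e: "coef_poly I e" "\<forall>y. g y = evalc I e y"
      by blast
    have "\<exists>h. coef_poly I h & (\<forall>y. evalc I h y = evalc I c y * evalc I e y)"
      using assms(1) c(1)
    proof (induction rule: coef_poly_induct)
      case (const k)
      show ?case by (rule exI[of _ "%w. k * e w"]) (auto simp: evalc_constc evalc_scale e coef_poly_intros)
    next
      case (add c c')
      then obtain h h' where "coef_poly I h" "\<forall>y. evalc I h y = evalc I c y * evalc I e y"
        "coef_poly I h'" "\<forall>y. evalc I h' y = evalc I c' y * evalc I e y" by blast
      then show ?case
        by (intro exI[of _ "%w. h w + h' w"]) (auto simp: evalc_add add coef_poly_intros algebra_simps)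
    next
      case (mulx i c)
      then obtain h where "coef_poly I h" "\<forall>y. evalc I h y = evalc I c y * evalc I e y" by blast
      then show ?case using mulx
        by (intro exI[of _ "mulx i h"]) (auto simp: evalc_mulx assms(1) coef_poly_intros)
    qed
    then show ?case using c e by auto
  qed
  then show ?thesis using that by blast
qed

subsection \<open>Orthogonal projection\<close>

inductive_set lin_span :: "('a => complex) set => ('a => complex) set" for S where
  zero: "(%_. 0) \<in> lin_span S"
| step: "c \<in> lin_span S ==> s \<in> S ==> (%w. c w + k * s w) \<in> lin_span S"

lemma lin_span_add: "c \<in> lin_span S ==> e \<in> lin_span S ==> (%w. c w + e w) \<in> lin_span S"
proof (induction rule: lin_span.induct)
  case (step c s k)
  have "(%w. (c w + e w) + k * s w) \<in> lin_span S" using step by (intro lin_span.step) auto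
  then show ?case by (simp add: add_ac)
qed simp

lemma lin_span_scale: "c \<in> lin_span S ==> (%w. r * c w) \<in> lin_span S"
proof (induction rule: lin_span.induct)
  case (step c s k)
  have "(%w. r * c w + (r * k) * s w) \<in> lin_span S" using step by (intro lin_span.step) auto
  then show ?case by (simp add: distrib_left mult.assoc)
qed (simp add: lin_span.zero)

lemma lin_span_mono: "c \<in> lin_span S ==> S \<subseteq> T ==> c \<in> lin_span T"
  by (induction rule: lin_span.induct) (auto intro: lin_span.intros)

lemma lin_span_coef_poly:
  "c \<in> lin_span S ==> (!!s. s \<in> S ==> coef_poly I s) ==> coef_poly I c"
  by (induction rule: lin_span.induct) (auto intro!: coef_poly_zero coef_poly_add coef_poly_scale)

lemma lin_span_orthogonal:
  "e \<in> lin_span S ==> (!!s. s \<in> S ==> fischer I c s = 0) ==> fischer I c e = 0"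
  by (induction rule: lin_span.induct) (auto simp: fischer_add_right fischer_scale_right)

text \<open>The Gram-Schmidt process, for a span without a chosen basis.\<close>

lemma orthogonal_projection:
  assumes "finite S" "!!s. s \<in> S ==> coef_poly I s" "coef_poly I g"
  obtains p where "p \<in> lin_span S" "!!s. s \<in> S ==> fischer I (%w. g w - p w) s = 0"
proof -
  have "\<exists>p \<in> lin_span S. \<forall>s\<in>S. fischer I (%w. g w - p w) s = 0"
    using assms
  proof (induction S arbitrary: g rule: finite_induct)
    case empty
    then show ?case by (auto intro: lin_span.zero)
  next
    case (insert x S)
    obtain p where p: "p \<in> lin_span S" "\<forall>s\<in>S. fischer I (%w. g w - p w) s = 0"
      using insert.IH[of g] insert.prems by auto
    obtain q where q: "q \<in> lin_span S" "\<forall>s\<in>S. fischer I (%w. x w - q w) s = 0"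
      using insert.IH[of x] insert.prems by auto
    define z where "z = (%w. x w - q w)"
    have cpS: "coef_poly I s" if "s \<in> lin_span S" for s
      using lin_span_coef_poly[OF that] insert.prems(1) by blast
    have cpd: "coef_poly I (%w. a w - b w)" if "coef_poly I a" "coef_poly I b" for a b
      using coef_poly_add[OF that(1) coef_poly_scale[OF that(2), of "-1"]] by simp
    have cz: "coef_poly I z" unfolding z_def by (intro cpd cpS q insert.prems(1)) simp
    define r where "r = (%w. g w - p w)"
    have cr: "coef_poly I r" unfolding r_def by (intro cpd cpS p insert.prems(2))
    define k where "k = (if fischer I z z = 0 then 0 else fischer I r z / fischer I z z)"
    define p' where "p' = (%w. p w + k * z w)"
    have r': "(%w. g w - p' w) = (%w. r w + (- k) * z w)"
      by (auto simp: r_def p'_def)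
    have fr': "fischer I (%w. g w - p' w) s = fischer I r s - k * fischer I z s" for s
      unfolding r' fischer_add[OF cr coef_poly_scale[OF cz]] fischer_scale by simp
    have zx: "z \<in> lin_span (insert x S)"
    proof -
      have "(%w. (- 1) * q w + 1 * x w) \<in> lin_span (insert x S)"
        by (intro lin_span.step lin_span_scale lin_span_mono[OF q(1)]) auto
      then show ?thesis by (simp add: z_def)
    qed
    have "p' \<in> lin_span (insert x S)" unfolding p'_def
      by (intro lin_span_add lin_span_scale zx lin_span_mono[OF p(1)]) auto
    moreover have oS: "fischer I (%w. g w - p' w) s = 0" if "s \<in> S" for s
      using p(2) q(2) that by (simp add: fr' r_def z_def)
    moreover have "fischer I (%w. g w - p' w) x = 0"
    proof -
      have "fischer I r z = 0" if "fischer I z z = 0"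
        using fischer_definite[OF cz that] by simp
      then have "fischer I (%w. g w - p' w) z = 0" by (auto simp: fr' k_def)
      moreover have "fischer I (%w. g w - p' w) q = 0"
        by (rule lin_span_orthogonal[OF q(1) oS])
      moreover have "x = (%w. z w + q w)" by (auto simp: z_def)
      ultimately show ?thesis using fischer_add_right[of I _ z q] by simp
    qed
    ultimately show ?case by blast
  qed
  then show ?thesis using that by blast
qed

section \<open>Invariants of the general linear group\<close>

text \<open>Coordinates on the affine space that parametrizes the determinantal variety: a square matrix \<open>Top\<close>, and factors \<open>Lft\<close> and
\<open>Rgt\<close> of the lower block. The general linear group of size \<open>t\<close> acts on the factors by \<open>(A, B) \<mapsto> (A g, g\<^sup>-\<^sup>1 B)\<close>.\<close>

datatype yvar = Top nat nat | Lft nat nat | Rgt nat nat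

definition yvars :: "nat => nat => nat => yvar set" where
  "yvars d m t = {v. case v of Top i j => i < d & j < d | Lft i a => i < m & a < t | Rgt a j => a < t & j < d}"

definition lvars :: "nat => nat => nat => yvar set" where
  "lvars d m t = {v. case v of Top i j => i < d & j < d | Lft i a => i < m & a < t | Rgt a j => False}"

lemma yvars_simps [simp]:
  "Top i j \<in> yvars d m t \<longleftrightarrow> i < d & j < d"
  "Lft i a \<in> yvars d m t \<longleftrightarrow> i < m & a < t"
  "Rgt a j \<in> yvars d m t \<longleftrightarrow> a < t & j < d"
  "Top i j \<in> lvars d m t \<longleftrightarrow> i < d & j < d"
  "Lft i a \<in> lvars d m t \<longleftrightarrow> i < m & a < t"
  "Rgt a j \<notin> lvars d m t"
  by (auto simp: yvars_def lvars_def)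

lemma finite_yvars: "finite (yvars d m t)"
proof (rule finite_subset)
  show "yvars d m t \<subseteq> (%(i, j). Top i j) ` ({..<d} \<times> {..<d}) \<union> (%(i, j). Lft i j) ` ({..<m} \<times> {..<t})
      \<union> (%(i, j). Rgt i j) ` ({..<t} \<times> {..<d})"
  proof
    fix v assume "v \<in> yvars d m t"
    then show "v \<in> (%(i, j). Top i j) ` ({..<d} \<times> {..<d}) \<union> (%(i, j). Lft i j) ` ({..<m} \<times> {..<t})
      \<union> (%(i, j). Rgt i j) ` ({..<t} \<times> {..<d})" by (cases v) (auto simp: image_iff)
  qed
qed auto

lemma lvars_subset: "lvars d m t \<subseteq> yvars d m t"
proof
  fix v assume "v \<in> lvars d m t" then show "v \<in> yvars d m t" by (cases v) auto
qed

lemma finite_lvars: "finite (lvars d m t)"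
  by (rule finite_subset[OF lvars_subset finite_yvars])

text \<open>The operators \<open>opE\<close> and \<open>opF\<close> are the actions of matrix units of the Lie algebra on the two factors; \<open>opQ\<close> is multiplication with an
entry of the product of the factors, and \<open>opD\<close> is its adjoint. The predicate \<open>gl_inv\<close> expresses invariance
under the Lie algebra.\<close>

definition opE :: "nat => nat => nat => ((yvar => nat) => complex) => (yvar => nat) => complex" where
  "opE m a b c = (%w. \<Sum>i<m. mulx (Lft i a) (dvx (Lft i b) c) w)"

definition opF :: "nat => nat => nat => ((yvar => nat) => complex) => (yvar => nat) => complex" where
  "opF d a b c = (%w. \<Sum>j<d. mulx (Rgt a j) (dvx (Rgt b j) c) w)"

definition opQ :: "nat => nat => nat => ((yvar => nat) => complex) => (yvar => nat) => complex" where
  "opQ t i j c = (%w. \<Sum>k<t. mulx (Lft i k) (mulx (Rgt k j) c) w)"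

definition opD :: "nat => nat => nat => ((yvar => nat) => complex) => (yvar => nat) => complex" where
  "opD t i j c = (%w. \<Sum>k<t. dvx (Lft i k) (dvx (Rgt k j) c) w)"

definition gl_inv :: "nat => nat => nat => ((yvar => nat) => complex) => bool" where
  "gl_inv d m t c \<longleftrightarrow> (\<forall>a<t. \<forall>b<t. opE m a b c = opF d b a c)"

lemma sum_delta2:
  fixes f :: "nat => nat => complex"
  assumes "i < m" "b < t"
  shows "(\<Sum>i'<m. \<Sum>k<t. if i' = i & k = b then f i' k else 0) = f i b"
proof -
  have "(\<Sum>k<t. if i' = i & k = b then f i' k else 0) = (if i' = i then f i b else 0)" for i'
    using assms(2) by (cases "i' = i") (simp_all add: sum.delta)
  then show ?thesis using assms(1) by (simp add: sum.delta)
qed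

lemma sum_swap4:
  "(\<Sum>i\<in>A. \<Sum>j\<in>B. \<Sum>a\<in>C. \<Sum>b\<in>D. f i j a b) = (\<Sum>a\<in>C. \<Sum>b\<in>D. \<Sum>i\<in>A. \<Sum>j\<in>B. f i j a b)"
proof -
  have "(\<Sum>i\<in>A. \<Sum>j\<in>B. \<Sum>a\<in>C. \<Sum>b\<in>D. f i j a b) = (\<Sum>i\<in>A. \<Sum>a\<in>C. \<Sum>j\<in>B. \<Sum>b\<in>D. f i j a b)"
    by (rule sum.cong[OF refl], rule sum.swap)
  also have "\<dots> = (\<Sum>a\<in>C. \<Sum>i\<in>A. \<Sum>j\<in>B. \<Sum>b\<in>D. f i j a b)"
    by (rule sum.swap)
  also have "\<dots> = (\<Sum>a\<in>C. \<Sum>i\<in>A. \<Sum>b\<in>D. \<Sum>j\<in>B. f i j a b)"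
    by (rule sum.cong[OF refl], rule sum.cong[OF refl], rule sum.swap)
  also have "\<dots> = (\<Sum>a\<in>C. \<Sum>b\<in>D. \<Sum>i\<in>A. \<Sum>j\<in>B. f i j a b)"
    by (rule sum.cong[OF refl], rule sum.swap)
  finally show ?thesis .
qed

lemma mulx_zero [simp]: "mulx v (%_. 0) = (%_. 0)" and dvx_zero [simp]: "dvx v (%_. 0) = (%_. 0)"
  by (auto simp: mulx_def dvx_def)

lemma opE_opQ:
  assumes "i < m" "b < t"
  shows "opE m a b (opQ t i j c) = (%w. opQ t i j (opE m a b c) w + mulx (Lft i a) (mulx (Rgt b j) c) w)"
proof
  fix w
  have "opE m a b (opQ t i j c) w = (\<Sum>i'<m. \<Sum>k<t.
      mulx (Lft i' a) (mulx (Lft i k) (mulx (Rgt k j) (dvx (Lft i' b) c))) w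
      + (if i' = i & k = b then mulx (Lft i' a) (mulx (Rgt k j) c) w else 0))"
    unfolding opE_def opQ_def dvx_sum mulx_sum
    by (intro sum.cong refl) (auto simp: dvx_mulx mulx_add mulx_if_zero)
  also have "\<dots> = (\<Sum>i'<m. \<Sum>k<t. mulx (Lft i' a) (mulx (Lft i k) (mulx (Rgt k j) (dvx (Lft i' b) c))) w)
      + mulx (Lft i a) (mulx (Rgt b j) c) w"
    unfolding sum.distrib sum_delta2[OF assms] ..
  also have "(\<Sum>i'<m. \<Sum>k<t. mulx (Lft i' a) (mulx (Lft i k) (mulx (Rgt k j) (dvx (Lft i' b) c))) w)
      = opQ t i j (opE m a b c) w"
    unfolding opE_def opQ_def mulx_sum
    by (subst sum.swap) (simp add: mulx_mulx)
  finally show "opE m a b (opQ t i j c) w = opQ t i j (opE m a b c) w + mulx (Lft i a) (mulx (Rgt b j) c) w" .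
qed

lemma opF_opQ:
  assumes "j < d" "a < t"
  shows "opF d b a (opQ t i j c) = (%w. opQ t i j (opF d b a c) w + mulx (Lft i a) (mulx (Rgt b j) c) w)"
proof
  fix w
  have "opF d b a (opQ t i j c) w = (\<Sum>j'<d. \<Sum>k<t.
      mulx (Lft i k) (mulx (Rgt k j) (mulx (Rgt b j') (dvx (Rgt a j') c))) w
      + (if j' = j & k = a then mulx (Lft i k) (mulx (Rgt b j') c) w else 0))"
    unfolding opF_def opQ_def dvx_sum mulx_sum
    by (intro sum.cong refl) (auto simp: dvx_mulx mulx_add mulx_if_zero mulx_mulx)
  also have "\<dots> = (\<Sum>j'<d. \<Sum>k<t. mulx (Lft i k) (mulx (Rgt k j) (mulx (Rgt b j') (dvx (Rgt a j') c))) w)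
      + mulx (Lft i a) (mulx (Rgt b j) c) w"
    unfolding sum.distrib sum_delta2[OF assms] ..
  also have "(\<Sum>j'<d. \<Sum>k<t. mulx (Lft i k) (mulx (Rgt k j) (mulx (Rgt b j') (dvx (Rgt a j') c))) w)
      = opQ t i j (opF d b a c) w"
    unfolding opF_def opQ_def mulx_sum
    by (subst sum.swap) simp
  finally show "opF d b a (opQ t i j c) w = opQ t i j (opF d b a c) w + mulx (Lft i a) (mulx (Rgt b j) c) w" .
qed

lemma opD_opE:
  assumes "i < m" "a < t"
  shows "opD t i j (opE m a b c) = (%w. opE m a b (opD t i j c) w + dvx (Lft i b) (dvx (Rgt a j) c) w)"
proof
  fix w
  have "opD t i j (opE m a b c) w = (\<Sum>k<t. \<Sum>i'<m.
      mulx (Lft i' a) (dvx (Lft i' b) (dvx (Lft i k) (dvx (Rgt k j) c))) w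
      + (if i' = i & k = a then dvx (Lft i' b) (dvx (Rgt k j) c) w else 0))"
    unfolding opE_def opD_def dvx_sum mulx_sum
    by (intro sum.cong refl) (auto simp: dvx_mulx dvx_dvx)
  also have "\<dots> = (\<Sum>i'<m. \<Sum>k<t.
      mulx (Lft i' a) (dvx (Lft i' b) (dvx (Lft i k) (dvx (Rgt k j) c))) w
      + (if i' = i & k = a then dvx (Lft i' b) (dvx (Rgt k j) c) w else 0))"
    by (rule sum.swap)
  also have "\<dots> = (\<Sum>i'<m. \<Sum>k<t. mulx (Lft i' a) (dvx (Lft i' b) (dvx (Lft i k) (dvx (Rgt k j) c))) w)
      + dvx (Lft i b) (dvx (Rgt a j) c) w"
    unfolding sum.distrib sum_delta2[OF assms] ..
  also have "(\<Sum>i'<m. \<Sum>k<t. mulx (Lft i' a) (dvx (Lft i' b) (dvx (Lft i k) (dvx (Rgt k j) c))) w)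
      = opE m a b (opD t i j c) w"
    unfolding opE_def opD_def mulx_sum dvx_sum ..
  finally show "opD t i j (opE m a b c) w = opE m a b (opD t i j c) w + dvx (Lft i b) (dvx (Rgt a j) c) w" .
qed

lemma opD_opF:
  assumes "j < d" "b < t"
  shows "opD t i j (opF d b a c) = (%w. opF d b a (opD t i j c) w + dvx (Lft i b) (dvx (Rgt a j) c) w)"
proof
  fix w
  have "opD t i j (opF d b a c) w = (\<Sum>k<t. \<Sum>j'<d.
      mulx (Rgt b j') (dvx (Rgt a j') (dvx (Lft i k) (dvx (Rgt k j) c))) w
      + (if j' = j & k = b then dvx (Lft i k) (dvx (Rgt a j') c) w else 0))"
    unfolding opF_def opD_def dvx_sum mulx_sum
    by (intro sum.cong refl) (auto simp: dvx_mulx dvx_add dvx_dvx)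
  also have "\<dots> = (\<Sum>j'<d. \<Sum>k<t.
      mulx (Rgt b j') (dvx (Rgt a j') (dvx (Lft i k) (dvx (Rgt k j) c))) w
      + (if j' = j & k = b then dvx (Lft i k) (dvx (Rgt a j') c) w else 0))"
    by (rule sum.swap)
  also have "\<dots> = (\<Sum>j'<d. \<Sum>k<t. mulx (Rgt b j') (dvx (Rgt a j') (dvx (Lft i k) (dvx (Rgt k j) c))) w)
      + dvx (Lft i b) (dvx (Rgt a j) c) w"
    unfolding sum.distrib sum_delta2[OF assms] ..
  also have "(\<Sum>j'<d. \<Sum>k<t. mulx (Rgt b j') (dvx (Rgt a j') (dvx (Lft i k) (dvx (Rgt k j) c))) w)
      = opF d b a (opD t i j c) w"
    unfolding opF_def opD_def mulx_sum dvx_sum ..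
  finally show "opD t i j (opF d b a c) w = opF d b a (opD t i j c) w + dvx (Lft i b) (dvx (Rgt a j) c) w" .
qed

lemma gl_inv_opQ:
  assumes "gl_inv d m t c" "i < m" "j < d" shows "gl_inv d m t (opQ t i j c)"
  unfolding gl_inv_def
proof (intro allI impI)
  fix a b assume "a < t" "b < t"
  then have "opE m a b c = opF d b a c" using assms(1) by (simp add: gl_inv_def)
  then show "opE m a b (opQ t i j c) = opF d b a (opQ t i j c)"
    unfolding opE_opQ[OF assms(2) \<open>b < t\<close>] opF_opQ[OF assms(3) \<open>a < t\<close>] by simp
qed

lemma gl_inv_opD:
  assumes "gl_inv d m t c" "i < m" "j < d" shows "gl_inv d m t (opD t i j c)"
  unfolding gl_inv_def
proof (intro allI impI)
  fix a b assume "a < t" "b < t"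
  then have "opE m a b c = opF d b a c" using assms(1) by (simp add: gl_inv_def)
  then have "opD t i j (opE m a b c) = opD t i j (opF d b a c)" by simp
  then show "opE m a b (opD t i j c) = opF d b a (opD t i j c)"
    unfolding opD_opE[OF assms(2) \<open>a < t\<close>] opD_opF[OF assms(3) \<open>b < t\<close>] by (auto simp: fun_eq_iff)
qed

lemma opE_Top: "opE m a b (mulx (Top i j) c) = mulx (Top i j) (opE m a b c)"
    "opE m a b (dvx (Top i j) c) = dvx (Top i j) (opE m a b c)"
  unfolding opE_def mulx_sum dvx_sum by (simp_all add: dvx_mulx mulx_mulx dvx_dvx)

lemma opF_Top: "opF d a b (mulx (Top i j) c) = mulx (Top i j) (opF d a b c)"
    "opF d a b (dvx (Top i j) c) = dvx (Top i j) (opF d a b c)"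
  unfolding opF_def mulx_sum dvx_sum by (simp_all add: dvx_mulx mulx_mulx dvx_dvx)

lemma gl_inv_Top:
  assumes "gl_inv d m t c"
  shows "gl_inv d m t (mulx (Top i j) c)" "gl_inv d m t (dvx (Top i j) c)"
  using assms by (simp_all add: gl_inv_def opE_Top opF_Top)

lemma opE_linear: "opE m a b (%w. c w + k * e w) = (%w. opE m a b c w + k * opE m a b e w)"
  by (simp add: opE_def dvx_add dvx_scale mulx_add mulx_scale sum.distrib sum_distrib_left)

lemma opF_linear: "opF d a b (%w. c w + k * e w) = (%w. opF d a b c w + k * opF d a b e w)"
  by (simp add: opF_def dvx_add dvx_scale mulx_add mulx_scale sum.distrib sum_distrib_left)

lemma gl_inv_linear:
  "gl_inv d m t c ==> gl_inv d m t e ==> gl_inv d m t (%w. c w + k * e w)"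
  by (simp add: gl_inv_def opE_linear opF_linear)

lemma gl_inv_constc: "gl_inv d m t (constc k)"
  by (simp add: gl_inv_def opE_def opF_def dvx_constc)

lemma gl_inv_zero: "gl_inv d m t (%_. 0)"
  by (simp add: gl_inv_def opE_def opF_def)

lemma coef_poly_ops:
  assumes "coef_poly (yvars d m t) c"
  shows "a < t ==> b < t ==> coef_poly (yvars d m t) (opE m a b c)"
    and "a < t ==> b < t ==> coef_poly (yvars d m t) (opF d a b c)"
    and "i < m ==> j < d ==> coef_poly (yvars d m t) (opQ t i j c)"
    and "i < m ==> j < d ==> coef_poly (yvars d m t) (opD t i j c)"
  unfolding opE_def opF_def opQ_def opD_def
  by (intro coef_poly_sum coef_poly_mulx coef_poly_dvx assms; simp)+

lemma opE_adjoint: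
  assumes "coef_poly (yvars d m t) c" "coef_poly (yvars d m t) e" "a < t" "b < t"
  shows "fischer (yvars d m t) (opE m a b c) e = fischer (yvars d m t) c (opE m b a e)"
proof -
  let ?I = "yvars d m t"
  have "fischer ?I (opE m a b c) e = (\<Sum>i<m. fischer ?I (mulx (Lft i a) (dvx (Lft i b) c)) e)"
    unfolding opE_def by (rule fischer_sum, intro coef_poly_mulx coef_poly_dvx assms) (use assms in auto)
  also have "\<dots> = (\<Sum>i<m. fischer ?I c (mulx (Lft i b) (dvx (Lft i a) e)))"
  proof (rule sum.cong[OF refl])
    fix i assume "i \<in> {..<m}"
    then have v: "Lft i a \<in> ?I" "Lft i b \<in> ?I" using assms by auto
    show "fischer ?I (mulx (Lft i a) (dvx (Lft i b) c)) e = fischer ?I c (mulx (Lft i b) (dvx (Lft i a) e))"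
      unfolding fischer_adjoint[OF finite_yvars v(1)]
      by (rule fischer_adjoint'[OF finite_yvars v(2) assms(1) coef_poly_dvx[OF assms(2) v(1)]])
  qed
  also have "\<dots> = fischer ?I c (opE m b a e)" unfolding opE_def fischer_sum_right ..
  finally show ?thesis .
qed

lemma opD_adjoint:
  assumes "coef_poly (yvars d m t) c" "coef_poly (yvars d m t) e" "i < m" "j < d"
  shows "fischer (yvars d m t) (opD t i j c) e = fischer (yvars d m t) c (opQ t i j e)"
proof -
  let ?I = "yvars d m t"
  have "fischer ?I (opD t i j c) e = (\<Sum>k<t. fischer ?I (dvx (Lft i k) (dvx (Rgt k j) c)) e)"
    unfolding opD_def by (rule fischer_sum, intro coef_poly_mulx coef_poly_dvx assms) (use assms in auto)
  also have "\<dots> = (\<Sum>k<t. fischer ?I c (mulx (Lft i k) (mulx (Rgt k j) e)))"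
  proof (rule sum.cong[OF refl])
    fix k assume "k \<in> {..<t}"
    then have v: "Lft i k \<in> ?I" "Rgt k j \<in> ?I" using assms by auto
    show "fischer ?I (dvx (Lft i k) (dvx (Rgt k j) c)) e = fischer ?I c (mulx (Lft i k) (mulx (Rgt k j) e))"
      unfolding fischer_adjoint'[OF finite_yvars v(1) coef_poly_dvx[OF assms(1) v(2)] assms(2)]
        fischer_adjoint'[OF finite_yvars v(2) assms(1) coef_poly_mulx[OF assms(2) v(1)]]
      by (subst mulx_mulx) simp
  qed
  also have "\<dots> = fischer ?I c (opQ t i j e)" unfolding opQ_def fischer_sum_right ..
  finally show ?thesis .
qed

text \<open>Both sides consist of the same products of two variables with two derivatives, and the derivatives with respect
to entries of one factor commute with the variables of the other.\<close>

lemma casimir: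
  "(\<Sum>i<m. \<Sum>j<d. opQ t i j (opD t i j c) w) = (\<Sum>a<t. \<Sum>b<t. opE m a b (opF d a b c) w)"
proof -
  have "(\<Sum>i<m. \<Sum>j<d. opQ t i j (opD t i j c) w) =
      (\<Sum>i<m. \<Sum>j<d. \<Sum>a<t. \<Sum>b<t. mulx (Lft i a) (dvx (Lft i b) (mulx (Rgt a j) (dvx (Rgt b j) c))) w)"
    unfolding opQ_def opD_def mulx_sum by (intro sum.cong refl) (simp add: dvx_mulx)
  also have "\<dots> = (\<Sum>a<t. \<Sum>b<t. opE m a b (opF d a b c) w)"
    unfolding opE_def opF_def mulx_sum dvx_sum by (rule sum_swap4)
  finally show ?thesis .
qed

text \<open>The level bounds the degree in the entries of \<open>Top\<close> and \<open>Lft\<close>. It decreases under \<open>opD\<close> and the derivatives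
with respect to \<open>Top\<close>, which makes the induction in \<open>invariant_in_span\<close> work.\<close>

definition has_level :: "nat => nat => nat => nat => ((yvar => nat) => complex) => bool" where
  "has_level d m t n c \<longleftrightarrow> (\<forall>w. c w ~= 0 --> (\<Sum>v\<in>lvars d m t. w v) < n)"

lemma level_shift:
  fixes w :: "yvar => nat"
  shows
  "(\<Sum>u\<in>lvars d m t. (w(v := w v + 1)) u) = (\<Sum>u\<in>lvars d m t. w u) + (if v \<in> lvars d m t then 1 else 0)"
proof (cases "v \<in> lvars d m t")
  case True
  then show ?thesis using finite_lvars[of d m t] by (simp add: sum.remove[of "lvars d m t" v])
next
  case False
  then have "(\<Sum>u\<in>lvars d m t. (w(v := w v + 1)) u) = (\<Sum>u\<in>lvars d m t. w u)"
    by (intro sum.cong) auto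
  then show ?thesis using False by simp
qed

lemma has_level_dvx: "has_level d m t (Suc n) c ==> v \<in> lvars d m t ==> has_level d m t n (dvx v c)"
  unfolding has_level_def
proof (intro allI impI)
  fix w assume *: "\<forall>w. c w ~= 0 --> sum w (lvars d m t) < Suc n" "v \<in> lvars d m t" "dvx v c w ~= 0"
  then have "c (w(v := w v + 1)) ~= 0" by (auto simp: dvx_def)
  then have "sum (w(v := w v + 1)) (lvars d m t) < Suc n" using *(1) by blast
  then show "sum w (lvars d m t) < n" using level_shift[where v=v and w=w and d=d and m=m and t=t] *(2) by simp
qed

lemma has_level_dvx_Rgt: "has_level d m t n c ==> has_level d m t n (dvx (Rgt k j) c)"
  unfolding has_level_def
proof (intro allI impI)
  fix w assume *: "\<forall>w. c w ~= 0 --> sum w (lvars d m t) < n" "dvx (Rgt k j) c w ~= 0"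
  let ?v = "Rgt k j"
  from * have "c (w(?v := w ?v + 1)) ~= 0" by (auto simp: dvx_def)
  then have "sum (w(?v := w ?v + 1)) (lvars d m t) < n" using *(1) by blast
  then show "sum w (lvars d m t) < n" using level_shift[where v="?v" and w=w and d=d and m=m and t=t] by simp
qed

lemma has_level_mulx:
  assumes "has_level d m t n c" shows "has_level d m t (Suc n) (mulx v c)"
    and "v \<notin> lvars d m t ==> has_level d m t n (mulx v c)"
proof -
  have *: "sum w (lvars d m t) < n + (if v \<in> lvars d m t then 1 else 0)" if "mulx v c w ~= 0" for w
  proof -
    let ?\<beta> = "w(v := w v - 1)"
    have "w v ~= 0" "c ?\<beta> ~= 0" using that by (auto simp: mulx_def split: if_splits)
    then have "sum ?\<beta> (lvars d m t) < n" "w = ?\<beta>(v := ?\<beta> v + 1)"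
      using assms unfolding has_level_def by auto
    then show ?thesis using level_shift[where v=v and w="?\<beta>" and d=d and m=m and t=t] by simp
  qed
  show "has_level d m t (Suc n) (mulx v c)"
    unfolding has_level_def
  proof (intro allI impI)
    fix w assume "mulx v c w ~= 0"
    from *[OF this] show "sum w (lvars d m t) < Suc n" by (simp split: if_splits)
  qed
  show "has_level d m t n (mulx v c)" if "v \<notin> lvars d m t"
    unfolding has_level_def using * that by simp
qed

lemma has_level_sum:
  assumes "!!a. a \<in> A ==> has_level d m t n (f a)" shows "has_level d m t n (%w. \<Sum>a\<in>A. f a w)"
  unfolding has_level_def
proof (intro allI impI)
  fix w assume "(\<Sum>a\<in>A. f a w) ~= 0"
  then obtain a where "a \<in> A" "f a w ~= 0" by (meson sum.neutral)
  then show "sum w (lvars d m t) < n" using assms unfolding has_level_def by blast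
qed

lemma has_level_linear:
  assumes "has_level d m t n c" "has_level d m t n e" shows "has_level d m t n (%w. c w + k * e w)"
  unfolding has_level_def
proof (intro allI impI)
  fix w assume "c w + k * e w ~= 0"
  then have "c w ~= 0 \<or> e w ~= 0" by auto
  then show "sum w (lvars d m t) < n" using assms unfolding has_level_def by blast
qed

text \<open>The monomials with fewer than \<open>n\<close> factors in the entries of \<open>Top\<close> and of the product of \<open>Lft\<close> and \<open>Rgt\<close>.\<close>

primrec mons :: "nat => nat => nat => nat => ((yvar => nat) => complex) set" where
  "mons d m t 0 = {}"
| "mons d m t (Suc n) = insert (constc 1)
     ((%(i, j, c). mulx (Top i j) c) ` ({..<d} \<times> {..<d} \<times> mons d m t n) \<union>
      (%(i, j, c). opQ t i j c) ` ({..<m} \<times> {..<d} \<times> mons d m t n))"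

lemma finite_mons: "finite (mons d m t n)"
  by (induction n) auto

lemma coef_poly_mons: "c \<in> mons d m t n ==> coef_poly (yvars d m t) c"
  by (induction n arbitrary: c) (auto intro!: coef_poly_constc coef_poly_mulx coef_poly_ops)

lemma gl_inv_mons: "c \<in> mons d m t n ==> gl_inv d m t c"
  by (induction n arbitrary: c) (auto intro!: gl_inv_constc gl_inv_opQ gl_inv_Top)

lemma has_level_opQ: "has_level d m t n c ==> has_level d m t (Suc n) (opQ t i j c)"
  unfolding opQ_def by (intro has_level_sum has_level_mulx(1) has_level_mulx(2)) auto

lemma has_level_opD: "has_level d m t (Suc n) c ==> i < m ==> has_level d m t n (opD t i j c)"
  unfolding opD_def by (intro has_level_sum has_level_dvx has_level_dvx_Rgt) auto

lemma has_level_mons: "c \<in> mons d m t n ==> has_level d m t n c"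
proof (induction n arbitrary: c)
  case (Suc n)
  have "has_level d m t (Suc n) (constc 1)" by (auto simp: has_level_def constc_def)
  then show ?case using Suc has_level_mulx(1) has_level_opQ by auto
qed simp

lemma lin_span_props:
  assumes "s \<in> lin_span (mons d m t n)"
  shows "coef_poly (yvars d m t) s" "gl_inv d m t s" "has_level d m t n s"
proof -
  show "coef_poly (yvars d m t) s" using lin_span_coef_poly[OF assms coef_poly_mons] .
  show "gl_inv d m t s" using assms
    by (induction rule: lin_span.induct) (auto intro: gl_inv_linear gl_inv_mons gl_inv_zero)
  show "has_level d m t n s" using assms
  proof (induction rule: lin_span.induct)
    case zero then show ?case by (simp add: has_level_def)
  next
    case step then show ?case by (metis has_level_linear has_level_mons)
  qed
qed

text \<open>If \<open>opD\<close> annihilates the invariant \<open>h\<close>, then the inner product of \<open>h\<close> with the right hand side of \<open>casimir\<close> is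
zero. By invariance and adjointness it is the sum of the squared norms of all \<open>opE m b a h\<close>. For \<open>a = b\<close> this
says that \<open>h\<close> has degree \<open>0\<close> in the columns of \<open>Lft\<close>; by invariance the same holds for the rows of \<open>Rgt\<close>.\<close>

lemma harmonic_invariant:
  assumes cp: "coef_poly (yvars d m t) h" and inv: "gl_inv d m t h"
    and D: "!!i j. i < m ==> j < d ==> opD t i j h = (%_. 0)"
    and T: "!!i j. i < d ==> j < d ==> dvx (Top i j) h = (%_. 0)"
    and w: "h w ~= 0"
  shows "w = (%_. 0)"
proof -
  let ?I = "yvars d m t"
  have opQ0: "opQ t i j (%_. 0) = (%_. 0)" for i j by (auto simp: opQ_def mulx_def)
  have "(%w. \<Sum>a<t. \<Sum>b<t. opE m a b (opF d a b h) w) = (%_. 0)"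
    unfolding casimir[symmetric] by (intro ext sum.neutral ballI) (simp add: D opQ0)
  moreover have "opF d a b h = opE m b a h" if "a < t" "b < t" for a b
    using inv that by (simp add: gl_inv_def)
  ultimately have "(%w. \<Sum>a<t. \<Sum>b<t. opE m a b (opE m b a h) w) = (%_. 0)"
    by simp
  then have "fischer ?I (%w. \<Sum>a<t. \<Sum>b<t. opE m a b (opE m b a h) w) h = 0" by simp
  also have "fischer ?I (%w. \<Sum>a<t. \<Sum>b<t. opE m a b (opE m b a h) w) h =
      (\<Sum>a<t. fischer ?I (%w. \<Sum>b<t. opE m a b (opE m b a h) w) h)"
    by (rule fischer_sum, intro coef_poly_sum coef_poly_ops cp) simp_all
  also have "\<dots> = (\<Sum>a<t. \<Sum>b<t. fischer ?I (opE m a b (opE m b a h)) h)"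
    by (rule sum.cong[OF refl], rule fischer_sum, intro coef_poly_ops cp) simp_all
  also have "\<dots> = (\<Sum>a<t. \<Sum>b<t. fischer ?I (opE m b a h) (opE m b a h))"
    by (intro sum.cong refl opE_adjoint coef_poly_ops cp) auto
  also have "\<dots> = of_real (\<Sum>a<t. \<Sum>b<t. Re (fischer ?I (opE m b a h) (opE m b a h)))"
    unfolding of_real_sum by (intro sum.cong refl fischer_self_nonneg)
  finally have "(\<Sum>a<t. \<Sum>b<t. Re (fischer ?I (opE m b a h) (opE m b a h))) = 0"
    by (simp only: of_real_eq_0_iff)
  then have "Re (fischer ?I (opE m a a h) (opE m a a h)) = 0" if "a < t" for a
    using that by (simp add: sum_nonneg_eq_0_iff sum_nonneg fischer_self_nonneg(2))
  then have "fischer ?I (opE m a a h) (opE m a a h) = 0" if "a < t" for a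
    using that fischer_self_nonneg(1)[of ?I "opE m a a h"] by simp
  then have E0: "opE m a a h = (%_. 0)" if "a < t" for a
    using that by (intro fischer_definite[OF coef_poly_ops(1)[OF cp]]) auto
  have F0: "opF d a a h = (%_. 0)" if "a < t" for a
    using E0[OF that] inv that by (simp add: gl_inv_def)
  have L: "w (Lft i a) = 0" if "i < m" "a < t" for i a
  proof -
    have "(\<Sum>i<m. of_nat (w (Lft i a)) * h w) = 0"
      using fun_cong[OF E0[OF that(2)], of w] by (simp add: opE_def mulx_dvx_same)
    then have "of_nat (\<Sum>i<m. w (Lft i a)) = (0::complex)"
      using w by (simp flip: sum_distrib_right)
    then have "(\<Sum>i<m. w (Lft i a)) = 0" by (simp only: of_nat_eq_0_iff)
    then show ?thesis using that by simp
  qed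
  have R: "w (Rgt a i) = 0" if "i < d" "a < t" for i a
  proof -
    have "(\<Sum>i<d. of_nat (w (Rgt a i)) * h w) = 0"
      using fun_cong[OF F0[OF that(2)], of w] by (simp add: opF_def mulx_dvx_same)
    then have "of_nat (\<Sum>i<d. w (Rgt a i)) = (0::complex)"
      using w by (simp flip: sum_distrib_right)
    then have "(\<Sum>i<d. w (Rgt a i)) = 0" by (simp only: of_nat_eq_0_iff)
    then show ?thesis using that by simp
  qed
  have P: "w (Top i j) = 0" if "i < d" "j < d" for i j
  proof -
    have "of_nat (w (Top i j)) * h w = 0"
      unfolding mulx_dvx_same[symmetric] T[OF that] by (simp add: mulx_def)
    then show ?thesis using w by simp
  qed
  show ?thesis
  proof
    fix v
    show "w v = 0"
    proof (cases "v \<in> ?I")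
      case True then show ?thesis by (cases v) (auto simp: L R P)
    next
      case False then show ?thesis by (rule coef_polyD[OF cp w])
    qed
  qed
qed

text \<open>Subtract the orthogonal projection to the span of the monomials of this level. The images of the difference \<open>h\<close> under \<open>opD\<close> and the
derivatives with respect to \<open>Top\<close> are invariants of smaller level, so by induction they lie in the smaller
span; by adjointness they are orthogonal to it, hence zero. So \<open>h\<close> is constant, and it is orthogonal to \<open>1\<close>.\<close>

lemma invariant_in_span:
  assumes "coef_poly (yvars d m t) c" "gl_inv d m t c" "has_level d m t n c"
  shows "c \<in> lin_span (mons d m t n)"
  using assms
proof (induction n arbitrary: c)
  case 0
  then have "c = (%_. 0)" by (auto simp: has_level_def)
  then show ?case using lin_span.zero by simp
next
  case (Suc n)
  let ?I = "yvars d m t"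
  have cm: "coef_poly ?I s" if "s \<in> mons d m t (Suc n)" for s by (rule coef_poly_mons[OF that])
  obtain p where p: "p \<in> lin_span (mons d m t (Suc n))"
    and orth: "!!s. s \<in> mons d m t (Suc n) ==> fischer ?I (%w. c w - p w) s = 0"
    by (rule orthogonal_projection[OF finite_mons cm Suc.prems(1)]) (assumption | rule that)+
  define h where "h = (%w. c w - p w)"
  have h': "h = (%w. c w + (-1) * p w)" by (auto simp: h_def)
  have cp: "coef_poly ?I h" unfolding h' by (intro coef_poly_add coef_poly_scale Suc.prems lin_span_props[OF p])
  have inv: "gl_inv d m t h" unfolding h' by (intro gl_inv_linear Suc.prems lin_span_props[OF p])
  have lev: "has_level d m t (Suc n) h" unfolding h' by (intro has_level_linear Suc.prems lin_span_props[OF p])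
  have orth': "fischer ?I h s = 0" if "s \<in> mons d m t (Suc n)" for s
    unfolding h_def by (rule orth[OF that])
  have zero: "e = (%_. 0)" if "coef_poly ?I e" "gl_inv d m t e" "has_level d m t n e"
    and o: "!!s. s \<in> mons d m t n ==> fischer ?I e s = 0" for e
    by (rule fischer_definite[OF that(1) lin_span_orthogonal[OF Suc.IH[OF that(1-3)] o]])
  have "opD t i j h = (%_. 0)" if "i < m" "j < d" for i j
  proof (rule zero)
    show "fischer ?I (opD t i j h) s = 0" if s: "s \<in> mons d m t n" for s
      unfolding opD_adjoint[OF cp coef_poly_mons[OF s] \<open>i < m\<close> \<open>j < d\<close>]
      by (rule orth') (use s \<open>i < m\<close> \<open>j < d\<close> in \<open>auto intro!: rev_image_eqI[of "(i, j, s)"]\<close>)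
  qed (use that cp inv lev in \<open>auto intro: coef_poly_ops gl_inv_opD has_level_opD\<close>)
  moreover have "dvx (Top i j) h = (%_. 0)" if "i < d" "j < d" for i j
  proof (rule zero)
    have v: "Top i j \<in> ?I" "Top i j \<in> lvars d m t" using that by auto
    show "coef_poly ?I (dvx (Top i j) h)" by (rule coef_poly_dvx[OF cp v(1)])
    show "has_level d m t n (dvx (Top i j) h)" by (rule has_level_dvx[OF lev v(2)])
    show "fischer ?I (dvx (Top i j) h) s = 0" if s: "s \<in> mons d m t n" for s
      unfolding fischer_adjoint'[OF finite_yvars v(1) cp coef_poly_mons[OF s]]
      by (rule orth') (use s \<open>i < d\<close> \<open>j < d\<close> in \<open>auto intro!: rev_image_eqI[of "(i, j, s)"]\<close>)
  qed (rule gl_inv_Top[OF inv])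
  ultimately have supp: "w = (%_. 0)" if "h w ~= 0" for w
    using harmonic_invariant[OF cp inv] that by blast
  have "fischer ?I h (constc 1) = 0" by (rule orth') simp
  moreover have "fischer ?I h (constc 1) = h (%_. 0)"
    by (subst fischer_superset[of "{%_. 0}"]) (use supp in \<open>auto simp: constc_def\<close>)
  ultimately have "h = (%_. 0)" using supp by (intro ext) metis
  then have "c = p" by (auto simp: h_def fun_eq_iff)
  then show ?case using p by simp
qed

lemma evalc_span:
  assumes "s \<in> lin_span (mons d m t n)"
  obtains p where "poly_fun ({..<d + m} \<times> {..<d}) p"
    and "!!y. evalc (yvars d m t) s y = p (%(i, j). if i < d then y (Top i j) else \<Sum>a<t. y (Lft (i - d) a) * y (Rgt a j))"
proof -
  let ?I = "yvars d m t" and ?J = "{..<d + m} \<times> {..<d}"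
  let ?M = "%y (i, j). if i < d then y (Top i j) else \<Sum>a<t. y (Lft (i - d) a) * y (Rgt a j)"
  define good where "good = (%c. \<exists>p. poly_fun ?J p & (\<forall>y. evalc ?I c y = p (?M y)))"
  have mon: "good c" if "c \<in> mons d m t n" for c n
    using that
  proof (induction n arbitrary: c)
    case (Suc n)
    then consider "c = constc 1"
      | i j e where "i < d" "j < d" "e \<in> mons d m t n" "c = mulx (Top i j) e"
      | i j e where "i < m" "j < d" "e \<in> mons d m t n" "c = opQ t i j e" by auto
    then show ?case
    proof cases
      case 1
      then show ?thesis unfolding good_def
        by (intro exI[of _ "%_. 1"]) (auto simp: evalc_constc intro: poly_fun.const)
    next
      case (2 i j e)
      then obtain p where p: "poly_fun ?J p" "\<forall>y. evalc ?I e y = p (?M y)"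
        using Suc.IH unfolding good_def by blast
      have "poly_fun ?J (%x. x (i, j) * p x)" using 2 by (intro poly_fun.intros p) auto
      moreover have "evalc ?I c y = ?M y (i, j) * p (?M y)" for y
        using 2 p by (simp add: evalc_mulx finite_yvars)
      ultimately show ?thesis unfolding good_def by blast
    next
      case (3 i j e)
      then obtain p where p: "poly_fun ?J p" "\<forall>y. evalc ?I e y = p (?M y)"
        using Suc.IH unfolding good_def by blast
      have "poly_fun ?J (%x. x (d + i, j) * p x)" using 3 by (intro poly_fun.intros p) auto
      moreover have "evalc ?I c y = ?M y (d + i, j) * p (?M y)" for y
      proof -
        have "evalc ?I c y = (\<Sum>k<t. evalc ?I (mulx (Lft i k) (mulx (Rgt k j) e)) y)"
          unfolding 3(4) opQ_def
          by (rule evalc_sum, intro coef_poly_mulx coef_poly_mons[OF 3(3)]) (use 3 in auto)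
        also have "\<dots> = (\<Sum>k<t. y (Lft i k) * y (Rgt k j)) * p (?M y)"
          unfolding sum_distrib_right
          by (intro sum.cong refl) (use 3 p in \<open>simp add: evalc_mulx finite_yvars mult.assoc\<close>)
        finally show ?thesis by simp
      qed
      ultimately show ?thesis unfolding good_def by blast
    qed
  qed simp
  have "good s" using assms
  proof (induction rule: lin_span.induct)
    case zero
    then show ?case unfolding good_def by (intro exI[of _ "%_. 0"]) (auto intro: poly_fun.const)
  next
    case (step c s k)
    obtain p where p: "poly_fun ?J p" "\<forall>y. evalc ?I c y = p (?M y)" using step.IH unfolding good_def by blast
    obtain q where q: "poly_fun ?J q" "\<forall>y. evalc ?I s y = q (?M y)" using mon[OF step(2)] unfolding good_def by blast
    have "poly_fun ?J (%x. p x + k * q x)" by (intro poly_fun.intros p q)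
    moreover have "evalc ?I (%w. c w + k * s w) y = p (?M y) + k * q (?M y)" for y
      using evalc_add[OF lin_span_props(1)[OF step(1)] coef_poly_scale[OF coef_poly_mons[OF step(2)]]] p q
      by (simp add: evalc_scale)
    ultimately show ?case unfolding good_def by blast
  qed
  then show ?thesis using that unfolding good_def by blast
qed

text \<open>Invariance is only assumed where \<open>u\<close> does not vanish, and under all changes of the factors that preserve their product. Its
derivative along one-parameter subgroups is invariance under the Lie algebra, first where \<open>u\<close> does not vanish and then
everywhere.\<close>

theorem first_fundamental_theorem_GL:
  fixes d m t :: nat and G u :: "(yvar => complex) => complex"
  defines "M \<equiv> %y (i, j). if i < d then y (Top i j) else \<Sum>a<t. y (Lft (i - d) a) * y (Rgt a j)"
  assumes G: "poly_fun (yvars d m t) G" and u: "poly_fun (yvars d m t) u" "u y0 ~= 0"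
    and inv: "!!y y'. u y ~= 0 ==> M y = M y' ==> G y = G y'"
  obtains p where "poly_fun ({..<d + m} \<times> {..<d}) p" "!!y. G y = p (M y)"
proof -
  let ?I = "yvars d m t"
  obtain c where c: "coef_poly ?I c" "!!y. G y = evalc ?I c y"
    using poly_fun_imp_evalc[OF finite_yvars G] by metis
  have "opE m a b c = opF d b a c" if ab: "a < t" "b < t" for a b
  proof -
    define k where "k = (%w. opE m a b c w + (-1) * opF d b a c w)"
    have kc: "coef_poly ?I k" unfolding k_def
      by (intro coef_poly_add coef_poly_scale coef_poly_ops c ab)
    have ev: "evalc ?I k y = (\<Sum>i<m. y (Lft i a) * evalc ?I (dvx (Lft i b) c) y) - (\<Sum>j<d. y (Rgt b j) * evalc ?I (dvx (Rgt a j) c) y)" for y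
    proof -
      have "evalc ?I (opE m a b c) y = (\<Sum>i<m. evalc ?I (mulx (Lft i a) (dvx (Lft i b) c)) y)"
        unfolding opE_def by (rule evalc_sum, intro coef_poly_mulx coef_poly_dvx c) (use ab in auto)
      also have "\<dots> = (\<Sum>i<m. y (Lft i a) * evalc ?I (dvx (Lft i b) c) y)"
        by (intro sum.cong refl evalc_mulx finite_yvars) (use ab in auto)
      finally have 1: "evalc ?I (opE m a b c) y = (\<Sum>i<m. y (Lft i a) * evalc ?I (dvx (Lft i b) c) y)" .
      have "evalc ?I (opF d b a c) y = (\<Sum>j<d. evalc ?I (mulx (Rgt b j) (dvx (Rgt a j) c)) y)"
        unfolding opF_def by (rule evalc_sum, intro coef_poly_mulx coef_poly_dvx c) (use ab in auto)
      also have "\<dots> = (\<Sum>j<d. y (Rgt b j) * evalc ?I (dvx (Rgt a j) c) y)"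
        by (intro sum.cong refl evalc_mulx finite_yvars) (use ab in auto)
      finally have 2: "evalc ?I (opF d b a c) y = (\<Sum>j<d. y (Rgt b j) * evalc ?I (dvx (Rgt a j) c) y)" .
      show ?thesis unfolding k_def
          evalc_add[OF coef_poly_ops(1)[OF c(1) ab] coef_poly_scale[OF coef_poly_ops(2)[OF c(1) ab(2,1)]]]
          evalc_scale 1 2 by simp
    qed
    have k0: "evalc ?I k y = 0" if uy: "u y ~= 0" for y
    proof -
      define \<gamma> :: "complex => yvar => complex" where "\<gamma> = (%s v. case v of Top i j => y (Top i j)
        | Lft i k => if k = b then (if a = b then (1 + s) * y (Lft i a) else y (Lft i b) + s * y (Lft i a)) else y (Lft i k)
        | Rgt k j => if k = a then (if a = b then y (Rgt a j) / (1 + s) else y (Rgt a j) - s * y (Rgt b j)) else y (Rgt k j))"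
      define \<gamma>' where "\<gamma>' = (%v. case v of Top i j => 0 | Lft i k => if k = b then y (Lft i a) else 0
        | Rgt k j => if k = a then - y (Rgt b j) else 0)"
      have \<gamma>0: "\<gamma> 0 = y"
      proof
        fix v show "\<gamma> 0 v = y v" by (cases v) (auto simp: \<gamma>_def)
      qed
      have der: "((%s. \<gamma> s v) has_field_derivative \<gamma>' v) (at 0)" for v
      proof (cases v)
        case (Rgt k j)
        have "((%s. y (Rgt a j) / (1 + s)) has_field_derivative - y (Rgt a j)) (at 0)"
          by (auto intro!: derivative_eq_intros)
        moreover have "((%s. y (Rgt a j) - s * y (Rgt b j)) has_field_derivative - y (Rgt b j)) (at 0)"
          by (auto intro!: derivative_eq_intros)
        ultimately show ?thesis using Rgt by (cases "a = b") (auto simp: \<gamma>_def \<gamma>'_def)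
      next
        case (Lft i k)
        have "((%s. (1 + s) * y (Lft i a)) has_field_derivative y (Lft i a)) (at 0)"
          by (auto intro!: derivative_eq_intros)
        moreover have "((%s. y (Lft i b) + s * y (Lft i a)) has_field_derivative y (Lft i a)) (at 0)"
          by (auto intro!: derivative_eq_intros)
        ultimately show ?thesis using Lft by (cases "a = b") (auto simp: \<gamma>_def \<gamma>'_def)
      qed (auto simp: \<gamma>_def \<gamma>'_def)
      have Meq: "M y = M (\<gamma> s)" if s: "1 + s ~= 0" for s
      proof -
        have "(\<Sum>k<t. \<gamma> s (Lft i k) * \<gamma> s (Rgt k j)) = (\<Sum>k<t. y (Lft i k) * y (Rgt k j))" for i j
        proof (cases "a = b")
          case True
          then show ?thesis using s by (intro sum.cong refl) (auto simp: \<gamma>_def)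
        next
          case False
          have "\<gamma> s (Lft i k) * \<gamma> s (Rgt k j) = y (Lft i k) * y (Rgt k j)
              + (if k = b then s * y (Lft i a) * y (Rgt b j) else 0)
              - (if k = a then s * y (Lft i a) * y (Rgt b j) else 0)" for k
            using False by (auto simp: \<gamma>_def algebra_simps)
          then show ?thesis using ab by (simp add: sum.distrib sum_subtractf sum.delta)
        qed
        then show ?thesis by (auto simp: M_def fun_eq_iff) (simp_all add: \<gamma>_def)
      qed
      have "((%s. evalc ?I c (\<gamma> s)) has_field_derivative (\<Sum>v\<in>?I. \<gamma>' v * evalc ?I (dvx v c) (\<gamma> 0))) (at 0)"
        by (rule evalc_chain_rule[OF finite_yvars c(1) der])
      moreover have "((%s. evalc ?I c (\<gamma> s)) has_field_derivative 0) (at 0)"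
      proof -
        have "\<forall>\<^sub>F s in nhds 0. 1 + s ~= (0::complex)"
        proof -
          have "\<forall>\<^sub>F s in nhds 0. s ~= (-1::complex)" by (rule t1_space_nhds) simp
          then show ?thesis by eventually_elim (metis add.inverse_inverse add_eq_0_iff)
        qed
        then have "\<forall>\<^sub>F s in nhds 0. evalc ?I c (\<gamma> s) = evalc ?I c y"
          by eventually_elim (simp add: c(2)[symmetric] inv[OF uy Meq, symmetric])
        then show ?thesis using DERIV_cong_ev[of 0 0 "%s. evalc ?I c (\<gamma> s)" "%_. evalc ?I c y" 0 0]
          by simp
      qed
      ultimately have "(\<Sum>v\<in>?I. \<gamma>' v * evalc ?I (dvx v c) y) = 0"
        unfolding \<gamma>0 by (rule DERIV_unique)
      also have "(\<Sum>v\<in>?I. \<gamma>' v * evalc ?I (dvx v c) y) =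
          (\<Sum>v\<in>(%i. Lft i b) ` {..<m} \<union> (%j. Rgt a j) ` {..<d}. \<gamma>' v * evalc ?I (dvx v c) y)"
      proof (rule sum.mono_neutral_right[OF finite_yvars])
        show "(%i. Lft i b) ` {..<m} \<union> Rgt a ` {..<d} \<subseteq> ?I" using ab by auto
        show "\<forall>v\<in>?I - ((%i. Lft i b) ` {..<m} \<union> Rgt a ` {..<d}). \<gamma>' v * evalc ?I (dvx v c) y = 0"
        proof
          fix v assume "v \<in> ?I - ((%i. Lft i b) ` {..<m} \<union> Rgt a ` {..<d})"
          then have "\<gamma>' v = 0" by (cases v) (auto simp: \<gamma>'_def)
          then show "\<gamma>' v * evalc ?I (dvx v c) y = 0" by simp
        qed
      qed
      also have "\<dots> = (\<Sum>v\<in>(%i. Lft i b) ` {..<m}. \<gamma>' v * evalc ?I (dvx v c) y)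
          + (\<Sum>v\<in>(%j. Rgt a j) ` {..<d}. \<gamma>' v * evalc ?I (dvx v c) y)"
        by (rule sum.union_disjoint) auto
      also have "\<dots> = evalc ?I k y"
        unfolding ev by (subst (1 2) sum.reindex) (auto simp: inj_on_def \<gamma>'_def sum_negf)
      finally show ?thesis .
    qed
    have pk: "poly_fun ?I (evalc ?I k)"
      unfolding evalc_def by (intro poly_fun_sum poly_fun.mult poly_fun.const poly_fun_prod poly_fun_power poly_fun.coord)
    have "u y * evalc ?I k y = 0" for y using k0 by (cases "u y = 0") auto
    then have "evalc ?I k y = 0" for y
      using poly_fun_no_zero_divisors[OF u(1) pk _ u(2)] by simp
    then have "k = (%_. 0)" by (rule evalc_injective[OF finite_yvars kc])
    then show ?thesis by (auto simp: k_def fun_eq_iff)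
  qed
  then have inv_c: "gl_inv d m t c" by (simp add: gl_inv_def)
  have "finite {w. c w ~= 0}" using c(1) by (simp add: coef_poly_def)
  then have "\<exists>n. \<forall>w\<in>{w. c w ~= 0}. sum w (lvars d m t) < n"
    using finite_nat_set_iff_bounded[of "(%w. sum w (lvars d m t)) ` {w. c w ~= 0}"] by blast
  then obtain n where "has_level d m t n c" unfolding has_level_def by blast
  then have "c \<in> lin_span (mons d m t n)" by (rule invariant_in_span[OF c(1) inv_c])
  from evalc_span[OF this] obtain p where p: "poly_fun ({..<d + m} \<times> {..<d}) p"
    "!!y. evalc ?I c y = p (%(i, j). if i < d then y (Top i j) else \<Sum>a<t. y (Lft (i - d) a) * y (Rgt a j))"
    by blast
  show ?thesis by (rule that[OF p(1)]) (simp only: c(2) p(2) M_def)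
qed

section \<open>Subspaces and matrices\<close>

definition colspan :: "complex mat => complex vec set" where
  "colspan M = (%v. M *\<^sub>v v) ` carrier_vec (dim_col M)"

definition full_col_rank :: "complex mat => bool" where
  "full_col_rank M \<longleftrightarrow> (\<forall>v\<in>carrier_vec (dim_col M). M *\<^sub>v v = 0\<^sub>v (dim_row M) --> v = 0\<^sub>v (dim_col M))"

text \<open>The maximal minors of \<open>M\<close>. They are the coordinates of the exterior product of the columns.\<close>

definition plk :: "nat => nat => complex mat => nat set => complex" where
  "plk N d M J = (if J \<in> plucker_index d N then det (mat d d (%(i, j). M $$ (pick J i, j))) else 0)"

lemma full_col_rankD:
  assumes "full_col_rank M" "M \<in> carrier_mat N d" "v \<in> carrier_vec d" "M *\<^sub>v v = 0\<^sub>v N"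
  shows "v = 0\<^sub>v d"
  using assms unfolding full_col_rank_def by auto

lemma span_cols:
  assumes "set vs \<subseteq> carrier_vec N"
  shows "LinearCombinations.module.span class_ring (module_vec TYPE(complex) N) (set vs) = colspan (mat_of_cols N vs)"
proof -
  interpret vec_space "TYPE(complex)" N .
  have "cols (mat_of_cols N vs) = vs" using assms by (simp add: cols_mat_of_cols)
  then have "span (set vs) = col_space (mat_of_cols N vs)" by (simp add: col_space_def)
  also have "\<dots> = colspan (mat_of_cols N vs)"
    by (subst col_space_eq[of _ "length vs"]) (auto simp: colspan_def intro!: mult_mat_vec_carrier[OF mat_of_cols_carrier(1)])
  finally show ?thesis .
qed

lemma lincomb_cols:
  assumes "set vs \<subseteq> carrier_vec N" "distinct vs"
  shows "LinearCombinations.module.lincomb (module_vec TYPE(complex) N) f (set vs) =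
    mat_of_cols N vs *\<^sub>v vec (length vs) (%i. f (vs ! i))"
proof -
  interpret vec_space "TYPE(complex)" N .
  show ?thesis
    unfolding lincomb_as_lincomb_list_distinct[OF assms]
    by (rule lincomb_list_as_mat_mult) (use assms in auto)
qed

lemma lin_indpt_cols_iff:
  assumes "set vs \<subseteq> carrier_vec N" "distinct vs"
  shows "\<not> LinearCombinations.module.lin_dep class_ring (module_vec TYPE(complex) N) (set vs) \<longleftrightarrow>
    full_col_rank (mat_of_cols N vs)"
proof -
  interpret vec_space "TYPE(complex)" N .
  show ?thesis
  proof
    assume li: "\<not> lin_dep (set vs)"
    show "full_col_rank (mat_of_cols N vs)" unfolding full_col_rank_def
    proof (intro ballI impI)
      fix v assume v: "v \<in> carrier_vec (dim_col (mat_of_cols N vs))"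
        "mat_of_cols N vs *\<^sub>v v = 0\<^sub>v (dim_row (mat_of_cols N vs))"
      have dv: "dim_vec v = length vs" using v(1) by simp
      define f where "f = (%x. v $ (THE i. i < length vs & vs ! i = x))"
      have f: "f (vs ! i) = v $ i" if "i < length vs" for i
      proof -
        have "(THE j. j < length vs & vs ! j = vs ! i) = i"
          using that assms(2) by (intro the_equality) (auto simp: nth_eq_iff_index_eq)
        then show ?thesis by (simp add: f_def)
      qed
      have "vec (length vs) (%i. f (vs ! i)) = v" using dv f by (intro eq_vecI) auto
      then have lc: "lincomb f (set vs) = 0\<^sub>v N" using lincomb_cols[OF assms, of f] v(2) by simp
      have "f x = 0" if "x \<in> set vs" for x
      proof (rule ccontr)
        assume "f x ~= 0"
        then have "lin_dep (set vs)" unfolding lin_dep_def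
          using lc that by (intro exI[of _ "set vs"] exI[of _ f] exI[of _ x]) auto
        then show False using li by simp
      qed
      then have "v $ i = 0" if "i < length vs" for i using f[OF that] that by (metis nth_mem)
      then show "v = 0\<^sub>v (dim_col (mat_of_cols N vs))" using dv by (intro eq_vecI) auto
    qed
  next
    assume fr: "full_col_rank (mat_of_cols N vs)"
    show "\<not> lin_dep (set vs)"
    proof
      assume "lin_dep (set vs)"
      from finite_lin_dep[OF finite_set this] assms(1) obtain a v
        where a: "lincomb a (set vs) = 0\<^sub>v N" and v: "v \<in> set vs" "a v ~= 0" by auto
      let ?u = "vec (length vs) (%i. a (vs ! i))"
      have "mat_of_cols N vs *\<^sub>v ?u = 0\<^sub>v N" using lincomb_cols[OF assms, of a] a by simp
      then have u: "?u = 0\<^sub>v (length vs)"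
        by (intro full_col_rankD[OF fr mat_of_cols_carrier(1)]) simp_all
      obtain i where i: "i < length vs" "vs ! i = v" using v(1) by (auto simp: in_set_conv_nth)
      have "?u $ i = a v" using i by simp
      then show False using u i v(2) by simp
    qed
  qed
qed

lemma full_col_rank_distinct:
  assumes "full_col_rank (mat_of_cols N vs)"
  shows "distinct vs"
proof (rule ccontr)
  assume "\<not> distinct vs"
  then obtain i j where ij: "i < length vs" "j < length vs" "i ~= j" "vs ! i = vs ! j"
    by (auto simp: distinct_conv_nth)
  let ?u = "vec (length vs) (%k. if k = i then 1 else if k = j then -1 else (0::complex))"
  have "mat_of_cols N vs *\<^sub>v ?u = 0\<^sub>v N"
  proof (rule eq_vecI)
    fix r assume r: "r < dim_vec (0\<^sub>v N)"
    have "(mat_of_cols N vs *\<^sub>v ?u) $ r = (\<Sum>k<length vs. vs ! k $ r * (if k = i then 1 else if k = j then -1 else 0))"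
      using r by (simp add: scalar_prod_def mat_of_cols_index atLeast0LessThan)
    also have "\<dots> = (\<Sum>k\<in>{i, j}. vs ! k $ r * (if k = i then 1 else if k = j then -1 else 0))"
      using ij by (intro sum.mono_neutral_right) auto
    also have "\<dots> = 0" using ij by simp
    finally show "(mat_of_cols N vs *\<^sub>v ?u) $ r = 0\<^sub>v N $ r" using r by simp
  qed simp
  then have "?u = 0\<^sub>v (length vs)" by (intro full_col_rankD[OF assms mat_of_cols_carrier(1)]) simp_all
  moreover have "?u $ i = 1" using ij by simp
  ultimately show False using ij by simp
qed

lemma mat_of_cols_carrier_cols:
  assumes "M \<in> carrier_mat N d"
  shows "mat_of_cols N (cols M) = M" "set (cols M) \<subseteq> carrier_vec N" "length (cols M) = d"
  using assms mat_of_cols_cols[of M] cols_dim[of M] by auto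

lemma colspan_subspace:
  assumes "M \<in> carrier_mat N d"
  shows "VectorSpace.subspace class_ring (colspan M) (module_vec TYPE(complex) N)"
proof -
  interpret vec_space "TYPE(complex)" N .
  note c = mat_of_cols_carrier_cols(2)[OF assms]
  have "colspan M = span (set (cols M))" using span_cols[OF c] mat_of_cols_carrier_cols(1)[OF assms] by simp
  then show ?thesis using span_is_subspace[OF c] by simp
qed

lemma ordered_basis_iff:
  assumes V: "VectorSpace.subspace class_ring V (module_vec TYPE(complex) N)"
  shows "distinct vs & vectorspace.basis class_ring (subspace_vs N V) (set vs) \<longleftrightarrow>
    set vs \<subseteq> carrier_vec N & full_col_rank (mat_of_cols N vs) & colspan (mat_of_cols N vs) = V"
proof -
  interpret vec_space "TYPE(complex)" N .
  interpret W: vectorspace class_ring "subspace_vs N V"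
    unfolding subspace_vs_def by (rule subspace_is_vs[OF V])
  have sub: "submodule class_ring V (module_vec TYPE(complex) N)" using V by (rule is_module)
  have VN: "V \<subseteq> carrier_vec N"
    using sub unfolding submodule_def by auto
  have cV': "carrier (subspace_vs N V) = V" by (simp add: subspace_vs_def)
  have eq: "W.span S = span S" "W.lin_dep S = lin_dep S" if "S \<subseteq> V" for S
    using span_li_not_depend[OF that sub] by (simp_all add: subspace_vs_def)
  have "W.basis (set vs) \<longleftrightarrow> set vs \<subseteq> V & \<not> lin_dep (set vs) & span (set vs) = V"
    unfolding W.basis_def cV' using eq[of "set vs"] by auto
  moreover have "span (set vs) = V ==> set vs \<subseteq> carrier_vec N ==> set vs \<subseteq> V"
    using in_own_span[of "set vs"] by auto
  ultimately show ?thesis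
    using VN span_cols[of vs N] lin_indpt_cols_iff[of vs N] full_col_rank_distinct[of N vs] by auto
qed

lemma subspace_dim_colspan:
  assumes "M \<in> carrier_mat N d" "full_col_rank M"
  shows "vectorspace.dim class_ring (subspace_vs N (colspan M)) = d"
proof -
  interpret vec_space "TYPE(complex)" N .
  interpret W: vectorspace class_ring "subspace_vs N (colspan M)"
    unfolding subspace_vs_def by (rule subspace_is_vs[OF colspan_subspace[OF assms(1)]])
  note c = mat_of_cols_carrier_cols[OF assms(1)]
  have *: "distinct (cols M) & W.basis (set (cols M))"
    unfolding ordered_basis_iff[OF colspan_subspace[OF assms(1)]] using c assms by simp
  then have "W.dim = card (set (cols M))" using W.dim_basis by blast
  also have "\<dots> = d" using * c(3) by (simp add: distinct_card)
  finally show ?thesis .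
qed

lemma grassmannian_iff:
  "V \<in> grassmannian d N \<longleftrightarrow> (\<exists>M\<in>carrier_mat N d. full_col_rank M & V = colspan M)"
proof
  assume V: "V \<in> grassmannian d N"
  interpret vec_space "TYPE(complex)" N .
  have sV: "VectorSpace.subspace class_ring V (module_vec TYPE(complex) N)"
    and dV: "vectorspace.dim class_ring (subspace_vs N V) = d"
    using V by (auto simp: grassmannian_def)
  interpret W: vectorspace class_ring "subspace_vs N V"
    unfolding subspace_vs_def by (rule subspace_is_vs[OF sV])
  have sub: "submodule class_ring V (module_vec TYPE(complex) N)" using sV by (rule is_module)
  have VN: "V \<subseteq> carrier_vec N"
    using sub unfolding submodule_def by auto
  have cV': "carrier (subspace_vs N V) = V" by (simp add: subspace_vs_def)
  have eq: "W.lin_dep S = lin_dep S" if "S \<subseteq> V" for S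
    using span_li_not_depend[OF that sub] by (simp_all add: subspace_vs_def)
  have bound: "finite A & card A \<le> dim" if "A \<subseteq> carrier (subspace_vs N V) & W.lin_indpt A" for A
  proof -
    have "A \<subseteq> V" "\<not> lin_dep A" using that eq[of A] cV' by auto
    then show ?thesis using li_le_dim[OF fin_dim, of A] VN by auto
  qed
  have "{} \<subseteq> carrier (subspace_vs N V) & W.lin_indpt {}"
    by (auto simp: W.lin_dep_def)
  from maximal_exists[of "%S. S \<subseteq> carrier (subspace_vs N V) & W.lin_indpt S", OF bound this]
  obtain A where A: "finite A" "W.basis A" using W.max_li_is_basis by blast
  obtain vs where vs: "set vs = A" "distinct vs" using finite_distinct_list[OF A(1)] by blast
  have *: "set vs \<subseteq> carrier_vec N & full_col_rank (mat_of_cols N vs) & colspan (mat_of_cols N vs) = V"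
    using ordered_basis_iff[OF sV, of vs] vs A by simp
  have "d = length vs" using W.dim_basis[OF A] dV vs by (simp add: distinct_card[symmetric])
  then show "\<exists>M\<in>carrier_mat N d. full_col_rank M & V = colspan M"
    using * by (intro bexI[of _ "mat_of_cols N vs"]) auto
next
  assume "\<exists>M\<in>carrier_mat N d. full_col_rank M & V = colspan M"
  then show "V \<in> grassmannian d N"
    using colspan_subspace subspace_dim_colspan unfolding grassmannian_def by auto
qed

section \<open>Pluecker coordinates\<close>

lemma pick_bij:
  assumes "J \<in> plucker_index d N"
  shows "bij_betw (pick J) {..<d} J" "!!i. i < d ==> pick J i < N"
proof -
  have J: "J \<subseteq> {..<N}" "card J = d" "finite J"
    using assms finite_subset by (auto simp: plucker_index_def)
  have inj: "inj_on (pick J) {..<d}"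
  proof (rule inj_onI)
    fix x y assume "x \<in> {..<d}" "y \<in> {..<d}" "pick J x = pick J y"
    then show "x = y" using pick_mono_le[of x J y] pick_mono_le[of y J x] J
      by (metis lessThan_iff less_irrefl linorder_neqE_nat)
  qed
  have sub: "pick J ` {..<d} \<subseteq> J" using pick_in_set_le J by auto
  have "pick J ` {..<d} = J"
    by (rule card_subset_eq[OF J(3) sub]) (simp add: card_image[OF inj] J)
  then show "bij_betw (pick J) {..<d} J" using inj by (simp add: bij_betw_def)
  show "!!i. i < d ==> pick J i < N" using sub J(1) by auto
qed

lemma plucker_index_lessThan: "d \<le> N ==> {..<d} \<in> plucker_index d N"
  by (auto simp: plucker_index_def)

lemma pick_lessThan: assumes "i < d" shows "pick {..<d} i = i"
proof -
  have "{a \<in> {..<d}. a < i} = {..<i}" using assms by auto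
  then show ?thesis using pick_card_in_set[of i "{..<d}"] assms by simp
qed

lemma wedge_eq_plk:
  assumes "length vs = d"
  shows "wedge N vs = plk N d (mat_of_cols N vs)"
proof
  fix J
  show "wedge N vs J = plk N d (mat_of_cols N vs) J"
  proof (cases "J \<in> plucker_index d N")
    case True
    then have c: "card {i. i < N & i \<in> J} = d"
      by (auto simp: plucker_index_def intro!: arg_cong[where f=card])
    have "submatrix (mat_of_cols N vs) J UNIV = mat d d (%(i, j). mat_of_cols N vs $$ (pick J i, j))"
      unfolding submatrix_def using c assms by (intro eq_matI) (auto simp: pick_UNIV)
    then show ?thesis using True assms by (simp add: wedge_def plk_def)
  qed (use assms in \<open>simp add: wedge_def plk_def\<close>)
qed

lemma det_rows_mult:
  assumes "M \<in> carrier_mat N d" "g \<in> carrier_mat d d" "!!i. i < d ==> f i < N"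
  shows "det (mat d d (%(i, j). (M * g) $$ (f i, j))) = det (mat d d (%(i, j). M $$ (f i, j))) * det g"
proof -
  have "mat d d (%(i, j). (M * g) $$ (f i, j)) = mat d d (%(i, j). M $$ (f i, j)) * g"
    using assms by (intro eq_matI) (auto simp: scalar_prod_def)
  then show ?thesis using det_mult[of _ d g] assms by simp
qed

lemma plk_mult:
  assumes "M \<in> carrier_mat N d" "g \<in> carrier_mat d d"
  shows "plk N d (M * g) = (%J. det g * plk N d M J)"
proof
  fix J show "plk N d (M * g) J = det g * plk N d M J"
  proof (cases "J \<in> plucker_index d N")
    case True
    from det_rows_mult[OF assms pick_bij(2)[OF True]] True show ?thesis by (simp add: plk_def mult.commute)
  qed (simp add: plk_def)
qed

lemma det_nonzero_inverse:
  fixes g :: "complex mat"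
  assumes "g \<in> carrier_mat d d" "det g ~= 0"
  obtains h where "h \<in> carrier_mat d d" "g * h = 1\<^sub>m d" "h * g = 1\<^sub>m d"
  using det_non_zero_imp_unit[OF assms(1), of "()"] assms
  unfolding Units_def ring_mat_def by auto

lemma colspan_mult:
  assumes "M \<in> carrier_mat N d" "g \<in> carrier_mat d d" "det g ~= 0"
  shows "colspan (M * g) = colspan M"
proof -
  obtain h where h: "h \<in> carrier_mat d d" "g * h = 1\<^sub>m d"
    using det_nonzero_inverse[OF assms(2,3)] by metis
  have sub: "colspan (A * k) \<subseteq> colspan A" if "A \<in> carrier_mat N d" "k \<in> carrier_mat d d" for A k
  proof
    fix x assume "x \<in> colspan (A * k)"
    then obtain v where v: "v \<in> carrier_vec (dim_col k)" "x = (A * k) *\<^sub>v v" by (auto simp: colspan_def)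
    then have "v \<in> carrier_vec d" using that by simp
    note v = this v(2)
    then have "x = A *\<^sub>v (k *\<^sub>v v)" using that by simp
    then show "x \<in> colspan A" using v that by (auto simp: colspan_def)
  qed
  have "M = M * g * h" using assms h by simp
  then have "colspan M \<subseteq> colspan (M * g)" using sub[of "M * g" h] assms h by auto
  then show ?thesis using sub[OF assms(1,2)] by auto
qed

lemma full_col_rank_mult:
  assumes "M \<in> carrier_mat N d" "g \<in> carrier_mat d d" "det g ~= 0" "full_col_rank M"
  shows "full_col_rank (M * g)"
  unfolding full_col_rank_def
proof (intro ballI impI)
  fix v assume "v \<in> carrier_vec (dim_col (M * g))" and *: "(M * g) *\<^sub>v v = 0\<^sub>v (dim_row (M * g))"
  then have v: "v \<in> carrier_vec d" using assms by simp
  have "M *\<^sub>v (g *\<^sub>v v) = 0\<^sub>v N" using * assms v by simp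
  then have "g *\<^sub>v v = 0\<^sub>v d" using full_col_rankD[OF assms(4,1)] assms v by auto
  then have "v = 0\<^sub>v d" using det_0_iff_vec_prod_zero_field[OF assms(2)] assms(3) v by auto
  then show "v = 0\<^sub>v (dim_col (M * g))" using assms by simp
qed

lemma colspan_eq_imp_mult:
  assumes "M \<in> carrier_mat N d" "W \<in> carrier_mat N d" "full_col_rank W" "colspan W = colspan M"
  obtains g where "g \<in> carrier_mat d d" "W = M * g" "det g ~= 0"
proof -
  have "\<exists>v\<in>carrier_vec d. M *\<^sub>v v = col W j" if "j < d" for j
  proof -
    have "W *\<^sub>v unit_vec d j = col W j" using assms(2) that by (intro eq_vecI) auto
    then have "col W j \<in> colspan W" using assms(2)
      unfolding colspan_def by (intro image_eqI[of _ _ "unit_vec d j"]) auto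
    then have "col W j \<in> colspan M" using assms(4) by simp
    then show ?thesis using assms(1) by (auto simp: colspan_def)
  qed
  then obtain v where v: "!!j. j < d ==> v j \<in> carrier_vec d & M *\<^sub>v v j = col W j" by metis
  define g where "g = mat d d (%(i, j). v j $ i)"
  have g: "g \<in> carrier_mat d d" by (simp add: g_def)
  have colg: "col g j = v j" if "j < d" for j using v[OF that] that by (auto simp: g_def)
  have W: "W = M * g"
  proof (rule mat_col_eqI)
    fix j assume "j < dim_col (M * g)"
    then have j: "j < d" using g by simp
    show "col W j = col (M * g) j" using col_mult2[OF assms(1) g j] colg[OF j] v[OF j] by simp
  qed (use assms g in auto)
  have "det g ~= 0"
  proof
    assume "det g = 0"
    then obtain u where u: "u \<in> carrier_vec d" "u ~= 0\<^sub>v d" "g *\<^sub>v u = 0\<^sub>v d"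
      using det_0_iff_vec_prod_zero_field[OF g] by auto
    have "W *\<^sub>v u = M *\<^sub>v (g *\<^sub>v u)" unfolding W using assms(1) g u by simp
    also have "\<dots> = 0\<^sub>v N" using u assms(1) by auto
    finally show False using full_col_rankD[OF assms(3,2)] u by auto
  qed
  then show ?thesis using that g W by blast
qed

text \<open>Two ordered bases of a subspace differ by an invertible matrix, and the minors change by its determinant. Conversely every multiple
of the coordinates comes from a basis, as one basis vector can be rescaled.\<close>

lemma plucker_colspan:
  assumes "M \<in> carrier_mat N d" "full_col_rank M" "0 < d"
  shows "plucker N (colspan M) = proj_point (plk N d M)"
proof (intro equalityI subsetI)
  fix x assume "x \<in> plucker N (colspan M)"
  then obtain vs where vs: "x = wedge N vs" "distinct vs"
    "vectorspace.basis class_ring (subspace_vs N (colspan M)) (set vs)"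
    unfolding plucker_def by blast
  then have W: "set vs \<subseteq> carrier_vec N" "full_col_rank (mat_of_cols N vs)" "colspan (mat_of_cols N vs) = colspan M"
    using ordered_basis_iff[OF colspan_subspace[OF assms(1)], of vs] by auto
  have "length vs = d"
    using subspace_dim_colspan[OF mat_of_cols_carrier(1) W(2)] subspace_dim_colspan[OF assms(1,2)] W(3) by simp
  then have "mat_of_cols N vs \<in> carrier_mat N d" by auto
  from colspan_eq_imp_mult[OF assms(1) this W(2,3)] obtain g
    where g: "g \<in> carrier_mat d d" "mat_of_cols N vs = M * g" "det g ~= 0" by metis
  then have "x = (%J. det g * plk N d M J)"
    unfolding vs(1) wedge_eq_plk[OF \<open>length vs = d\<close>] g(2) using plk_mult[OF assms(1) g(1)] by simp
  then show "x \<in> proj_point (plk N d M)" using g(3) unfolding proj_point_def by blast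
next
  fix x assume "x \<in> proj_point (plk N d M)"
  then obtain c where c: "c ~= 0" "x = (%J. c * plk N d M J)" unfolding proj_point_def by blast
  define g where "g = mat_diag d (%i. if i = 0 then c else 1)"
  have gc: "g \<in> carrier_mat d d" by (simp add: g_def)
  have "upper_triangular g" by (auto simp: g_def mat_diag_def)
  then have "det g = prod_list (diag_mat g)" using gc by (rule det_upper_triangular)
  also have "\<dots> = (\<Prod>i = 0..<d. g $$ (i, i))" using gc by (simp add: prod_list_diag_prod)
  also have "\<dots> = (\<Prod>i = 0..<d. if i = 0 then c else 1)"
    by (intro prod.cong refl) (auto simp: g_def mat_diag_def)
  also have "\<dots> = c" using assms(3) by (simp add: prod.delta)
  finally have dg: "det g = c" .
  let ?vs = "cols (M * g)"
  have vs: "set ?vs \<subseteq> carrier_vec N" "mat_of_cols N ?vs = M * g" "length ?vs = d"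
    using mat_of_cols_carrier_cols[OF mult_carrier_mat[OF assms(1) gc]] by auto
  have "distinct ?vs & vectorspace.basis class_ring (subspace_vs N (colspan M)) (set ?vs)"
    unfolding ordered_basis_iff[OF colspan_subspace[OF assms(1)]] vs(2)
    using vs(1) full_col_rank_mult[OF assms(1) gc _ assms(2)] colspan_mult[OF assms(1) gc] c dg by simp
  moreover have "x = wedge N ?vs"
    unfolding wedge_eq_plk[OF vs(3)] vs(2) plk_mult[OF assms(1) gc] dg by (rule c)
  ultimately show "x \<in> plucker N (colspan M)" unfolding plucker_def by blast
qed

subsection \<open>Charts\<close>

text \<open>The value on basis vectors of the alternating form with coordinates \<open>x\<close>: the index \<open>f\<close> may be unsorted or have repetitions,
and the determinant is the sign of the sorting permutation.\<close>

definition ext_coord :: "nat => (nat set => complex) => (nat => nat) => complex" where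
  "ext_coord d x f = (if inj_on f {..<d}
     then det (mat d d (%(i, k). if f i = pick (f ` {..<d}) k then 1 else 0)) * x (f ` {..<d}) else 0)"

text \<open>If \<open>M\<close> is normalized to the identity in the rows \<open>J\<close>, then its entry in row \<open>i\<close> and column \<open>j\<close> is the minor for the rows \<open>J\<close> with the \<open>j\<close>-th one
replaced by \<open>i\<close>. So the matrix is linear in the Pluecker coordinates, up to the factor \<open>x J\<close>.\<close>

definition chart :: "nat => nat => nat set => (nat set => complex) => complex mat" where
  "chart N d J x = mat N d (%(i, j). ext_coord d x ((pick J)(j := i)))"

lemma image_plucker_index:
  "inj_on f {..<d} ==> (!!i. i < d ==> f i < N) ==> f ` {..<d} \<in> plucker_index d N"
  by (auto simp: plucker_index_def card_image)

lemma ext_coord_plk: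
  assumes M: "M \<in> carrier_mat N d" and f: "!!i. i < d ==> f i < N"
  shows "ext_coord d (plk N d M) f = det (mat d d (%(i, j). M $$ (f i, j)))"
proof (cases "inj_on f {..<d}")
  case True
  let ?J = "f ` {..<d}"
  have J: "?J \<in> plucker_index d N" by (rule image_plucker_index[OF True f])
  note bij = pick_bij(1)[OF J]
  let ?P = "mat d d (%(i, k). if f i = pick ?J k then 1 else 0) :: complex mat"
  let ?S = "mat d d (%(i, j). M $$ (pick ?J i, j))"
  have "mat d d (%(i, j). M $$ (f i, j)) = ?P * ?S"
  proof (rule eq_matI)
    fix i j assume "i < dim_row (?P * ?S)" "j < dim_col (?P * ?S)"
    then have ij: "i < d" "j < d" by auto
    have "f i \<in> ?J" using ij by auto
    then obtain k where k: "k < d" "pick ?J k = f i"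
      using bij unfolding bij_betw_def by (metis image_iff lessThan_iff)
    have u: "f i = pick ?J l \<longleftrightarrow> l = k" if "l < d" for l
      using bij k that unfolding bij_betw_def inj_on_def by (metis lessThan_iff)
    have "(?P * ?S) $$ (i, j) = (\<Sum>l<d. (if f i = pick ?J l then 1 else 0) * M $$ (pick ?J l, j))"
      using ij by (simp add: scalar_prod_def atLeast0LessThan)
    also have "\<dots> = (\<Sum>l<d. if l = k then M $$ (f i, j) else 0)"
      by (intro sum.cong refl) (use u k in auto)
    also have "\<dots> = M $$ (f i, j)" using k by (simp add: sum.delta)
    finally show "mat d d (%(i, j). M $$ (f i, j)) $$ (i, j) = (?P * ?S) $$ (i, j)" using ij by simp
  qed auto
  then have "det (mat d d (%(i, j). M $$ (f i, j))) = det ?P * det ?S"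
    using det_mult[of ?P d ?S] by simp
  then show ?thesis using True J by (simp add: ext_coord_def plk_def)
next
  case False
  then obtain i i' where ii: "i < d" "i' < d" "i ~= i'" "f i = f i'" by (auto simp: inj_on_def)
  have "det (mat d d (%(i, j). M $$ (f i, j))) = 0"
    by (rule det_identical_rows[of _ d i i']) (use ii in \<open>auto intro!: eq_vecI\<close>)
  then show ?thesis using False by (simp add: ext_coord_def)
qed

lemma ext_coord_scale: "ext_coord d (%K. c * x K) f = c * ext_coord d x f"
  by (simp add: ext_coord_def)

lemma hom_poly_ext_coord:
  assumes "d \<le> N" "!!i. i < d ==> f i < N"
  shows "hom_poly (plucker_index d N) 1 (%x. ext_coord d x f)"
proof (cases "inj_on f {..<d}")
  case True
  then show ?thesis
    using hom_poly_cmult[OF hom_poly.coord[OF image_plucker_index[OF True assms(2)]]] by (simp add: ext_coord_def)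
next
  case False
  have "plucker_index d N ~= {}" using plucker_index_lessThan[OF assms(1)] by auto
  then show ?thesis using False by (simp add: ext_coord_def hom_poly_zero)
qed

lemma chart_index_less:
  assumes "J \<in> plucker_index d N" "i < N" "r < d"
  shows "((pick J)(j := i)) r < N"
  using assms pick_bij(2)[OF assms(1)] by auto

lemma hom_poly_chart:
  assumes "d \<le> N" "J \<in> plucker_index d N" "i < N" "j < d"
  shows "hom_poly (plucker_index d N) 1 (%x. chart N d J x $$ (i, j))"
proof -
  have "hom_poly (plucker_index d N) 1 (%x. ext_coord d x ((pick J)(j := i)))"
    by (rule hom_poly_ext_coord[OF assms(1) chart_index_less[OF assms(2,3)]])
  then show ?thesis using assms by (simp add: chart_def)
qed

lemma chart_carrier [simp]: "chart N d J x \<in> carrier_mat N d"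
  by (simp add: chart_def)

lemma det_replace_row_one:
  assumes "j < d"
  shows "det (mat d d (%(r, s). if r = j then v s else if r = s then 1 else 0)) = (v j :: complex)"
proof -
  let ?x = "vec d v"
  have "mat d d (%(r, s). if r = j then v s else if r = s then 1 else 0) = (replace_col (1\<^sub>m d) (1\<^sub>m d *\<^sub>v ?x) j)\<^sup>T"
    by (rule eq_matI) (auto simp: replace_col_def)
  then have "det (mat d d (%(r, s). if r = j then v s else if r = s then 1 else 0)) = det (replace_col (1\<^sub>m d) (1\<^sub>m d *\<^sub>v ?x) j)"
    using det_transpose[of "replace_col (1\<^sub>m d) (1\<^sub>m d *\<^sub>v ?x) j" d] by (simp add: replace_col_def carrier_matI)
  also have "\<dots> = v j" using cramer_lemma_mat[of "1\<^sub>m d" d ?x j] assms by simp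
  finally show ?thesis .
qed

lemma chart_plk:
  assumes M: "M \<in> carrier_mat N d" and J: "J \<in> plucker_index d N"
    and norm: "!!i j. i < d ==> j < d ==> M $$ (pick J i, j) = (if i = j then 1 else 0)"
    and x: "x = (%K. c * plk N d M K)"
  shows "chart N d J x = c \<cdot>\<^sub>m M"
proof (rule eq_matI)
  fix i j assume "i < dim_row (c \<cdot>\<^sub>m M)" "j < dim_col (c \<cdot>\<^sub>m M)"
  then have ij: "i < N" "j < d" using M by auto
  have ext: "ext_coord d (plk N d M) ((pick J)(j := i)) = det (mat d d (%(r, s). M $$ (((pick J)(j := i)) r, s)))"
    by (rule ext_coord_plk[OF M chart_index_less[OF J ij(1)]])
  have "chart N d J x $$ (i, j) = c * det (mat d d (%(r, s). M $$ (((pick J)(j := i)) r, s)))"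
    unfolding ext[symmetric] using ij by (simp add: chart_def x ext_coord_scale)
  also have "mat d d (%(r, s). M $$ (((pick J)(j := i)) r, s)) =
      mat d d (%(r, s). if r = j then M $$ (i, s) else if r = s then 1 else 0)"
    by (rule eq_matI) (auto simp: norm)
  also have "det \<dots> = M $$ (i, j)" by (rule det_replace_row_one[OF ij(2)])
  finally show "chart N d J x $$ (i, j) = (c \<cdot>\<^sub>m M) $$ (i, j)" using ij M by simp
qed (use M in \<open>auto simp: chart_def\<close>)

lemma chart_rows:
  assumes J: "J \<in> plucker_index d N" and "i < d" "j < d"
  shows "chart N d J x $$ (pick J i, j) = (if i = j then x J else 0)"
proof (cases "i = j")
  case True
  have inj: "inj_on (pick J) {..<d}" and im: "pick J ` {..<d} = J"
    using pick_bij(1)[OF J] by (auto simp: bij_betw_def)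
  have "mat d d (%(i, k). if pick J i = pick J k then 1 else 0) = (1\<^sub>m d :: complex mat)"
    using inj by (intro eq_matI) (auto simp: inj_on_def)
  then have "ext_coord d x (pick J) = x J" using inj im by (simp add: ext_coord_def)
  moreover have "(pick J)(j := pick J i) = pick J" using True by auto
  ultimately show ?thesis using True assms pick_bij(2)[OF J assms(2)] by (simp add: chart_def)
next
  case False
  have "\<not> inj_on ((pick J)(j := pick J i)) {..<d}"
    using False assms unfolding inj_on_def by (intro notI) (metis fun_upd_other fun_upd_same lessThan_iff)
  then show ?thesis using False assms pick_bij(2)[OF J assms(2)] by (simp add: chart_def ext_coord_def)
qed

lemma plk_smult:
  assumes "M \<in> carrier_mat N d" "J \<in> plucker_index d N"
  shows "plk N d (c \<cdot>\<^sub>m M) J = c ^ d * plk N d M J"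
proof -
  have "mat d d (%(i, j). (c \<cdot>\<^sub>m M) $$ (pick J i, j)) = c \<cdot>\<^sub>m mat d d (%(i, j). M $$ (pick J i, j))"
    using assms pick_bij(2)[OF assms(2)] by (intro eq_matI) auto
  then show ?thesis using assms(2) by (simp add: plk_def)
qed

lemma plk_normalized:
  assumes "J \<in> plucker_index d N" "!!i j. i < d ==> j < d ==> M $$ (pick J i, j) = (if i = j then 1 else 0)"
  shows "plk N d M J = 1"
proof -
  have "mat d d (%(i, j). M $$ (pick J i, j)) = 1\<^sub>m d" using assms(2) by (intro eq_matI) auto
  then show ?thesis using assms(1) by (simp add: plk_def)
qed

lemma plk_nonzero_full_col_rank:
  assumes M: "M \<in> carrier_mat N d" and "plk N d M J ~= 0"
  shows "full_col_rank M"
  unfolding full_col_rank_def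
proof (intro ballI impI)
  fix v assume v: "v \<in> carrier_vec (dim_col M)" and 0: "M *\<^sub>v v = 0\<^sub>v (dim_row M)"
  have J: "J \<in> plucker_index d N" and d: "det (mat d d (%(i, j). M $$ (pick J i, j))) ~= 0"
    using assms(2) by (auto simp: plk_def split: if_splits)
  have v': "v \<in> carrier_vec d" using v M by simp
  have "mat d d (%(i, j). M $$ (pick J i, j)) *\<^sub>v v = 0\<^sub>v d"
  proof (rule eq_vecI)
    fix i assume "i < dim_vec (0\<^sub>v d :: complex vec)"
    then have i: "i < d" by simp
    note pi = pick_bij(2)[OF J i]
    have "(mat d d (%(i, j). M $$ (pick J i, j)) *\<^sub>v v) $ i = (M *\<^sub>v v) $ (pick J i)"
      using i pi M v' by (simp add: scalar_prod_def)
    also have "\<dots> = 0" unfolding 0 using pi M by simp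
    finally show "(mat d d (%(i, j). M $$ (pick J i, j)) *\<^sub>v v) $ i = 0\<^sub>v d $ i" using i by simp
  qed simp
  then have "v = 0\<^sub>v d"
    using det_0_iff_vec_prod_zero_field[of "mat d d (%(i, j). M $$ (pick J i, j))" d] d v' by auto
  then show "v = 0\<^sub>v (dim_col M)" using M by simp
qed

lemma normalize_at:
  assumes M: "M \<in> carrier_mat N d" and nz: "plk N d M J ~= 0"
  obtains g where "g \<in> carrier_mat d d" "det g ~= 0"
    "!!i j. i < d ==> j < d ==> (M * g) $$ (pick J i, j) = (if i = j then 1 else 0)"
proof -
  let ?S = "mat d d (%(i, j). M $$ (pick J i, j))"
  have J: "J \<in> plucker_index d N" and d: "det ?S ~= 0"
    using nz by (auto simp: plk_def split: if_splits)
  obtain g where g: "g \<in> carrier_mat d d" "?S * g = 1\<^sub>m d"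
    by (rule det_nonzero_inverse[of ?S d]) (use d in auto)
  have "det ?S * det g = 1" using det_mult[of ?S d g] g by simp
  then have "det g ~= 0" by auto
  moreover have "(M * g) $$ (pick J i, j) = (if i = j then 1 else 0)" if "i < d" "j < d" for i j
  proof -
    have "(M * g) $$ (pick J i, j) = (?S * g) $$ (i, j)"
      using M g(1) that pick_bij(2)[OF J that(1)] by (simp add: scalar_prod_def)
    then show ?thesis using g(2) that by simp
  qed
  ultimately show ?thesis using that g(1) by blast
qed

subsection \<open>Rank\<close>

definition rank_le :: "nat => complex mat => bool" where
  "rank_le t M \<longleftrightarrow> (\<exists>A\<in>carrier_mat (dim_row M) t. \<exists>B\<in>carrier_mat t (dim_col M). M = A * B)"

definition minor :: "nat => complex mat => (nat => nat) => (nat => nat) => complex" where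
  "minor r M f g = det (mat r r (%(i, j). M $$ (f i, g j)))"

lemma rank_le_imp_minors_zero:
  assumes M: "M \<in> carrier_mat m n" and "rank_le t M"
    and fg: "!!i. i < Suc t ==> f i < m" "!!j. j < Suc t ==> g j < n"
  shows "minor (Suc t) M f g = 0"
proof -
  obtain A B where A: "A \<in> carrier_mat m t" and B: "B \<in> carrier_mat t n" and MAB: "M = A * B"
    using assms(2) M unfolding rank_le_def by auto
  let ?A = "mat (Suc t) (Suc t) (%(i, k). if k < t then A $$ (f i, k) else 0)"
  let ?B = "mat (Suc t) (Suc t) (%(k, j). if k < t then B $$ (k, g j) else 0)"
  have "mat (Suc t) (Suc t) (%(i, j). M $$ (f i, g j)) = ?A * ?B"
  proof (rule eq_matI)
    fix i j assume "i < dim_row (?A * ?B)" "j < dim_col (?A * ?B)"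
    then have ij: "i < Suc t" "j < Suc t" by auto
    have "(?A * ?B) $$ (i, j) = (\<Sum>k<Suc t. (if k < t then A $$ (f i, k) else 0) * (if k < t then B $$ (k, g j) else 0))"
      using ij by (simp add: scalar_prod_def atLeast0LessThan del: sum.lessThan_Suc)
    also have "\<dots> = (\<Sum>k<t. A $$ (f i, k) * B $$ (k, g j))" by simp
    also have "\<dots> = M $$ (f i, g j)"
      unfolding MAB using A B fg ij by (simp add: scalar_prod_def atLeast0LessThan)
    finally show "mat (Suc t) (Suc t) (%(i, j). M $$ (f i, g j)) $$ (i, j) = (?A * ?B) $$ (i, j)"
      using ij by simp
  qed auto
  moreover have "det ?A = 0"
  proof -
    have "?A *\<^sub>v unit_vec (Suc t) t = 0\<^sub>v (Suc t)"
      by (rule eq_vecI) (auto simp: scalar_prod_right_unit)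
    then show ?thesis using det_0_iff_vec_prod_zero_field[of ?A "Suc t"]
      by (auto intro!: bexI exI[of _ "unit_vec (Suc t) t"])
  qed
  ultimately show ?thesis using det_mult[of ?A "Suc t" ?B] by (simp add: minor_def)
qed

text \<open>Take a nonzero minor of maximal size. All minors that border it vanish, so by Cramer's rule every column is a combination of
its columns.\<close>

lemma minors_zero_imp_rank_le:
  assumes M: "M \<in> carrier_mat m n"
    and z: "!!f g. (!!i. i < Suc t ==> f i < m) ==> (!!j. j < Suc t ==> g j < n) ==> minor (Suc t) M f g = 0"
  shows "rank_le t M"
proof -
  define P where "P = (%r. \<exists>f g. (\<forall>i<r. f i < m) & (\<forall>j<r. g j < n) & minor r M f g ~= 0)"
  have "P 0" by (simp add: P_def minor_def)
  moreover have "\<not> P (Suc t)" using z unfolding P_def by blast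
  ultimately have "\<exists>r\<le>t. P r & \<not> P (Suc r)"
    by (induction t) (auto simp: le_Suc_eq)
  then obtain r where r: "r \<le> t" "P r" "\<not> P (Suc r)" by blast
  obtain f g where fg: "\<forall>i<r. f i < m" "\<forall>j<r. g j < n" "minor r M f g ~= 0"
    using r(2) unfolding P_def by blast
  define S where "S = mat r r (%(i, j). M $$ (f i, g j))"
  have Sc: "S \<in> carrier_mat r r" by (simp add: S_def)
  have "det S ~= 0" using fg(3) by (simp add: minor_def S_def)
  from det_nonzero_inverse[OF Sc this] obtain T where T: "T \<in> carrier_mat r r" "T * S = 1\<^sub>m r" by metis
  define c where "c = (%j. T *\<^sub>v vec r (%k. M $$ (f k, j)))"
  have key: "M $$ (i, j) = (\<Sum>l<r. M $$ (i, g l) * c j $ l)" if ij: "i < m" "j < n" for i j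
  proof -
    define f' where "f' = f(r := i)"
    define g' where "g' = g(r := j)"
    define W where "W = mat (Suc r) (Suc r) (%(a, b). M $$ (f' a, g' b))"
    have Wc: "W \<in> carrier_mat (Suc r) (Suc r)" by (simp add: W_def)
    have "minor (Suc r) M f' g' = 0"
    proof (rule ccontr)
      assume "minor (Suc r) M f' g' ~= 0"
      moreover have "\<forall>a<Suc r. f' a < m" "\<forall>b<Suc r. g' b < n"
        using fg ij by (auto simp: f'_def g'_def less_Suc_eq)
      ultimately show False using r(3) unfolding P_def by blast
    qed
    then have "det W = 0" by (simp add: minor_def W_def)
    then obtain v where v: "v \<in> carrier_vec (Suc r)" "v ~= 0\<^sub>v (Suc r)" "W *\<^sub>v v = 0\<^sub>v (Suc r)"
      using det_0_iff_vec_prod_zero_field[OF Wc] by auto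
    have row: "(\<Sum>l<r. M $$ (f' a, g l) * v $ l) + M $$ (f' a, j) * v $ r = 0" if a: "a < Suc r" for a
    proof -
      have "0 = (W *\<^sub>v v) $ a" unfolding v(3) using a by simp
      also have "\<dots> = (\<Sum>l<Suc r. M $$ (f' a, g' l) * v $ l)"
        using a v(1) by (simp add: W_def scalar_prod_def atLeast0LessThan del: sum.lessThan_Suc)
      also have "\<dots> = (\<Sum>l<r. M $$ (f' a, g l) * v $ l) + M $$ (f' a, j) * v $ r"
        by (simp add: g'_def)
      finally show ?thesis by simp
    qed
    let ?x = "vec r (%l. v $ l)"
    have Sx: "S *\<^sub>v ?x = vec r (%k. - (M $$ (f k, j) * v $ r))"
    proof (rule eq_vecI)
      fix k assume "k < dim_vec (vec r (%k. - (M $$ (f k, j) * v $ r)))"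
      then have k: "k < r" by simp
      have "(S *\<^sub>v ?x) $ k = (\<Sum>l<r. M $$ (f k, g l) * v $ l)"
        using k by (simp add: S_def scalar_prod_def atLeast0LessThan)
      also have "\<dots> = - (M $$ (f k, j) * v $ r)"
        by (rule eq_neg_iff_add_eq_0[THEN iffD2]) (use row[of k] k in \<open>simp add: f'_def\<close>)
      finally show "(S *\<^sub>v ?x) $ k = vec r (%k. - (M $$ (f k, j) * v $ r)) $ k" using k by simp
    qed (simp add: S_def)
    have "?x = T *\<^sub>v (S *\<^sub>v ?x)"
      using assoc_mult_mat_vec[OF T(1) Sc, of ?x] T(2) by simp
    also have "\<dots> = (- (v $ r)) \<cdot>\<^sub>v c j"
    proof -
      have "vec r (%k. - (M $$ (f k, j) * v $ r)) = (- (v $ r)) \<cdot>\<^sub>v vec r (%k. M $$ (f k, j))"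
        by (rule eq_vecI) auto
      then show ?thesis unfolding Sx c_def using T(1) by (simp add: mult_mat_vec)
    qed
    finally have x: "?x = (- (v $ r)) \<cdot>\<^sub>v c j" .
    have cj: "c j \<in> carrier_vec r" using T(1) by (simp add: c_def)
    have vl: "v $ l = - (v $ r) * c j $ l" if "l < r" for l
    proof -
      have "?x $ l = - (v $ r) * c j $ l" unfolding x using cj that by simp
      then show ?thesis using that by simp
    qed
    have vr: "v $ r ~= 0"
    proof
      assume 0: "v $ r = 0"
      have "v = 0\<^sub>v (Suc r)"
      proof (rule eq_vecI)
        fix l assume "l < dim_vec (0\<^sub>v (Suc r) :: complex vec)"
        then show "v $ l = 0\<^sub>v (Suc r) $ l" using vl[of l] 0 by (cases "l = r") auto
      qed (use v in simp)
      then show False using v(2) by simp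
    qed
    have "(\<Sum>l<r. M $$ (i, g l) * v $ l) = - (v $ r) * (\<Sum>l<r. M $$ (i, g l) * c j $ l)"
      unfolding sum_distrib_left by (intro sum.cong refl) (simp add: vl)
    then have "v $ r * (M $$ (i, j) - (\<Sum>l<r. M $$ (i, g l) * c j $ l)) = 0"
      using row[of r] by (simp add: f'_def algebra_simps)
    then show ?thesis using vr by simp
  qed
  define A where "A = mat m t (%(i, l). if l < r then M $$ (i, g l) else 0)"
  define B where "B = mat t n (%(l, j). if l < r then c j $ l else 0)"
  have "M = A * B"
  proof (rule eq_matI)
    fix i j assume "i < dim_row (A * B)" "j < dim_col (A * B)"
    then have ij: "i < m" "j < n" by (auto simp: A_def B_def)
    have "(A * B) $$ (i, j) = (\<Sum>l<t. (if l < r then M $$ (i, g l) else 0) * (if l < r then c j $ l else 0))"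
      using ij by (simp add: A_def B_def scalar_prod_def atLeast0LessThan)
    also have "\<dots> = (\<Sum>l<r. M $$ (i, g l) * c j $ l)"
      using r(1) by (intro sum.mono_neutral_cong_right) auto
    finally show "M $$ (i, j) = (A * B) $$ (i, j)" using key[OF ij] by simp
  qed (use M in \<open>auto simp: A_def B_def\<close>)
  moreover have "A \<in> carrier_mat m t" "B \<in> carrier_mat t n" by (simp_all add: A_def B_def)
  ultimately show ?thesis using M unfolding rank_le_def by auto
qed

lemma rank_le_mult:
  assumes "M \<in> carrier_mat m n" "g \<in> carrier_mat n k" "rank_le t M"
  shows "rank_le t (M * g)"
proof -
  obtain A B where "A \<in> carrier_mat m t" "B \<in> carrier_mat t n" "M = A * B"
    using assms unfolding rank_le_def by auto
  then have "M * g = A * (B * g)" "B * g \<in> carrier_mat t k" using assms by auto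
  then show ?thesis using \<open>A \<in> carrier_mat m t\<close> assms unfolding rank_le_def by auto
qed

lemma rank_le_mult_left:
  assumes "M \<in> carrier_mat m n" "g \<in> carrier_mat k m" "rank_le t M"
  shows "rank_le t (g * M)"
proof -
  obtain A B where "A \<in> carrier_mat m t" "B \<in> carrier_mat t n" "M = A * B"
    using assms unfolding rank_le_def by auto
  then have "g * M = (g * A) * B" "g * A \<in> carrier_mat k t" using assms by auto
  then show ?thesis using \<open>B \<in> carrier_mat t n\<close> assms unfolding rank_le_def by auto
qed

lemma full_col_rank_imp_plk:
  assumes M: "M \<in> carrier_mat N d" and fr: "full_col_rank M"
  obtains J where "J \<in> plucker_index d N" "plk N d M J ~= 0"
proof -
  have "\<exists>J. plk N d M J ~= 0"
  proof (rule ccontr)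
    assume "\<not> (\<exists>J. plk N d M J ~= 0)"
    then have z: "plk N d M = (%_. 0)" by auto
    have "d ~= 0"
    proof
      assume "d = 0"
      then have "plk N d M {} = 1" by (simp add: plk_def plucker_index_def)
      then show False using z by simp
    qed
    then obtain t where t: "d = Suc t" by (cases d) auto
    have "rank_le t M"
    proof (rule minors_zero_imp_rank_le[OF M])
      fix f g :: "nat => nat" assume f: "!!i. i < Suc t ==> f i < N" and g: "!!j. j < Suc t ==> g j < d"
      let ?F = "mat d d (%(i, j). M $$ (f i, j))"
      let ?G = "mat d d (%(k, j). if k = g j then 1 else 0) :: complex mat"
      have "mat (Suc t) (Suc t) (%(i, j). M $$ (f i, g j)) = ?F * ?G"
      proof (rule eq_matI)
        fix i j assume "i < dim_row (?F * ?G)" "j < dim_col (?F * ?G)"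
        then have ij: "i < d" "j < d" by auto
        have "(?F * ?G) $$ (i, j) = (\<Sum>k<d. if k = g j then M $$ (f i, k) else 0)"
          using ij by (simp add: scalar_prod_def atLeast0LessThan if_distrib cong: if_cong)
        also have "\<dots> = M $$ (f i, g j)" using g[of j] ij t by (simp add: sum.delta)
        finally show "mat (Suc t) (Suc t) (%(i, j). M $$ (f i, g j)) $$ (i, j) = (?F * ?G) $$ (i, j)"
          using ij t by simp
      qed (use t in auto)
      moreover have "det ?F = 0"
      proof -
        have "ext_coord d (plk N d M) f = 0" unfolding z by (simp add: ext_coord_def)
        then show ?thesis using ext_coord_plk[OF M, of f] f t by simp
      qed
      ultimately show "minor (Suc t) M f g = 0"
        using det_mult[of ?F d ?G] by (simp add: minor_def)
    qed
    then obtain A B where AB: "A \<in> carrier_mat N t" "B \<in> carrier_mat t d" "M = A * B"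
      using M unfolding rank_le_def by auto
    let ?B = "mat d d (%(i, j). if i < t then B $$ (i, j) else 0)"
    have "det (?B\<^sup>T) = 0"
    proof -
      have "?B\<^sup>T *\<^sub>v unit_vec d t = 0\<^sub>v d" using t
        by (intro eq_vecI) (auto simp: scalar_prod_right_unit)
      moreover have "unit_vec d t ~= (0\<^sub>v d :: complex vec)" using t by simp
      ultimately show ?thesis 
        by (intro det_0_iff_vec_prod_zero_field[of "?B\<^sup>T" d, THEN iffD2] exI[of _ "unit_vec d t"]) auto
    qed
    then have "det ?B = 0" using det_transpose[of ?B d] by simp
    then obtain v where v: "v \<in> carrier_vec d" "v ~= 0\<^sub>v d" "?B *\<^sub>v v = 0\<^sub>v d"
      using det_0_iff_vec_prod_zero_field[of ?B d] by auto
    have "B *\<^sub>v v = 0\<^sub>v t"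
    proof (rule eq_vecI)
      fix i assume "i < dim_vec (0\<^sub>v t :: complex vec)"
      then have i: "i < t" by simp
      have "(B *\<^sub>v v) $ i = (?B *\<^sub>v v) $ i" using i t AB(2) v(1) by (simp add: scalar_prod_def)
      then show "(B *\<^sub>v v) $ i = 0\<^sub>v t $ i" unfolding v(3) using i t by simp
    qed (use AB in simp)
    then have "M *\<^sub>v v = 0\<^sub>v N" unfolding AB(3) using AB v by (auto simp: assoc_mult_mat_vec[of A N t B d v])
    then show False using full_col_rankD[OF fr M v(1)] v(2) by simp
  qed
  then obtain J where "plk N d M J ~= 0" by blast
  moreover from this have "J \<in> plucker_index d N" by (simp add: plk_def split: if_splits)
  ultimately show ?thesis using that by blast
qed

section \<open>The determinantal variety\<close>

definition low :: "nat => complex mat => complex mat" where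
  "low d M = mat (dim_row M - d) (dim_col M) (%(i, j). M $$ (d + i, j))"

text \<open>The parametrization: \<open>y\<close> ranges over the affine space with coordinates \<open>yvar\<close>.\<close>

definition MY :: "nat => nat => nat => (yvar => complex) => complex mat" where
  "MY N d t y = mat N d (%(i, j). if i < d then y (Top i j) else \<Sum>a<t. y (Lft (i - d) a) * y (Rgt a j))"

definition detvar :: "nat => nat => nat => complex vec set set" where
  "detvar N d t = {colspan M | M. M \<in> carrier_mat N d & full_col_rank M & rank_le t (low d M)}"

lemma low_carrier: "M \<in> carrier_mat N k ==> low d M \<in> carrier_mat (N - d) k"
  by (auto simp: low_def)

lemma low_index: "M \<in> carrier_mat N k ==> i < N - d ==> j < k ==> low d M $$ (i, j) = M $$ (d + i, j)"
  by (auto simp: low_def)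

lemma low_mult:
  assumes "M \<in> carrier_mat N k" "g \<in> carrier_mat k l"
  shows "low d (M * g) = low d M * g"
  by (rule eq_matI) (use assms in \<open>auto simp: low_def scalar_prod_def\<close>)

lemma low_smult:
  assumes "M \<in> carrier_mat N k"
  shows "low d (c \<cdot>\<^sub>m M) = c \<cdot>\<^sub>m low d M"
  by (rule eq_matI) (use assms in \<open>auto simp: low_def\<close>)

lemma MY_carrier [simp]: "MY N d t y \<in> carrier_mat N d"
  by (simp add: MY_def)

lemma rank_low_MY: "rank_le t (low d (MY N d t y))"
proof -
  let ?A = "mat (N - d) t (%(i, a). y (Lft i a))" and ?B = "mat t d (%(a, j). y (Rgt a j))"
  have "low d (MY N d t y) = ?A * ?B"
    by (rule eq_matI) (auto simp: low_def MY_def scalar_prod_def atLeast0LessThan)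
  moreover have "?A \<in> carrier_mat (N - d) t" "?B \<in> carrier_mat t d" by auto
  moreover have "dim_row (low d (MY N d t y)) = N - d" "dim_col (low d (MY N d t y)) = d"
    by (simp_all add: low_def MY_def)
  ultimately show ?thesis unfolding rank_le_def by metis
qed

lemma rank_low_imp_MY:
  assumes M: "M \<in> carrier_mat N d" and "rank_le t (low d M)"
  obtains y where "M = MY N d t y"
proof -
  obtain A B where A: "A \<in> carrier_mat (N - d) t" and B: "B \<in> carrier_mat t d" and AB: "low d M = A * B"
    using assms low_carrier[OF M, of d] unfolding rank_le_def by auto
  define y where "y = (%v. case v of Top i j => M $$ (i, j) | Lft i a => A $$ (i, a) | Rgt a j => B $$ (a, j))"
  have "M = MY N d t y"
  proof (rule eq_matI)
    fix i j assume "i < dim_row (MY N d t y)" "j < dim_col (MY N d t y)"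
    then have ij: "i < N" "j < d" by (auto simp: MY_def)
    show "M $$ (i, j) = MY N d t y $$ (i, j)"
    proof (cases "i < d")
      case True then show ?thesis using ij by (simp add: MY_def y_def)
    next
      case False
      then have "M $$ (i, j) = low d M $$ (i - d, j)" using low_index[OF M, of "i - d" d j] ij by simp
      also have "\<dots> = (\<Sum>a<t. A $$ (i - d, a) * B $$ (a, j))"
        unfolding AB using A B ij False by (simp add: scalar_prod_def atLeast0LessThan)
      finally show ?thesis using ij False by (simp add: MY_def y_def)
    qed
  qed (use M in \<open>auto simp: MY_def\<close>)
  then show ?thesis using that by blast
qed

lemma detvar_MY: "detvar N d t = {colspan (MY N d t y) | y. full_col_rank (MY N d t y)}"
proof (intro equalityI subsetI)
  fix V assume "V \<in> detvar N d t"
  then obtain M where M: "M \<in> carrier_mat N d" "full_col_rank M" "rank_le t (low d M)" "V = colspan M"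
    unfolding detvar_def by blast
  obtain y where "M = MY N d t y" by (rule rank_low_imp_MY[OF M(1,3)])
  then show "V \<in> {colspan (MY N d t y) | y. full_col_rank (MY N d t y)}" using M by blast
next
  fix V assume "V \<in> {colspan (MY N d t y) | y. full_col_rank (MY N d t y)}"
  then show "V \<in> detvar N d t" unfolding detvar_def using MY_carrier rank_low_MY by blast
qed

lemma colspan_in_detvar_iff:
  assumes "M \<in> carrier_mat N d" "full_col_rank M"
  shows "colspan M \<in> detvar N d t \<longleftrightarrow> rank_le t (low d M)"
proof
  assume "colspan M \<in> detvar N d t"
  then obtain W where W: "W \<in> carrier_mat N d" "full_col_rank W" "rank_le t (low d W)" "colspan M = colspan W"
    unfolding detvar_def by blast
  obtain g where g: "g \<in> carrier_mat d d" "M = W * g"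
    using colspan_eq_imp_mult[OF W(1) assms W(4)] by metis
  show "rank_le t (low d M)"
    unfolding g(2) low_mult[OF W(1) g(1)] by (rule rank_le_mult[OF low_carrier[OF W(1)] g(1) W(3)])
qed (use assms in \<open>auto simp: detvar_def\<close>)

lemma detvar_subset_grassmannian: "detvar N d t \<subseteq> grassmannian d N"
  unfolding detvar_def by (auto simp: grassmannian_iff)

lemma poly_fun_MY:
  assumes "d \<le> N" "i < N" "j < d"
  shows "poly_fun (yvars d (N - d) t) (%y. MY N d t y $$ (i, j))"
proof (cases "i < d")
  case True then show ?thesis using assms by (simp add: MY_def poly_fun.coord)
next
  case False
  then have "poly_fun (yvars d (N - d) t) (%y. \<Sum>a<t. y (Lft (i - d) a) * y (Rgt a j))"
    using assms by (intro poly_fun_sum poly_fun.mult poly_fun.coord) auto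
  then show ?thesis using assms False by (simp add: MY_def)
qed

lemma poly_fun_plk_MY:
  assumes "d \<le> N" shows "poly_fun (yvars d (N - d) t) (%y. plk N d (MY N d t y) J)"
proof (cases "J \<in> plucker_index d N")
  case True
  have "poly_fun (yvars d (N - d) t) (%y. det (mat d d (%(i, j). MY N d t y $$ (pick J i, j))))"
    by (rule poly_fun_det, rule poly_fun_MY[OF assms pick_bij(2)[OF True]])
  then show ?thesis using True by (simp add: plk_def)
qed (simp add: plk_def poly_fun.const)

lemma poly_fun_hom_MY:
  assumes "d \<le> N" "hom_poly (plucker_index d N) k f"
  shows "poly_fun (yvars d (N - d) t) (%y. f (plk N d (MY N d t y)))"
  by (rule poly_fun_compose[OF hom_poly_imp_poly_fun[OF assms(2)] poly_fun_plk_MY[OF assms(1)]])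

definition y_one :: "yvar => complex" where
  "y_one v = (case v of Top i j => if i = j then 1 else 0 | _ => 0)"

lemma plk_MY_one: assumes "d \<le> N" shows "plk N d (MY N d t y_one) {..<d} = 1"
  by (rule plk_normalized[OF plucker_index_lessThan[OF assms]])
    (use assms in \<open>auto simp: pick_lessThan MY_def y_one_def\<close>)

text \<open>The matrices of full rank contain the complement of the zeros of a single minor, which is not the zero polynomial.\<close>

lemma poly_fun_zero_of_zero_on_full_rank:
  assumes "d \<le> N" "poly_fun (yvars d (N - d) t) f"
    and "!!y. full_col_rank (MY N d t y) ==> f y = 0"
  shows "f y = 0"
proof (rule poly_fun_no_zero_divisors[OF poly_fun_plk_MY[OF assms(1), of t "{..<d}"] assms(2)])
  show "plk N d (MY N d t y) {..<d} * f y = 0" for y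
    using assms(3)[of y] plk_nonzero_full_col_rank[OF MY_carrier, of N d t y] by fastforce
  show "plk N d (MY N d t y_one) {..<d} ~= 0" using plk_MY_one[OF assms(1)] by simp
qed

section \<open>The Zariski topology on projective space\<close>

definition nonzero_locus :: "'i set => (('i => complex) => complex) => ('i => complex) set set" where
  "nonzero_locus I f = {p \<in> proj_space I. \<exists>x\<in>p. f x ~= 0}"

lemma proj_point_self: "x \<in> proj_point x"
  unfolding proj_point_def by (rule CollectI, rule exI[of _ 1]) simp

lemma proj_pointE:
  assumes "z \<in> proj_point x" obtains c where "c ~= 0" "z = (%i. c * x i)"
  using assms unfolding proj_point_def by (elim CollectE exE conjE) (rule that)

lemma hom_poly_nonzero_proj_point:
  assumes "hom_poly I k f" "z \<in> proj_point x"
  shows "f z ~= 0 \<longleftrightarrow> f x ~= 0"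
proof -
  obtain c where "c ~= 0" "z = (%i. c * x i)" using assms(2) by (rule proj_pointE)
  then show ?thesis using hom_poly_scale[OF assms(1), of c x] by simp
qed

lemma proj_point_in_nonzero_locus:
  assumes "hom_poly I k f" "proj_point x \<in> proj_space I"
  shows "proj_point x \<in> nonzero_locus I f \<longleftrightarrow> f x ~= 0"
proof
  assume "proj_point x \<in> nonzero_locus I f"
  then obtain z where "z \<in> proj_point x" "f z ~= 0" unfolding nonzero_locus_def by (elim CollectE conjE bexE)
  then show "f x ~= 0" using hom_poly_nonzero_proj_point[OF assms(1)] by simp
next
  assume "f x ~= 0"
  then show "proj_point x \<in> nonzero_locus I f"
    unfolding nonzero_locus_def by (intro CollectI conjI assms(2) bexI[of _ x] proj_point_self)
qed

lemma proj_spaceE: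
  assumes "p \<in> proj_space I"
  obtains x where "p = proj_point x" "\<forall>i. i \<notin> I --> x i = 0" "\<exists>i\<in>I. x i ~= 0"
  using assms unfolding proj_space_def by (elim CollectE exE conjE) (rule that)

lemma nonzero_locus_mult:
  assumes "hom_poly I k f" "hom_poly I l g"
  shows "nonzero_locus I (%x. f x * g x) = nonzero_locus I f \<inter> nonzero_locus I g"
proof (rule Set.set_eqI)
  fix p
  show "p \<in> nonzero_locus I (%x. f x * g x) \<longleftrightarrow> p \<in> nonzero_locus I f \<inter> nonzero_locus I g"
  proof (cases "p \<in> proj_space I")
    case True
    then obtain x where x: "p = proj_point x" by (rule proj_spaceE)
    show ?thesis using proj_point_in_nonzero_locus[OF assms(1), of x] proj_point_in_nonzero_locus[OF assms(2), of x]
      proj_point_in_nonzero_locus[OF hom_poly.mult[OF assms], of x] True x by auto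
  qed (auto simp: nonzero_locus_def)
qed

lemma zariski_proj_alt:
  "zariski_proj I = topology_generated_by {nonzero_locus I f | f k. hom_poly I k f}"
  unfolding zariski_proj_def nonzero_locus_def ..

lemma openin_nonzero_locus: "hom_poly I k f ==> openin (zariski_proj I) (nonzero_locus I f)"
  unfolding zariski_proj_alt
  by (rule topology_generated_by_Basis, rule CollectI, rule exI[of _ f], rule exI[of _ k]) simp

lemma nonzero_locus_one: "nonzero_locus I (%_. 1) = proj_space I"
proof -
  have "\<exists>x. x \<in> p" if "p \<in> proj_space I" for p
    using that by (rule proj_spaceE) (simp, rule exI, rule proj_point_self)
  then show ?thesis unfolding nonzero_locus_def by auto
qed

lemma topspace_zariski_proj: "topspace (zariski_proj I) = proj_space I"
proof -
  have "nonzero_locus I (%_. 1) \<in> {nonzero_locus I f | f k. hom_poly I k f}"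
    by (rule CollectI, rule exI[of _ "%_. 1"], rule exI[of _ 0]) (simp add: hom_poly.const)
  then have "proj_space I \<subseteq> \<Union> {nonzero_locus I f | f k. hom_poly I k f}"
    unfolding nonzero_locus_one by blast
  then show ?thesis unfolding zariski_proj_alt topology_generated_by_topspace
    by (auto simp: nonzero_locus_def)
qed

lemma zariski_basis:
  assumes "openin (zariski_proj I) U" "p \<in> U"
  obtains k f where "hom_poly I k f" "p \<in> nonzero_locus I f" "nonzero_locus I f \<subseteq> U"
proof -
  have "generate_topology_on {nonzero_locus I f | f k. hom_poly I k f} U"
    using assms(1) unfolding zariski_proj_alt openin_topology_generated_by_iff .
  then have "\<forall>p\<in>U. \<exists>k f. hom_poly I k f & p \<in> nonzero_locus I f & nonzero_locus I f \<subseteq> U"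
  proof (induction rule: generate_topology_on.induct)
    case (Int a b)
    show ?case
    proof
      fix p assume "p \<in> a \<inter> b"
      then obtain k f l g where f: "hom_poly I k f" "p \<in> nonzero_locus I f" "nonzero_locus I f \<subseteq> a"
        and g: "hom_poly I l g" "p \<in> nonzero_locus I g" "nonzero_locus I g \<subseteq> b" using Int.IH by blast
      show "\<exists>k f. hom_poly I k f & p \<in> nonzero_locus I f & nonzero_locus I f \<subseteq> a \<inter> b"
        using hom_poly.mult[OF f(1) g(1)] nonzero_locus_mult[OF f(1) g(1)] f g
        by (intro exI[of _ "k + l"] exI[of _ "%x. f x * g x"]) auto
    qed
  next
    case (UN K)
    show ?case
    proof
      fix p assume "p \<in> \<Union> K"
      then obtain a where a: "a \<in> K" "p \<in> a" by blast
      then obtain k f where "hom_poly I k f" "p \<in> nonzero_locus I f" "nonzero_locus I f \<subseteq> a"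
        using UN.IH[OF a(1)] by blast
      then show "\<exists>k f. hom_poly I k f & p \<in> nonzero_locus I f & nonzero_locus I f \<subseteq> \<Union> K"
        using a(1) by (intro exI[of _ k] exI[of _ f]) auto
    qed
  qed auto
  then show ?thesis using assms(2) that by blast
qed

lemma closedin_hom_zeros:
  assumes "!!f. f \<in> F ==> \<exists>k. hom_poly I k f"
  shows "closedin (zariski_proj I) {p \<in> proj_space I. \<forall>f\<in>F. p \<notin> nonzero_locus I f}"
proof -
  have "proj_space I - {p \<in> proj_space I. \<forall>f\<in>F. p \<notin> nonzero_locus I f} = \<Union> (nonzero_locus I ` F)"
    by (auto simp: nonzero_locus_def)
  moreover have "openin (zariski_proj I) (\<Union> (nonzero_locus I ` F))"
  proof (rule openin_Union)
    fix S assume "S \<in> nonzero_locus I ` F"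
    then obtain f where f: "f \<in> F" "S = nonzero_locus I f" by (rule imageE) simp
    from assms[OF f(1)] obtain k where "hom_poly I k f" by (rule exE)
    then show "openin (zariski_proj I) S" unfolding f(2) by (rule openin_nonzero_locus)
  qed
  moreover have "{p \<in> proj_space I. \<forall>f\<in>F. p \<notin> nonzero_locus I f} \<subseteq> proj_space I" by (rule Collect_restrict)
  ultimately show ?thesis unfolding closedin_def topspace_zariski_proj by (simp only: simp_thms)
qed

section \<open>The image of the determinantal variety is closed and irreducible\<close>

lemma plucker_image_detvar:
  assumes "0 < d"
  shows "plucker N ` detvar N d t = {proj_point (plk N d (MY N d t y)) | y. full_col_rank (MY N d t y)}"
proof -
  have eq: "plucker N (colspan (MY N d t y)) = proj_point (plk N d (MY N d t y))" if "full_col_rank (MY N d t y)" for y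
    by (rule plucker_colspan[OF MY_carrier that assms])
  have "plucker N ` detvar N d t = {plucker N (colspan (MY N d t y)) | y. full_col_rank (MY N d t y)}"
    unfolding detvar_MY by blast
  also have "\<dots> = {proj_point (plk N d (MY N d t y)) | y. full_col_rank (MY N d t y)}"
    by (rule Collect_cong, rule ex_cong1) (auto simp: eq)
  finally show ?thesis .
qed

lemma proj_point_plk_in_proj_space:
  assumes "M \<in> carrier_mat N d" "full_col_rank M"
  shows "proj_point (plk N d M) \<in> proj_space (plucker_index d N)"
proof -
  obtain J where "J \<in> plucker_index d N" "plk N d M J ~= 0" by (rule full_col_rank_imp_plk[OF assms])
  then show ?thesis unfolding proj_space_def
    by (intro CollectI exI[of _ "plk N d M"] conjI refl allI impI bexI[of _ J]) (auto simp: plk_def)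
qed

lemma proj_point_scale:
  assumes "c ~= 0" shows "proj_point (%i. c * x i) = proj_point x"
proof (intro equalityI subsetI)
  fix z assume "z \<in> proj_point (%i. c * x i)"
  then obtain e where "e ~= 0" "z = (%i. e * (c * x i))" unfolding proj_point_def by blast
  then show "z \<in> proj_point x" using assms unfolding proj_point_def
    by (intro CollectI exI[of _ "e * c"]) (auto simp: mult.assoc)
next
  fix z assume "z \<in> proj_point x"
  then obtain e where "e ~= 0" "z = (%i. e * x i)" unfolding proj_point_def by blast
  then show "z \<in> proj_point (%i. c * x i)" using assms unfolding proj_point_def
    by (intro CollectI exI[of _ "e / c"]) (auto simp: field_simps)
qed

text \<open>Equations for the Grassmannian and for the rank condition, in terms of the matrix that the chart at \<open>J\<close> reconstructs. The leading factor
\<open>x J\<close> makes them hold trivially outside the domain of the chart, so that they are valid on the whole variety.\<close>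

definition plucker_eq :: "nat => nat => nat set => nat set => (nat set => complex) => complex" where
  "plucker_eq N d J K x = x J * (x J ^ (d - 1) * x K - plk N d (chart N d J x) K)"

definition det_eq :: "nat => nat => nat => nat set => (nat => nat) => (nat => nat) => (nat set => complex) => complex" where
  "det_eq N d t J f g x = x J * minor (Suc t) (low d (chart N d J x)) f g"

lemma hom_poly_plucker_eq:
  assumes "0 < d" "d \<le> N" "J \<in> plucker_index d N" "K \<in> plucker_index d N"
  shows "hom_poly (plucker_index d N) (1 + d) (plucker_eq N d J K)"
proof -
  let ?I = "plucker_index d N"
  have ne: "?I ~= {}" using assms by auto
  have "hom_poly ?I (d * 1) (%x. det (mat d d (%(i, j). chart N d J x $$ (pick K i, j))))"
    by (rule hom_poly_det[OF ne hom_poly_chart[OF assms(2,3) pick_bij(2)[OF assms(4)]]])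
  then have "hom_poly ?I d (%x. plk N d (chart N d J x) K)" using assms(4) by (simp add: plk_def)
  moreover have "hom_poly ?I ((d - 1) * 1 + 1) (%x. x J ^ (d - 1) * x K)"
    by (intro hom_poly.mult hom_poly_power hom_poly.coord assms)
  ultimately show ?thesis
    unfolding plucker_eq_def using assms(1) by (intro hom_poly.mult hom_poly_diff hom_poly.coord assms) simp
qed

lemma hom_poly_det_eq:
  assumes "d \<le> N" "J \<in> plucker_index d N" "!!i. i < Suc t ==> f i < N - d" "!!j. j < Suc t ==> g j < d"
  shows "hom_poly (plucker_index d N) (1 + Suc t * 1) (det_eq N d t J f g)"
proof -
  let ?I = "plucker_index d N"
  have ne: "?I ~= {}" using assms by auto
  have "hom_poly ?I (Suc t * 1) (%x. det (mat (Suc t) (Suc t) (%(i, j). low d (chart N d J x) $$ (f i, g j))))"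
  proof (rule hom_poly_det[OF ne])
    fix i j assume ij: "i < Suc t" "j < Suc t"
    have "hom_poly ?I 1 (%x. chart N d J x $$ (d + f i, g j))"
      using assms(3)[OF ij(1)] by (intro hom_poly_chart assms ij) auto
    then show "hom_poly ?I 1 (%x. low d (chart N d J x) $$ (f i, g j))"
      using low_index[OF chart_carrier assms(3)[OF ij(1)] assms(4)[OF ij(2)]] by simp
  qed
  then show ?thesis unfolding det_eq_def minor_def by (intro hom_poly.mult hom_poly.coord assms)
qed

lemma chart_of_plk:
  assumes M: "M \<in> carrier_mat N d" and x: "x = (%K. c * plk N d M K)" and "x J ~= 0"
  obtains M' where "M' \<in> carrier_mat N d" "colspan M' = colspan M" "chart N d J x = x J \<cdot>\<^sub>m M'"
    "x = (%K. x J * plk N d M' K)" "\<exists>g\<in>carrier_mat d d. M' = M * g"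
proof -
  have nz: "plk N d M J ~= 0" and J: "J \<in> plucker_index d N"
    using assms(3) x by (auto simp: plk_def split: if_splits)
  obtain g where g: "g \<in> carrier_mat d d" "det g ~= 0"
    "!!i j. i < d ==> j < d ==> (M * g) $$ (pick J i, j) = (if i = j then 1 else 0)"
    by (rule normalize_at[OF M nz]) blast
  let ?M = "M * g"
  have Mc: "?M \<in> carrier_mat N d" using M g by simp
  have one: "plk N d ?M J = 1" by (rule plk_normalized[OF J g(3)])
  have x': "x = (%K. (c / det g) * plk N d ?M K)" unfolding x plk_mult[OF M g(1)] using g(2) by auto
  then have xJ: "x J = c / det g" using one by simp
  have x'': "x = (%K. x J * plk N d ?M K)" unfolding xJ by (rule x')
  show ?thesis
  proof (rule that[of ?M])
    show "chart N d J x = x J \<cdot>\<^sub>m ?M" by (rule chart_plk[OF Mc J g(3) x''])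
  qed (use Mc colspan_mult[OF M g(1,2)] x'' g(1) in auto)
qed

lemma rank_le_smult:
  assumes "M \<in> carrier_mat m n" "rank_le t M" shows "rank_le t (c \<cdot>\<^sub>m M)"
proof -
  have "c \<cdot>\<^sub>m M = M * (c \<cdot>\<^sub>m 1\<^sub>m n)" using assms(1) mult_smult_distrib[OF assms(1) one_carrier_mat] by simp
  then show ?thesis using rank_le_mult[OF assms(1) smult_carrier_mat[OF one_carrier_mat] assms(2)] by simp
qed

lemma plucker_image_detvar_closed:
  assumes d: "0 < d" "d \<le> N"
  shows "closedin (zariski_proj (plucker_index d N)) (plucker N ` detvar N d t)"
proof -
  let ?I = "plucker_index d N"
  define F where "F = {plucker_eq N d J K | J K. J \<in> ?I & K \<in> ?I} \<union>
    {det_eq N d t J f g | J f g. J \<in> ?I & (\<forall>i<Suc t. f i < N - d) & (\<forall>j<Suc t. g j < d)}"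
  have F1: "plucker_eq N d J K \<in> F" if "J \<in> ?I" "K \<in> ?I" for J K
    unfolding F_def using that by (intro UnI1 CollectI exI[of _ J] exI[of _ K] conjI refl)
  have F2: "det_eq N d t J f g \<in> F" if "J \<in> ?I" "\<forall>i<Suc t. f i < N - d" "\<forall>j<Suc t. g j < d" for J f g
    unfolding F_def using that by (intro UnI2 CollectI exI[of _ J] exI[of _ f] exI[of _ g] conjI refl)
  have hom: "\<exists>k. hom_poly ?I k f" if "f \<in> F" for f
    using that hom_poly_plucker_eq[OF d] hom_poly_det_eq[OF d(2)] unfolding F_def by blast
  have "plucker N ` detvar N d t = {p \<in> proj_space ?I. \<forall>f\<in>F. p \<notin> nonzero_locus ?I f}"
  proof (intro equalityI subsetI)
    fix p assume "p \<in> plucker N ` detvar N d t"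
    then obtain M where M: "M \<in> carrier_mat N d" "full_col_rank M" "rank_le t (low d M)" "p = proj_point (plk N d M)"
      unfolding detvar_def using plucker_colspan[OF _ _ d(1), of _ N] by auto
    have pp: "p \<in> proj_space ?I" unfolding M(4) by (rule proj_point_plk_in_proj_space[OF M(1,2)])
    let ?x = "plk N d M"
    have norm: "\<exists>M'\<in>carrier_mat N d. chart N d J ?x = ?x J \<cdot>\<^sub>m M' & ?x = (%K. ?x J * plk N d M' K) &
        (\<exists>g\<in>carrier_mat d d. M' = M * g)" if "?x J ~= 0" for J
      by (rule chart_of_plk[OF M(1), of ?x 1 J]) (simp, rule that, blast)
    have plucker_zero: "plucker_eq N d J K ?x = 0" if K: "K \<in> ?I" for J K
    proof (cases "?x J = 0")
      case False
      from norm[OF this] obtain M' where M': "M' \<in> carrier_mat N d" "chart N d J ?x = ?x J \<cdot>\<^sub>m M'"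
        "?x = (%K. ?x J * plk N d M' K)" by blast
      have "?x K = ?x J * plk N d M' K" using fun_cong[OF M'(3)] .
      moreover have "?x J ^ d = ?x J ^ (d - 1) * ?x J" using d(1) by (simp add: power_eq_if)
      ultimately show ?thesis unfolding plucker_eq_def M'(2) plk_smult[OF M'(1) K] by simp
    qed (simp add: plucker_eq_def)
    have det_zero: "det_eq N d t J h g ?x = 0" if hg: "\<forall>i<Suc t. h i < N - d" "\<forall>j<Suc t. g j < d" for J h g
    proof (cases "?x J = 0")
      case False
      from norm[OF this] obtain M' k where M': "M' \<in> carrier_mat N d" "chart N d J ?x = ?x J \<cdot>\<^sub>m M'"
        and k: "k \<in> carrier_mat d d" "M' = M * k" by blast
      have r: "rank_le t (low d M')" unfolding k(2) low_mult[OF M(1) k(1)]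
        by (rule rank_le_mult[OF low_carrier[OF M(1)] k(1) M(3)])
      have "rank_le t (low d (chart N d J ?x))"
        unfolding M'(2) low_smult[OF M'(1)] by (rule rank_le_smult[OF low_carrier[OF M'(1)] r])
      then have "minor (Suc t) (low d (chart N d J ?x)) h g = 0"
        by (rule rank_le_imp_minors_zero[OF low_carrier[OF chart_carrier]]) (use hg in auto)
      then show ?thesis unfolding det_eq_def by simp
    qed (simp add: det_eq_def)
    have "f ?x = 0" if "f \<in> F" for f
      using that plucker_zero det_zero unfolding F_def by (elim UnE CollectE exE conjE) simp_all
    note zero = this
    have "p \<notin> nonzero_locus ?I f" if f: "f \<in> F" for f
    proof -
      obtain k where "hom_poly ?I k f" using hom[OF f] by blast
      from proj_point_in_nonzero_locus[OF this pp[unfolded M(4)]] zero[OF f] show ?thesis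
        unfolding M(4) by simp
    qed
    then show "p \<in> {p \<in> proj_space ?I. \<forall>f\<in>F. p \<notin> nonzero_locus ?I f}" using pp by simp
  next
    fix p assume "p \<in> {p \<in> proj_space ?I. \<forall>f\<in>F. p \<notin> nonzero_locus ?I f}"
    then have p: "p \<in> proj_space ?I" "!!f. f \<in> F ==> p \<notin> nonzero_locus ?I f" by auto
    obtain x where x: "p = proj_point x" "\<forall>i. i \<notin> ?I --> x i = 0" "\<exists>i\<in>?I. x i ~= 0"
      using p(1) by (rule proj_spaceE)
    have z: "f x = 0" if f: "f \<in> F" for f
    proof -
      obtain k where "hom_poly ?I k f" using hom[OF f] by blast
      from proj_point_in_nonzero_locus[OF this p(1)[unfolded x(1)]] p(2)[OF f] show ?thesis
        unfolding x(1) by simp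
    qed
    obtain J where J: "J \<in> ?I" "x J ~= 0" using x(3) by blast
    define M where "M = (1 / x J) \<cdot>\<^sub>m chart N d J x"
    have M: "M \<in> carrier_mat N d" by (simp add: M_def)
    have norm: "M $$ (pick J i, j) = (if i = j then 1 else 0)" if "i < d" "j < d" for i j
      using chart_rows[OF J(1) that, of x] J(2) pick_bij(2)[OF J(1) that(1)] that chart_carrier[of N d J x]
      by (auto simp: M_def simp del: chart_carrier)
    have C: "chart N d J x = x J \<cdot>\<^sub>m M" unfolding M_def using J(2) by (intro eq_matI) auto
    have one: "plk N d M J = 1" by (rule plk_normalized[OF J(1) norm])
    have fr: "full_col_rank M" by (rule plk_nonzero_full_col_rank[OF M, of J]) (use one in simp)
    have "x = (%K. x J * plk N d M K)"
    proof
      fix K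
      show "x K = x J * plk N d M K"
      proof (cases "K \<in> ?I")
        case True
        have "plucker_eq N d J K x = 0" by (rule z[OF F1[OF J(1) True]])
        then have "x J ^ (d - 1) * x K = x J ^ d * plk N d M K"
          using J(2) unfolding plucker_eq_def C plk_smult[OF M True] by simp
        moreover have "x J ^ d = x J ^ (d - 1) * x J" using d(1) by (simp add: power_eq_if)
        ultimately show ?thesis using J(2) by simp
      qed (use x(2) in \<open>simp add: plk_def\<close>)
    qed
    then have p': "p = proj_point (plk N d M)" unfolding x(1) using proj_point_scale[OF J(2), of "plk N d M"] by simp
    have "rank_le t (low d (chart N d J x))"
    proof (rule minors_zero_imp_rank_le[OF low_carrier[OF chart_carrier]])
      fix f g :: "nat => nat" assume "!!i. i < Suc t ==> f i < N - d" "!!j. j < Suc t ==> g j < d"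
      then have "det_eq N d t J f g x = 0" by (intro z F2 J(1)) auto
      then show "minor (Suc t) (low d (chart N d J x)) f g = 0" using J(2) by (simp add: det_eq_def)
    qed
    then have "rank_le t (low d M)"
      unfolding M_def low_smult[OF chart_carrier] by (rule rank_le_smult[OF low_carrier[OF chart_carrier]])
    then have "colspan M \<in> detvar N d t" using M fr by (auto simp: detvar_def)
    then show "p \<in> plucker N ` detvar N d t" using plucker_colspan[OF M fr d(1)] p' by auto
  qed
  then show ?thesis using closedin_hom_zeros[OF hom] by simp
qed

lemma hom_poly_zero_on_detvar:
  assumes "0 < d" "d \<le> N" "hom_poly (plucker_index d N) k f"
    and "!!p. p \<in> plucker N ` detvar N d t ==> p \<notin> nonzero_locus (plucker_index d N) f"
  shows "f (plk N d (MY N d t y)) = 0"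
proof (rule poly_fun_zero_of_zero_on_full_rank[OF assms(2) poly_fun_hom_MY[OF assms(2,3)]])
  fix y assume fr: "full_col_rank (MY N d t y)"
  then have "proj_point (plk N d (MY N d t y)) \<in> plucker N ` detvar N d t"
    unfolding plucker_image_detvar[OF assms(1)] by blast
  from assms(4)[OF this] show "f (plk N d (MY N d t y)) = 0"
    using proj_point_in_nonzero_locus[OF assms(3) proj_point_plk_in_proj_space[OF MY_carrier fr]] by blast
qed

text \<open>Pulled back to the affine space, both polynomials are nonzero, and so is their product.\<close>

lemma detvar_nonzero_loci_meet:
  assumes d: "0 < d" "d \<le> N" and f: "hom_poly (plucker_index d N) k f" and g: "hom_poly (plucker_index d N) l g"
    and p: "p \<in> plucker N ` detvar N d t" "p \<in> nonzero_locus (plucker_index d N) f"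
    and q: "q \<in> plucker N ` detvar N d t" "q \<in> nonzero_locus (plucker_index d N) g"
  obtains r where "r \<in> plucker N ` detvar N d t" "r \<in> nonzero_locus (plucker_index d N) f"
    "r \<in> nonzero_locus (plucker_index d N) g"
proof -
  let ?I = "plucker_index d N"
  have "\<exists>r \<in> plucker N ` detvar N d t. r \<in> nonzero_locus ?I (%x. f x * g x)"
  proof (rule ccontr)
    assume "\<not> ?thesis"
    then have z: "f (plk N d (MY N d t y)) * g (plk N d (MY N d t y)) = 0" for y
      using hom_poly_zero_on_detvar[OF d hom_poly.mult[OF f g]] by blast
    obtain y where y: "full_col_rank (MY N d t y)" "p = proj_point (plk N d (MY N d t y))"
      using p(1) unfolding plucker_image_detvar[OF d(1)] by blast
    obtain y' where y': "full_col_rank (MY N d t y')" "q = proj_point (plk N d (MY N d t y'))"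
      using q(1) unfolding plucker_image_detvar[OF d(1)] by blast
    have "f (plk N d (MY N d t y)) ~= 0"
      using proj_point_in_nonzero_locus[OF f proj_point_plk_in_proj_space[OF MY_carrier y(1)]] p(2) y(2) by blast
    then have "g (plk N d (MY N d t y')) = 0"
      using poly_fun_no_zero_divisors[OF poly_fun_hom_MY[OF d(2) f] poly_fun_hom_MY[OF d(2) g] z] by blast
    then show False
      using proj_point_in_nonzero_locus[OF g proj_point_plk_in_proj_space[OF MY_carrier y'(1)]] q(2) y'(2) by blast
  qed
  then show ?thesis using that unfolding nonzero_locus_mult[OF f g] by blast
qed

lemma plucker_image_detvar_irreducible:
  assumes d: "0 < d" "d \<le> N"
  shows "irreducible_in (zariski_proj (plucker_index d N)) (plucker N ` detvar N d t)"
proof -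
  let ?I = "plucker_index d N" and ?X = "plucker N ` detvar N d t"
  have sub: "?X \<subseteq> proj_space ?I"
    using closedin_subset[OF plucker_image_detvar_closed[OF d]] unfolding topspace_zariski_proj .
  have "plk N d (MY N d t y_one) {..<d} ~= 0" using plk_MY_one[OF d(2)] by simp
  then have "full_col_rank (MY N d t y_one)" by (rule plk_nonzero_full_col_rank[OF MY_carrier])
  then have ne: "?X ~= {}" unfolding plucker_image_detvar[OF d(1)] by blast
  have "?X \<subseteq> C \<or> ?X \<subseteq> D" if C: "closedin (zariski_proj ?I) C" and D: "closedin (zariski_proj ?I) D" and CD: "?X \<subseteq> C \<union> D" for C D
  proof (rule ccontr)
    assume "\<not> ?thesis"
    then obtain p q where p: "p \<in> ?X" "p \<notin> C" and q: "q \<in> ?X" "q \<notin> D" by blast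
    have "openin (zariski_proj ?I) (proj_space ?I - C)" using C unfolding closedin_def topspace_zariski_proj by blast
    from zariski_basis[OF this, of p] obtain k f where f: "hom_poly ?I k f" "p \<in> nonzero_locus ?I f"
      "nonzero_locus ?I f \<subseteq> proj_space ?I - C" using p sub by blast
    have "openin (zariski_proj ?I) (proj_space ?I - D)" using D unfolding closedin_def topspace_zariski_proj by blast
    from zariski_basis[OF this, of q] obtain l g where g: "hom_poly ?I l g" "q \<in> nonzero_locus ?I g"
      "nonzero_locus ?I g \<subseteq> proj_space ?I - D" using q sub by blast
    obtain r where "r \<in> ?X" "r \<in> nonzero_locus ?I f" "r \<in> nonzero_locus ?I g"
      by (rule detvar_nonzero_loci_meet[OF d f(1) g(1) p(1) f(2) q(1) g(2)])
    then show False using CD f(3) g(3) by blast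
  qed
  then show ?thesis using sub ne unfolding irreducible_in_def topspace_zariski_proj by blast
qed

lemma plucker_image_detvar_variety:
  assumes d: "0 < d" "d \<le> N"
  shows "quasi_projective_variety (plucker_index d N) (plucker N ` detvar N d t)"
proof -
  let ?I = "plucker_index d N" and ?X = "plucker N ` detvar N d t"
  have cl: "zariski_proj ?I closure_of ?X = ?X"
    using plucker_image_detvar_closed[OF d] by (simp add: closure_of_eq)
  have "?X \<subseteq> topspace (zariski_proj ?I)" using closedin_subset[OF plucker_image_detvar_closed[OF d]] .
  then have "topspace (subtopology (zariski_proj ?I) ?X) = ?X" by (rule topspace_subtopology_subset)
  then have "openin (subtopology (zariski_proj ?I) ?X) ?X"
    using openin_topspace[of "subtopology (zariski_proj ?I) ?X"] by (simp only:)
  then show ?thesis unfolding quasi_projective_variety_def cl using plucker_image_detvar_irreducible[OF d] by blast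
qed

section \<open>Germs of regular functions\<close>

text \<open>A germ is the class of a section under agreement on a neighbourhood of \<open>p\<close>, so the unions in the ring operations reduce to
the operations on representatives.\<close>

locale variety_point =
  fixes I :: "'i set" and X :: "('i => complex) set set" and p :: "('i => complex) set"
  assumes X_sub: "X \<subseteq> proj_space I" and p_in_X: "p \<in> X"
begin

abbreviation "TX \<equiv> subtopology (zariski_proj I) X"
abbreviation "SA \<equiv> sections_at I X p"
abbreviation "R \<equiv> local_ring I X p"
abbreviation "gm \<equiv> germ I X p"

definition agree :: "'i local_section => 'i local_section => bool" where
  "agree s s' \<longleftrightarrow> (\<exists>W. openin TX W & p \<in> W & W \<subseteq> fst s \<inter> fst s' & (\<forall>q\<in>W. snd s q = snd s' q))"

lemma openin_TX_X: "openin TX X"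
proof -
  have "topspace TX = X" using X_sub by (simp add: topspace_zariski_proj Int_absorb1)
  then show ?thesis using openin_topspace[of TX] by (simp only:)
qed

lemma openin_TX_locus: "hom_poly I k f ==> openin TX (X \<inter> nonzero_locus I f)"
  using openin_nonzero_locus by (auto simp: openin_subtopology)

lemma TX_basis:
  assumes "openin TX W" "p \<in> W"
  obtains k u where "hom_poly I k u" "p \<in> nonzero_locus I u" "X \<inter> nonzero_locus I u \<subseteq> W"
proof -
  obtain V where V: "openin (zariski_proj I) V" "W = V \<inter> X" using assms(1) by (auto simp: openin_subtopology)
  from zariski_basis[OF V(1), of p] obtain k u where "hom_poly I k u" "p \<in> nonzero_locus I u" "nonzero_locus I u \<subseteq> V"
    using assms(2) V(2) by blast
  then show ?thesis using that[of k u] V(2) by blast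
qed

lemma SA_iff: "(U, f) \<in> SA \<longleftrightarrow> p \<in> U & regular_on I X U f"
  by (simp add: sections_at_def)

lemma regular_on_openin: "regular_on I X U f ==> openin TX U"
  by (simp add: regular_on_def)

lemma regular_onE:
  assumes "regular_on I X U f" "q \<in> U"
  obtains W k g h where "hom_poly I k g" "hom_poly I k h" "openin TX W" "q \<in> W" "W \<subseteq> U"
    "!!r x. r \<in> W ==> x \<in> r ==> h x ~= 0 & f r = g x / h x"
proof -
  from assms obtain W k g h where "hom_poly I k g & hom_poly I k h & openin TX W & q \<in> W & W \<subseteq> U &
        (\<forall>q\<in>W. \<forall>x\<in>q. h x ~= 0 & f q = g x / h x)"
    unfolding regular_on_def by meson
  then show ?thesis using that[of k g h W] by blast
qed

lemma regular_onI:
  assumes "openin TX U"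
    and "!!q. q \<in> U ==> \<exists>W k g h. hom_poly I k g & hom_poly I k h &
        openin TX W & q \<in> W & W \<subseteq> U & (\<forall>q\<in>W. \<forall>x\<in>q. h x ~= 0 & f q = g x / h x)"
  shows "regular_on I X U f"
  using assms unfolding regular_on_def by blast

lemma regular_on_const: assumes "openin TX U" shows "regular_on I X U (%_. c)"
proof (rule regular_onI[OF assms])
  fix q assume "q \<in> U"
  then show "\<exists>W k g h. hom_poly I k g & hom_poly I k h &
        openin TX W & q \<in> W & W \<subseteq> U & (\<forall>q\<in>W. \<forall>x\<in>q. h x ~= 0 & c = g x / h x)"
    using assms by (intro exI[of _ U] exI[of _ 0] exI[of _ "%_. c"] exI[of _ "%_. 1"]) (auto intro: hom_poly.const)
qed

lemma regular_on_add_mult: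
  assumes f: "regular_on I X U f" and g: "regular_on I X V g"
  shows "regular_on I X (U \<inter> V) (%q. f q + g q)" "regular_on I X (U \<inter> V) (%q. f q * g q)"
proof -
  have op: "openin TX (U \<inter> V)" using f g by (intro openin_Int regular_on_openin)
  have *: "\<exists>W k a b c. hom_poly I k a & hom_poly I k b & hom_poly I k c & openin TX W & q \<in> W & W \<subseteq> U \<inter> V &
      (\<forall>r\<in>W. \<forall>x\<in>r. c x ~= 0 & f r + g r = a x / c x & f r * g r = b x / c x)" if q: "q \<in> U \<inter> V" for q
  proof -
    obtain W k a h where 1: "hom_poly I k a" "hom_poly I k h" "openin TX W" "q \<in> W" "W \<subseteq> U"
      "!!r x. r \<in> W ==> x \<in> r ==> h x ~= 0 & f r = a x / h x"
      by (rule regular_onE[OF f, of q]) (use q in auto)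
    obtain W' k' a' h' where 2: "hom_poly I k' a'" "hom_poly I k' h'" "openin TX W'" "q \<in> W'" "W' \<subseteq> V"
      "!!r x. r \<in> W' ==> x \<in> r ==> h' x ~= 0 & g r = a' x / h' x"
      by (rule regular_onE[OF g, of q]) (use q in auto)
    have n1: "hom_poly I (k + k') (%x. a x * h' x + h x * a' x)"
      by (intro hom_poly.add hom_poly.mult 1 2)
    have n2: "hom_poly I (k + k') (%x. a x * a' x)" and n3: "hom_poly I (k + k') (%x. h x * h' x)"
      by (intro hom_poly.mult 1 2)+
    have n4: "openin TX (W \<inter> W')" by (intro openin_Int 1 2)
    have n5: "\<forall>r\<in>W \<inter> W'. \<forall>x\<in>r. h x * h' x ~= 0 & f r + g r = (a x * h' x + h x * a' x) / (h x * h' x) &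
        f r * g r = (a x * a' x) / (h x * h' x)"
    proof (intro ballI)
      fix r x assume r: "r \<in> W \<inter> W'" "x \<in> r"
      have nz: "h x ~= 0" "h' x ~= 0" and fg: "f r = a x / h x" "g r = a' x / h' x"
        using 1(6)[of r x] 2(6)[of r x] r by simp_all
      show "h x * h' x ~= 0 & f r + g r = (a x * h' x + h x * a' x) / (h x * h' x) &
          f r * g r = (a x * a' x) / (h x * h' x)"
        unfolding fg using nz by (simp add: add_frac_eq mult.commute)
    qed
    show ?thesis
      by (intro exI[of _ "W \<inter> W'"] exI[of _ "k + k'"] exI[of _ "%x. a x * h' x + h x * a' x"]
          exI[of _ "%x. a x * a' x"] exI[of _ "%x. h x * h' x"] conjI n1 n2 n3 n4 n5 IntI 1(4) 2(4) Int_mono 1(5) 2(5))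
  qed
  show "regular_on I X (U \<inter> V) (%q. f q + g q)"
  proof (rule regular_onI[OF op])
    fix q assume "q \<in> U \<inter> V"
    from *[OF this] obtain W k a b c where "hom_poly I k a" "hom_poly I k c" "openin TX W" "q \<in> W" "W \<subseteq> U \<inter> V"
      "\<forall>r\<in>W. \<forall>x\<in>r. c x ~= 0 & f r + g r = a x / c x & f r * g r = b x / c x" by (elim exE conjE) (rule that)
    then show "\<exists>W k a c. hom_poly I k a & hom_poly I k c & openin TX W & q \<in> W & W \<subseteq> U \<inter> V &
        (\<forall>r\<in>W. \<forall>x\<in>r. c x ~= 0 & f r + g r = a x / c x)"
      by (intro exI[of _ W] exI[of _ k] exI[of _ a] exI[of _ c]) simp
  qed
  show "regular_on I X (U \<inter> V) (%q. f q * g q)"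
  proof (rule regular_onI[OF op])
    fix q assume "q \<in> U \<inter> V"
    from *[OF this] obtain W k a b c where "hom_poly I k b" "hom_poly I k c" "openin TX W" "q \<in> W" "W \<subseteq> U \<inter> V"
      "\<forall>r\<in>W. \<forall>x\<in>r. c x ~= 0 & f r + g r = a x / c x & f r * g r = b x / c x" by (elim exE conjE) (rule that)
    then show "\<exists>W k b c. hom_poly I k b & hom_poly I k c & openin TX W & q \<in> W & W \<subseteq> U \<inter> V &
        (\<forall>r\<in>W. \<forall>x\<in>r. c x ~= 0 & f r * g r = b x / c x)"
      by (intro exI[of _ W] exI[of _ k] exI[of _ b] exI[of _ c]) simp
  qed
qed

lemma SA_const: "openin TX U ==> p \<in> U ==> (U, %_. c) \<in> SA"
  by (simp add: SA_iff regular_on_const)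

lemma SA_add: "(U, f) \<in> SA ==> (V, g) \<in> SA ==> (U \<inter> V, %q. f q + g q) \<in> SA"
  by (simp add: SA_iff regular_on_add_mult)

lemma SA_mult: "(U, f) \<in> SA ==> (V, g) \<in> SA ==> (U \<inter> V, %q. f q * g q) \<in> SA"
  by (simp add: SA_iff regular_on_add_mult)

lemma agreeE:
  assumes "agree s s'"
  obtains W where "openin TX W" "p \<in> W" "W \<subseteq> fst s" "W \<subseteq> fst s'" "\<forall>q\<in>W. snd s q = snd s' q"
  using assms unfolding agree_def by (elim exE conjE) (rule that, simp_all)

lemma agree_intro:
  assumes "openin TX W" "p \<in> W" "W \<subseteq> fst s" "W \<subseteq> fst s'" "!!q. q \<in> W ==> snd s q = snd s' q"
  shows "agree s s'"
  unfolding agree_def by (intro exI[of _ W] conjI ballI Int_greatest assms)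

lemma agree_sym: assumes "agree s s'" shows "agree s' s"
proof -
  obtain W where W: "openin TX W" "p \<in> W" "W \<subseteq> fst s" "W \<subseteq> fst s'" "\<forall>q\<in>W. snd s q = snd s' q"
    by (rule agreeE[OF assms])
  show ?thesis by (rule agree_intro[OF W(1,2,4,3)]) (simp add: W(5))
qed

lemma agree_trans:
  assumes "agree s s'" "agree s' s''" shows "agree s s''"
proof -
  obtain W where W: "openin TX W" "p \<in> W" "W \<subseteq> fst s" "W \<subseteq> fst s'" "\<forall>q\<in>W. snd s q = snd s' q"
    by (rule agreeE[OF assms(1)])
  obtain V where V: "openin TX V" "p \<in> V" "V \<subseteq> fst s'" "V \<subseteq> fst s''" "\<forall>q\<in>V. snd s' q = snd s'' q"
    by (rule agreeE[OF assms(2)])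
  show ?thesis
    by (rule agree_intro[OF openin_Int[OF W(1) V(1)]]) (use W V in auto)
qed

lemma agreeI:
  assumes "s \<in> SA" "s' \<in> SA" "!!q. q \<in> fst s ==> q \<in> fst s' ==> snd s q = snd s' q"
  shows "agree s s'"
proof -
  obtain U f V g where s: "s = (U, f)" "s' = (V, g)" by (cases s, cases s')
  have 1: "openin TX U" "p \<in> U" "openin TX V" "p \<in> V"
    using assms(1,2) regular_on_openin[of U f] regular_on_openin[of V g] unfolding s SA_iff by simp_all
  show ?thesis unfolding s
    by (rule agree_intro[OF openin_Int[OF 1(1,3)]]) (use 1 assms(3) in \<open>auto simp: s\<close>)
qed

lemma agree_refl: "s \<in> SA ==> agree s s"
  by (rule agreeI) simp_all

lemma germ_alt: "gm s = {s' \<in> SA. agree s s'}"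
  unfolding germ_def agree_def ..

lemma germ_eq_iff:
  assumes "s \<in> SA" "s' \<in> SA" shows "gm s = gm s' \<longleftrightarrow> agree s s'"
proof
  assume "gm s = gm s'"
  moreover have "s' \<in> gm s'" unfolding germ_alt using assms(2) agree_refl by simp
  ultimately have "s' \<in> gm s" by simp
  then show "agree s s'" by (simp add: germ_alt)
next
  assume a: "agree s s'"
  have "agree s r \<longleftrightarrow> agree s' r" for r
    by (rule iffI) (rule agree_trans[OF agree_sym[OF a]], assumption, rule agree_trans[OF a], assumption)
  then show "gm s = gm s'" unfolding germ_alt by simp
qed

lemma germ_eqI:
  assumes "s \<in> SA" "s' \<in> SA" "!!q. q \<in> fst s ==> q \<in> fst s' ==> snd s q = snd s' q"
  shows "gm s = gm s'"
  unfolding germ_eq_iff[OF assms(1,2)] by (rule agreeI[OF assms])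

lemma agree_cong2:
  assumes "agree (U, f) (U', f')" "agree (V, g) (V', g')"
  shows "agree (U \<inter> V, %q. F (f q) (g q)) (U' \<inter> V', %q. F (f' q) (g' q))"
proof -
  obtain W where W: "openin TX W" "p \<in> W" "W \<subseteq> U" "W \<subseteq> U'" "\<forall>q\<in>W. f q = f' q"
    by (rule agreeE[OF assms(1)]) (rule that, simp_all)
  obtain W' where W': "openin TX W'" "p \<in> W'" "W' \<subseteq> V" "W' \<subseteq> V'" "\<forall>q\<in>W'. g q = g' q"
    by (rule agreeE[OF assms(2)]) (rule that, simp_all)
  show ?thesis
    by (rule agree_intro[OF openin_Int[OF W(1) W'(1)]]) (use W W' in auto)
qed

lemma germ_op:
  assumes a: "(U, f) \<in> SA" and b: "(V, g) \<in> SA"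
    and F: "!!U f V g. (U, f) \<in> SA ==> (V, g) \<in> SA ==> (U \<inter> V, %q. F (f q) (g q)) \<in> SA"
  shows "(\<Union>(U, f)\<in>gm (U, f). \<Union>(V, g)\<in>gm (V, g). gm (U \<inter> V, %q. F (f q) (g q))) = gm (U \<inter> V, %q. F (f q) (g q))"
proof -
  have eq: "gm (U' \<inter> V', %q. F (f' q) (g' q)) = gm (U \<inter> V, %q. F (f q) (g q))"
    if "(U', f') \<in> gm (U, f)" "(V', g') \<in> gm (V, g)" for U' f' V' g'
  proof -
    have s: "(U', f') \<in> SA" "(V', g') \<in> SA" "agree (U, f) (U', f')" "agree (V, g) (V', g')"
      using that by (auto simp: germ_alt)
    have "agree (U \<inter> V, %q. F (f q) (g q)) (U' \<inter> V', %q. F (f' q) (g' q))"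
      by (rule agree_cong2[OF s(3,4)])
    then show ?thesis using germ_eq_iff[OF F[OF a b] F[OF s(1,2)]] by simp
  qed
  have mem: "(U, f) \<in> gm (U, f)" "(V, g) \<in> gm (V, g)" using a b agree_refl by (auto simp: germ_alt)
  let ?Z = "gm (U \<inter> V, %q. F (f q) (g q))"
  have inner: "(\<Union>(V, g)\<in>gm (V, g). gm (U' \<inter> V, %q. F (f' q) (g q))) = ?Z" if u: "(U', f') \<in> gm (U, f)" for U' f'
  proof -
    have "(\<Union>(V, g)\<in>gm (V, g). gm (U' \<inter> V, %q. F (f' q) (g q))) = (\<Union>v\<in>gm (V, g). ?Z)"
      by (rule SUP_cong[OF refl]) (use eq[OF u] in \<open>auto split: prod.split\<close>)
    then show ?thesis using mem(2) by auto
  qed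
  have "(\<Union>(U, f)\<in>gm (U, f). \<Union>(V, g)\<in>gm (V, g). gm (U \<inter> V, %q. F (f q) (g q))) = (\<Union>u\<in>gm (U, f). ?Z)"
    by (rule SUP_cong[OF refl]) (use inner in \<open>auto split: prod.split\<close>)
  then show ?thesis using mem(1) by auto
qed

lemma carrier_R: "carrier R = gm ` SA" by (simp add: local_ring_def)
lemma one_R: "\<one>\<^bsub>R\<^esub> = gm (X, %_. 1)" by (simp add: local_ring_def)
lemma zero_R: "\<zero>\<^bsub>R\<^esub> = gm (X, %_. 0)" by (simp add: local_ring_def)

lemma mult_R: "(U, f) \<in> SA ==> (V, g) \<in> SA ==> gm (U, f) \<otimes>\<^bsub>R\<^esub> gm (V, g) = gm (U \<inter> V, %q. f q * g q)"
  unfolding local_ring_def monoid.simps by (rule germ_op[where F = "(*)"]) (simp_all add: SA_mult)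

lemma add_R: "(U, f) \<in> SA ==> (V, g) \<in> SA ==> gm (U, f) \<oplus>\<^bsub>R\<^esub> gm (V, g) = gm (U \<inter> V, %q. f q + g q)"
  unfolding local_ring_def ring.simps by (rule germ_op[where F = "(+)"]) (simp_all add: SA_add)

lemma SA_X: "(X, %_. c) \<in> SA"
  by (rule SA_const[OF openin_TX_X p_in_X])

lemma carrier_RE:
  assumes "a \<in> carrier R" obtains U f where "(U, f) \<in> SA" "a = gm (U, f)"
  using assms unfolding carrier_R by auto

lemma SA_carrier: "s \<in> SA ==> gm s \<in> carrier R"
  unfolding carrier_R by blast

lemma cring_R: "cring R"
proof (rule cringI)
  show "abelian_group R"
  proof (rule abelian_groupI)
    fix a b assume "a \<in> carrier R" "b \<in> carrier R"
    then obtain U f V g where *: "(U, f) \<in> SA" "a = gm (U, f)" "(V, g) \<in> SA" "b = gm (V, g)"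
      by (metis carrier_RE)
    show "a \<oplus>\<^bsub>R\<^esub> b \<in> carrier R" using * by (simp add: add_R SA_add SA_carrier)
    show "a \<oplus>\<^bsub>R\<^esub> b = b \<oplus>\<^bsub>R\<^esub> a" using * by (simp add: add_R Int_commute add.commute)
  next
    show "\<zero>\<^bsub>R\<^esub> \<in> carrier R" unfolding zero_R by (rule SA_carrier[OF SA_X])
  next
    fix a b c assume "a \<in> carrier R" "b \<in> carrier R" "c \<in> carrier R"
    then obtain U f V g W h where *: "(U, f) \<in> SA" "a = gm (U, f)" "(V, g) \<in> SA" "b = gm (V, g)"
      "(W, h) \<in> SA" "c = gm (W, h)" by (metis carrier_RE)
    show "a \<oplus>\<^bsub>R\<^esub> b \<oplus>\<^bsub>R\<^esub> c = a \<oplus>\<^bsub>R\<^esub> (b \<oplus>\<^bsub>R\<^esub> c)"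
      using * by (simp add: add_R SA_add Int_assoc add.assoc)
  next
    fix a assume "a \<in> carrier R"
    then obtain U f where *: "(U, f) \<in> SA" "a = gm (U, f)" by (rule carrier_RE)
    show "\<zero>\<^bsub>R\<^esub> \<oplus>\<^bsub>R\<^esub> a = a"
      unfolding zero_R *(2) add_R[OF SA_X *(1)] by (rule germ_eqI[OF SA_add[OF SA_X *(1)] *(1)]) simp
    have op: "openin TX U" "p \<in> U" using *(1) by (auto simp: SA_iff intro: regular_on_openin)
    have neg: "(U \<inter> U, %q. (-1) * f q) \<in> SA" by (rule SA_mult[OF SA_const[OF op] *(1)])
    have "gm (U \<inter> U, %q. (-1) * f q) \<oplus>\<^bsub>R\<^esub> a = \<zero>\<^bsub>R\<^esub>"
      unfolding zero_R *(2) add_R[OF neg *(1)] by (rule germ_eqI[OF SA_add[OF neg *(1)] SA_X]) simp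
    then show "\<exists>y\<in>carrier R. y \<oplus>\<^bsub>R\<^esub> a = \<zero>\<^bsub>R\<^esub>" using SA_carrier[OF neg] by blast
  qed
next
  show "comm_monoid R"
  proof (rule comm_monoidI)
    fix a b assume "a \<in> carrier R" "b \<in> carrier R"
    then obtain U f V g where *: "(U, f) \<in> SA" "a = gm (U, f)" "(V, g) \<in> SA" "b = gm (V, g)"
      by (metis carrier_RE)
    show "a \<otimes>\<^bsub>R\<^esub> b \<in> carrier R" using * by (simp add: mult_R SA_mult SA_carrier)
    show "a \<otimes>\<^bsub>R\<^esub> b = b \<otimes>\<^bsub>R\<^esub> a" using * by (simp add: mult_R Int_commute mult.commute)
  next
    show "\<one>\<^bsub>R\<^esub> \<in> carrier R" unfolding one_R by (rule SA_carrier[OF SA_X])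
  next
    fix a b c assume "a \<in> carrier R" "b \<in> carrier R" "c \<in> carrier R"
    then obtain U f V g W h where *: "(U, f) \<in> SA" "a = gm (U, f)" "(V, g) \<in> SA" "b = gm (V, g)"
      "(W, h) \<in> SA" "c = gm (W, h)" by (metis carrier_RE)
    show "a \<otimes>\<^bsub>R\<^esub> b \<otimes>\<^bsub>R\<^esub> c = a \<otimes>\<^bsub>R\<^esub> (b \<otimes>\<^bsub>R\<^esub> c)"
      using * by (simp add: mult_R SA_mult Int_assoc mult.assoc)
  next
    fix a assume "a \<in> carrier R"
    then obtain U f where *: "(U, f) \<in> SA" "a = gm (U, f)" by (rule carrier_RE)
    show "\<one>\<^bsub>R\<^esub> \<otimes>\<^bsub>R\<^esub> a = a"
      unfolding one_R *(2) mult_R[OF SA_X *(1)] by (rule germ_eqI[OF SA_mult[OF SA_X *(1)] *(1)]) simp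
  qed
next
  fix a b c assume "a \<in> carrier R" "b \<in> carrier R" "c \<in> carrier R"
  then obtain U f V g W h where *: "(U, f) \<in> SA" "a = gm (U, f)" "(V, g) \<in> SA" "b = gm (V, g)"
    "(W, h) \<in> SA" "c = gm (W, h)" by (metis carrier_RE)
  show "(a \<oplus>\<^bsub>R\<^esub> b) \<otimes>\<^bsub>R\<^esub> c = a \<otimes>\<^bsub>R\<^esub> c \<oplus>\<^bsub>R\<^esub> b \<otimes>\<^bsub>R\<^esub> c"
    unfolding *(2,4,6) add_R[OF *(1,3)] mult_R[OF SA_add[OF *(1,3)] *(5)] mult_R[OF *(1,5)] mult_R[OF *(3,5)]
      add_R[OF SA_mult[OF *(1,5)] SA_mult[OF *(3,5)]]
    by (rule germ_eqI[OF SA_mult[OF SA_add[OF *(1,3)] *(5)] SA_add[OF SA_mult[OF *(1,5)] SA_mult[OF *(3,5)]]])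
      (simp add: distrib_right)
qed

subsection \<open>Germs as fractions\<close>

text \<open>A quotient of homogeneous forms of the same degree does not depend on the representative of the point, so an arbitrary one is used.\<close>

definition quot :: "(('i => complex) => complex) => (('i => complex) => complex) => ('i => complex) set => complex" where
  "quot g h q = g (SOME x. x \<in> q) / h (SOME x. x \<in> q)"

lemma quot_eq:
  assumes "hom_poly I k g" "hom_poly I k h" "q \<in> proj_space I" "x \<in> q" "h x ~= 0"
  shows "quot g h q = g x / h x"
proof -
  obtain z where z: "q = proj_point z" using assms(3) by (rule proj_spaceE)
  have "(SOME x. x \<in> q) \<in> q" by (rule someI[of "%x. x \<in> q", OF assms(4)])
  then obtain c where c: "c ~= 0" "(SOME x. x \<in> q) = (%i. c * z i)" unfolding z proj_point_def by blast
  obtain e where e: "e ~= 0" "x = (%i. e * z i)" using assms(4) unfolding z proj_point_def by blast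
  have hz: "h z ~= 0" using assms(5) unfolding e(2) hom_poly_scale[OF assms(2)] by simp
  show ?thesis unfolding quot_def c(2) e(2) hom_poly_scale[OF assms(1)] hom_poly_scale[OF assms(2)]
    using c(1) e(1) hz by simp
qed

lemma nonzero_locus_all:
  assumes "hom_poly I k h" "q \<in> nonzero_locus I h" "x \<in> q" shows "h x ~= 0"
proof -
  have "q \<in> proj_space I" using assms(2) by (simp add: nonzero_locus_def)
  then obtain z where z: "q = proj_point z" by (rule proj_spaceE)
  obtain x' where "x' \<in> q" "h x' ~= 0" using assms(2) unfolding nonzero_locus_def by blast
  then have "h z ~= 0" using hom_poly_nonzero_proj_point[OF assms(1)] z by blast
  then show ?thesis using hom_poly_nonzero_proj_point[OF assms(1)] z assms(3) by blast
qed

lemma SA_quot: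
  assumes "hom_poly I k g" "hom_poly I k h" "p \<in> nonzero_locus I h"
  shows "(X \<inter> nonzero_locus I h, quot g h) \<in> SA"
proof -
  have op: "openin TX (X \<inter> nonzero_locus I h)" by (rule openin_TX_locus[OF assms(2)])
  have "h x ~= 0 & quot g h q = g x / h x" if "q \<in> X \<inter> nonzero_locus I h" "x \<in> q" for q x
    using quot_eq[OF assms(1,2), of q x] nonzero_locus_all[OF assms(2), of q x] that X_sub by auto
  then have "regular_on I X (X \<inter> nonzero_locus I h) (quot g h)"
    using op assms by (intro regular_onI) blast+
  then show ?thesis using assms(3) p_in_X by (simp add: SA_iff)
qed

lemma section_as_quot:
  assumes "s \<in> SA"
  obtains k g h where "hom_poly I k g" "hom_poly I k h" "p \<in> nonzero_locus I h"
    "agree s (X \<inter> nonzero_locus I h, quot g h)"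
proof -
  obtain U f where s: "s = (U, f)" by (cases s)
  have r: "regular_on I X U f" "p \<in> U" using assms by (auto simp: s SA_iff)
  obtain W k g h where 1: "hom_poly I k g" "hom_poly I k h" "openin TX W" "p \<in> W" "W \<subseteq> U"
    "!!r x. r \<in> W ==> x \<in> r ==> h x ~= 0 & f r = g x / h x"
    by (rule regular_onE[OF r]) blast
  obtain l u where u: "hom_poly I l u" "p \<in> nonzero_locus I u" "X \<inter> nonzero_locus I u \<subseteq> W"
    by (rule TX_basis[OF 1(3,4)])
  have hom: "hom_poly I (k + l) (%x. g x * u x)" "hom_poly I (k + l) (%x. h x * u x)"
    by (intro hom_poly.mult 1 u)+
  obtain z where z: "p = proj_point z" using p_in_X X_sub proj_spaceE by (metis subsetD)
  have "h z ~= 0" using 1(6)[OF 1(4)] proj_point_self[of z] z by blast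
  then have "p \<in> nonzero_locus I h"
    using proj_point_in_nonzero_locus[OF 1(2), of z] p_in_X X_sub z by blast
  then have pn: "p \<in> nonzero_locus I (%x. h x * u x)" unfolding nonzero_locus_mult[OF 1(2) u(1)] using u(2) by blast
  have "agree (U, f) (X \<inter> nonzero_locus I (%x. h x * u x), quot (%x. g x * u x) (%x. h x * u x))"
  proof (rule agreeI)
    show "(X \<inter> nonzero_locus I (%x. h x * u x), quot (%x. g x * u x) (%x. h x * u x)) \<in> SA"
      by (rule SA_quot[OF hom pn])
    fix q assume "q \<in> fst (X \<inter> nonzero_locus I (%x. h x * u x), quot (%x. g x * u x) (%x. h x * u x))"
    then have q: "q \<in> X" "q \<in> nonzero_locus I (%x. h x * u x)" by auto
    then have "q \<in> W" using u(3) unfolding nonzero_locus_mult[OF 1(2) u(1)] by blast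
    obtain x where x: "x \<in> q" using q(2) unfolding nonzero_locus_def by blast
    have "h x * u x ~= 0" using nonzero_locus_all[OF hom(2) q(2) x] .
    then show "snd (U, f) q = snd (X \<inter> nonzero_locus I (%x. h x * u x), quot (%x. g x * u x) (%x. h x * u x)) q"
      using quot_eq[OF hom, of q x] 1(6)[OF \<open>q \<in> W\<close> x] q(1) X_sub x by auto
  qed (use assms s in simp)
  then show ?thesis using that[OF hom pn] s by simp
qed

lemma quot_common_factor:
  assumes "hom_poly I k g" "hom_poly I k h" "hom_poly I l u" "p \<in> nonzero_locus I h" "p \<in> nonzero_locus I u"
  shows "agree (X \<inter> nonzero_locus I h, quot g h)
    (X \<inter> nonzero_locus I (%x. h x * u x), quot (%x. g x * u x) (%x. h x * u x))"
proof (rule agreeI)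
  have hom: "hom_poly I (k + l) (%x. g x * u x)" "hom_poly I (k + l) (%x. h x * u x)"
    by (intro hom_poly.mult assms)+
  have pn: "p \<in> nonzero_locus I (%x. h x * u x)" unfolding nonzero_locus_mult[OF assms(2,3)] using assms by blast
  show "(X \<inter> nonzero_locus I h, quot g h) \<in> SA" by (rule SA_quot[OF assms(1,2,4)])
  show "(X \<inter> nonzero_locus I (%x. h x * u x), quot (%x. g x * u x) (%x. h x * u x)) \<in> SA"
    by (rule SA_quot[OF hom pn])
  fix q assume "q \<in> fst (X \<inter> nonzero_locus I (%x. h x * u x), quot (%x. g x * u x) (%x. h x * u x))"
  then have q: "q \<in> X" "q \<in> nonzero_locus I (%x. h x * u x)" by auto
  obtain x where x: "x \<in> q" using q(2) unfolding nonzero_locus_def by blast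
  have hu: "h x * u x ~= 0" using nonzero_locus_all[OF hom(2) q(2) x] .
  then show "snd (X \<inter> nonzero_locus I h, quot g h) q =
      snd (X \<inter> nonzero_locus I (%x. h x * u x), quot (%x. g x * u x) (%x. h x * u x)) q"
    using quot_eq[OF hom, of q x] quot_eq[OF assms(1,2), of q x] q(1) X_sub x by auto
qed

text \<open>Finitely many germs are fractions of forms with a common denominator, all of the same degree. This reduces computations in
the local ring to identities of polynomials.\<close>

lemma sections_common_denominator:
  assumes "!!i. i < (n::nat) ==> s i \<in> SA"
  obtains k g h where "\<forall>i<n. hom_poly I k (g i)" "hom_poly I k h" "p \<in> nonzero_locus I h"
    "\<forall>i<n. agree (s i) (X \<inter> nonzero_locus I h, quot (g i) h)"
proof -
  have "\<exists>k g h. (\<forall>i<n. hom_poly I k (g i)) & hom_poly I k h & p \<in> nonzero_locus I h &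
      (\<forall>i<n. agree (s i) (X \<inter> nonzero_locus I h, quot (g i) h))"
    using assms
  proof (induction n)
    case 0
    have "p \<in> nonzero_locus I (%_. 1)" unfolding nonzero_locus_one using p_in_X X_sub by blast
    then show ?case by (intro exI[of _ 0] exI[of _ "%_ _. 0"] exI[of _ "%_. 1"]) (auto intro: hom_poly.const)
  next
    case (Suc n)
    then obtain k g h where IH: "\<forall>i<n. hom_poly I k (g i)" "hom_poly I k h" "p \<in> nonzero_locus I h"
      "\<forall>i<n. agree (s i) (X \<inter> nonzero_locus I h, quot (g i) h)" by (metis less_Suc_eq)
    obtain l g' h' where 2: "hom_poly I l g'" "hom_poly I l h'" "p \<in> nonzero_locus I h'"
      "agree (s n) (X \<inter> nonzero_locus I h', quot g' h')"
      by (rule section_as_quot[of "s n"]) (use Suc.prems in auto)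
    define G where "G = (%i. if i < n then (%x. g i x * h' x) else (%x. g' x * h x))"
    have homH: "hom_poly I (k + l) (%x. h x * h' x)" by (intro hom_poly.mult IH 2)
    have "hom_poly I (k + l) (G i)" if "i < Suc n" for i
    proof (cases "i < n")
      case True then show ?thesis using IH(1) 2(2) by (simp add: G_def hom_poly.mult)
    next
      case False
      then show ?thesis using hom_poly.mult[OF 2(1) IH(2)] by (simp add: G_def add.commute)
    qed
    moreover have "agree (s i) (X \<inter> nonzero_locus I (%x. h x * h' x), quot (G i) (%x. h x * h' x))" if "i < Suc n" for i
    proof (cases "i < n")
      case True
      have "agree (s i) (X \<inter> nonzero_locus I (%x. h x * h' x), quot (%x. g i x * h' x) (%x. h x * h' x))"
        by (rule agree_trans[OF _ quot_common_factor[OF _ IH(2) 2(2) IH(3) 2(3)]]) (use IH True in auto)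
      then show ?thesis using True by (simp add: G_def)
    next
      case False
      then have i: "i = n" using that by simp
      have "agree (s n) (X \<inter> nonzero_locus I (%x. h' x * h x), quot (%x. g' x * h x) (%x. h' x * h x))"
        by (rule agree_trans[OF 2(4) quot_common_factor[OF 2(1,2) IH(2) 2(3) IH(3)]])
      then show ?thesis using i by (simp add: G_def mult.commute)
    qed
    moreover have "p \<in> nonzero_locus I (%x. h x * h' x)"
      unfolding nonzero_locus_mult[OF IH(2) 2(2)] using IH(3) 2(3) by blast
    ultimately show ?case using homH by blast
  qed
  then show ?thesis by (elim exE conjE) (rule that)
qed

lemma SA_pow: "(U, f) \<in> SA ==> (U, %q. f q ^ n) \<in> SA"
proof (induction n)
  case 0 then show ?case using SA_const[of U 1] by (auto simp: SA_iff intro: regular_on_openin)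
next
  case (Suc n) then show ?case using SA_mult[of U f U "%q. f q ^ n"] by simp
qed

lemma SA_mult': "(U, f) \<in> SA ==> (U, g) \<in> SA ==> (U, %q. f q * g q) \<in> SA"
  using SA_mult[of U f U g] by simp

lemma SA_sum:
  assumes "openin TX U" "p \<in> U" "!!i. i < (n::nat) ==> (U, f i) \<in> SA"
  shows "(U, %q. \<Sum>i<n. f i q) \<in> SA"
  using assms(3)
proof (induction n)
  case 0 then show ?case using SA_const[OF assms(1,2)] by simp
next
  case (Suc n)
  then have "(U \<inter> U, %q. (\<Sum>i<n. f i q) + f n q) \<in> SA" by (intro SA_add) auto
  then show ?case by simp
qed

lemma germ_pow:
  assumes "(U, f) \<in> SA" shows "gm (U, f) [^]\<^bsub>R\<^esub> (n::nat) = gm (U, %q. f q ^ n)"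
proof -
  interpret cring R by (rule cring_R)
  show ?thesis
  proof (induction n)
    case 0
    have "gm (X, %_. 1) = gm (U, %q. f q ^ 0)" by (rule germ_eqI[OF SA_X SA_pow[OF assms]]) simp
    then show ?case by (simp add: one_R)
  next
    case (Suc n)
    then show ?case using mult_R[OF SA_pow[OF assms] assms, of n] by (simp add: mult.commute)
  qed
qed

lemma germ_sum:
  assumes "openin TX U" "p \<in> U" "!!i. i < (n::nat) ==> (U, f i) \<in> SA"
  shows "finsum R (%i. gm (U, f i)) {..<n} = gm (U, %q. \<Sum>i<n. f i q)"
proof -
  interpret cring R by (rule cring_R)
  show ?thesis using assms(3)
  proof (induction n)
    case 0
    have "gm (X, %_. 0) = gm (U, %_. 0)" by (rule germ_eqI[OF SA_X SA_const[OF assms(1,2)]]) simp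
    then show ?case by (simp add: zero_R)
  next
    case (Suc n)
    have "finsum R (%i. gm (U, f i)) {..<Suc n} = gm (U, f n) \<oplus>\<^bsub>R\<^esub> finsum R (%i. gm (U, f i)) {..<n}"
      unfolding lessThan_Suc by (rule finsum_insert) (use Suc.prems in \<open>auto intro: SA_carrier\<close>)
    also have "\<dots> = gm (U, f n) \<oplus>\<^bsub>R\<^esub> gm (U, %q. \<Sum>i<n. f i q)" using Suc by simp
    also have "\<dots> = gm (U \<inter> U, %q. f n q + (\<Sum>i<n. f i q))"
      by (rule add_R) (use Suc.prems SA_sum[OF assms(1,2), of n f] in auto)
    finally show ?case by (simp add: add.commute)
  qed
qed

end

section \<open>Normality of the determinantal variety\<close>

text \<open>A polynomial in the entries of the normalized matrix becomes a form in the Pluecker coordinates after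
multiplication with a power of \<open>x J\<close>.\<close>

lemma poly_fun_chart_homogenize:
  assumes "d \<le> N" "J \<in> plucker_index d N" "poly_fun ({..<N} \<times> {..<d}) P"
  shows "\<exists>e H. hom_poly (plucker_index d N) e H &
    (\<forall>x. x J ~= 0 --> H x = x J ^ e * P (%(i, j). chart N d J x $$ (i, j) / x J))"
  using assms(3)
proof (induction rule: poly_fun.induct)
  case (const c)
  show ?case by (rule exI[of _ 0], rule exI[of _ "%_. c"]) (simp add: hom_poly.const)
next
  case (coord v)
  obtain i j where v: "v = (i, j)" "i < N" "j < d" using coord by (cases v) auto
  show ?case
    by (rule exI[of _ 1], rule exI[of _ "%x. chart N d J x $$ (i, j)"])
      (use hom_poly_chart[OF assms(1,2) v(2,3)] in \<open>simp add: v\<close>)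
next
  case (add f g)
  from add.IH obtain e H e' H' where H: "hom_poly (plucker_index d N) e H"
      "\<forall>x. x J ~= 0 --> H x = x J ^ e * f (%(i, j). chart N d J x $$ (i, j) / x J)"
    and H': "hom_poly (plucker_index d N) e' H'"
      "\<forall>x. x J ~= 0 --> H' x = x J ^ e' * g (%(i, j). chart N d J x $$ (i, j) / x J)"
    by (elim exE conjE) (rule that)
  have xe: "hom_poly (plucker_index d N) (n * 1) (%x. x J ^ n)" for n
    by (rule hom_poly_power[OF hom_poly.coord[OF assms(2)]])
  have "hom_poly (plucker_index d N) (e + e' * 1) (%x. H x * x J ^ e')"
    by (rule hom_poly.mult[OF H(1) xe])
  moreover have "hom_poly (plucker_index d N) (e' + e * 1) (%x. H' x * x J ^ e)"
    by (rule hom_poly.mult[OF H'(1) xe])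
  ultimately have "hom_poly (plucker_index d N) (e + e') (%x. H x * x J ^ e' + H' x * x J ^ e)"
    by (intro hom_poly.add) (simp_all add: add.commute)
  moreover have "H x * x J ^ e' + H' x * x J ^ e = x J ^ (e + e') *
      (f (%(i, j). chart N d J x $$ (i, j) / x J) + g (%(i, j). chart N d J x $$ (i, j) / x J))" if "x J ~= 0" for x
    unfolding H(2)[rule_format, of x, OF that] H'(2)[rule_format, of x, OF that] power_add
    by (simp only: distrib_left mult_ac)
  ultimately show ?case
    by (intro exI[of _ "e + e'"] exI[of _ "%x. H x * x J ^ e' + H' x * x J ^ e"] conjI allI impI)
next
  case (mult f g)
  from mult.IH obtain e H e' H' where H: "hom_poly (plucker_index d N) e H"
      "\<forall>x. x J ~= 0 --> H x = x J ^ e * f (%(i, j). chart N d J x $$ (i, j) / x J)"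
    and H': "hom_poly (plucker_index d N) e' H'"
      "\<forall>x. x J ~= 0 --> H' x = x J ^ e' * g (%(i, j). chart N d J x $$ (i, j) / x J)"
    by (elim exE conjE) (rule that)
  have "hom_poly (plucker_index d N) (e + e') (%x. H x * H' x)" by (rule hom_poly.mult[OF H(1) H'(1)])
  moreover have "H x * H' x = x J ^ (e + e') *
      (f (%(i, j). chart N d J x $$ (i, j) / x J) * g (%(i, j). chart N d J x $$ (i, j) / x J))" if "x J ~= 0" for x
    unfolding H(2)[rule_format, of x, OF that] H'(2)[rule_format, of x, OF that] power_add
    by (simp only: mult_ac)
  ultimately show ?case
    by (intro exI[of _ "e + e'"] exI[of _ "%x. H x * H' x"] conjI allI impI)
qed

locale detvar_point =
  fixes N d t :: nat and p :: "(nat set => complex) set"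
  assumes d0: "0 < d" and dN: "d \<le> N" and p_in: "p \<in> plucker N ` detvar N d t"
begin

abbreviation "PI \<equiv> plucker_index d N"
abbreviation "XX \<equiv> plucker N ` detvar N d t"
abbreviation "pl y \<equiv> plk N d (MY N d t y)"

lemma XX_sub: "XX \<subseteq> proj_space PI"
  using closedin_subset[OF plucker_image_detvar_closed[OF d0 dN]] unfolding topspace_zariski_proj .

sublocale variety_point PI XX p
  by (unfold_locales) (rule XX_sub, rule p_in)

lemma XX_param:
  assumes "q \<in> XX" obtains y where "full_col_rank (MY N d t y)" "q = proj_point (pl y)"
  using assms unfolding plucker_image_detvar[OF d0] by (elim CollectE exE conjE) (rule that)

lemma param_XX: "full_col_rank (MY N d t y) ==> proj_point (pl y) \<in> XX"
  unfolding plucker_image_detvar[OF d0] by (intro CollectI exI[of _ y] conjI refl)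

lemma param_locus:
  assumes "hom_poly PI k f" "full_col_rank (MY N d t y)"
  shows "proj_point (pl y) \<in> nonzero_locus PI f \<longleftrightarrow> f (pl y) ~= 0"
  by (rule proj_point_in_nonzero_locus[OF assms(1) proj_point_plk_in_proj_space[OF MY_carrier assms(2)]])

lemma quot_param:
  assumes "hom_poly PI k g" "hom_poly PI k h" "full_col_rank (MY N d t y)" "h (pl y) ~= 0"
  shows "quot g h (proj_point (pl y)) = g (pl y) / h (pl y)"
  by (rule quot_eq[OF assms(1,2) proj_point_plk_in_proj_space[OF MY_carrier assms(3)] proj_point_self assms(4)])

lemma poly_pl: "hom_poly PI k f ==> poly_fun (yvars d (N - d) t) (%y. f (pl y))"
  by (rule poly_fun_hom_MY[OF dN])

lemma nonzero_at_p:
  assumes "hom_poly PI k f" "p \<in> nonzero_locus PI f" obtains y where "f (pl y) ~= 0"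
proof -
  obtain y where y: "full_col_rank (MY N d t y)" "p = proj_point (pl y)" by (rule XX_param[OF p_in_X])
  show ?thesis using param_locus[OF assms(1) y(1)] assms(2) y(2) that by blast
qed

lemma germ_zero_iff:
  assumes g: "hom_poly PI k g" "hom_poly PI k h" "p \<in> nonzero_locus PI h"
    and z: "!!y. g (pl y) = 0"
  shows "gm (XX \<inter> nonzero_locus PI h, quot g h) = \<zero>\<^bsub>R\<^esub>"
  unfolding zero_R
proof (rule germ_eqI[OF SA_quot[OF g] SA_X])
  fix q assume "q \<in> fst (XX \<inter> nonzero_locus PI h, quot g h)"
  then have q: "q \<in> XX" "q \<in> nonzero_locus PI h" by simp_all
  obtain y where y: "full_col_rank (MY N d t y)" "q = proj_point (pl y)" by (rule XX_param[OF q(1)])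
  have "h (pl y) ~= 0" using param_locus[OF g(2) y(1)] q(2) y(2) by simp
  then show "snd (XX \<inter> nonzero_locus PI h, quot g h) q = snd (XX, %_. 0) q"
    using quot_param[OF g(1,2) y(1)] z y(2) by simp
qed

lemma germ_zeroE:
  assumes "s \<in> SA" "gm s = \<zero>\<^bsub>R\<^esub>"
  obtains l u where "hom_poly PI l u" "p \<in> nonzero_locus PI u"
    "\<forall>y. full_col_rank (MY N d t y) --> u (pl y) ~= 0 --> proj_point (pl y) \<in> fst s & snd s (proj_point (pl y)) = 0"
proof -
  have "agree s (XX, %_. 0)" using assms germ_eq_iff[OF assms(1) SA_X] unfolding zero_R by simp
  then obtain W where W: "openin TX W" "p \<in> W" "W \<subseteq> fst s" "\<forall>q\<in>W. snd s q = 0"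
    by (rule agreeE) (rule that, simp_all)
  obtain l u where u: "hom_poly PI l u" "p \<in> nonzero_locus PI u" "XX \<inter> nonzero_locus PI u \<subseteq> W"
    by (rule TX_basis[OF W(1,2)])
  show ?thesis
  proof (rule that[OF u(1,2)], intro allI impI)
    fix y assume y: "full_col_rank (MY N d t y)" "u (pl y) ~= 0"
    then have "proj_point (pl y) \<in> W" using param_XX[OF y(1)] param_locus[OF u(1) y(1)] u(3) by blast
    then show "proj_point (pl y) \<in> fst s & snd s (proj_point (pl y)) = 0" using W(3,4) by blast
  qed
qed

lemma domain_R: "domain R"
proof -
  interpret cring R by (rule cring_R)
  show ?thesis
  proof (unfold_locales)
    show "\<one>\<^bsub>R\<^esub> ~= \<zero>\<^bsub>R\<^esub>"
    proof
      assume "\<one>\<^bsub>R\<^esub> = \<zero>\<^bsub>R\<^esub>"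
      then have one0: "gm (XX, %_. 1) = \<zero>\<^bsub>R\<^esub>" unfolding one_R .
      obtain l u where u: "hom_poly PI l u" "p \<in> nonzero_locus PI u"
        "\<forall>y. full_col_rank (MY N d t y) --> u (pl y) ~= 0 -->
          proj_point (pl y) \<in> fst (XX, %_ :: (nat set => complex) set. 1 :: complex) &
          snd (XX, %_ :: (nat set => complex) set. 1 :: complex) (proj_point (pl y)) = 0"
        by (rule germ_zeroE[OF SA_X one0])
      obtain y where y: "full_col_rank (MY N d t y)" "p = proj_point (pl y)" by (rule XX_param[OF p_in_X])
      show False using u(3)[rule_format, OF y(1)] param_locus[OF u(1) y(1)] u(2) y(2) by simp
    qed
  next
    fix a b assume ab: "a \<otimes>\<^bsub>R\<^esub> b = \<zero>\<^bsub>R\<^esub>" "a \<in> carrier R" "b \<in> carrier R"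
    obtain sa where sa: "sa \<in> SA" "a = gm sa" using ab(2) unfolding carrier_R by auto
    obtain sb where sb: "sb \<in> SA" "b = gm sb" using ab(3) unfolding carrier_R by auto
    define s where "s = (%i::nat. if i = 0 then sa else sb)"
    have s: "s i \<in> SA" for i using sa sb by (simp add: s_def)
    obtain k g h where g: "\<forall>i<2. hom_poly PI k (g i)" "hom_poly PI k h" "p \<in> nonzero_locus PI h"
      "\<forall>i<2. agree (s i) (XX \<inter> nonzero_locus PI h, quot (g i) h)"
      by (rule sections_common_denominator[of 2 s, OF s])
    let ?U = "XX \<inter> nonzero_locus PI h"
    have SAq: "(?U, quot (g i) h) \<in> SA" if "i < 2" for i by (rule SA_quot[OF g(1)[rule_format, OF that] g(2,3)])
    have eq: "gm (s i) = gm (?U, quot (g i) h)" if "i < 2" for i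
      using germ_eq_iff[OF s SAq[OF that]] g(4) that by simp
    have a: "a = gm (?U, quot (g 0) h)" and b: "b = gm (?U, quot (g 1) h)"
      using eq[of 0] eq[of 1] sa sb by (simp_all add: s_def)
    let ?s = "(?U \<inter> ?U, %q. quot (g 0) h q * quot (g 1) h q)"
    have sS: "?s \<in> SA" by (rule SA_mult[OF SAq SAq]) simp_all
    have s0: "gm ?s = \<zero>\<^bsub>R\<^esub>" using ab(1) mult_R[OF SAq SAq, of 0 1] unfolding a b by simp
    obtain l u where u: "hom_poly PI l u" "p \<in> nonzero_locus PI u"
      "\<forall>y. full_col_rank (MY N d t y) --> u (pl y) ~= 0 -->
        proj_point (pl y) \<in> fst ?s & snd ?s (proj_point (pl y)) = 0"
      by (rule germ_zeroE[OF sS s0])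
    have hom: "hom_poly PI k (g 0)" "hom_poly PI k (g 1)" using g(1) by simp_all
    have "u (pl y) * (g 0 (pl y) * g 1 (pl y)) = 0" for y
    proof (rule poly_fun_zero_of_zero_on_full_rank[OF dN
          poly_fun.mult[OF poly_pl[OF u(1)] poly_fun.mult[OF poly_pl[OF hom(1)] poly_pl[OF hom(2)]]]])
      fix y assume y: "full_col_rank (MY N d t y)"
      show "u (pl y) * (g 0 (pl y) * g 1 (pl y)) = 0"
      proof (cases "u (pl y) = 0")
        case False
        from u(3)[rule_format, OF y False] have 1: "proj_point (pl y) \<in> nonzero_locus PI h"
          "quot (g 0) h (proj_point (pl y)) * quot (g 1) h (proj_point (pl y)) = 0" by simp_all
        have "h (pl y) ~= 0" using 1(1) param_locus[OF g(2) y] by simp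
        then show ?thesis
          using 1(2) unfolding quot_param[OF hom(1) g(2) y \<open>h (pl y) ~= 0\<close>] quot_param[OF hom(2) g(2) y \<open>h (pl y) ~= 0\<close>]
          by simp
      qed simp
    qed
    note uz = this
    obtain yu where "u (pl yu) ~= 0" by (rule nonzero_at_p[OF u(1,2)])
    then have gz: "g 0 (pl y) * g 1 (pl y) = 0" for y
      using poly_fun_no_zero_divisors[OF poly_pl[OF u(1)] poly_fun.mult[OF poly_pl[OF hom(1)] poly_pl[OF hom(2)]] uz] by simp
    show "a = \<zero>\<^bsub>R\<^esub> \<or> b = \<zero>\<^bsub>R\<^esub>"
    proof (cases "\<forall>y. g 0 (pl y) = 0")
      case True
      then show ?thesis unfolding a using germ_zero_iff[OF hom(1) g(2,3)] by simp
    next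
      case False
      then obtain y0 where "g 0 (pl y0) ~= 0" by blast
      then have "g 1 (pl y) = 0" for y
        using poly_fun_no_zero_divisors[OF poly_pl[OF hom(1)] poly_pl[OF hom(2)] gz] by simp
      then show ?thesis unfolding b using germ_zero_iff[OF hom(2) g(2,3)] by simp
    qed
  qed
qed

text \<open>The first fundamental theorem writes \<open>G\<close> as a polynomial in the entries of the matrix. Homogenized in the chart at a
nonzero coordinate of \<open>p\<close>, it gives a fraction whose denominator does not vanish at \<open>p\<close>.\<close>

lemma fraction_regular:
  assumes hom: "hom_poly PI k g" "hom_poly PI k g'" "hom_poly PI k h" and ph: "p \<in> nonzero_locus PI h"
    and G: "poly_fun (yvars d (N - d) t) G" "!!y. h (pl y) * g (pl y) = G y * g' (pl y)"
    and nz: "g' (pl y0) ~= 0"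
  shows "\<exists>r\<in>carrier R. gm (XX \<inter> nonzero_locus PI h, quot g h) = r \<otimes>\<^bsub>R\<^esub> gm (XX \<inter> nonzero_locus PI h, quot g' h)"
proof -
  let ?U = "XX \<inter> nonzero_locus PI h"
  let ?M = "%(y :: yvar => complex) (i, j). if i < d then y (Top i j) else \<Sum>a<t. y (Lft (i - d) a) * y (Rgt a j)"
  have MYM: "MY N d t y = mat N d (?M y)" for y by (simp add: MY_def)
  have inv: "G y = G y'" if y: "g' (pl y) ~= 0" "?M y = ?M y'" for y y'
  proof -
    have e: "MY N d t y = MY N d t y'" unfolding MYM y(2) ..
    have "G y * g' (pl y) = h (pl y) * g (pl y)" by (rule G(2)[symmetric])
    also have "\<dots> = G y' * g' (pl y')" unfolding e by (rule G(2))
    finally have "G y * g' (pl y') = G y' * g' (pl y')" unfolding e .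
    moreover have "g' (pl y') ~= 0" using y(1) unfolding e .
    ultimately show ?thesis by simp
  qed
  obtain P where P: "poly_fun ({..<d + (N - d)} \<times> {..<d}) P" "!!y. G y = P (?M y)"
    by (rule first_fundamental_theorem_GL[OF G(1) poly_pl[OF hom(2)] nz inv]) blast+
  have P1: "poly_fun ({..<N} \<times> {..<d}) P" using P(1) dN by simp
  obtain z where z: "full_col_rank (MY N d t z)" "p = proj_point (pl z)" by (rule XX_param[OF p_in_X])
  obtain J where J: "J \<in> PI" "pl z J ~= 0" by (rule full_col_rank_imp_plk[OF MY_carrier z(1)])
  from poly_fun_chart_homogenize[OF dN J(1) P1] obtain e H where H: "hom_poly PI e H"
    "\<forall>x. x J ~= 0 --> H x = x J ^ e * P (%(i, j). chart N d J x $$ (i, j) / x J)"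
    by (elim exE conjE) (rule that)
  have xe: "hom_poly PI (n * 1) (%x. x J ^ n)" for n by (rule hom_poly_power[OF hom_poly.coord[OF J(1)]])
  have xe': "hom_poly PI n (%x. x J ^ n)" for n using xe[of n] by simp
  let ?g = "%x. H x * x J ^ Suc k" and ?h = "%x. h x * (x J ^ Suc e)"
  have hg: "hom_poly PI (k + Suc e) ?g" using hom_poly.mult[OF H(1) xe'[of "Suc k"]] by (simp add: add.commute)
  have hh: "hom_poly PI (k + Suc e) ?h" by (rule hom_poly.mult[OF hom(3) xe'])
  have hz: "h (pl z) ~= 0" using ph param_locus[OF hom(3) z(1)] z(2) by simp
  have pn: "p \<in> nonzero_locus PI ?h" unfolding z(2) param_locus[OF hh z(1)] using hz J(2) by simp
  let ?V = "XX \<inter> nonzero_locus PI ?h"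
  have r: "(?V, quot ?g ?h) \<in> SA" by (rule SA_quot[OF hg hh pn])
  have sg: "(?U, quot g h) \<in> SA" by (rule SA_quot[OF hom(1,3) ph])
  have sg': "(?U, quot g' h) \<in> SA" by (rule SA_quot[OF hom(2,3) ph])
  have "gm (?U, quot g h) = gm (?V \<inter> ?U, %q. quot ?g ?h q * quot g' h q)"
  proof (rule germ_eqI[OF sg SA_mult[OF r sg']])
    fix q assume "q \<in> fst (?V \<inter> ?U, %q. quot ?g ?h q * quot g' h q)"
    then have q: "q \<in> XX" "q \<in> nonzero_locus PI ?h" by simp_all
    obtain y where y: "full_col_rank (MY N d t y)" "q = proj_point (pl y)" by (rule XX_param[OF q(1)])
    let ?x = "pl y"
    have "?h ?x ~= 0" using q(2) unfolding y(2) param_locus[OF hh y(1)] .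
    then have hx: "h ?x ~= 0" and xJ: "?x J ~= 0" and hhx: "?h ?x ~= 0" by simp_all
    have key: "h ?x * g ?x * ?x J ^ e = H ?x * ?x J ^ k * g' ?x"
    proof -
      obtain M' where M': "M' \<in> carrier_mat N d" "chart N d J ?x = ?x J \<cdot>\<^sub>m M'"
        "?x = (%K. ?x J * plk N d M' K)" "\<exists>g\<in>carrier_mat d d. M' = MY N d t y * g"
        by (rule chart_of_plk[OF MY_carrier[of N d t y], of ?x 1 J]) (simp, rule xJ, rule that)
      obtain c where c: "c \<in> carrier_mat d d" "M' = MY N d t y * c" using M'(4) by blast
      have "rank_le t (low d M')" unfolding c(2) low_mult[OF MY_carrier c(1)]
        by (rule rank_le_mult[OF low_carrier[OF MY_carrier] c(1) rank_low_MY])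
      then obtain y' where y': "M' = MY N d t y'" by (rule rank_low_imp_MY[OF M'(1)])
      have xy': "?x = (%K. ?x J * pl y' K)" using M'(3) unfolding y' .
      have sc: "f ?x = ?x J ^ k * f (pl y')" if "hom_poly PI k f" for f
        by (subst xy') (rule hom_poly_scale[OF that])
      have "P (%(i, j). chart N d J ?x $$ (i, j) / ?x J) = P (?M y')"
      proof (rule poly_fun_cong[OF P1])
        fix v assume "v \<in> {..<N} \<times> {..<d}"
        then obtain i j where v: "v = (i, j)" "i < N" "j < d" by auto
        have "chart N d J ?x $$ (i, j) = ?x J * MY N d t y' $$ (i, j)"
          unfolding M'(2) y' using v carrier_matD[OF MY_carrier[of N d t y']] by simp
        then show "(case v of (i, j) => chart N d J ?x $$ (i, j) / ?x J) = ?M y' v"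
          using xJ v by (simp add: MY_def)
      qed
      then have HP: "H ?x = ?x J ^ e * G y'" using H(2) xJ P(2)[of y'] by simp
      have "h ?x * g ?x * ?x J ^ e = ?x J ^ k * ?x J ^ k * ?x J ^ e * (h (pl y') * g (pl y'))"
        unfolding sc[OF hom(1)] sc[OF hom(3)] by (simp add: mult_ac)
      also have "\<dots> = H ?x * ?x J ^ k * g' ?x"
        unfolding G(2) HP sc[OF hom(2)] by (simp add: mult_ac)
      finally show ?thesis .
    qed
    have q1: "quot g h q = g ?x / h ?x" unfolding y(2) by (rule quot_param[OF hom(1,3) y(1) hx])
    have q2: "quot g' h q = g' ?x / h ?x" unfolding y(2) by (rule quot_param[OF hom(2,3) y(1) hx])
    have q3: "quot ?g ?h q = ?g ?x / ?h ?x" unfolding y(2) by (rule quot_param[OF hg hh y(1) hhx])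
    have "g ?x / h ?x = (H ?x * ?x J ^ Suc k) / (h ?x * (?x J ^ Suc e)) * (g' ?x / h ?x)"
    proof -
      have "(H ?x * ?x J ^ Suc k) / (h ?x * (?x J ^ Suc e)) * (g' ?x / h ?x) =
          (H ?x * ?x J ^ k * g' ?x) / (h ?x * ?x J ^ e * h ?x)"
        using xJ by simp
      also have "\<dots> = (h ?x * g ?x * ?x J ^ e) / (h ?x * ?x J ^ e * h ?x)" unfolding key ..
      also have "\<dots> = g ?x / h ?x" using xJ hx by simp
      finally show ?thesis by (rule sym)
    qed
    then show "snd (?U, quot g h) q = snd (?V \<inter> ?U, %q. quot ?g ?h q * quot g' h q) q"
      unfolding snd_conv q1 q2 q3 .
  qed
  also have "\<dots> = gm (?V, quot ?g ?h) \<otimes>\<^bsub>R\<^esub> gm (?U, quot g' h)" by (rule mult_R[OF r sg', symmetric])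
  finally show ?thesis using SA_carrier[OF r] by (rule bexI)
qed

text \<open>After pulling back to the affine space and clearing denominators, the fraction times \<open>h\<close> is integral over the
polynomials, hence a polynomial, and \<open>fraction_regular\<close> applies.\<close>

lemma integrally_closed_R: "integrally_closed_domain R"
  unfolding integrally_closed_domain_def
proof (intro conjI domain_R ballI allI impI)
  fix a b n c
  assume a: "a \<in> carrier R" and b: "b \<in> carrier R - {\<zero>\<^bsub>R\<^esub>}" and c: "c \<in> {..<n::nat} \<rightarrow> carrier R"
    and eq: "a [^]\<^bsub>R\<^esub> n \<oplus>\<^bsub>R\<^esub> (\<Oplus>\<^bsub>R\<^esub>i\<in>{..<n}. c i \<otimes>\<^bsub>R\<^esub> (a [^]\<^bsub>R\<^esub> i \<otimes>\<^bsub>R\<^esub> b [^]\<^bsub>R\<^esub> (n - i))) = \<zero>\<^bsub>R\<^esub>"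
  interpret cring R by (rule cring_R)
  obtain sa where sa: "sa \<in> SA" "a = gm sa" using a unfolding carrier_R by auto
  obtain sb where sb: "sb \<in> SA" "b = gm sb" using b unfolding carrier_R by auto
  have "\<forall>i. \<exists>s. i < n --> s \<in> SA & c i = gm s"
  proof
    fix i
    show "\<exists>s. i < n --> s \<in> SA & c i = gm s"
    proof (cases "i < n")
      case True
      then have "c i \<in> gm ` SA" using c unfolding carrier_R by auto
      then show ?thesis by auto
    qed simp
  qed
  then obtain sc where sc: "\<forall>i. i < n --> sc i \<in> SA & c i = gm (sc i)" by (rule choice[THEN exE])
  define s where "s = (%i::nat. case i of 0 => sa | Suc 0 => sb | Suc (Suc j) => sc j)"
  have s: "s i \<in> SA" if "i < Suc (Suc n)" for i
    using that sa(1) sb(1) sc by (auto simp: s_def split: nat.split)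
  obtain k g h where g: "\<forall>i<Suc (Suc n). hom_poly PI k (g i)" "hom_poly PI k h" "p \<in> nonzero_locus PI h"
    "\<forall>i<Suc (Suc n). agree (s i) (XX \<inter> nonzero_locus PI h, quot (g i) h)"
    by (rule sections_common_denominator[of "Suc (Suc n)" s, OF s])
  let ?U = "XX \<inter> nonzero_locus PI h"
  have opU: "openin TX ?U" by (rule openin_TX_locus[OF g(2)])
  have pU: "p \<in> ?U" using p_in_X g(3) by simp
  have SAq: "(?U, quot (g i) h) \<in> SA" if "i < Suc (Suc n)" for i
    by (rule SA_quot[OF g(1)[rule_format, OF that] g(2,3)])
  have geq: "gm (s i) = gm (?U, quot (g i) h)" if "i < Suc (Suc n)" for i
    using germ_eq_iff[OF s[OF that] SAq[OF that]] g(4) that by simp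
  define \<alpha> \<beta> \<gamma> where "\<alpha> = g 0" and "\<beta> = g (Suc 0)" and "\<gamma> = (%i. g (Suc (Suc i)))"
  have ha: "hom_poly PI k \<alpha>" and hb: "hom_poly PI k \<beta>" and hc: "!!i. i < n ==> hom_poly PI k (\<gamma> i)"
    using g(1) by (simp_all add: \<alpha>_def \<beta>_def \<gamma>_def)
  have SAa: "(?U, quot \<alpha> h) \<in> SA" and SAb: "(?U, quot \<beta> h) \<in> SA" and SAc: "!!i. i < n ==> (?U, quot (\<gamma> i) h) \<in> SA"
    using SAq by (simp_all add: \<alpha>_def \<beta>_def \<gamma>_def)
  have aeq: "a = gm (?U, quot \<alpha> h)" and beq: "b = gm (?U, quot \<beta> h)"
    using geq[of 0] geq[of "Suc 0"] sa(2) sb(2) by (simp_all add: s_def \<alpha>_def \<beta>_def)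
  have ceq: "c i = gm (?U, quot (\<gamma> i) h)" if "i < n" for i
    using geq[of "Suc (Suc i)"] sc that by (simp add: s_def \<gamma>_def)
  define T where "T = (%i q. quot (\<gamma> i) h q * (quot \<alpha> h q ^ i * quot \<beta> h q ^ (n - i)))"
  have SAT: "(?U, T i) \<in> SA" if "i < n" for i
    unfolding T_def by (intro SA_mult' SAc[OF that] SA_pow SAa SAb)
  have ceqT: "c i \<otimes>\<^bsub>R\<^esub> (a [^]\<^bsub>R\<^esub> i \<otimes>\<^bsub>R\<^esub> b [^]\<^bsub>R\<^esub> (n - i)) = gm (?U, T i)" if i: "i < n" for i
    unfolding ceq[OF i] aeq beq germ_pow[OF SAa] germ_pow[OF SAb] mult_R[OF SA_pow[OF SAa] SA_pow[OF SAb]] Int_absorb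
      mult_R[OF SAc[OF i] SA_mult'[OF SA_pow[OF SAa] SA_pow[OF SAb]]] T_def ..
  have sumeq: "(\<Oplus>\<^bsub>R\<^esub>i\<in>{..<n}. c i \<otimes>\<^bsub>R\<^esub> (a [^]\<^bsub>R\<^esub> i \<otimes>\<^bsub>R\<^esub> b [^]\<^bsub>R\<^esub> (n - i))) = gm (?U, %q. \<Sum>i<n. T i q)"
  proof -
    have "(\<Oplus>\<^bsub>R\<^esub>i\<in>{..<n}. c i \<otimes>\<^bsub>R\<^esub> (a [^]\<^bsub>R\<^esub> i \<otimes>\<^bsub>R\<^esub> b [^]\<^bsub>R\<^esub> (n - i))) = (\<Oplus>\<^bsub>R\<^esub>i\<in>{..<n}. gm (?U, T i))"
      by (rule finsum_cong'[OF refl]) (use SAT ceqT in \<open>auto intro: SA_carrier\<close>)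
    also have "\<dots> = gm (?U, %q. \<Sum>i<n. T i q)" by (rule germ_sum[OF opU pU SAT])
    finally show ?thesis .
  qed
  have SAsum: "(?U, %q. \<Sum>i<n. T i q) \<in> SA" by (rule SA_sum[OF opU pU SAT])
  let ?F = "(?U \<inter> ?U, %q. quot \<alpha> h q ^ n + (\<Sum>i<n. T i q))"
  have FS: "?F \<in> SA" by (rule SA_add[OF SA_pow[OF SAa] SAsum])
  have eq': "a [^]\<^bsub>R\<^esub> n \<oplus>\<^bsub>R\<^esub> gm (?U, %q. \<Sum>i<n. T i q) = \<zero>\<^bsub>R\<^esub>" using eq unfolding sumeq .
  have F0: "gm ?F = \<zero>\<^bsub>R\<^esub>"
    using eq' unfolding aeq germ_pow[OF SAa] add_R[OF SA_pow[OF SAa] SAsum] .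
  obtain l u where u: "hom_poly PI l u" "p \<in> nonzero_locus PI u"
    "\<forall>y. full_col_rank (MY N d t y) --> u (pl y) ~= 0 -->
      proj_point (pl y) \<in> fst ?F & snd ?F (proj_point (pl y)) = 0"
    by (rule germ_zeroE[OF FS F0])
  \<comment> \<open>Clearing denominators turns the equation into a monic one for \<open>h \<alpha> / \<beta>\<close>, pulled back to the affine space.\<close>
  define A where "A = (%y. h (pl y) * \<alpha> (pl y))"
  define E where "E = (%i y. \<gamma> i (pl y) * h (pl y) ^ (n - 1 - i))"
  have pA: "poly_fun (yvars d (N - d) t) A" unfolding A_def by (rule poly_fun.mult[OF poly_pl[OF g(2)] poly_pl[OF ha]])
  have pB: "poly_fun (yvars d (N - d) t) (%y. \<beta> (pl y))" by (rule poly_pl[OF hb])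
  have pE: "poly_fun (yvars d (N - d) t) (E i)" if "i < n" for i
    unfolding E_def by (rule poly_fun.mult[OF poly_pl[OF hc[OF that]] poly_fun_power[OF poly_pl[OF g(2)]]])
  define Q where "Q = (%y. A y ^ n + (\<Sum>i<n. E i y * A y ^ i * \<beta> (pl y) ^ (n - i)))"
  have pQ: "poly_fun (yvars d (N - d) t) Q"
    unfolding Q_def by (intro poly_fun.add poly_fun_power pA poly_fun_sum poly_fun.mult pE pB) simp
  have "u (pl y) * Q y = 0" for y
  proof (rule poly_fun_zero_of_zero_on_full_rank[OF dN poly_fun.mult[OF poly_pl[OF u(1)] pQ]])
    fix y assume y: "full_col_rank (MY N d t y)"
    show "u (pl y) * Q y = 0"
    proof (cases "u (pl y) = 0")
      case False
      from u(3)[rule_format, OF y False] have 1: "proj_point (pl y) \<in> nonzero_locus PI h"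
        "quot \<alpha> h (proj_point (pl y)) ^ n + (\<Sum>i<n. T i (proj_point (pl y))) = 0" by simp_all
      have hy: "h (pl y) ~= 0" using 1(1) param_locus[OF g(2) y] by simp
      let ?a = "\<alpha> (pl y)" and ?b = "\<beta> (pl y)" and ?h = "h (pl y)" and ?c = "%i. \<gamma> i (pl y)"
      have Teq: "T i (proj_point (pl y)) = (?c i / ?h) * ((?a / ?h) ^ i * (?b / ?h) ^ (n - i))" if "i < n" for i
        unfolding T_def quot_param[OF ha g(2) y hy] quot_param[OF hb g(2) y hy] quot_param[OF hc[OF that] g(2) y hy] ..
      have z: "(?a / ?h) ^ n + (\<Sum>i<n. (?c i / ?h) * ((?a / ?h) ^ i * (?b / ?h) ^ (n - i))) = 0"
        using 1(2) Teq unfolding quot_param[OF ha g(2) y hy] by simp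
      have "Q y = (?h ^ n * ?h ^ n) * ((?a / ?h) ^ n + (\<Sum>i<n. (?c i / ?h) * ((?a / ?h) ^ i * (?b / ?h) ^ (n - i))))"
      proof -
        have "A y ^ n = (?h ^ n * ?h ^ n) * (?a / ?h) ^ n"
          using hy by (simp add: A_def power_mult_distrib power_divide)
        moreover have "E i y * A y ^ i * ?b ^ (n - i) =
            (?h ^ n * ?h ^ n) * ((?c i / ?h) * ((?a / ?h) ^ i * (?b / ?h) ^ (n - i)))" if i: "i < n" for i
        proof -
          have n1: "?h ^ n = ?h ^ i * ?h ^ (n - i)" using i by (simp flip: power_add)
          have n2: "?h ^ n = ?h * ?h ^ (n - 1 - i) * ?h ^ i"
          proof -
            have "n = Suc (n - 1 - i) + i" using i by simp
            then show ?thesis by (metis power_add power_Suc)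
          qed
          have "(?h ^ n * ?h ^ n) * ((?c i / ?h) * ((?a / ?h) ^ i * (?b / ?h) ^ (n - i))) =
              ((?h ^ n / ?h) * ?c i) * (?a ^ i * ?b ^ (n - i)) * (?h ^ n / (?h ^ i * ?h ^ (n - i)))"
            by (simp add: power_divide)
          also have "?h ^ n / (?h ^ i * ?h ^ (n - i)) = 1" unfolding n1 using hy by simp
          also have "?h ^ n / ?h = ?h ^ (n - 1 - i) * ?h ^ i" unfolding n2 using hy by simp
          finally show ?thesis unfolding E_def A_def power_mult_distrib by (simp add: mult_ac)
        qed
        ultimately show ?thesis unfolding Q_def distrib_left sum_distrib_left
          by (intro arg_cong2[where f = "(+)"] sum.cong refl) simp_all
      qed
      then show ?thesis unfolding z by simp
    qed simp
  qed
  note uQ = this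
  obtain yu where "u (pl yu) ~= 0" by (rule nonzero_at_p[OF u(1,2)])
  then have Q0: "Q y = 0" for y using poly_fun_no_zero_divisors[OF poly_pl[OF u(1)] pQ uQ] by simp
  have "\<exists>y0. \<beta> (pl y0) ~= 0"
  proof (rule ccontr)
    assume "\<not> ?thesis"
    then have "b = \<zero>\<^bsub>R\<^esub>" unfolding beq using germ_zero_iff[OF hb g(2,3)] by simp
    then show False using b by simp
  qed
  then obtain y0 where y0: "\<beta> (pl y0) ~= 0" by (rule exE)
  obtain G where G: "poly_fun (yvars d (N - d) t) G" "\<forall>y. A y = G y * \<beta> (pl y)"
    by (rule poly_fun_integrally_closed[OF pA pB pE Q0[unfolded Q_def] y0]) (assumption, simp)
  show "\<exists>r\<in>carrier R. a = r \<otimes>\<^bsub>R\<^esub> b"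
    unfolding aeq beq
    by (rule fraction_regular[OF ha hb g(2,3) G(1) _ y0]) (use G(2) in \<open>simp add: A_def\<close>)
qed

end

theorem plucker_image_detvar_normal:
  assumes "0 < d" "d \<le> N"
  shows "normal_variety (plucker_index d N) (plucker N ` detvar N d t)"
  unfolding normal_variety_def
proof (intro conjI ballI)
  show "quasi_projective_variety (plucker_index d N) (plucker N ` detvar N d t)"
    by (rule plucker_image_detvar_variety[OF assms])
  fix p assume p: "p \<in> plucker N ` detvar N d t"
  interpret detvar_point N d t p by (unfold_locales) (rule assms, rule assms, rule p)
  show "integrally_closed_domain (local_ring (plucker_index d N) (plucker N ` detvar N d t) p)"
    by (rule integrally_closed_R)
qed

section \<open>Stabilizers of coordinate subspaces in the general linear group\<close>

lemma mult_entry: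
  fixes A B :: "complex mat"
  assumes "A \<in> carrier_mat n k" "B \<in> carrier_mat k m" "i < n" "j < m"
  shows "(A * B) $$ (i, j) = (\<Sum>l<k. A $$ (i, l) * B $$ (l, j))"
  using assms by (auto simp: scalar_prod_def lessThan_atLeast0 intro!: sum.cong)

lemma GL_iff: "A \<in> carrier (GL N) \<longleftrightarrow> A \<in> carrier_mat N N & det A ~= 0"
proof
  assume "A \<in> carrier (GL N)"
  then have A: "A \<in> carrier_mat N N" "\<exists>B\<in>carrier_mat N N. B * A = 1\<^sub>m N"
    by (auto simp: GL_def units_of_def Units_def ring_mat_def)
  then obtain B where "B \<in> carrier_mat N N" "B * A = 1\<^sub>m N" by blast
  then have "det B * det A = 1" using det_mult[of B N A] A(1) by simp
  then show "A \<in> carrier_mat N N & det A ~= 0" using A(1) by auto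
next
  assume A: "A \<in> carrier_mat N N & det A ~= 0"
  obtain h where "h \<in> carrier_mat N N" "A * h = 1\<^sub>m N" "h * A = 1\<^sub>m N"
    by (rule det_nonzero_inverse[of A N]) (use A in auto)
  then show "A \<in> carrier (GL N)"
    using A by (auto simp: GL_def units_of_def Units_def ring_mat_def)
qed

lemma GL_mult [simp]: "A \<otimes>\<^bsub>GL N\<^esub> B = A * B"
  by (simp add: GL_def units_of_def ring_mat_def)

lemma GL_one [simp]: "\<one>\<^bsub>GL N\<^esub> = 1\<^sub>m N"
  by (simp add: GL_def units_of_def ring_mat_def)

lemma GL_group: "group (GL N)"
proof -
  interpret ring "ring_mat TYPE(complex) N ()" by (rule ring_mat)
  show ?thesis unfolding GL_def by (rule units_group)
qed

lemma one_in_GL: "1\<^sub>m N \<in> carrier (GL N)" by (simp add: GL_iff)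

lemma mult_in_GL: "A \<in> carrier (GL N) ==> B \<in> carrier (GL N) ==> A * B \<in> carrier (GL N)"
  by (auto simp: GL_iff det_mult)

lemma GL_inv:
  assumes "A \<in> carrier (GL N)"
  shows "inv\<^bsub>GL N\<^esub> A \<in> carrier (GL N)" "A * inv\<^bsub>GL N\<^esub> A = 1\<^sub>m N" "inv\<^bsub>GL N\<^esub> A * A = 1\<^sub>m N"
  using group.inv_closed[OF GL_group assms] group.r_inv[OF GL_group assms] group.l_inv[OF GL_group assms]
  by simp_all

lemma GL_inv_eqI:
  assumes "A * B = 1\<^sub>m N" "A \<in> carrier_mat N N" "B \<in> carrier_mat N N"
  shows "A \<in> carrier (GL N)" "B \<in> carrier (GL N)" "inv\<^bsub>GL N\<^esub> A = B"
proof -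
  have "det A * det B = 1" using det_mult[OF assms(2,3)] assms(1) by simp
  then show AB: "A \<in> carrier (GL N)" "B \<in> carrier (GL N)" using assms by (auto simp: GL_iff)
  show "inv\<^bsub>GL N\<^esub> A = B"
    using group.inv_equality[OF GL_group _ AB] group.inv_comm[OF GL_group _ AB] assms(1) by simp
qed

lemma GL_subgroupI:
  assumes "H \<subseteq> carrier (GL N)" "1\<^sub>m N \<in> H" "!!A B. A \<in> H ==> B \<in> H ==> A * B \<in> H"
    and "!!A. A \<in> H ==> inv\<^bsub>GL N\<^esub> A \<in> H"
  shows "subgroup H (GL N)"
  by (rule group.subgroupI[OF GL_group]) (use assms in auto)

lemma subgroup_GLD:
  assumes "subgroup H (GL N)"
  shows "H \<subseteq> carrier (GL N)" "1\<^sub>m N \<in> H" "!!A B. A \<in> H ==> B \<in> H ==> A * B \<in> H"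
    "!!A. A \<in> H ==> inv\<^bsub>GL N\<^esub> A \<in> H"
  using subgroup.subset[OF assms] subgroup.one_closed[OF assms] subgroup.m_closed[OF assms] subgroup.m_inv_closed[OF assms]
  by simp_all

text \<open>The stabilizer of the coordinate subspaces spanned by the \<open>e\<^sub>i\<close> with \<open>i \<in> T\<close>, for all \<open>T \<in> \<T>\<close>. The block
triangular and block diagonal groups and the Borel subgroups below are instances.\<close>

definition coord_stab :: "nat => nat set set => complex mat set" where
  "coord_stab N \<T> = {A \<in> carrier (GL N). \<forall>T\<in>\<T>. \<forall>i<N. \<forall>j<N. j \<in> T --> i \<notin> T --> A $$ (i, j) = 0}"

text \<open>If \<open>A\<close> maps a coordinate subspace into itself, then it maps it onto itself for reasons of
  dimension: the inclusion \<open>P\<close> of the subspace satisfies \<open>A P = P C\<close>, and the square matrix \<open>C\<close> is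
  injective, hence invertible.\<close>

lemma inverse_preserves_coordinate_subspace:
  fixes A A' :: "complex mat"
  assumes A: "A \<in> carrier_mat N N" "A' \<in> carrier_mat N N" "A' * A = 1\<^sub>m N"
    and z: "!!i j. i < N ==> j < N ==> j \<in> T ==> i \<notin> T ==> A $$ (i, j) = 0"
    and ij: "i < N" "j < N" "j \<in> T" "i \<notin> T"
  shows "A' $$ (i, j) = 0"
proof -
  define r where "r = card (T \<inter> {..<N})"
  have "finite (T \<inter> {..<N})" by simp
  from ex_bij_betw_nat_finite[OF this] obtain f where f: "bij_betw f {..<r} (T \<inter> {..<N})"
    unfolding r_def lessThan_atLeast0[of "card _"] by (rule exE)
  have fN: "f l < N" "f l \<in> T" if "l < r" for l using bij_betwE[OF f] that by auto
  have fE: thesis if k: "k < N" "k \<in> T" and e: "!!m. m < r ==> k = f m ==> thesis" for k thesis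
  proof -
    have "k \<in> f ` {..<r}" using f k by (simp add: bij_betw_def)
    then show ?thesis by (rule imageE) (rule e, simp_all)
  qed
  have finj: "f l = f m \<longleftrightarrow> l = m" if "l < r" "m < r" for l m
    using bij_betw_imp_inj_on[OF f] that by (auto simp: inj_on_def)
  define P where "P = mat N r (%(i, l). if i = f l then 1 else (0 :: complex))"
  define C where "C = mat r r (%(k, l). A $$ (f k, f l))"
  have P: "P \<in> carrier_mat N r" and C: "C \<in> carrier_mat r r" by (simp_all add: P_def C_def)
  have PX: "(P * X) $$ (f m, l) = X $$ (m, l)" if "X \<in> carrier_mat r k" "m < r" "l < k" for X k m l
  proof -
    have "(P * X) $$ (f m, l) = (\<Sum>q<r. (if q = m then X $$ (q, l) else 0))"
      unfolding mult_entry[OF P that(1) fN(1)[OF that(2)] that(3)]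
      by (rule sum.cong) (use that fN finj in \<open>auto simp: P_def\<close>)
    then show ?thesis using that by simp
  qed
  have PX0: "(P * X) $$ (i, l) = 0" if "X \<in> carrier_mat r k" "i < N" "i \<notin> T" "l < k" for X k i l
    unfolding mult_entry[OF P that(1,2,4)] using that fN by (intro sum.neutral) (auto simp: P_def)
  have XP: "(X * P) $$ (i, l) = X $$ (i, f l)" if "X \<in> carrier_mat N N" "i < N" "l < r" for X i l
  proof -
    have "(X * P) $$ (i, l) = (\<Sum>q<N. (if q = f l then X $$ (i, q) else 0))"
      unfolding mult_entry[OF that(1) P that(2,3)] by (rule sum.cong) (use that in \<open>auto simp: P_def\<close>)
    then show ?thesis using fN[OF that(3)] by simp
  qed
  have AP: "A * P = P * C"
  proof (rule eq_matI)
    fix i l assume "i < dim_row (P * C)" "l < dim_col (P * C)"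
    then have il: "i < N" "l < r" using P C by auto
    show "(A * P) $$ (i, l) = (P * C) $$ (i, l)"
    proof (cases "i \<in> T")
      case True
      obtain m where "m < r" "i = f m" by (rule fE[OF il(1) True])
      then show ?thesis using XP[OF A(1) il] PX[OF C _ il(2)] il(2) by (simp add: C_def)
    next
      case False
      then show ?thesis using XP[OF A(1) il] PX0[OF C il(1) False il(2)] z[OF il(1) fN(1) fN(2)] il(2) by simp
    qed
  qed (use A P C in auto)
  have "det C ~= 0"
  proof
    assume "det C = 0"
    then obtain v where v: "v \<in> carrier_vec r" "v ~= 0\<^sub>v r" "C *\<^sub>v v = 0\<^sub>v r"
      using det_0_iff_vec_prod_zero_field[OF C] by blast
    define V where "V = mat r 1 (%(i, _). v $ i)"
    have V: "V \<in> carrier_mat r 1" by (simp add: V_def)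
    have z1: "(0 :: nat) < 1" by simp
    have "(C * V) $$ (i, 0) = 0" if "i < r" for i
    proof -
      have "(C * V) $$ (i, 0) = (C *\<^sub>v v) $ i"
        unfolding mult_entry[OF C V that z1] using C v(1) that
        by (auto simp: V_def scalar_prod_def lessThan_atLeast0 intro!: sum.cong)
      then show ?thesis using v(3) that by simp
    qed
    then have CV: "C * V = 0\<^sub>m r 1" using C V by (intro eq_matI) auto
    have PVc: "P * V \<in> carrier_mat N 1" using P V by (rule mult_carrier_mat)
    have "P * V = A' * A * (P * V)" unfolding A(3) by (rule left_mult_one_mat[OF PVc, symmetric])
    also have "\<dots> = A' * (A * (P * V))" by (rule assoc_mult_mat[OF A(2,1) PVc])
    also have "A * (P * V) = P * C * V" unfolding AP[symmetric] by (rule assoc_mult_mat[OF A(1) P V, symmetric])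
    also have "P * C * V = P * (C * V)" by (rule assoc_mult_mat[OF P C V])
    also have "A' * (P * (C * V)) = 0\<^sub>m N 1" unfolding CV using A(2) P by simp
    finally have PV: "P * V = 0\<^sub>m N 1" .
    have "v $ m = 0" if "m < r" for m
    proof -
      have "v $ m = (P * V) $$ (f m, 0)" using PX[OF V that z1] that by (simp add: V_def)
      then show ?thesis unfolding PV using fN(1)[OF that] by simp
    qed
    then have "v = 0\<^sub>v r" using v(1) by auto
    then show False using v(2) by simp
  qed
  then obtain h where h: "h \<in> carrier_mat r r" "C * h = 1\<^sub>m r" by (rule det_nonzero_inverse[OF C])
  have "A' * P = A' * (P * (C * h))" using h(2) P by simp
  also have "P * (C * h) = A * P * h" unfolding AP by (rule assoc_mult_mat[OF P C h(1), symmetric])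
  also have "A' * (A * P * h) = P * h"
    using A P h(1) by (simp add: assoc_mult_mat[of _ N N _ r _ r] flip: assoc_mult_mat[of _ N N _ N _ r])
  finally have A'P: "A' * P = P * h" .
  obtain l where l: "l < r" "j = f l" by (rule fE[OF ij(2,3)])
  have "A' $$ (i, j) = (P * h) $$ (i, l)" using XP[OF A(2) ij(1) l(1)] l(2) A'P by simp
  then show ?thesis using PX0[OF h(1) ij(1,4) l(1)] by simp
qed

lemma coord_stab_subgroup: "subgroup (coord_stab N \<T>) (GL N)"
proof (rule GL_subgroupI)
  show "coord_stab N \<T> \<subseteq> carrier (GL N)" by (auto simp: coord_stab_def)
  show "1\<^sub>m N \<in> coord_stab N \<T>" by (auto simp: coord_stab_def one_in_GL)
  show "A * B \<in> coord_stab N \<T>" if AB: "A \<in> coord_stab N \<T>" "B \<in> coord_stab N \<T>" for A B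
  proof -
    have c: "A \<in> carrier_mat N N" "B \<in> carrier_mat N N" using AB by (auto simp: coord_stab_def GL_iff)
    have "(A * B) $$ (i, j) = 0" if T: "T \<in> \<T>" "i < N" "j < N" "j \<in> T" "i \<notin> T" for T i j
      unfolding mult_entry[OF c T(2,3)]
    proof (rule sum.neutral, rule ballI)
      fix l assume "l \<in> {..<N}"
      then show "A $$ (i, l) * B $$ (l, j) = 0" using AB T by (cases "l \<in> T") (auto simp: coord_stab_def)
    qed
    then show ?thesis using AB mult_in_GL[of A N B] by (auto simp: coord_stab_def)
  qed
  show "inv\<^bsub>GL N\<^esub> A \<in> coord_stab N \<T>" if A: "A \<in> coord_stab N \<T>" for A
  proof -
    have G: "A \<in> carrier (GL N)" using A by (simp add: coord_stab_def)
    have "(inv\<^bsub>GL N\<^esub> A) $$ (i, j) = 0" if T: "T \<in> \<T>" "i < N" "j < N" "j \<in> T" "i \<notin> T" for T i j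
      by (rule inverse_preserves_coordinate_subspace[of A N _ T])
        (use G GL_inv[OF G] A T in \<open>auto simp: GL_iff coord_stab_def\<close>)
    then show ?thesis using GL_inv(1)[OF G] by (auto simp: coord_stab_def)
  qed
qed

section \<open>Connectedness of linearly defined groups\<close>

lemma openin_GL_nonzero: "f \<in> mat_polys N ==> openin (zariski_GL N) {A \<in> carrier (GL N). f A ~= 0}"
  unfolding zariski_GL_def
  by (rule topology_generated_by_Basis, rule CollectI, rule exI[of _ f]) (rule conjI[OF refl])

lemma topspace_zariski_GL: "topspace (zariski_GL N) = carrier (GL N)"
proof -
  have "{A \<in> carrier (GL N). (1 :: complex) ~= 0} \<in> {{A \<in> carrier (GL N). f A ~= 0} | f. f \<in> mat_polys N}"
    by (rule CollectI, rule exI[of _ "%_. 1"], rule conjI[OF refl mat_polys.const])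
  then have "carrier (GL N) \<subseteq> \<Union> {{A \<in> carrier (GL N). f A ~= 0} | f. f \<in> mat_polys N}"
    by (intro Union_upper) simp
  then show ?thesis unfolding zariski_GL_def topology_generated_by_topspace by auto
qed

lemma zariski_GL_basis:
  assumes "openin (zariski_GL N) U" "A \<in> U"
  obtains f where "f \<in> mat_polys N" "f A ~= 0" "\<forall>B\<in>carrier (GL N). f B ~= 0 --> B \<in> U"
proof -
  have "generate_topology_on {{A \<in> carrier (GL N). f A ~= 0} | f. f \<in> mat_polys N} U"
    using assms(1) unfolding zariski_GL_def openin_topology_generated_by_iff .
  then have "\<forall>A\<in>U. \<exists>f\<in>mat_polys N. f A ~= 0 & (\<forall>B\<in>carrier (GL N). f B ~= 0 --> B \<in> U)"
  proof (induction rule: generate_topology_on.induct)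
    case (Int a b)
    show ?case
    proof
      fix A assume "A \<in> a \<inter> b"
      then obtain f g where f: "f \<in> mat_polys N" "f A ~= 0" "\<forall>B\<in>carrier (GL N). f B ~= 0 --> B \<in> a"
        and g: "g \<in> mat_polys N" "g A ~= 0" "\<forall>B\<in>carrier (GL N). g B ~= 0 --> B \<in> b" using Int.IH by blast
      show "\<exists>f\<in>mat_polys N. f A ~= 0 & (\<forall>B\<in>carrier (GL N). f B ~= 0 --> B \<in> a \<inter> b)"
        using mat_polys.mult[OF f(1) g(1)] f g by (intro bexI[of _ "%A. f A * g A"]) auto
    qed
  next
    case (UN K)
    show ?case
    proof
      fix A assume "A \<in> \<Union> K"
      then obtain a where a: "a \<in> K" "A \<in> a" by blast
      then obtain f where "f \<in> mat_polys N" "f A ~= 0" "\<forall>B\<in>carrier (GL N). f B ~= 0 --> B \<in> a"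
        using UN.IH[OF a(1)] by blast
      then show "\<exists>f\<in>mat_polys N. f A ~= 0 & (\<forall>B\<in>carrier (GL N). f B ~= 0 --> B \<in> \<Union> K)"
        using a(1) by (intro bexI[of _ f]) auto
    qed
  qed auto
  then show ?thesis using assms(2) that by blast
qed

definition affine_subset :: "nat => (nat \<times> nat \<times> complex) set => complex mat set" where
  "affine_subset N F = {A \<in> carrier (GL N). \<forall>(i, j, c)\<in>F. i < N --> j < N --> A $$ (i, j) = c}"

lemma affine_subsetD:
  assumes "A \<in> affine_subset N F" "(i, j, c) \<in> F" "i < N" "j < N" shows "A $$ (i, j) = c"
  using bspec[of F "%(i, j, c). i < N --> j < N --> A $$ (i, j) = c", OF _ assms(2)] assms(1,3,4)
  unfolding affine_subset_def by simp

lemma affine_subsetI: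
  assumes "A \<in> carrier (GL N)" "!!i j c. (i, j, c) \<in> F ==> i < N ==> j < N ==> A $$ (i, j) = c"
  shows "A \<in> affine_subset N F"
  unfolding affine_subset_def by (rule CollectI, rule conjI, rule assms(1), rule ballI) (clarsimp simp: assms(2))

lemma affine_subset_closed: "closedin (zariski_GL N) (affine_subset N F)"
proof -
  have "openin (zariski_GL N) {A \<in> carrier (GL N). A $$ (i, j) + (- c) ~= 0}" if "i < N" "j < N" for i j c
    using openin_GL_nonzero[OF mat_polys.add[OF mat_polys.entry[OF that] mat_polys.const[of "- c"]]] .
  then have "openin (zariski_GL N) (\<Union>(i, j, c)\<in>{(i, j, c)\<in>F. i < N & j < N}. {A \<in> carrier (GL N). A $$ (i, j) + (- c) ~= 0})"
    by (intro openin_Union) auto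
  moreover have "topspace (zariski_GL N) - affine_subset N F =
      (\<Union>(i, j, c)\<in>{(i, j, c)\<in>F. i < N & j < N}. {A \<in> carrier (GL N). A $$ (i, j) + (- c) ~= 0})"
    unfolding topspace_zariski_GL affine_subset_def by fastforce
  ultimately have op: "openin (zariski_GL N) (topspace (zariski_GL N) - affine_subset N F)" by (simp only:)
  have "affine_subset N F \<subseteq> topspace (zariski_GL N)"
    unfolding topspace_zariski_GL affine_subset_def by (rule Collect_restrict)
  then show ?thesis unfolding closedin_def using op by (rule conjI)
qed

definition mat_line :: "nat => complex mat => complex mat => complex => complex mat" where
  "mat_line N A B s = mat N N (%ij. A $$ ij + s * (B $$ ij - A $$ ij))"

lemma mat_polys_mat_line: "f \<in> mat_polys N ==> \<exists>p. \<forall>s. f (mat_line N A B s) = poly p s"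
proof (induction rule: mat_polys.induct)
  case (const c)
  show ?case by (rule exI[of _ "[:c:]"]) simp
next
  case (entry i j)
  then show ?case
    by (intro exI[of _ "[:A $$ (i, j), B $$ (i, j) - A $$ (i, j):]"]) (simp add: mat_line_def)
next
  case (add f g)
  from add.IH obtain p q where "\<forall>s. f (mat_line N A B s) = poly p s" "\<forall>s. g (mat_line N A B s) = poly q s"
    by (elim exE) (rule that)
  then show ?case by (intro exI[of _ "p + q"]) simp
next
  case (mult f g)
  from mult.IH obtain p q where "\<forall>s. f (mat_line N A B s) = poly p s" "\<forall>s. g (mat_line N A B s) = poly q s"
    by (elim exE) (rule that)
  then show ?case by (intro exI[of _ "p * q"]) simp
qed

lemma mat_polys_sum: "(!!x. x \<in> X ==> f x \<in> mat_polys N) ==> (%A. \<Sum>x\<in>X. f x A) \<in> mat_polys N"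
  by (induction X rule: infinite_finite_induct) (auto intro: mat_polys.const mat_polys.add)

lemma mat_polys_prod: "(!!x. x \<in> X ==> f x \<in> mat_polys N) ==> (%A. \<Prod>x\<in>X. f x A) \<in> mat_polys N"
  by (induction X rule: infinite_finite_induct) (auto intro: mat_polys.const mat_polys.mult)

lemma mat_polys_det:
  obtains D where "D \<in> mat_polys N" "\<forall>A\<in>carrier_mat N N. D A = det A"
proof (rule that)
  let ?D = "%A :: complex mat. \<Sum>p | p permutes {0..<N}. signof p * (\<Prod>i = 0..<N. A $$ (i, p i))"
  show "?D \<in> mat_polys N"
    by (intro mat_polys_sum mat_polys.mult mat_polys.const mat_polys_prod mat_polys.entry)
      (auto simp: permutes_in_image)
  show "\<forall>A\<in>carrier_mat N N. ?D A = det A" by (intro ballI) (simp add: det_def'[of _ N])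
qed

text \<open>Two points of a linearly defined set lie on a line. A nonzero polynomial in one variable has
  finitely many zeros, so nonempty open subsets of the set meet on that line.\<close>

lemma affine_subset_connected: "connectedin (zariski_GL N) (affine_subset N F)"
  unfolding connectedin
proof (intro conjI notI)
  show "affine_subset N F \<subseteq> topspace (zariski_GL N)"
    unfolding topspace_zariski_GL by (auto simp: affine_subset_def)
  assume "\<exists>E1 E2. openin (zariski_GL N) E1 & openin (zariski_GL N) E2 & affine_subset N F \<subseteq> E1 \<union> E2 &
    E1 \<inter> E2 \<inter> affine_subset N F = {} & E1 \<inter> affine_subset N F ~= {} & E2 \<inter> affine_subset N F ~= {}"
  then obtain E1 E2 where E: "openin (zariski_GL N) E1" "openin (zariski_GL N) E2" "E1 \<inter> E2 \<inter> affine_subset N F = {}"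
    and ne: "E1 \<inter> affine_subset N F ~= {}" "E2 \<inter> affine_subset N F ~= {}" by (elim exE conjE) (rule that)
  from ne obtain A B where A: "A \<in> E1" "A \<in> affine_subset N F" and B: "B \<in> E2" "B \<in> affine_subset N F"
    unfolding ex_in_conv[symmetric] Int_iff by (elim exE conjE) (rule that)
  obtain f where f: "f \<in> mat_polys N" "f A ~= 0" "\<forall>C\<in>carrier (GL N). f C ~= 0 --> C \<in> E1"
    by (rule zariski_GL_basis[OF E(1) A(1)])
  obtain g where g: "g \<in> mat_polys N" "g B ~= 0" "\<forall>C\<in>carrier (GL N). g C ~= 0 --> C \<in> E2"
    by (rule zariski_GL_basis[OF E(2) B(1)])
  obtain D where D: "D \<in> mat_polys N" "\<forall>A\<in>carrier_mat N N. D A = det A" by (rule mat_polys_det)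
  have c: "A \<in> carrier_mat N N" "B \<in> carrier_mat N N" "det A ~= 0"
    using A(2) B(2) unfolding affine_subset_def GL_iff by simp_all
  let ?l = "mat_line N A B"
  have l: "?l 0 = A" "?l 1 = B" "!!s. ?l s \<in> carrier_mat N N" using c by (auto simp: mat_line_def intro!: eq_matI)
  obtain p where p: "\<forall>s. f (?l s) = poly p s" using mat_polys_mat_line[OF f(1)] by blast
  obtain q where q: "\<forall>s. g (?l s) = poly q s" using mat_polys_mat_line[OF g(1)] by blast
  obtain r where r: "\<forall>s. D (?l s) = poly r s" using mat_polys_mat_line[OF D(1)] by blast
  have "poly p 0 ~= 0" "poly q 1 ~= 0" "poly r 0 ~= 0"
    using p[rule_format, of 0] q[rule_format, of 1] r[rule_format, of 0] f(2) g(2) D(2)[rule_format, OF c(1)] c(3) l by simp_all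
  then have "p * q * r ~= 0" by auto
  then have "finite {s. poly (p * q * r) s = 0}" by (rule poly_roots_finite)
  then have "{s. poly (p * q * r) s = 0} ~= UNIV" using infinite_UNIV_char_0[where 'a = complex] by metis
  then obtain s where s: "poly (p * q * r) s ~= 0" by blast
  then have nz: "poly p s ~= 0" "poly q s ~= 0" "poly r s ~= 0" by auto
  have "det (?l s) = poly r s" using D(2)[rule_format, OF l(3)[of s]] r[rule_format, of s] by simp
  then have GLs: "?l s \<in> carrier (GL N)" unfolding GL_iff using nz(3) l(3)[of s] by simp
  have "?l s \<in> E1" by (rule f(3)[rule_format, OF GLs]) (simp add: p[rule_format, of s] nz)
  moreover have "?l s \<in> E2" by (rule g(3)[rule_format, OF GLs]) (simp add: q[rule_format, of s] nz)
  moreover have "?l s \<in> affine_subset N F"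
  proof (rule affine_subsetI[OF GLs])
    fix i j c assume ijc: "(i, j, c) \<in> F" "i < N" "j < N"
    show "?l s $$ (i, j) = c"
      using affine_subsetD[OF A(2) ijc] affine_subsetD[OF B(2) ijc] ijc(2,3) by (simp add: mat_line_def)
  qed
  ultimately have "?l s \<in> E1 \<inter> E2 \<inter> affine_subset N F" by (intro IntI)
  then show False unfolding E(3) by simp
qed

lemma coord_stab_affine:
  "coord_stab N \<T> = affine_subset N {(i, j, c). c = 0 & (\<exists>T\<in>\<T>. j \<in> T & i \<notin> T)}"
proof (rule subset_antisym; rule subsetI)
  fix A assume A: "A \<in> coord_stab N \<T>"
  show "A \<in> affine_subset N {(i, j, c). c = 0 & (\<exists>T\<in>\<T>. j \<in> T & i \<notin> T)}"
    by (rule affine_subsetI) (use A in \<open>auto simp: coord_stab_def\<close>)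
next
  fix A assume A: "A \<in> affine_subset N {(i, j, c). c = 0 & (\<exists>T\<in>\<T>. j \<in> T & i \<notin> T)}"
  then have "A \<in> carrier (GL N)" unfolding affine_subset_def by simp
  moreover have "A $$ (i, j) = 0" if "T \<in> \<T>" "i < N" "j < N" "j \<in> T" "i \<notin> T" for T i j
    by (rule affine_subsetD[OF A _ that(2,3)]) (use that in auto)
  ultimately show "A \<in> coord_stab N \<T>" unfolding coord_stab_def by simp
qed

lemma coord_stab_connected: "connected_algebraic_group N (coord_stab N \<T>)"
  unfolding connected_algebraic_group_def linear_algebraic_group_def
  by (intro conjI coord_stab_subgroup) (simp_all add: coord_stab_affine affine_subset_closed affine_subset_connected)

section \<open>Unipotent radicals and Levi subgroups\<close>

definition tr :: "nat => complex mat => complex" where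
  "tr N A = (\<Sum>i<N. A $$ (i, i))"

lemma tr_mult:
  assumes "A \<in> carrier_mat N N" "B \<in> carrier_mat N N"
  shows "tr N (A * B) = (\<Sum>i<N. \<Sum>j<N. A $$ (i, j) * B $$ (j, i))"
  unfolding tr_def by (intro sum.cong refl) (simp add: mult_entry[OF assms])

lemma tr_comm:
  assumes "A \<in> carrier_mat N N" "B \<in> carrier_mat N N"
  shows "tr N (A * B) = tr N (B * A)"
  unfolding tr_mult[OF assms] tr_mult[OF assms(2,1)] by (subst sum.swap) (simp add: mult.commute)

lemma upper_triangular_power_diag:
  fixes B :: "complex mat"
  assumes B: "B \<in> carrier_mat N N" "upper_triangular B"
  shows "(\<forall>i<N. \<forall>j<i. (B ^\<^sub>m k) $$ (i, j) = 0) & (\<forall>i<N. (B ^\<^sub>m k) $$ (i, i) = (B $$ (i, i)) ^ k)"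
proof (induction k)
  case 0
  show ?case using B(1) by simp
next
  case (Suc k)
  have Bk: "B ^\<^sub>m k \<in> carrier_mat N N" by (rule pow_carrier_mat[OF B(1)])
  have B0: "B $$ (l, j) = 0" if "l < N" "j < l" for l j
    using upper_triangularD[OF B(2) that(2)] that(1) B(1) by simp
  have "(B ^\<^sub>m Suc k) $$ (i, j) = (if i = j then (B $$ (i, i)) ^ Suc k else 0)" if ij: "i < N" "j \<le> i" for i j
  proof -
    have jN: "j < N" using ij by simp
    have "(B ^\<^sub>m Suc k) $$ (i, j) = (\<Sum>l<N. (B ^\<^sub>m k) $$ (i, l) * B $$ (l, j))"
      unfolding pow_mat.simps by (rule mult_entry[OF Bk B(1) ij(1) jN])
    also have "\<dots> = (\<Sum>l<N. if l = i then (if i = j then (B $$ (i, i)) ^ Suc k else 0) else 0)"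
    proof (rule sum.cong[OF refl])
      fix l assume "l \<in> {..<N}"
      then have l: "l < N" by simp
      show "(B ^\<^sub>m k) $$ (i, l) * B $$ (l, j) = (if l = i then (if i = j then (B $$ (i, i)) ^ Suc k else 0) else 0)"
      proof (cases l i rule: linorder_cases)
        case less
        then show ?thesis using Suc.IH ij(1) by simp
      next
        case equal
        then show ?thesis using Suc.IH ij B0[of i j] by auto
      next
        case greater
        then show ?thesis using B0[of l j] ij l by simp
      qed
    qed
    finally show ?thesis using ij by simp
  qed
  note e = this
  show ?case using e by (intro conjI allI impI) (simp_all del: pow_mat.simps)
qed

lemma nilpotent_upper_triangular_diag:
  fixes B :: "complex mat"
  assumes "B \<in> carrier_mat N N" "upper_triangular B" "B ^\<^sub>m k = 0\<^sub>m N N" "i < N"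
  shows "B $$ (i, i) = 0"
proof -
  have "(B $$ (i, i)) ^ k = (B ^\<^sub>m k) $$ (i, i)" using upper_triangular_power_diag[OF assms(1,2), of k] assms(4) by simp
  then have "(B $$ (i, i)) ^ k = 0" unfolding assms(3) using assms(4) by simp
  then show ?thesis by simp
qed

text \<open>Schur triangulation: the diagonal of a nilpotent triangular matrix is zero.\<close>

lemma nilpotent_trace:
  assumes A: "A \<in> carrier_mat N N" "A ^\<^sub>m k = 0\<^sub>m N N"
  shows "tr N A = 0"
proof -
  obtain es where "char_poly A = (\<Prod>a\<leftarrow>es. [:- a, 1:])" using char_poly_factorized[OF A(1)] by blast
  then obtain B where B: "B \<in> carrier_mat N N" "upper_triangular B" "similar_mat A B"
    using schur_decomposition_exists[OF A(1)] by blast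
  obtain P Q where w: "similar_mat_wit A B P Q" using B(3) unfolding similar_mat_def by blast
  note w' = similar_mat_witD2[OF A(1) w]
  have "similar_mat_wit (A ^\<^sub>m k) (B ^\<^sub>m k) P Q" by (rule similar_mat_wit_pow[OF w])
  then have "similar_mat_wit (B ^\<^sub>m k) (0\<^sub>m N N) Q P" unfolding A(2) by (rule similar_mat_wit_sym)
  from similar_mat_witD2(3)[OF pow_carrier_mat[OF B(1)] this] have "B ^\<^sub>m k = Q * 0\<^sub>m N N * P" .
  then have Bk: "B ^\<^sub>m k = 0\<^sub>m N N" using w'(6,7) by simp
  have "tr N A = tr N (P * B * Q)" using w'(3) by simp
  also have "\<dots> = tr N (Q * (P * B))" by (rule tr_comm) (use w' in auto)
  also have "Q * (P * B) = B" using w' by (simp flip: assoc_mult_mat[of Q N N P N B N])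
  also have "tr N B = 0" unfolding tr_def
    using nilpotent_upper_triangular_diag[OF B(1,2) Bk] by (intro sum.neutral) simp
  finally show ?thesis .
qed

lemma unipotent_trace:
  assumes "unipotent N u" shows "tr N u = of_nat N"
proof -
  obtain k where u: "u \<in> carrier_mat N N" "(u - 1\<^sub>m N) ^\<^sub>m k = 0\<^sub>m N N" using assms unfolding unipotent_def by blast
  have "tr N (u - 1\<^sub>m N) = 0" by (rule nilpotent_trace[OF minus_carrier_mat[OF one_carrier_mat] u(2)])
  moreover have "tr N (u - 1\<^sub>m N) = tr N u - of_nat N"
    using u(1) by (simp add: tr_def sum_subtractf)
  ultimately show ?thesis by simp
qed

text \<open>The matrix with rows \<open>(p, q)\<close> and \<open>(r, s)\<close> in the coordinates \<open>a\<close> and \<open>b\<close>, extended by the identity.\<close>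

definition emb :: "nat => nat => nat => complex => complex => complex => complex => complex mat" where
  "emb N a b p q r s = mat N N (%(i, j).
     if i = a then (if j = a then p else if j = b then q else 0)
     else if i = b then (if j = a then r else if j = b then s else 0)
     else if i = j then 1 else 0)"

lemma emb_carrier [simp]: "emb N a b p q r s \<in> carrier_mat N N" by (simp add: emb_def)

lemma emb_mult_left:
  assumes "M \<in> carrier_mat N k" "a < N" "b < N" "a ~= b" "i < N" "j < k"
  shows "(emb N a b p q r s * M) $$ (i, j) =
    (if i = a then p * M $$ (a, j) + q * M $$ (b, j) else if i = b then r * M $$ (a, j) + s * M $$ (b, j) else M $$ (i, j))"
proof -
  have "(emb N a b p q r s * M) $$ (i, j) = (\<Sum>l<N. emb N a b p q r s $$ (i, l) * M $$ (l, j))"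
    by (rule mult_entry[OF emb_carrier assms(1,5,6)])
  also have "\<dots> = (\<Sum>l<N. (if l = a then (if i = a then p else if i = b then r else 0) * M $$ (l, j) else 0) +
      (if l = b then (if i = a then q else if i = b then s else 0) * M $$ (l, j) else 0) +
      (if l = i then (if i = a \<or> i = b then 0 else M $$ (l, j)) else 0))"
    by (rule sum.cong) (use assms in \<open>auto simp: emb_def\<close>)
  also have "\<dots> = (if i = a then p else if i = b then r else 0) * M $$ (a, j) +
      (if i = a then q else if i = b then s else 0) * M $$ (b, j) + (if i = a \<or> i = b then 0 else M $$ (i, j))"
    unfolding sum.distrib using assms by simp
  finally show ?thesis using assms by auto
qed

lemma emb_mult_right:
  assumes "M \<in> carrier_mat k N" "a < N" "b < N" "a ~= b" "i < k" "j < N"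
  shows "(M * emb N a b p q r s) $$ (i, j) =
    (if j = a then M $$ (i, a) * p + M $$ (i, b) * r else if j = b then M $$ (i, a) * q + M $$ (i, b) * s else M $$ (i, j))"
proof -
  have "(M * emb N a b p q r s) $$ (i, j) = (\<Sum>l<N. M $$ (i, l) * emb N a b p q r s $$ (l, j))"
    by (rule mult_entry[OF assms(1) emb_carrier assms(5,6)])
  also have "\<dots> = (\<Sum>l<N. (if l = a then M $$ (i, l) * (if j = a then p else if j = b then q else 0) else 0) +
      (if l = b then M $$ (i, l) * (if j = a then r else if j = b then s else 0) else 0) +
      (if l = j then (if j = a \<or> j = b then 0 else M $$ (i, l)) else 0))"
    by (rule sum.cong) (use assms in \<open>auto simp: emb_def\<close>)
  also have "\<dots> = M $$ (i, a) * (if j = a then p else if j = b then q else 0) +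
      M $$ (i, b) * (if j = a then r else if j = b then s else 0) + (if j = a \<or> j = b then 0 else M $$ (i, j))"
    unfolding sum.distrib using assms by simp
  finally show ?thesis using assms by auto
qed

lemma emb_mult:
  assumes "a < N" "b < N" "a ~= b"
  shows "emb N a b p q r s * emb N a b p' q' r' s' =
    emb N a b (p * p' + q * r') (p * q' + q * s') (r * p' + s * r') (r * q' + s * s')"
proof (rule eq_matI)
  fix i j assume "i < dim_row (emb N a b (p * p' + q * r') (p * q' + q * s') (r * p' + s * r') (r * q' + s * s'))"
    "j < dim_col (emb N a b (p * p' + q * r') (p * q' + q * s') (r * p' + s * r') (r * q' + s * s'))"
  then have ij: "i < N" "j < N" by (simp_all add: emb_def)
  show "(emb N a b p q r s * emb N a b p' q' r' s') $$ (i, j) =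
      emb N a b (p * p' + q * r') (p * q' + q * s') (r * p' + s * r') (r * q' + s * s') $$ (i, j)"
    unfolding emb_mult_left[OF emb_carrier assms ij] using assms ij by (simp add: emb_def)
qed (simp_all add: emb_def)

lemma emb_one: "emb N a b 1 0 0 1 = 1\<^sub>m N"
  by (rule eq_matI) (auto simp: emb_def)

lemma emb_GL:
  assumes "a < N" "b < N" "a ~= b" "p * s - q * r ~= 0"
  shows "emb N a b p q r s \<in> carrier (GL N)"
    "inv\<^bsub>GL N\<^esub> (emb N a b p q r s) =
       emb N a b (s / (p * s - q * r)) (- q / (p * s - q * r)) (- r / (p * s - q * r)) (p / (p * s - q * r))"
proof -
  define D where "D = p * s - q * r"
  have D0: "D ~= 0" using assms(4) by (simp add: D_def)
  have "p * (s / D) + q * (- r / D) = (p * s - q * r) / D" by (simp add: diff_divide_distrib)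
  then have 1: "p * (s / D) + q * (- r / D) = 1" unfolding D_def[symmetric] using D0 by simp
  have "r * (- q / D) + s * (p / D) = (p * s - q * r) / D" by (simp add: diff_divide_distrib mult.commute)
  then have 2: "r * (- q / D) + s * (p / D) = 1" unfolding D_def[symmetric] using D0 by simp
  have 3: "p * (- q / D) + q * (p / D) = 0" "r * (s / D) + s * (- r / D) = 0" by (simp_all add: mult.commute)
  have "emb N a b p q r s * emb N a b (s / D) (- q / D) (- r / D) (p / D) = 1\<^sub>m N"
    unfolding emb_mult[OF assms(1-3)] 1 2 3 by (rule emb_one)
  note g = GL_inv_eqI[OF this emb_carrier emb_carrier]
  show "emb N a b p q r s \<in> carrier (GL N)" by (rule g(1))
  show "inv\<^bsub>GL N\<^esub> (emb N a b p q r s) =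
      emb N a b (s / (p * s - q * r)) (- q / (p * s - q * r)) (- r / (p * s - q * r)) (p / (p * s - q * r))"
    using g(3) unfolding D_def .
qed

definition block_stab :: "nat => nat => complex mat set" where
  "block_stab N d = coord_stab N {{..<d}}"

definition block_diagonal :: "nat => nat => complex mat set" where
  "block_diagonal N d = coord_stab N {{..<d}, {d..}}"

lemma block_stab_iff:
  "A \<in> block_stab N d \<longleftrightarrow> A \<in> carrier (GL N) & (\<forall>i<N. \<forall>j<N. d \<le> i --> j < d --> A $$ (i, j) = 0)"
  unfolding block_stab_def coord_stab_def by auto

lemma block_diagonal_iff:
  "A \<in> block_diagonal N d \<longleftrightarrow> A \<in> carrier (GL N) & (\<forall>i<N. \<forall>j<N. (i < d) ~= (j < d) --> A $$ (i, j) = 0)"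
  unfolding block_diagonal_def coord_stab_def by (auto simp: not_le not_less)

lemma block_diagonal_sub: "block_diagonal N d \<subseteq> block_stab N d"
  unfolding block_diagonal_iff block_stab_iff subset_iff by auto

lemmas block_groups = coord_stab_subgroup[of N "{{..<d}}" for N d, folded block_stab_def]
  coord_stab_subgroup[of N "{{..<d}, {d..}}" for N d, folded block_diagonal_def]
  coord_stab_connected[of N "{{..<d}}" for N d, folded block_stab_def]
  coord_stab_connected[of N "{{..<d}, {d..}}" for N d, folded block_diagonal_def]

text \<open>The block diagonal part. On block upper triangular matrices it is multiplicative; its kernel is the unipotent radical and its image the
Levi part.\<close>

definition bd :: "nat => nat => complex mat => complex mat" where
  "bd N d A = mat N N (%(i, j). if (i < d) = (j < d) then A $$ (i, j) else 0)"

lemma bd_carrier [simp]: "bd N d A \<in> carrier_mat N N" by (simp add: bd_def)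

lemma bd_one: "bd N d (1\<^sub>m N) = 1\<^sub>m N" by (rule eq_matI) (auto simp: bd_def)

lemma block_stab_carrier: "A \<in> block_stab N d ==> A \<in> carrier_mat N N"
  by (simp add: block_stab_iff GL_iff)

lemma bd_mult:
  assumes "A \<in> block_stab N d" "B \<in> block_stab N d"
  shows "bd N d (A * B) = bd N d A * bd N d B"
proof (rule eq_matI)
  note c = block_stab_carrier[OF assms(1)] block_stab_carrier[OF assms(2)]
  fix i j assume "i < dim_row (bd N d A * bd N d B)" "j < dim_col (bd N d A * bd N d B)"
  then have ij: "i < N" "j < N" by (simp_all add: bd_def)
  show "bd N d (A * B) $$ (i, j) = (bd N d A * bd N d B) $$ (i, j)"
  proof (cases "(i < d) = (j < d)")
    case True
    have "(\<Sum>l<N. A $$ (i, l) * B $$ (l, j)) = (\<Sum>l<N. bd N d A $$ (i, l) * bd N d B $$ (l, j))"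
    proof (rule sum.cong[OF refl])
      fix l assume "l \<in> {..<N}"
      then show "A $$ (i, l) * B $$ (l, j) = bd N d A $$ (i, l) * bd N d B $$ (l, j)"
        using assms True ij by (cases "i < d"; cases "l < d") (auto simp: bd_def block_stab_iff)
    qed
    then show ?thesis unfolding mult_entry[OF bd_carrier bd_carrier ij] using True ij mult_entry[OF c ij] by (simp add: bd_def)
  next
    case False
    have "(\<Sum>l<N. bd N d A $$ (i, l) * bd N d B $$ (l, j)) = 0"
      by (rule sum.neutral) (use False ij in \<open>auto simp: bd_def\<close>)
    then show ?thesis unfolding mult_entry[OF bd_carrier bd_carrier ij] using False ij by (simp add: bd_def)
  qed
qed (simp_all add: bd_def)

lemma block_diagonal_bd:
  assumes "A \<in> block_stab N d"
  shows "A \<in> block_diagonal N d \<longleftrightarrow> bd N d A = A"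
proof
  have c: "A \<in> carrier_mat N N" by (rule block_stab_carrier[OF assms])
  show "bd N d A = A" if "A \<in> block_diagonal N d"
    by (rule eq_matI) (use that c in \<open>auto simp: bd_def block_diagonal_iff\<close>)
  assume e: "bd N d A = A"
  have "A $$ (i, j) = 0" if "i < N" "j < N" "(i < d) ~= (j < d)" for i j
    by (subst e[symmetric]) (use that in \<open>auto simp: bd_def\<close>)
  then show "A \<in> block_diagonal N d" using assms by (auto simp: block_diagonal_iff block_stab_iff)
qed

definition block_unipotent :: "nat => nat => complex mat set" where
  "block_unipotent N d = {A \<in> block_stab N d. bd N d A = 1\<^sub>m N}"

lemma block_unipotent_iff:
  "A \<in> block_unipotent N d \<longleftrightarrow>
    A \<in> carrier (GL N) & (\<forall>i<N. \<forall>j<N. \<not> (i < d & d \<le> j) --> A $$ (i, j) = (if i = j then 1 else 0))"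
  (is "?l \<longleftrightarrow> ?r")
proof
  assume ?l
  then have A: "A \<in> block_stab N d" "bd N d A = 1\<^sub>m N" by (auto simp: block_unipotent_def)
  have "A $$ (i, j) = (if i = j then 1 else 0)" if ij: "i < N" "j < N" "\<not> (i < d & d \<le> j)" for i j
  proof (cases "(i < d) = (j < d)")
    case True
    then have "A $$ (i, j) = bd N d A $$ (i, j)" using ij by (simp add: bd_def)
    then show ?thesis unfolding A(2) using ij by simp
  next
    case False
    then show ?thesis using A(1) ij by (auto simp: block_stab_iff)
  qed
  then show ?r using A(1) by (auto simp: block_stab_iff)
next
  assume r: ?r
  have "bd N d A = 1\<^sub>m N" by (rule eq_matI) (use r in \<open>auto simp: bd_def\<close>)
  then show ?l using r by (auto simp: block_unipotent_def block_stab_iff)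
qed

lemma block_unipotent_subgroup: "subgroup (block_unipotent N d) (GL N)"
proof (rule GL_subgroupI)
  note Q = subgroup_GLD[OF block_groups(1)[of N d]]
  show "block_unipotent N d \<subseteq> carrier (GL N)" using Q(1) by (auto simp: block_unipotent_def)
  show "1\<^sub>m N \<in> block_unipotent N d" using Q(2) by (simp add: block_unipotent_def bd_one)
  show "A * B \<in> block_unipotent N d" if "A \<in> block_unipotent N d" "B \<in> block_unipotent N d" for A B
    using that Q(3) by (simp add: block_unipotent_def bd_mult)
  show "inv\<^bsub>GL N\<^esub> A \<in> block_unipotent N d" if "A \<in> block_unipotent N d" for A
  proof -
    have A: "A \<in> block_stab N d" "bd N d A = 1\<^sub>m N" using that by (auto simp: block_unipotent_def)
    have i: "inv\<^bsub>GL N\<^esub> A \<in> block_stab N d" by (rule Q(4)[OF A(1)])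
    have AG: "A \<in> carrier (GL N)" using Q(1) A(1) by blast
    have "bd N d (A * inv\<^bsub>GL N\<^esub> A) = 1\<^sub>m N * bd N d (inv\<^bsub>GL N\<^esub> A)" unfolding bd_mult[OF A(1) i] A(2) ..
    then have "bd N d (inv\<^bsub>GL N\<^esub> A) = 1\<^sub>m N" unfolding GL_inv(2)[OF AG] bd_one left_mult_one_mat[OF bd_carrier] by (rule sym)
    then show ?thesis using i by (simp add: block_unipotent_def)
  qed
qed

lemma block_unipotent_connected: "connected_algebraic_group N (block_unipotent N d)"
proof -
  have eq: "block_unipotent N d = affine_subset N {(i, j, c). c = (if i = j then 1 else 0) & \<not> (i < d & d \<le> j)}"
    (is "_ = affine_subset N ?F")
  proof (rule subset_antisym; rule subsetI)
    fix A assume A: "A \<in> block_unipotent N d"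
    show "A \<in> affine_subset N ?F" by (rule affine_subsetI) (use A in \<open>simp_all add: block_unipotent_iff\<close>)
  next
    fix A assume A: "A \<in> affine_subset N ?F"
    then have "A \<in> carrier (GL N)" unfolding affine_subset_def by simp
    moreover have "A $$ (i, j) = (if i = j then 1 else 0)" if "i < N" "j < N" "\<not> (i < d & d \<le> j)" for i j
      by (rule affine_subsetD[OF A _ that(1,2)]) (use that in simp)
    ultimately show "A \<in> block_unipotent N d" unfolding block_unipotent_iff by simp
  qed
  have "closedin (zariski_GL N) (block_unipotent N d)" unfolding eq by (rule affine_subset_closed)
  moreover have "connectedin (zariski_GL N) (block_unipotent N d)" unfolding eq by (rule affine_subset_connected)
  ultimately show ?thesis unfolding connected_algebraic_group_def linear_algebraic_group_def
    by (intro conjI block_unipotent_subgroup)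
qed

lemma block_unipotent_unipotent:
  assumes "u \<in> block_unipotent N d" shows "unipotent N u"
proof -
  have c: "u \<in> carrier_mat N N" using assms by (simp add: block_unipotent_iff GL_iff)
  have n: "u - 1\<^sub>m N \<in> carrier_mat N N" by (rule minus_carrier_mat[OF one_carrier_mat])
  have z: "(u - 1\<^sub>m N) $$ (i, j) = 0" if "i < N" "j < N" "\<not> (i < d & d \<le> j)" for i j
    using assms c that by (simp add: block_unipotent_iff)
  have "(u - 1\<^sub>m N) * (u - 1\<^sub>m N) = 0\<^sub>m N N"
  proof (rule eq_matI)
    fix i j assume "i < dim_row (0\<^sub>m N N)" "j < dim_col (0\<^sub>m N N)"
    then have ij: "i < N" "j < N" by simp_all
    have "(\<Sum>l<N. (u - 1\<^sub>m N) $$ (i, l) * (u - 1\<^sub>m N) $$ (l, j)) = 0"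
    proof (rule sum.neutral, rule ballI)
      fix l assume "l \<in> {..<N}"
      then show "(u - 1\<^sub>m N) $$ (i, l) * (u - 1\<^sub>m N) $$ (l, j) = 0"
        using z[OF ij(1), of l] z[OF _ ij(2), of l] by (cases "l < d") auto
    qed
    then show "((u - 1\<^sub>m N) * (u - 1\<^sub>m N)) $$ (i, j) = 0\<^sub>m N N $$ (i, j)"
      unfolding mult_entry[OF n n ij] using ij by simp
  qed (use n in auto)
  then have "(u - 1\<^sub>m N) ^\<^sub>m 2 = 0\<^sub>m N N" using n by (simp add: numeral_2_eq_2)
  then show ?thesis using c unfolding unipotent_def by blast
qed

lemma GL_sub_group:
  assumes "subgroup G (GL N)"
  shows "group ((GL N)\<lparr>carrier := G\<rparr>)" "x \<in> G ==> inv\<^bsub>(GL N)\<lparr>carrier := G\<rparr>\<^esub> x = inv\<^bsub>GL N\<^esub> x"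
  using subgroup.subgroup_is_group[OF assms GL_group] group.m_inv_consistent[OF GL_group assms] by simp_all

lemma normal_in_GL_sub:
  assumes G: "subgroup G (GL N)"
  shows "normal U ((GL N)\<lparr>carrier := G\<rparr>) \<longleftrightarrow>
    subgroup U (GL N) & U \<subseteq> G & (\<forall>g\<in>G. \<forall>u\<in>U. g * u * inv\<^bsub>GL N\<^esub> g \<in> U)"
proof -
  have "subgroup U ((GL N)\<lparr>carrier := G\<rparr>) \<longleftrightarrow> subgroup U (GL N) & U \<subseteq> G"
    using group.incl_subgroup[OF GL_group G] group.subgroup_incl[OF GL_group _ G] subgroup.subset by fastforce
  then show ?thesis unfolding group.normal_inv_iff[OF GL_sub_group(1)[OF G]]
    using GL_sub_group(2)[OF G] by auto
qed

lemma block_unipotent_normal: "normal (block_unipotent N d) ((GL N)\<lparr>carrier := block_stab N d\<rparr>)"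
  unfolding normal_in_GL_sub[OF block_groups(1)]
proof (intro conjI ballI block_unipotent_subgroup)
  note Q = subgroup_GLD[OF block_groups(1)[of N d]]
  show "block_unipotent N d \<subseteq> block_stab N d" by (auto simp: block_unipotent_def)
  fix g u assume g: "g \<in> block_stab N d" and u: "u \<in> block_unipotent N d"
  have u': "u \<in> block_stab N d" "bd N d u = 1\<^sub>m N" using u by (auto simp: block_unipotent_def)
  have gG: "g \<in> carrier (GL N)" using Q(1) g by blast
  have "bd N d (g * u * inv\<^bsub>GL N\<^esub> g) = bd N d g * bd N d (inv\<^bsub>GL N\<^esub> g)"
    unfolding bd_mult[OF Q(3)[OF g u'(1)] Q(4)[OF g]] bd_mult[OF g u'(1)] u'(2) by (simp add: right_mult_one_mat[of _ N N])
  also have "\<dots> = 1\<^sub>m N" unfolding bd_mult[OF g Q(4)[OF g], symmetric] GL_inv(2)[OF gG] by (rule bd_one)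
  finally show "g * u * inv\<^bsub>GL N\<^esub> g \<in> block_unipotent N d"
    using Q(3)[OF Q(3)[OF g u'(1)] Q(4)[OF g]] by (simp add: block_unipotent_def)
qed

text \<open>If a normal unipotent subgroup contains \<open>u\<close>, and \<open>g = 1 + E\<close> with an off-diagonal matrix unit
  \<open>E\<close>, then the products of \<open>u\<close> with \<open>u\<close> and with \<open>g u g\<^sup>-\<^sup>1\<close> have the same trace, being unipotent.
  The difference of the two traces is the square of an entry of \<open>u\<close>.\<close>

lemma normal_unipotent_entry_zero:
  assumes u: "unipotent N (u * u)" "unipotent N (u * (emb N a b 1 1 0 1 * u * emb N a b 1 (- 1) 0 1))"
    "u \<in> carrier_mat N N" and ab: "a < N" "b < N" "a ~= b"
  shows "u $$ (b, a) = 0"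
proof -
  let ?g = "emb N a b 1 1 0 1" and ?h = "emb N a b 1 (- 1) 0 1"
  have c: "?g \<in> carrier_mat N N" "?h \<in> carrier_mat N N" "u * ?g \<in> carrier_mat N N" "u * ?h \<in> carrier_mat N N"
    using u(3) by (simp_all add: mult_carrier_mat[of _ N N])
  have "u * (?g * u * ?h) = u * (?g * (u * ?h))" unfolding assoc_mult_mat[OF c(1) u(3) c(2)] ..
  also have "\<dots> = (u * ?g) * (u * ?h)" by (rule assoc_mult_mat[OF u(3) c(1) c(4), symmetric])
  finally have e: "u * (?g * u * ?h) = (u * ?g) * (u * ?h)" .
  have "of_nat N = tr N ((u * ?g) * (u * ?h))" using unipotent_trace[OF u(2)] unfolding e by simp
  also have "\<dots> = (\<Sum>x<N. \<Sum>y<N. u $$ (x, y) * u $$ (y, x) + (if y = b then u $$ (x, a) * u $$ (b, x) else 0)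
      - (if x = b then u $$ (b, y) * u $$ (y, a) else 0) - (if y = b then if x = b then u $$ (b, a) * u $$ (b, a) else 0 else 0))"
    unfolding tr_mult[OF c(3,4)]
  proof (intro sum.cong refl)
    fix x y assume "x \<in> {..<N}" "y \<in> {..<N}"
    then have xy: "x < N" "y < N" by simp_all
    show "(u * ?g) $$ (x, y) * (u * ?h) $$ (y, x) =
      u $$ (x, y) * u $$ (y, x) + (if y = b then u $$ (x, a) * u $$ (b, x) else 0)
      - (if x = b then u $$ (b, y) * u $$ (y, a) else 0) - (if y = b then if x = b then u $$ (b, a) * u $$ (b, a) else 0 else 0)"
      unfolding emb_mult_right[OF u(3) ab xy] emb_mult_right[OF u(3) ab xy(2,1)]
      using ab by (auto simp: algebra_simps)
  qed
  also have "\<dots> = tr N (u * u) + (\<Sum>x<N. u $$ (x, a) * u $$ (b, x)) - (\<Sum>x<N. \<Sum>y<N. if x = b then u $$ (b, y) * u $$ (y, a) else 0)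
      - u $$ (b, a) * u $$ (b, a)"
    unfolding sum_subtractf sum.distrib tr_mult[OF u(3,3)] using ab by simp
  also have "(\<Sum>x<N. \<Sum>y<N. if x = b then u $$ (b, y) * u $$ (y, a) else 0) = (\<Sum>y<N. u $$ (b, y) * u $$ (y, a))"
    by (subst sum.swap) (use ab in simp)
  also have "\<dots> = (\<Sum>x<N. u $$ (x, a) * u $$ (b, x))" by (simp add: mult.commute)
  also have "tr N (u * u) = of_nat N" by (rule unipotent_trace[OF u(1)])
  finally show ?thesis by simp
qed

lemma normal_unipotent_sub_block_unipotent:
  assumes G: "subgroup G (GL N)" "block_diagonal N d \<subseteq> G" "G \<subseteq> block_stab N d"
    and U: "normal U ((GL N)\<lparr>carrier := G\<rparr>)" "\<forall>u\<in>U. unipotent N u"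
  shows "U \<subseteq> block_unipotent N d"
proof
  fix u assume u: "u \<in> U"
  have Usub: "subgroup U (GL N)" "U \<subseteq> G" "\<forall>g\<in>G. \<forall>u\<in>U. g * u * inv\<^bsub>GL N\<^esub> g \<in> U"
    using U(1) unfolding normal_in_GL_sub[OF G(1)] by auto
  note S = subgroup_GLD[OF Usub(1)]
  have uQ: "u \<in> block_stab N d" using u Usub(2) G(3) by blast
  have c: "u \<in> carrier_mat N N" by (rule block_stab_carrier[OF uQ])
  have off: "u $$ (b, a) = 0" if ab: "a < N" "b < N" "a ~= b" "(a < d) = (b < d)" for a b
  proof (rule normal_unipotent_entry_zero[OF _ _ c ab(1-3)])
    have g: "emb N a b 1 1 0 1 \<in> carrier (GL N)" "inv\<^bsub>GL N\<^esub> (emb N a b 1 1 0 1) = emb N a b 1 (- 1) 0 1"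
      using emb_GL[OF ab(1-3), of 1 1 1 0] by simp_all
    have "emb N a b 1 1 0 1 \<in> block_diagonal N d"
      unfolding block_diagonal_iff using g(1) ab by (auto simp: emb_def)
    then have "emb N a b 1 1 0 1 * u * emb N a b 1 (- 1) 0 1 \<in> U" using Usub(3) G(2) u g(2) by (metis subsetD)
    then show "unipotent N (u * (emb N a b 1 1 0 1 * u * emb N a b 1 (- 1) 0 1))" "unipotent N (u * u)"
      using S(3) u U(2) by blast+
  qed
  have tri: "u $$ (i, j) = 0" if "i < N" "j < i" for i j
    using off[of j i] uQ that by (cases "(j < d) = (i < d)") (auto simp: block_stab_iff)
  obtain k where k: "(u - 1\<^sub>m N) ^\<^sub>m k = 0\<^sub>m N N" using U(2) u unfolding unipotent_def by blast
  have diag: "u $$ (i, i) = 1" if i: "i < N" for i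
  proof -
    have "(u - 1\<^sub>m N) $$ (i, i) = 0"
    proof (rule nilpotent_upper_triangular_diag[OF _ _ k i])
      show "u - 1\<^sub>m N \<in> carrier_mat N N" by (rule minus_carrier_mat[OF one_carrier_mat])
      show "upper_triangular (u - 1\<^sub>m N)" using tri c by (auto simp: upper_triangular_def)
    qed
    then show ?thesis using i c by simp
  qed
  show "u \<in> block_unipotent N d" unfolding block_unipotent_iff
  proof (intro conjI allI impI)
    show "u \<in> carrier (GL N)" using uQ by (simp add: block_stab_iff)
    fix i j assume ij: "i < N" "j < N" "\<not> (i < d & d \<le> j)"
    show "u $$ (i, j) = (if i = j then 1 else 0)"
    proof (cases "(j < d) = (i < d)")
      case True
      then show ?thesis using off[of j i] diag[of i] ij by (cases "i = j") simp_all
    next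
      case False
      then have "d \<le> i" "j < d" using ij(3) by linarith+
      moreover from this have "u $$ (i, j) = 0" using uQ ij(1,2) unfolding block_stab_iff by simp
      ultimately show ?thesis by simp
    qed
  qed
qed

lemma unipotent_radical_block_stab: "unipotent_radical N (block_stab N d) = block_unipotent N d"
proof
  show "unipotent_radical N (block_stab N d) \<subseteq> block_unipotent N d"
    unfolding unipotent_radical_def
  proof (rule Union_least, elim CollectE conjE)
    fix U assume "normal U ((GL N)\<lparr>carrier := block_stab N d\<rparr>)" "\<forall>u\<in>U. unipotent N u"
    then show "U \<subseteq> block_unipotent N d"
      by (rule normal_unipotent_sub_block_unipotent[OF block_groups(1) block_diagonal_sub subset_refl])
  qed
  show "block_unipotent N d \<subseteq> unipotent_radical N (block_stab N d)"
    unfolding unipotent_radical_def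
    by (rule Union_upper, rule CollectI, intro conjI ballI block_unipotent_connected block_unipotent_normal)
      (rule block_unipotent_unipotent)
qed

lemma block_diagonal_inter_unipotent:
  assumes "A \<in> block_diagonal N d" "A \<in> block_unipotent N d" shows "A = 1\<^sub>m N"
  using assms block_diagonal_bd[of A N d] by (simp add: block_unipotent_def)

lemma block_diagonal_reductive: "connected_reductive N (block_diagonal N d)"
proof -
  have "unipotent_radical N (block_diagonal N d) \<subseteq> {1\<^sub>m N}"
  proof
    fix u assume "u \<in> unipotent_radical N (block_diagonal N d)"
    then obtain U where U: "normal U ((GL N)\<lparr>carrier := block_diagonal N d\<rparr>)" "\<forall>u\<in>U. unipotent N u" "u \<in> U"
      unfolding unipotent_radical_def by (elim UnionE CollectE conjE) (rule that)
    have "u \<in> block_unipotent N d"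
      using normal_unipotent_sub_block_unipotent[OF block_groups(2) subset_refl block_diagonal_sub U(1,2)] U(3) by blast
    moreover have "u \<in> block_diagonal N d" using U(1,3) unfolding normal_in_GL_sub[OF block_groups(2)] by blast
    ultimately show "u \<in> {1\<^sub>m N}" using block_diagonal_inter_unipotent by blast
  qed
  moreover have "1\<^sub>m N \<in> unipotent_radical N (block_diagonal N d)"
  proof -
    have s: "subgroup {1\<^sub>m N} (GL N)" using group.triv_subgroup[OF GL_group, of N] by simp
    have eq: "{1\<^sub>m N} = affine_subset N {(i, j, c). c = (if i = j then 1 else 0)}" (is "_ = affine_subset N ?F")
    proof (rule subset_antisym; rule subsetI)
      fix A :: "complex mat" assume "A \<in> {1\<^sub>m N}"
      then show "A \<in> affine_subset N ?F" by (intro affine_subsetI) (simp_all add: one_in_GL)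
    next
      fix A assume A: "A \<in> affine_subset N ?F"
      then have c: "A \<in> carrier_mat N N" unfolding affine_subset_def GL_iff by simp
      have "A $$ (i, j) = (if i = j then 1 else 0)" if "i < N" "j < N" for i j
        by (rule affine_subsetD[OF A _ that]) simp
      then have "A = 1\<^sub>m N" using c by (intro eq_matI) auto
      then show "A \<in> {1\<^sub>m N}" by simp
    qed
    have "closedin (zariski_GL N) {1\<^sub>m N}" unfolding eq by (rule affine_subset_closed)
    moreover have "connectedin (zariski_GL N) {1\<^sub>m N}" unfolding eq by (rule affine_subset_connected)
    ultimately have "connected_algebraic_group N {1\<^sub>m N}"
      unfolding connected_algebraic_group_def linear_algebraic_group_def by (intro conjI s)
    moreover have "normal {1\<^sub>m N} ((GL N)\<lparr>carrier := block_diagonal N d\<rparr>)"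
      unfolding normal_in_GL_sub[OF block_groups(2)]
    proof (intro conjI s ballI)
      note L = subgroup_GLD[OF block_groups(2)[of N d]]
      show "{1\<^sub>m N} \<subseteq> block_diagonal N d" using L(2) by simp
      fix g u :: "complex mat" assume "g \<in> block_diagonal N d" "u \<in> {1\<^sub>m N}"
      then have g: "g \<in> carrier (GL N)" "u = 1\<^sub>m N" using L(1) by auto
      then have "g \<in> carrier_mat N N" by (simp add: GL_iff)
      then show "g * u * inv\<^bsub>GL N\<^esub> g \<in> {1\<^sub>m N}" using GL_inv(2)[OF g(1)] g(2) by simp
    qed
    moreover have "unipotent N (1\<^sub>m N)"
      by (rule block_unipotent_unipotent[of _ N d]) (rule subgroup_GLD(2)[OF block_unipotent_subgroup])
    ultimately have "{1\<^sub>m N} \<subseteq> unipotent_radical N (block_diagonal N d)"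
      unfolding unipotent_radical_def by (intro Union_upper CollectI conjI ballI) simp_all
    then show ?thesis by simp
  qed
  ultimately show ?thesis unfolding connected_reductive_def using block_groups(4) by blast
qed

text \<open>The block diagonal part \<open>bd N d A\<close> is invertible, with inverse the block diagonal part of the inverse, and dividing by it leaves
identity blocks.\<close>

lemma block_stab_decomposition:
  assumes A: "A \<in> block_stab N d"
  shows "\<exists>l u. A = l * u & l \<in> block_diagonal N d & u \<in> block_unipotent N d"
proof -
  note Q = subgroup_GLD[OF block_groups(1)[of N d]]
  let ?A' = "inv\<^bsub>GL N\<^esub> A"
  have AG: "A \<in> carrier (GL N)" using Q(1) A by blast
  have A': "?A' \<in> block_stab N d" by (rule Q(4)[OF A])
  have e: "bd N d A * bd N d ?A' = 1\<^sub>m N" unfolding bd_mult[OF A A', symmetric] GL_inv(2)[OF AG] by (rule bd_one)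
  have e': "bd N d ?A' * bd N d A = 1\<^sub>m N" unfolding bd_mult[OF A' A, symmetric] GL_inv(3)[OF AG] by (rule bd_one)
  note g = GL_inv_eqI[OF e bd_carrier bd_carrier]
  have l: "bd N d A \<in> block_diagonal N d" "bd N d ?A' \<in> block_diagonal N d"
    using g unfolding block_diagonal_iff by (auto simp: bd_def)
  have lQ: "bd N d ?A' \<in> block_stab N d" using l(2) block_diagonal_sub by blast
  have idem: "bd N d (bd N d ?A') = bd N d ?A'" using l(2) block_diagonal_bd[OF lQ] by simp
  have "bd N d (bd N d ?A' * A) = 1\<^sub>m N" unfolding bd_mult[OF lQ A] idem by (rule e')
  then have u: "bd N d ?A' * A \<in> block_unipotent N d" using Q(3)[OF lQ A] by (simp add: block_unipotent_def)
  have "bd N d A * (bd N d ?A' * A) = (bd N d A * bd N d ?A') * A"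
    by (rule assoc_mult_mat[OF bd_carrier bd_carrier block_stab_carrier[OF A], symmetric])
  then have "A = bd N d A * (bd N d ?A' * A)" unfolding e using block_stab_carrier[OF A] by simp
  then show ?thesis using l(1) u by blast
qed

text \<open>Conjugation by the block scalar matrix \<open>t\<close> singles out the block diagonal matrices: for \<open>l\<close> in a Levi
  subgroup containing the torus, the commutator of \<open>l\<close> and \<open>t\<close> lies in this subgroup and in
  the unipotent radical, so \<open>l\<close> commutes with \<open>t\<close>.\<close>

theorem levi_part_block_stab: "levi_part N (block_stab N d) = block_diagonal N d"
  unfolding levi_part_def
proof (rule the_equality)
  note Q = subgroup_GLD[OF block_groups(1)[of N d]] and L = subgroup_GLD[OF block_groups(2)[of N d]]
  have torus: "diagonal_torus N \<subseteq> block_diagonal N d"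
    by (auto simp: diagonal_torus_def block_diagonal_iff diagonal_mat_def GL_iff)
  show "levi_subgroup N (block_stab N d) (block_diagonal N d) & diagonal_torus N \<subseteq> block_diagonal N d"
    unfolding levi_subgroup_def unipotent_radical_block_stab
  proof (intro conjI torus block_diagonal_sub)
    show "linear_algebraic_group N (block_diagonal N d)"
      using block_groups(4) unfolding connected_algebraic_group_def by blast
    have "1\<^sub>m N \<in> block_unipotent N d" by (rule subgroup_GLD(2)[OF block_unipotent_subgroup])
    then show "block_diagonal N d \<inter> block_unipotent N d = {1\<^sub>m N}"
      using block_diagonal_inter_unipotent L(2) by blast
    show "block_stab N d = {l * u |l u. l \<in> block_diagonal N d & u \<in> block_unipotent N d}" (is "_ = ?P")
    proof
      show "block_stab N d \<subseteq> ?P" using block_stab_decomposition by blast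
      have "l * u \<in> block_stab N d" if "l \<in> block_diagonal N d" "u \<in> block_unipotent N d" for l u
        by (rule Q(3)) (use that block_diagonal_sub in \<open>auto simp: block_unipotent_def\<close>)
      then show "?P \<subseteq> block_stab N d" by blast
    qed
  qed
  fix M assume "levi_subgroup N (block_stab N d) M & diagonal_torus N \<subseteq> M"
  note M' = this[unfolded levi_subgroup_def unipotent_radical_block_stab linear_algebraic_group_def]
  note M = M'[THEN conjunct1, THEN conjunct1, THEN conjunct1] M'[THEN conjunct1, THEN conjunct2, THEN conjunct1]
    M'[THEN conjunct1, THEN conjunct2, THEN conjunct2, THEN conjunct1]
    M'[THEN conjunct1, THEN conjunct2, THEN conjunct2, THEN conjunct2] M'[THEN conjunct2]
  note S = subgroup_GLD[OF M(1)]
  define f where "f = (%i. if i < d then 2 else (1 :: complex))"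
  define t where "t = mat N N (%(i, j). if i = j then f i else 0)"
  have tc: "t \<in> carrier_mat N N" by (simp add: t_def)
  have "upper_triangular t" by (auto simp: t_def upper_triangular_def)
  then have "det t = prod_list (diag_mat t)" by (rule det_upper_triangular[OF _ tc])
  also have "\<dots> ~= 0" by (auto simp: prod_list_zero_iff diag_mat_def t_def f_def)
  finally have tG: "t \<in> carrier (GL N)" using tc by (simp add: GL_iff)
  have tT: "t \<in> diagonal_torus N" using tG by (auto simp: diagonal_torus_def diagonal_mat_def t_def)
  have tl: "(t * l) $$ (i, j) = f i * l $$ (i, j)" if "l \<in> carrier_mat N N" "i < N" "j < N" for l i j
  proof -
    have "(t * l) $$ (i, j) = (\<Sum>k<N. if k = i then f i * l $$ (k, j) else 0)"
      unfolding mult_entry[OF tc that] by (rule sum.cong) (use that in \<open>auto simp: t_def\<close>)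
    then show ?thesis using that by simp
  qed
  have lt: "(l * t) $$ (i, j) = l $$ (i, j) * f j" if "l \<in> carrier_mat N N" "i < N" "j < N" for l i j
  proof -
    have "(l * t) $$ (i, j) = (\<Sum>k<N. if k = j then l $$ (i, k) * f j else 0)"
      unfolding mult_entry[OF that(1) tc that(2,3)] by (rule sum.cong) (use that in \<open>auto simp: t_def\<close>)
    then show ?thesis using that by simp
  qed
  have sub: "M \<subseteq> block_diagonal N d"
  proof
    fix l assume l: "l \<in> M"
    have lQ: "l \<in> block_stab N d" using M(2) l by blast
    have lG: "l \<in> carrier (GL N)" using S(1) l by blast
    have lc: "l \<in> carrier_mat N N" using lG by (simp add: GL_iff)
    have tM: "t \<in> M" using tT M(5) by blast
    have tQ: "t \<in> block_stab N d" using tM M(2) by blast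
    have comm: "bd N d t * bd N d l = bd N d l * bd N d t"
    proof -
      have bt: "bd N d t = t" by (rule eq_matI) (auto simp: bd_def t_def)
      show ?thesis unfolding bt
      proof (rule eq_matI)
        fix i j assume "i < dim_row (bd N d l * t)" "j < dim_col (bd N d l * t)"
        then have ij: "i < N" "j < N" by (simp_all add: bd_def t_def)
        show "(t * bd N d l) $$ (i, j) = (bd N d l * t) $$ (i, j)"
          unfolding tl[OF bd_carrier ij] lt[OF bd_carrier ij] using ij by (auto simp: bd_def f_def)
      qed (simp_all add: bd_def t_def)
    qed
    let ?x = "t * l * inv\<^bsub>GL N\<^esub> (l * t)"
    have ltM: "l * t \<in> M" "t * l \<in> M" using S(3) l tM by simp_all
    have xM: "?x \<in> M" by (rule S(3)[OF ltM(2) S(4)[OF ltM(1)]])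
    have ltQ: "l * t \<in> block_stab N d" "t * l \<in> block_stab N d" "inv\<^bsub>GL N\<^esub> (l * t) \<in> block_stab N d"
      using ltM S(4) M(2) by blast+
    have ltG: "l * t \<in> carrier (GL N)" using ltM(1) S(1) by blast
    have "bd N d ?x = bd N d (t * l) * bd N d (inv\<^bsub>GL N\<^esub> (l * t))" by (rule bd_mult[OF ltQ(2,3)])
    also have "bd N d (t * l) = bd N d (l * t)" unfolding bd_mult[OF tQ lQ] bd_mult[OF lQ tQ] by (rule comm)
    also have "bd N d (l * t) * bd N d (inv\<^bsub>GL N\<^esub> (l * t)) = 1\<^sub>m N"
      unfolding bd_mult[OF ltQ(1,3), symmetric] GL_inv(2)[OF ltG] by (rule bd_one)
    finally have "?x \<in> block_unipotent N d" using xM M(2) by (auto simp: block_unipotent_def)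
    then have "?x = 1\<^sub>m N" using xM M(3) by blast
    then have "?x * (l * t) = 1\<^sub>m N * (l * t)" by simp
    moreover have "?x * (l * t) = t * l * (inv\<^bsub>GL N\<^esub> (l * t) * (l * t))"
      by (rule assoc_mult_mat) (use lc tc GL_inv(1)[OF ltG] in \<open>auto simp: GL_iff\<close>)
    ultimately have "t * l = l * t" unfolding GL_inv(3)[OF ltG] using lc tc by simp
    then have fl: "f i * l $$ (i, j) = l $$ (i, j) * f j" if "i < N" "j < N" for i j
      by (simp only: tl[OF lc that, symmetric] lt[OF lc that, symmetric])
    have "l $$ (i, j) = 0" if "i < N" "j < N" "(i < d) ~= (j < d)" for i j
      using fl[OF that(1,2)] that by (cases "i < d") (simp_all add: f_def)
    then show "l \<in> block_diagonal N d" using lG by (auto simp: block_diagonal_iff)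
  qed
  moreover have "block_diagonal N d \<subseteq> M"
  proof
    fix A assume A: "A \<in> block_diagonal N d"
    then have "A \<in> block_stab N d" using block_diagonal_sub by blast
    then obtain l u where lu: "A = l * u" "l \<in> M" "u \<in> block_unipotent N d" using M(4) by blast
    have lL: "l \<in> block_diagonal N d" using sub lu(2) by blast
    have lG: "l \<in> carrier (GL N)" using S(1) lu(2) by blast
    have uc: "u \<in> carrier_mat N N" using lu(3) by (simp add: block_unipotent_iff GL_iff)
    have "inv\<^bsub>GL N\<^esub> l * A = (inv\<^bsub>GL N\<^esub> l * l) * u" unfolding lu(1)
      by (rule assoc_mult_mat[symmetric]) (use lG GL_inv(1)[OF lG] uc in \<open>auto simp: GL_iff\<close>)
    then have "u = inv\<^bsub>GL N\<^esub> l * A" unfolding GL_inv(3)[OF lG] using uc by simp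
    then have "u \<in> block_diagonal N d" using L(3)[OF L(4)[OF lL] A] by simp
    then have "u = 1\<^sub>m N" using lu(3) by (rule block_diagonal_inter_unipotent)
    then have "A = l" using lu(1) lG right_mult_one_mat[of l N N] by (simp add: GL_iff)
    then show "A \<in> M" using lu(2) by simp
  qed
  ultimately show "M = block_diagonal N d" by (rule subset_antisym)
qed

section \<open>A Borel subgroup\<close>

definition block_borel :: "nat => nat => complex mat set" where
  "block_borel N d = coord_stab N (insert {d..} (range lessThan))"

lemma block_borel_iff:
  "A \<in> block_borel N d \<longleftrightarrow> A \<in> carrier (GL N) &
    (\<forall>i<N. \<forall>j<N. j < i \<or> i < d & d \<le> j --> A $$ (i, j) = 0)" (is "_ \<longleftrightarrow> ?r")
proof
  assume "A \<in> block_borel N d"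
  then have A: "A \<in> carrier (GL N)" and z: "!!T i j. T \<in> insert {d..} (range lessThan) ==> i < N ==> j < N ==>
      j \<in> T ==> i \<notin> T ==> A $$ (i, j) = 0"
    unfolding block_borel_def coord_stab_def by blast+
  show ?r
  proof (intro conjI A allI impI)
    fix i j assume ij: "i < N" "j < N" "j < i \<or> i < d & d \<le> j"
    show "A $$ (i, j) = 0"
      using ij(3) z[of "{..<Suc j}", OF _ ij(1,2)] z[of "{d..}", OF _ ij(1,2)] by auto
  qed
next
  assume r: ?r
  show "A \<in> block_borel N d"
    unfolding block_borel_def coord_stab_def
  proof (intro CollectI conjI ballI allI impI)
    show "A \<in> carrier (GL N)" using r by blast
    fix T i j assume T: "T \<in> insert {d..} (range lessThan)" "i < N" "j < N" "j \<in> T" "i \<notin> T"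
    then have "j < i \<or> i < d & d \<le> j" by auto
    then show "A $$ (i, j) = 0" using r T(2,3) by blast
  qed
qed

lemma block_borel_subgroup: "subgroup (block_borel N d) (GL N)"
  unfolding block_borel_def by (rule coord_stab_subgroup)

lemma block_borel_sub: "block_borel N d \<subseteq> block_diagonal N d"
proof
  fix A assume A: "A \<in> block_borel N d"
  have "A $$ (i, j) = 0" if "i < N" "j < N" "(i < d) ~= (j < d)" for i j
  proof -
    have "j < i \<or> i < d & d \<le> j" using that(3) by linarith
    then show ?thesis using A that(1,2) unfolding block_borel_iff by blast
  qed
  then show "A \<in> block_diagonal N d" using A unfolding block_borel_iff block_diagonal_iff by blast
qed

lemma block_borel_upper: "block_borel N d \<subseteq> upper_triangular_group N"
  unfolding block_borel_iff upper_triangular_group_def upper_triangular_def GL_iff subset_iff by auto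

lemma solvable_GL_sub:
  assumes H: "subgroup H (GL N)"
  shows "solvable ((GL N)\<lparr>carrier := H\<rparr>) \<longleftrightarrow> (\<exists>n. (derived (GL N) ^^ n) H = {1\<^sub>m N})"
proof -
  have "(derived ((GL N)\<lparr>carrier := H\<rparr>) ^^ n) H = (derived (GL N) ^^ n) H & (derived (GL N) ^^ n) H \<subseteq> H" for n
  proof (induction n)
    case (Suc n)
    then show ?case
      using group.derived_consistent[OF GL_group _ H, of "(derived (GL N) ^^ n) H"] group.derived_incl[OF GL_group _ H] by simp
  qed simp
  then show ?thesis
    unfolding group.solvable_iff_trivial_derived_seq[OF GL_sub_group(1)[OF H]] by simp
qed

text \<open>Unipotent upper triangular matrices whose nonzero entries off the diagonal have distance at least \<open>k\<close> from it.\<close>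

definition upper_level :: "nat => nat => complex mat set" where
  "upper_level N k = {A \<in> carrier (GL N). \<forall>i<N. \<forall>j<N. j < i + k --> A $$ (i, j) = (if i = j then 1 else 0)}"

lemma upper_level_mult_entry:
  assumes A: "A \<in> upper_level N (Suc k)" "B \<in> upper_level N (Suc k)" and ij: "i < N" "j < N" "j < i + Suc (Suc k)"
  shows "(A * B) $$ (i, j) = A $$ (i, j) + B $$ (i, j) - (if i = j then 1 else 0)"
proof -
  have c: "A \<in> carrier_mat N N" "B \<in> carrier_mat N N" using A by (simp_all add: upper_level_def GL_iff)
  have a: "A $$ (i, l) = (if i = l then 1 else 0)" if "l < N" "l < i + Suc k" for l
    using A(1) ij(1) that unfolding upper_level_def by blast
  have b: "B $$ (l, j) = (if l = j then 1 else 0)" if "l < N" "j < l + Suc k" for l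
    using A(2) ij(2) that unfolding upper_level_def by blast
  have "(A * B) $$ (i, j) = (\<Sum>l<N. (if l = i then B $$ (l, j) else 0) + (if l = j then A $$ (i, l) else 0)
      - (if l = i then if i = j then 1 else 0 else 0))"
    unfolding mult_entry[OF c ij(1,2)]
  proof (rule sum.cong[OF refl])
    fix l assume "l \<in> {..<N}"
    then have l: "l < N" by simp
    show "A $$ (i, l) * B $$ (l, j) = (if l = i then B $$ (l, j) else 0) + (if l = j then A $$ (i, l) else 0)
      - (if l = i then if i = j then 1 else 0 else 0)"
    proof (cases "l = i \<or> l = j")
      case True
      then show ?thesis using a[OF l] b[OF l] by auto
    next
      case False
      then have "A $$ (i, l) = 0 \<or> B $$ (l, j) = 0" using a[OF l] b[OF l] ij(3) by (cases "l < i + Suc k") auto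
      then show ?thesis using False by auto
    qed
  qed
  then show ?thesis unfolding sum_subtractf sum.distrib using ij by simp
qed

lemma upper_triangular_inverse:
  assumes "A \<in> carrier (GL N)" "!!i j. i < N ==> j < i ==> A $$ (i, j) = 0" "i < N" "j < i"
  shows "(inv\<^bsub>GL N\<^esub> A) $$ (i, j) = 0"
  by (rule inverse_preserves_coordinate_subspace[of A N _ "{..j}"])
    (use assms GL_inv[OF assms(1)] in \<open>auto simp: GL_iff\<close>)

lemma upper_level_tri:
  assumes "A \<in> upper_level N (Suc k)" "i < N" "j < i" shows "A $$ (i, j) = 0"
proof -
  have "A $$ (i, j) = (if i = j then 1 else 0)" using assms unfolding upper_level_def by (simp add: less_imp_le_nat)
  then show ?thesis using assms(3) by simp
qed

lemma upper_level_subgroup: "subgroup (upper_level N (Suc k)) (GL N)"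
proof (rule GL_subgroupI)
  show sub: "upper_level N (Suc k) \<subseteq> carrier (GL N)" unfolding upper_level_def by (rule Collect_restrict)
  show "1\<^sub>m N \<in> upper_level N (Suc k)" by (simp add: upper_level_def one_in_GL)
  show "A * B \<in> upper_level N (Suc k)" if AB: "A \<in> upper_level N (Suc k)" "B \<in> upper_level N (Suc k)" for A B
  proof -
    have "(A * B) $$ (i, j) = (if i = j then 1 else 0)" if ij: "i < N" "j < N" "j < i + Suc k" for i j
      using upper_level_mult_entry[OF AB ij(1,2)] AB ij unfolding upper_level_def by simp
    then show ?thesis using mult_in_GL[of A N B] AB sub unfolding upper_level_def by blast
  qed
  show "inv\<^bsub>GL N\<^esub> A \<in> upper_level N (Suc k)" if A: "A \<in> upper_level N (Suc k)" for A
  proof -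
    have G: "A \<in> carrier (GL N)" using A sub by blast
    let ?A = "inv\<^bsub>GL N\<^esub> A"
    have c: "A \<in> carrier_mat N N" "?A \<in> carrier_mat N N" using G GL_inv(1)[OF G] by (simp_all add: GL_iff)
    have "?A $$ (i, j) = (if i = j then 1 else 0)" if ij: "i < N" "j < N" "j < i + Suc k" for i j
    proof -
      have "(?A * A) $$ (i, j) = (\<Sum>l<N. if l = j then ?A $$ (i, l) else 0)"
        unfolding mult_entry[OF c(2,1) ij(1,2)]
      proof (rule sum.cong[OF refl])
        fix l assume "l \<in> {..<N}"
        then have l: "l < N" by simp
        have 1: "l < i ==> ?A $$ (i, l) = 0"
          by (rule upper_triangular_inverse[OF G upper_level_tri[OF A] ij(1)])
        have 2: "j < l + Suc k ==> A $$ (l, j) = (if l = j then 1 else 0)"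
          using A l ij(2) unfolding upper_level_def by blast
        show "?A $$ (i, l) * A $$ (l, j) = (if l = j then ?A $$ (i, l) else 0)"
          using 1 2 ij(3) by (cases "l < i") auto
      qed
      then show ?thesis unfolding GL_inv(3)[OF G] using ij by simp
    qed
    then show ?thesis using GL_inv(1)[OF G] unfolding upper_level_def by blast
  qed
qed

text \<open>The commutator of \<open>A\<close> and \<open>B\<close> is \<open>1 + (A B - B A) (B A)\<^sup>-\<^sup>1\<close>, and multiplication with an upper triangular
  matrix does not decrease the distance of the nonzero entries from the diagonal.\<close>

lemma commutator_in_upper_level:
  assumes G: "A \<in> carrier (GL N)" "B \<in> carrier (GL N)"
    and tri: "!!i j. i < N ==> j < i ==> A $$ (i, j) = 0" "!!i j. i < N ==> j < i ==> B $$ (i, j) = 0"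
    and comm: "!!i j. i < N ==> j < N ==> j < i + k ==> (A * B) $$ (i, j) = (B * A) $$ (i, j)"
  shows "A * B * inv\<^bsub>GL N\<^esub> A * inv\<^bsub>GL N\<^esub> B \<in> upper_level N k"
proof -
  let ?A = "inv\<^bsub>GL N\<^esub> A" and ?B = "inv\<^bsub>GL N\<^esub> B"
  have c: "A \<in> carrier_mat N N" "B \<in> carrier_mat N N" "?A \<in> carrier_mat N N" "?B \<in> carrier_mat N N"
    using G GL_inv(1)[OF G(1)] GL_inv(1)[OF G(2)] by (simp_all add: GL_iff)
  have cc: "A * B \<in> carrier_mat N N" "B * A \<in> carrier_mat N N" "?A * ?B \<in> carrier_mat N N"
    using c by (auto intro: mult_carrier_mat)
  have e1: "A * B * ?A * ?B = (A * B) * (?A * ?B)" by (rule assoc_mult_mat[OF cc(1) c(3,4)])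
  have "B * A * (?A * ?B) = B * (A * (?A * ?B))" by (rule assoc_mult_mat[OF c(2,1) cc(3)])
  also have "A * (?A * ?B) = A * ?A * ?B" by (rule assoc_mult_mat[OF c(1,3,4), symmetric])
  also have "A * ?A * ?B = ?B" unfolding GL_inv(2)[OF G(1)] by (rule left_mult_one_mat[OF c(4)])
  finally have e2: "B * A * (?A * ?B) = 1\<^sub>m N" unfolding GL_inv(2)[OF G(2)] .
  have X: "(?A * ?B) $$ (i, j) = 0" if ij: "i < N" "j < i" for i j
  proof -
    have jN: "j < N" using ij by simp
    show ?thesis unfolding mult_entry[OF c(3,4) ij(1) jN]
    proof (rule sum.neutral, rule ballI)
      fix l assume l: "l \<in> {..<N}"
      show "?A $$ (i, l) * ?B $$ (l, j) = 0"
        using upper_triangular_inverse[OF G(1) tri(1) ij(1), of l] upper_triangular_inverse[OF G(2) tri(2), of l j] ij(2) l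
        by (cases "l < i") auto
    qed
  qed
  have "(A * B * ?A * ?B) $$ (i, j) = (if i = j then 1 else 0)" if ij: "i < N" "j < N" "j < i + k" for i j
  proof -
    have "(A * B * ?A * ?B) $$ (i, j) = (B * A * (?A * ?B)) $$ (i, j)"
      unfolding e1 mult_entry[OF cc(1,3) ij(1,2)] mult_entry[OF cc(2,3) ij(1,2)]
    proof (rule sum.cong[OF refl])
      fix l assume l: "l \<in> {..<N}"
      show "(A * B) $$ (i, l) * (?A * ?B) $$ (l, j) = (B * A) $$ (i, l) * (?A * ?B) $$ (l, j)"
        using comm[OF ij(1), of l] X[of l j] l ij(3) by (cases "j < l") auto
    qed
    then show ?thesis unfolding e2 using ij by simp
  qed
  moreover have "A * B * ?A * ?B \<in> carrier (GL N)"
    by (intro mult_in_GL G GL_inv(1))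
  ultimately show ?thesis unfolding upper_level_def by blast
qed

lemma derived_sub_upper_level:
  assumes "!!A B. A \<in> H ==> B \<in> H ==> A * B * inv\<^bsub>GL N\<^esub> A * inv\<^bsub>GL N\<^esub> B \<in> upper_level N (Suc k)"
  shows "derived (GL N) H \<subseteq> upper_level N (Suc k)"
  unfolding derived_def
  by (rule group.generate_subgroup_incl[OF GL_group _ upper_level_subgroup]) (auto simp: assms)

lemma commutator_in_derived:
  assumes "A \<in> K" "B \<in> K" shows "A * B * inv\<^bsub>GL N\<^esub> A * inv\<^bsub>GL N\<^esub> B \<in> derived (GL N) K"
  unfolding derived_def by (rule generate.incl) (use assms in auto)

lemma block_borel_derived: "(derived (GL N) ^^ Suc n) (block_borel N d) \<subseteq> upper_level N (Suc n)"
proof (induction n)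
  case 0
  have G: "A \<in> carrier (GL N)" and z: "!!i j. i < N ==> j < i ==> A $$ (i, j) = 0" if "A \<in> block_borel N d" for A
    using that unfolding block_borel_iff by auto
  have diag: "(A * B) $$ (i, j) = (if i = j then A $$ (i, i) * B $$ (i, i) else 0)"
    if AB: "A \<in> block_borel N d" "B \<in> block_borel N d" and ij: "i < N" "j < N" "j < i + Suc 0" for A B i j
  proof -
    have c: "A \<in> carrier_mat N N" "B \<in> carrier_mat N N" using G[OF AB(1)] G[OF AB(2)] by (simp_all add: GL_iff)
    have "(A * B) $$ (i, j) = (\<Sum>l<N. if l = i then if i = j then A $$ (i, i) * B $$ (i, i) else 0 else 0)"
      unfolding mult_entry[OF c ij(1,2)]
    proof (rule sum.cong[OF refl])
      fix l assume "l \<in> {..<N}"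
      then have l: "l < N" by simp
      show "A $$ (i, l) * B $$ (l, j) = (if l = i then if i = j then A $$ (i, i) * B $$ (i, i) else 0 else 0)"
      proof (cases l i rule: linorder_cases)
        case less
        then show ?thesis using z[OF AB(1) ij(1) less] by simp
      next
        case equal
        then show ?thesis using z[OF AB(2) ij(1), of j] ij(3) by (cases "i = j") auto
      next
        case greater
        then show ?thesis using z[OF AB(2) l, of j] ij(3) by auto
      qed
    qed
    then show ?thesis using ij by simp
  qed
  have "derived (GL N) (block_borel N d) \<subseteq> upper_level N (Suc 0)"
  proof (rule derived_sub_upper_level)
    fix A B assume AB: "A \<in> block_borel N d" "B \<in> block_borel N d"
    show "A * B * inv\<^bsub>GL N\<^esub> A * inv\<^bsub>GL N\<^esub> B \<in> upper_level N (Suc 0)"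
    proof (rule commutator_in_upper_level[OF G[OF AB(1)] G[OF AB(2)] z[OF AB(1)] z[OF AB(2)]])
      fix i j assume ij: "i < N" "j < N" "j < i + Suc 0"
      show "(A * B) $$ (i, j) = (B * A) $$ (i, j)"
        unfolding diag[OF AB ij] diag[OF AB(2,1) ij] by (simp only: mult.commute)
    qed
  qed
  then show ?case by simp
next
  case (Suc n)
  have "derived (GL N) ((derived (GL N) ^^ Suc n) (block_borel N d)) \<subseteq> upper_level N (Suc (Suc n))"
  proof (rule derived_sub_upper_level)
    fix A B assume "A \<in> (derived (GL N) ^^ Suc n) (block_borel N d)" "B \<in> (derived (GL N) ^^ Suc n) (block_borel N d)"
    then have AB: "A \<in> upper_level N (Suc n)" "B \<in> upper_level N (Suc n)" using Suc.IH by blast+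
    then have G: "A \<in> carrier (GL N)" "B \<in> carrier (GL N)" unfolding upper_level_def by blast+
    show "A * B * inv\<^bsub>GL N\<^esub> A * inv\<^bsub>GL N\<^esub> B \<in> upper_level N (Suc (Suc n))"
    proof (rule commutator_in_upper_level[OF G upper_level_tri[OF AB(1)] upper_level_tri[OF AB(2)]])
      fix i j assume ij: "i < N" "j < N" "j < i + Suc (Suc n)"
      show "(A * B) $$ (i, j) = (B * A) $$ (i, j)"
        unfolding upper_level_mult_entry[OF AB ij] upper_level_mult_entry[OF AB(2,1) ij] by simp
    qed
  qed
  then show ?case by simp
qed

lemma block_borel_connected_solvable: "connected_solvable_group N (block_borel N d)"
  unfolding connected_solvable_group_def
proof
  show "connected_algebraic_group N (block_borel N d)" unfolding block_borel_def by (rule coord_stab_connected)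
  have "upper_level N (Suc N) \<subseteq> {1\<^sub>m N}"
  proof
    fix A assume A: "A \<in> upper_level N (Suc N)"
    then have "A \<in> carrier_mat N N" by (simp add: upper_level_def GL_iff)
    moreover have "A $$ (i, j) = (if i = j then 1 else 0)" if "i < N" "j < N" for i j
      using A that unfolding upper_level_def by simp
    ultimately have "A = 1\<^sub>m N" by (intro eq_matI) auto
    then show "A \<in> {1\<^sub>m N}" by simp
  qed
  then have "(derived (GL N) ^^ Suc N) (block_borel N d) \<subseteq> {1\<^sub>m N}" using block_borel_derived by blast
  moreover have "1\<^sub>m N \<in> (derived (GL N) ^^ Suc N) (block_borel N d)"
    by (rule subgroup_GLD(2)[OF group.exp_of_derived_is_subgroup[OF GL_group block_borel_subgroup]])
  ultimately have "(derived (GL N) ^^ Suc N) (block_borel N d) = {1\<^sub>m N}" by blast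
  then show "solvable ((GL N)\<lparr>carrier := block_borel N d\<rparr>)" unfolding solvable_GL_sub[OF block_borel_subgroup] by (rule exI)
qed

text \<open>The two root subgroups of an \<open>SL\<^sub>2\<close> contain a torus element with eigenvalues \<open>2\<close> and \<open>1/2\<close>,
  and its commutators with the root subgroups fill them. So they survive in all derived subgroups.\<close>

lemma root_subgroups_not_solvable:
  assumes H: "subgroup H (GL N)" and ab: "a < N" "b < N" "a ~= b"
    and root: "!!x. emb N a b 1 x 0 1 \<in> H" "!!x. emb N a b 1 0 x 1 \<in> H"
  shows "\<not> solvable ((GL N)\<lparr>carrier := H\<rparr>)"
proof
  assume "solvable ((GL N)\<lparr>carrier := H\<rparr>)"
  then obtain n where n: "(derived (GL N) ^^ n) H = {1\<^sub>m N}" unfolding solvable_GL_sub[OF H] by blast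
  have "\<forall>x. emb N a b 1 x 0 1 \<in> (derived (GL N) ^^ n) H & emb N a b 1 0 x 1 \<in> (derived (GL N) ^^ n) H" for n
  proof (induction n)
    case 0
    show ?case using root by simp
  next
    case (Suc n)
    let ?K = "(derived (GL N) ^^ n) H"
    have K: "subgroup ?K (GL N)" by (rule group.exp_of_derived_is_subgroup[OF GL_group H])
    note S = subgroup_GLD[OF K]
    have e: "emb N a b 1 x 0 1 \<in> ?K" and f: "emb N a b 1 0 x 1 \<in> ?K" for x using Suc.IH by blast+
    have "emb N a b 1 1 0 1 * emb N a b 1 0 1 1 * (emb N a b 1 (- 1 / 2) 0 1 * emb N a b 1 0 (- 2) 1) \<in> ?K"
      by (intro S(3) e f)
    then have h: "emb N a b 2 0 0 (1 / 2) \<in> ?K" unfolding emb_mult[OF ab] by simp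
    have hi: "inv\<^bsub>GL N\<^esub> (emb N a b 2 0 0 (1 / 2)) = emb N a b (1 / 2) 0 0 2"
      using emb_GL(2)[OF ab, of 2 "1 / 2" 0 0] by simp
    have ei: "inv\<^bsub>GL N\<^esub> (emb N a b 1 x 0 1) = emb N a b 1 (- x) 0 1" for x
      using emb_GL(2)[OF ab, of 1 1 x 0] by simp
    have fi: "inv\<^bsub>GL N\<^esub> (emb N a b 1 0 x 1) = emb N a b 1 0 (- x) 1" for x
      using emb_GL(2)[OF ab, of 1 1 0 x] by simp
    note com = commutator_in_derived[of _ ?K _ N]
    have "emb N a b 1 x 0 1 \<in> derived (GL N) ?K" for x
      using com[OF h e[of "x / 3"]] unfolding hi ei emb_mult[OF ab] by simp
    moreover have "emb N a b 1 0 x 1 \<in> derived (GL N) ?K" for x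
      using com[OF h f[of "- 4 * x / 3"]] unfolding hi fi emb_mult[OF ab] by (simp add: field_simps)
    ultimately show ?case by simp
  qed
  then have "emb N a b 1 1 0 1 = 1\<^sub>m N" using n by blast
  then have "emb N a b 1 1 0 1 $$ (a, b) = 1\<^sub>m N $$ (a, b)" by simp
  then show False using ab by (simp add: emb_def)
qed

lemma emb_in_block_borel:
  assumes "a < N" "b < N" "a ~= b" "(a < d) = (b < d)" "p * s ~= 0"
    and "q = 0 \<or> a < b" "r = 0 \<or> b < a"
  shows "emb N a b p q r s \<in> block_borel N d"
proof -
  have "p * s - q * r ~= 0" using assms by auto
  then have "emb N a b p q r s \<in> carrier (GL N)" by (rule emb_GL(1)[OF assms(1-3)])
  moreover have "emb N a b p q r s $$ (i, j) = 0" if "i < N" "j < N" "j < i \<or> i < d & d \<le> j" for i j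
    using that assms(3,4,6,7) by (auto simp: emb_def)
  ultimately show ?thesis unfolding block_borel_iff by blast
qed

text \<open>Let \<open>g\<close> be block diagonal and not upper triangular, let \<open>b\<close> be the first column with a nonzero entry below
  the diagonal and \<open>a\<close> the last row with such an entry. Row operations make this column a multiple of a unit vector,
  \<open>h\<close>. Conjugating a root element by \<open>h\<close> yields \<open>1 + e\<^sub>a \<rho>\<close> with \<open>\<rho>\<^sub>b ~= 0\<close>, and conjugating by the torus isolates the entry
  at \<open>(a, b)\<close>.\<close>

lemma over_block_borel_root_subgroups:
  assumes H: "subgroup H (GL N)" "block_borel N d \<subseteq> H" "H \<subseteq> block_diagonal N d"
    and g: "g \<in> H" "g \<notin> block_borel N d"
  obtains a b where "a < N" "b < N" "a ~= b" "\<forall>x. emb N a b 1 x 0 1 \<in> H" "\<forall>x. emb N a b 1 0 x 1 \<in> H"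
proof -
  note S = subgroup_GLD[OF H(1)]
  have gc: "g \<in> carrier_mat N N" using S(1) g(1) by (auto simp: GL_iff)
  have L0: "x $$ (i, j) = 0" if "x \<in> H" "i < N" "j < N" "(i < d) ~= (j < d)" for x i j
    using that H(3) unfolding block_diagonal_iff subset_iff by blast
  have "\<exists>j. j < N & (\<exists>i<N. j < i & g $$ (i, j) ~= 0)"
  proof (rule ccontr)
    assume n: "\<not> ?thesis"
    have "g $$ (i, j) = 0" if ij: "i < N" "j < N" "j < i \<or> i < d & d \<le> j" for i j
    proof (cases "j < i")
      case True
      then show ?thesis using n ij by blast
    next
      case False
      then have "(i < d) ~= (j < d)" using ij(3) by linarith
      then show ?thesis using L0[OF g(1) ij(1,2)] by blast
    qed
    then have "g \<in> block_borel N d" using S(1) g(1) unfolding block_borel_iff by blast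
    then show False using g(2) by blast
  qed
  from exists_least_iff[THEN iffD1, OF this] obtain b
    where bb: "(b < N & (\<exists>i<N. b < i & g $$ (i, b) ~= 0)) &
      (\<forall>m<b. \<not> (m < N & (\<exists>i<N. m < i & g $$ (i, m) ~= 0)))" by (rule exE)
  note b = bb[THEN conjunct1, THEN conjunct1] bb[THEN conjunct1, THEN conjunct2] and least = bb[THEN conjunct2]
  define I where "I = {i. i < N & b < i & g $$ (i, b) ~= 0}"
  have I: "finite I" "I ~= {}" using b(2) by (auto simp: I_def)
  define a where "a = Max I"
  have aI: "a \<in> I" unfolding a_def by (rule Max_in[OF I])
  have a: "a < N" "b < a" "g $$ (a, b) ~= 0" using aI by (simp_all add: I_def)
  have last: "g $$ (i, b) = 0" if "i < N" "a < i" for i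
  proof (rule ccontr)
    assume "g $$ (i, b) ~= 0"
    then have "i \<in> I" using that a(2) by (simp add: I_def)
    then have "i \<le> a" unfolding a_def by (rule Max_ge[OF I(1)])
    then show False using that by simp
  qed
  have first: "g $$ (i, j) = 0" if "i < N" "j < b" "j < i" for i j
    using least that b(1) by (meson less_trans)
  have same: "(a < d) = (b < d)" using L0[OF g(1) a(1) b(1)] a(3) by blast
  define u where "u = mat N N (%(i, j). if i = j then 1 else if j = a & i < a then - g $$ (i, b) / g $$ (a, b) else 0)"
  have uc: "u \<in> carrier_mat N N" by (simp add: u_def)
  have "det u = prod_list (diag_mat u)" by (rule det_upper_triangular[OF _ uc]) (auto simp: u_def upper_triangular_def)
  also have "\<dots> ~= 0" by (auto simp: prod_list_zero_iff diag_mat_def u_def)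
  finally have uG: "u \<in> carrier (GL N)" using uc by (simp add: GL_iff)
  have "u $$ (i, j) = 0" if ij: "i < N" "j < N" "j < i \<or> i < d & d \<le> j" for i j
  proof (cases "j = a & i < a")
    case True
    then have "(i < d) ~= (b < d)" using ij(3) same by auto
    then have "g $$ (i, b) = 0" by (rule L0[OF g(1) ij(1) b(1)])
    then show ?thesis using True ij by (simp add: u_def)
  next
    case False
    then show ?thesis using ij by (auto simp: u_def)
  qed
  then have uB: "u \<in> block_borel N d" using uG unfolding block_borel_iff by blast
  define h where "h = u * g"
  have hH: "h \<in> H" unfolding h_def by (rule S(3)) (use uB H(2) g(1) in auto)
  have hG: "h \<in> carrier (GL N)" using S(1) hH by blast
  let ?h = "inv\<^bsub>GL N\<^esub> h"
  have hc: "h \<in> carrier_mat N N" "?h \<in> carrier_mat N N" using hG GL_inv(1)[OF hG] by (simp_all add: GL_iff)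
  have h': "h $$ (i, j) = g $$ (i, j) + (if i < a then - g $$ (i, b) / g $$ (a, b) * g $$ (a, j) else 0)"
    if ij: "i < N" "j < N" for i j
  proof -
    have "h $$ (i, j) = (\<Sum>l<N. (if l = i then g $$ (l, j) else 0) +
        (if l = a then (if i < a then - g $$ (i, b) / g $$ (a, b) * g $$ (l, j) else 0) else 0))"
      unfolding h_def mult_entry[OF uc gc ij] by (rule sum.cong) (use ij in \<open>auto simp: u_def\<close>)
    also have "\<dots> = (\<Sum>l<N. if l = i then g $$ (l, j) else 0) +
        (\<Sum>l<N. if l = a then (if i < a then - g $$ (i, b) / g $$ (a, b) * g $$ (l, j) else 0) else 0)"
      by (rule sum.distrib)
    finally show ?thesis using ij(1) a(1) by simp
  qed
  have hb: "h $$ (i, b) = (if i = a then g $$ (a, b) else 0)" if "i < N" for i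
    unfolding h'[OF that b(1)] using a(3) last[OF that] by (cases i a rule: linorder_cases) auto
  have "\<exists>c. b < c & c < N & ?h $$ (c, b) ~= 0"
  proof (rule ccontr)
    assume n: "\<not> ?thesis"
    have "(h * ?h) $$ (b, b) = (\<Sum>l<N. h $$ (b, l) * ?h $$ (l, b))" by (rule mult_entry[OF hc b(1) b(1)])
    also have "\<dots> = 0"
    proof (rule sum.neutral, rule ballI)
      fix l assume "l \<in> {..<N}"
      then have l: "l < N" by simp
      show "h $$ (b, l) * ?h $$ (l, b) = 0"
      proof (cases l b rule: linorder_cases)
        case less
        have "l < a" using less a(2) by simp
        then have "h $$ (b, l) = 0"
          unfolding h'[OF b(1) l] using first[OF b(1) less less] first[OF a(1) less] by simp
        then show ?thesis by simp
      next
        case equal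
        then show ?thesis using hb[OF b(1)] a(2) by simp
      next
        case greater
        then show ?thesis using n l by simp
      qed
    qed
    finally show False unfolding GL_inv(2)[OF hG] using b(1) by simp
  qed
  then obtain c where c: "b < c" "c < N" "?h $$ (c, b) ~= 0" by blast
  have sc: "(b < d) = (c < d)" using L0[OF S(4)[OF hH] c(2) b(1)] c(3) by blast
  define E where "E = emb N b c 1 1 0 1"
  have EB: "E \<in> block_borel N d" unfolding E_def by (rule emb_in_block_borel) (use b c sc in auto)
  have Ec: "E \<in> carrier_mat N N" by (simp add: E_def)
  have bc: "b ~= c" and ba: "b ~= a" "a ~= b" using c a by simp_all
  define k where "k = h * E * ?h"
  have kH: "k \<in> H" unfolding k_def by (intro S(3) S(4) hH) (use EB H(2) in blast)
  have hEc: "h * E \<in> carrier_mat N N" by (rule mult_carrier_mat[OF hc(1) Ec])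
  have kc: "k \<in> carrier_mat N N" unfolding k_def by (rule mult_carrier_mat[OF hEc hc(2)])
  define \<rho> where "\<rho> = (%j. g $$ (a, b) * ?h $$ (c, j))"
  have k: "k $$ (i, j) = (if i = j then 1 else 0) + (if i = a then \<rho> j else 0)" if ij: "i < N" "j < N" for i j
  proof -
    have "k $$ (i, j) = (\<Sum>l<N. h $$ (i, l) * ?h $$ (l, j) + (if l = c then h $$ (i, b) * ?h $$ (l, j) else 0))"
      unfolding k_def mult_entry[OF hEc hc(2) ij]
    proof (rule sum.cong[OF refl])
      fix l assume "l \<in> {..<N}"
      then have l: "l < N" by simp
      show "(h * E) $$ (i, l) * ?h $$ (l, j) = h $$ (i, l) * ?h $$ (l, j) + (if l = c then h $$ (i, b) * ?h $$ (l, j) else 0)"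
        unfolding E_def emb_mult_right[OF hc(1) b(1) c(2) bc ij(1) l] using bc by (simp add: distrib_right)
    qed
    also have "\<dots> = (h * ?h) $$ (i, j) + h $$ (i, b) * ?h $$ (c, j)"
      unfolding sum.distrib mult_entry[OF hc ij] using c(2) by simp
    finally show ?thesis unfolding GL_inv(2)[OF hG] hb[OF ij(1)] using ij by (simp add: \<rho>_def)
  qed
  define t where "t = emb N b a 2 0 0 1"
  have tH: "t \<in> H" using emb_in_block_borel[OF b(1) a(1) ba(1) same[symmetric], of 2 1 0 0] H(2) unfolding t_def by auto
  have ti: "inv\<^bsub>GL N\<^esub> t = emb N b a (1 / 2) 0 0 1" unfolding t_def using emb_GL(2)[OF b(1) a(1) ba(1), of 2 1 0 0] by simp
  define k2 where "k2 = t * k * emb N b a (1 / 2) 0 0 1"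
  have k2H: "k2 \<in> H" unfolding k2_def ti[symmetric] by (intro S(3) S(4) tH kH)
  have tk: "t * k \<in> carrier_mat N N" unfolding t_def by (rule mult_carrier_mat[OF emb_carrier kc])
  have k2c: "k2 \<in> carrier_mat N N" unfolding k2_def by (rule mult_carrier_mat[OF tk emb_carrier])
  have k2: "k2 $$ (i, j) = (if i = j then 1 else 0) + (if i = a then if j = b then \<rho> j / 2 else \<rho> j else 0)"
    if ij: "i < N" "j < N" for i j
    unfolding k2_def emb_mult_right[OF tk b(1) a(1) ba(1) ij]
    using emb_mult_left[OF kc b(1) a(1) ba(1) ij(1), of _ 2 0 0 1, folded t_def] k ij a(1) b(1) ba by auto
  define x where "x = \<rho> b / 2"
  have x0: "x ~= 0" using a(3) c(3) by (simp add: x_def \<rho>_def)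
  define m where "m = emb N a b 1 x 0 1"
  have mk: "m * k2 = k"
  proof (rule eq_matI)
    fix i j assume "i < dim_row k" "j < dim_col k"
    then have ij: "i < N" "j < N" using kc by auto
    show "(m * k2) $$ (i, j) = k $$ (i, j)"
      unfolding m_def emb_mult_left[OF k2c a(1) b(1) ba(2) ij] using k2[OF ij] k2[OF a(1) ij(2)] k2[OF b(1) ij(2)] k[OF ij] k[OF a(1) ij(2)] ba
      by (auto simp: x_def)
  qed (use kc k2c in \<open>auto simp: m_def emb_def\<close>)
  have k2G: "k2 \<in> carrier (GL N)" using S(1) k2H by blast
  have k2i: "inv\<^bsub>GL N\<^esub> k2 \<in> carrier_mat N N" using GL_inv(1)[OF k2G] by (simp add: GL_iff)
  have mc: "m \<in> carrier_mat N N" by (simp add: m_def)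
  have "m = m * (k2 * inv\<^bsub>GL N\<^esub> k2)" unfolding GL_inv(2)[OF k2G] by (rule right_mult_one_mat[OF mc, symmetric])
  also have "\<dots> = k * inv\<^bsub>GL N\<^esub> k2" unfolding mk[symmetric] by (rule assoc_mult_mat[OF mc k2c k2i, symmetric])
  finally have mH: "m \<in> H" using S(3)[OF kH S(4)[OF k2H]] by simp
  have low: "emb N a b 1 y 0 1 \<in> H" for y
  proof (cases "y = 0")
    case True
    then show ?thesis using S(2) by (simp add: emb_one)
  next
    case False
    let ?t = "emb N a b (y / x) 0 0 1"
    have nz: "y / x ~= 0" using False x0 by simp
    have t: "?t \<in> H" using emb_in_block_borel[OF a(1) b(1) ba(2) same, of "y / x" 1 0 0] nz H(2) by auto
    have "?t * m * inv\<^bsub>GL N\<^esub> ?t \<in> H" by (intro S(3) S(4) t mH)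
    also have "inv\<^bsub>GL N\<^esub> ?t = emb N a b (1 / (y / x)) 0 0 1"
      using emb_GL(2)[OF a(1) b(1) ba(2), of "y / x" 1 0 0] nz by simp
    also have "?t * m * \<dots> = emb N a b 1 y 0 1"
      unfolding m_def emb_mult[OF a(1) b(1) ba(2)] using nz False x0 by simp
    finally show ?thesis .
  qed
  moreover have "emb N a b 1 0 y 1 \<in> H" for y
    using emb_in_block_borel[OF a(1) b(1) ba(2) same, of 1 1 0 y] a(2) H(2) by auto
  ultimately show ?thesis using that[OF a(1) b(1) ba(2)] by blast
qed

theorem block_borel_borel: "borel_subgroup N (block_diagonal N d) (block_borel N d)"
  unfolding borel_subgroup_def
proof (intro conjI allI impI block_borel_sub block_borel_connected_solvable)
  fix H assume H: "connected_solvable_group N H & block_borel N d \<subseteq> H & H \<subseteq> block_diagonal N d"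
  then have sub: "subgroup H (GL N)" and solv: "solvable ((GL N)\<lparr>carrier := H\<rparr>)"
    unfolding connected_solvable_group_def connected_algebraic_group_def linear_algebraic_group_def by blast+
  show "H = block_borel N d"
  proof (rule ccontr)
    assume "H ~= block_borel N d"
    then obtain g where g: "g \<in> H" "g \<notin> block_borel N d" using H by blast
    obtain a b where ab: "a < N" "b < N" "a ~= b" "\<forall>x. emb N a b 1 x 0 1 \<in> H" "\<forall>x. emb N a b 1 0 x 1 \<in> H"
      by (rule over_block_borel_root_subgroups[OF sub _ _ g]) (use H in blast)+
    have "\<not> solvable ((GL N)\<lparr>carrier := H\<rparr>)"
      by (rule root_subgroups_not_solvable[OF sub ab(1-3)]) (use ab in blast)+
    then show False using solv by blast
  qed
qed

section \<open>The open orbit\<close>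

lemma mat_act_colspan:
  assumes "A \<in> carrier_mat N N" "M \<in> carrier_mat N d"
  shows "mat_act A (colspan M) = colspan (A * M)"
proof -
  have "mat_act A (colspan M) = (%v. A *\<^sub>v (M *\<^sub>v v)) ` carrier_vec d"
    unfolding mat_act_def colspan_def image_image using assms(2) by simp
  also have "\<dots> = (%v. (A * M) *\<^sub>v v) ` carrier_vec d"
    by (rule image_cong[OF refl]) (rule assoc_mult_mat_vec[OF assms, symmetric])
  finally show ?thesis unfolding colspan_def using assms(2) by simp
qed

lemma full_col_rank_GL:
  assumes A: "A \<in> carrier (GL N)" and M: "M \<in> carrier_mat N d" "full_col_rank M"
  shows "full_col_rank (A * M)"
proof -
  have c: "A \<in> carrier_mat N N" "inv\<^bsub>GL N\<^esub> A \<in> carrier_mat N N" using A GL_inv(1)[OF A] by (simp_all add: GL_iff)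
  have AM: "A * M \<in> carrier_mat N d" by (rule mult_carrier_mat[OF c(1) M(1)])
  have "v = 0\<^sub>v d" if v: "v \<in> carrier_vec d" "(A * M) *\<^sub>v v = 0\<^sub>v N" for v
  proof -
    have Mv: "M *\<^sub>v v \<in> carrier_vec N" by (rule mult_mat_vec_carrier[OF M(1) v(1)])
    have "M *\<^sub>v v = (inv\<^bsub>GL N\<^esub> A * A) *\<^sub>v (M *\<^sub>v v)" unfolding GL_inv(3)[OF A] using Mv by simp
    also have "\<dots> = inv\<^bsub>GL N\<^esub> A *\<^sub>v (A *\<^sub>v (M *\<^sub>v v))" by (rule assoc_mult_mat_vec[OF c(2,1) Mv])
    also have "A *\<^sub>v (M *\<^sub>v v) = 0\<^sub>v N" using assoc_mult_mat_vec[OF c(1) M(1) v(1)] v(2) by simp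
    also have "inv\<^bsub>GL N\<^esub> A *\<^sub>v 0\<^sub>v N = 0\<^sub>v N" using c(2) by (intro eq_vecI) auto
    finally show ?thesis by (rule full_col_rankD[OF M(2,1) v(1)])
  qed
  then show ?thesis unfolding full_col_rank_def carrier_matD[OF AM] by blast
qed

lemma low_block_stab_mult:
  assumes A: "A \<in> block_stab N d" and M: "M \<in> carrier_mat N k" and r: "rank_le t (low d M)"
  shows "rank_le t (low d (A * M))"
proof -
  have c: "A \<in> carrier_mat N N" by (rule block_stab_carrier[OF A])
  define D where "D = mat (N - d) (N - d) (%(i, j). A $$ (d + i, d + j))"
  have D: "D \<in> carrier_mat (N - d) (N - d)" by (simp add: D_def)
  have AM: "A * M \<in> carrier_mat N k" by (rule mult_carrier_mat[OF c M])
  have "low d (A * M) = D * low d M"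
  proof (rule eq_matI)
    fix i j assume "i < dim_row (D * low d M)" "j < dim_col (D * low d M)"
    then have ij: "i < N - d" "j < k" using D low_carrier[OF M, of d] by auto
    have i: "d + i < N" "d \<le> N" using ij by auto
    have "low d (A * M) $$ (i, j) = (\<Sum>l<N. A $$ (d + i, l) * M $$ (l, j))"
      unfolding low_index[OF AM ij] by (rule mult_entry[OF c M i(1) ij(2)])
    also have "\<dots> = (\<Sum>l\<in>{d..<N}. A $$ (d + i, l) * M $$ (l, j))"
    proof (rule sum.mono_neutral_right)
      show "\<forall>l\<in>{..<N} - {d..<N}. A $$ (d + i, l) * M $$ (l, j) = 0"
        using A i(1) unfolding block_stab_iff by auto
    qed auto
    also have "\<dots> = (\<Sum>l<N - d. A $$ (d + i, d + l) * M $$ (d + l, j))"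
      by (rule sum.reindex_bij_witness[of _ "%l. d + l" "%l. l - d"]) auto
    also have "\<dots> = (D * low d M) $$ (i, j)"
      unfolding mult_entry[OF D low_carrier[OF M] ij]
      by (rule sum.cong) (use ij in \<open>auto simp: D_def low_index[OF M]\<close>)
    finally show "low d (A * M) $$ (i, j) = (D * low d M) $$ (i, j)" .
  qed (use low_carrier[OF AM, of d] low_carrier[OF M, of d] D in auto)
  then show ?thesis using rank_le_mult_left[OF low_carrier[OF M] D r] by simp
qed

lemma detvarE:
  assumes "p \<in> detvar N d t"
  obtains M where "M \<in> carrier_mat N d" "full_col_rank M" "rank_le t (low d M)" "p = colspan M"
  using assms unfolding detvar_def by (elim CollectE exE conjE) (rule that)

lemma block_stab_acts_on_detvar:
  assumes A: "A \<in> block_stab N d" and p: "p \<in> detvar N d t"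
  shows "mat_act A p \<in> detvar N d t"
proof -
  obtain M where M: "M \<in> carrier_mat N d" "full_col_rank M" "rank_le t (low d M)" "p = colspan M" by (rule detvarE[OF p])
  have c: "A \<in> carrier_mat N N" by (rule block_stab_carrier[OF A])
  have G: "A \<in> carrier (GL N)" using A unfolding block_stab_iff by blast
  show ?thesis unfolding M(4) mat_act_colspan[OF c M(1)] detvar_def
    by (intro CollectI exI[of _ "A * M"] conjI refl mult_carrier_mat[OF c M(1)] full_col_rank_GL[OF G M(1,2)]
        low_block_stab_mult[OF A M(1,3)])
qed

text \<open>The chart recovers the normalized matrix from the coordinates.\<close>

lemma plucker_inj:
  assumes "0 < d" and M: "M \<in> carrier_mat N d" "full_col_rank M" and W: "W \<in> carrier_mat N d" "full_col_rank W"
    and eq: "plucker N (colspan M) = plucker N (colspan W)"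
  shows "colspan M = colspan W"
proof -
  have "plk N d M \<in> proj_point (plk N d W)"
    using proj_point_self[of "plk N d M"] eq unfolding plucker_colspan[OF M assms(1)] plucker_colspan[OF W assms(1)] by simp
  then obtain c where c: "c ~= 0" "plk N d M = (%K. c * plk N d W K)" by (rule proj_pointE)
  obtain J where J: "J \<in> plucker_index d N" "plk N d M J ~= 0" by (rule full_col_rank_imp_plk[OF M])
  obtain M1 where M1: "M1 \<in> carrier_mat N d" "colspan M1 = colspan M" "chart N d J (plk N d M) = plk N d M J \<cdot>\<^sub>m M1"
    by (rule chart_of_plk[OF M(1), of "plk N d M" 1 J]) (simp, rule J(2), rule that)
  obtain W1 where W1: "W1 \<in> carrier_mat N d" "colspan W1 = colspan W" "chart N d J (plk N d M) = plk N d M J \<cdot>\<^sub>m W1"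
    by (rule chart_of_plk[OF W(1) c(2) J(2)])
  have e: "plk N d M J \<cdot>\<^sub>m M1 = plk N d M J \<cdot>\<^sub>m W1" using M1(3) W1(3) by simp
  have "M1 $$ (i, j) = W1 $$ (i, j)" if "i < N" "j < d" for i j
  proof -
    have "(plk N d M J \<cdot>\<^sub>m M1) $$ (i, j) = (plk N d M J \<cdot>\<^sub>m W1) $$ (i, j)" unfolding e ..
    then show ?thesis using M1(1) W1(1) that J(2) by simp
  qed
  then have "M1 = W1" using M1(1) W1(1) by (intro eq_matI) auto
  then show ?thesis using M1(2) W1(2) by simp
qed

lemma plucker_inj_on_detvar: "0 < d ==> inj_on (plucker N) (detvar N d t)"
proof (rule inj_onI)
  fix p q assume d: "0 < d" and p: "p \<in> detvar N d t" and q: "q \<in> detvar N d t" and e: "plucker N p = plucker N q"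
  obtain M where M: "M \<in> carrier_mat N d" "full_col_rank M" "rank_le t (low d M)" "p = colspan M" by (rule detvarE[OF p])
  obtain W where W: "W \<in> carrier_mat N d" "full_col_rank W" "rank_le t (low d W)" "q = colspan W" by (rule detvarE[OF q])
  show "p = q" unfolding M(4) W(4) by (rule plucker_inj[OF d M(1,2) W(1,2)]) (use e M(4) W(4) in simp)
qed

lemma det_schur_complement:
  fixes X :: "nat => nat => complex"
  assumes "X 0 0 ~= 0"
  shows "det (mat (Suc n) (Suc n) (%(i, j). X i j)) =
    X 0 0 * det (mat n n (%(i, j). X (Suc i) (Suc j) - X (Suc i) 0 * X 0 (Suc j) / X 0 0))"
proof -
  let ?X = "mat (Suc n) (Suc n) (%(i, j). X i j)"
  define U where "U = mat (Suc n) (Suc n) (%(i, j). if i = j then 1 else if i = 0 then - X 0 j / X 0 0 else 0)"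
  have c: "?X \<in> carrier_mat (Suc n) (Suc n)" "U \<in> carrier_mat (Suc n) (Suc n)" by (simp_all add: U_def)
  have "det U = prod_list (diag_mat U)" by (rule det_upper_triangular[OF _ c(2)]) (auto simp: U_def upper_triangular_def)
  also have "\<dots> = 1" unfolding prod_list_diag_prod by (rule prod.neutral) (simp add: U_def)
  finally have dU: "det ?X = det (?X * U)" using det_mult[OF c] by simp
  have XU: "(?X * U) $$ (i, j) = (if j = 0 then X i 0 else X i j - X i 0 * X 0 j / X 0 0)" if ij: "i < Suc n" "j < Suc n" for i j
  proof -
    have "(?X * U) $$ (i, j) = (\<Sum>l<Suc n. (if l = j then X i j else 0) + (if l = 0 then (if j = 0 then 0 else - X i 0 * X 0 j / X 0 0) else 0))"
      unfolding mult_entry[OF c ij] by (rule sum.cong) (use ij in \<open>auto simp: U_def\<close>)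
    also have "\<dots> = (\<Sum>l<Suc n. if l = j then X i j else 0) + (\<Sum>l<Suc n. if l = 0 then (if j = 0 then 0 else - X i 0 * X 0 j / X 0 0) else 0)"
      by (rule sum.distrib)
    also have "(\<Sum>l<Suc n. if l = j then X i j else 0) = X i j" using ij(2) by (subst sum.delta) auto
    also have "(\<Sum>l<Suc n. if l = 0 then (if j = 0 then 0 else - X i 0 * X 0 j / X 0 0) else 0) = (if j = 0 then 0 else - X i 0 * X 0 j / X 0 0)"
      by (subst sum.delta) auto
    finally show ?thesis by simp
  qed
  have XUc: "?X * U \<in> carrier_mat (Suc n) (Suc n)" by (rule mult_carrier_mat[OF c])
  have "det (?X * U) = (\<Sum>j<Suc n. (?X * U) $$ (0, j) * cofactor (?X * U) 0 j)"
    by (rule laplace_expansion_row[OF XUc]) simp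
  also have "\<dots> = (\<Sum>j<Suc n. if j = 0 then X 0 0 * cofactor (?X * U) 0 0 else 0)"
  proof (rule sum.cong[OF refl])
    fix j assume "j \<in> {..<Suc n}"
    then show "(?X * U) $$ (0, j) * cofactor (?X * U) 0 j = (if j = 0 then X 0 0 * cofactor (?X * U) 0 0 else 0)"
      using XU[of 0 j] assms by (cases "j = 0") simp_all
  qed
  also have "\<dots> = X 0 0 * cofactor (?X * U) 0 0" by (subst sum.delta) auto
  also have "cofactor (?X * U) 0 0 = det (mat_delete (?X * U) 0 0)" by (simp add: cofactor_def)
  also have "mat_delete (?X * U) 0 0 = mat n n (%(i, j). X (Suc i) (Suc j) - X (Suc i) 0 * X 0 (Suc j) / X 0 0)"
  proof (rule eq_matI)
    fix i j assume "i < dim_row (mat n n (%(i, j). X (Suc i) (Suc j) - X (Suc i) 0 * X 0 (Suc j) / X 0 0))"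
      "j < dim_col (mat n n (%(i, j). X (Suc i) (Suc j) - X (Suc i) 0 * X 0 (Suc j) / X 0 0))"
    then have ij: "i < n" "j < n" by simp_all
    have "mat_delete (?X * U) 0 0 $$ (i, j) = (?X * U) $$ (Suc i, Suc j)"
      using mat_delete_index[OF XUc, of 0 0 i j] ij by (simp add: insert_index_def)
    then show "mat_delete (?X * U) 0 0 $$ (i, j) = mat n n (%(i, j). X (Suc i) (Suc j) - X (Suc i) 0 * X 0 (Suc j) / X 0 0) $$ (i, j)"
      using XU[of "Suc i" "Suc j"] ij by simp
  qed (use c in \<open>auto simp: mat_delete_def\<close>)
  finally show ?thesis using dU by simp
qed

text \<open>Gaussian elimination without row exchanges. The first pivot is the top left entry; both hypotheses pass to its
  Schur complement.\<close>

lemma triangular_factorization: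
  fixes K :: "nat => nat => complex"
  assumes "\<forall>k\<le>t. det (mat k k (%(i, j). K i j)) ~= 0"
    and "\<forall>p<m. \<forall>q<n. det (mat (Suc t) (Suc t) (%(i, j). K (if i < t then i else p) (if j < t then j else q))) = 0"
  shows "\<exists>L R. (\<forall>p i. p < i --> L p i = 0) & (\<forall>i q. q < i --> R i q = 0) & (\<forall>i<t. L i i ~= 0 & R i i ~= (0 :: complex)) &
    (\<forall>p<m. \<forall>q<n. K p q = (\<Sum>i<t. L p i * R i q))"
  using assms
proof (induction t arbitrary: K m n)
  case 0
  have "K p q = 0" if "p < m" "q < n" for p q
    using 0(2)[rule_format, OF that] det_schur_complement[of "%_ _. K p q" 0] by (cases "K p q = 0") simp_all
  then show ?case by (intro exI[of _ "%_ _. 0"] conjI allI impI) simp_all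
next
  case (Suc t)
  define k0 where "k0 = K 0 0"
  have k0: "K 0 0 = k0" "k0 ~= 0"
  proof -
    have "det (mat (Suc 0) (Suc 0) (%(i, j). K i j)) ~= 0" using Suc.prems(1) by simp
    then have "det (mat (Suc 0) (Suc 0) (%(i, j). K i j)) ~= 0 & True" by simp
    moreover have "det (mat (Suc 0) (Suc 0) (%(i, j). K i j)) = K 0 0"
      by (subst laplace_expansion_row[of _ "Suc 0" 0]) (auto simp: cofactor_def mat_delete_def det_dim_zero)
    ultimately show "K 0 0 = k0" "k0 ~= 0" by (simp_all add: k0_def)
  qed
  define K' where "K' = (%p q. K (Suc p) (Suc q) - K (Suc p) 0 * K 0 (Suc q) / K 0 0)"
  have nz: "K 0 0 ~= 0" using k0 by simp
  have 1: "\<forall>k\<le>t. det (mat k k (%(i, j). K' i j)) ~= 0"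
  proof (intro allI impI)
    fix k assume "k \<le> t"
    then have "det (mat (Suc k) (Suc k) (%(i, j). K i j)) ~= 0" using Suc.prems(1) by simp
    then show "det (mat k k (%(i, j). K' i j)) ~= 0" unfolding det_schur_complement[of K, OF nz] K'_def by simp
  qed
  have 2: "\<forall>p<m - 1. \<forall>q<n - 1. det (mat (Suc t) (Suc t) (%(i, j). K' (if i < t then i else p) (if j < t then j else q))) = 0"
  proof (intro allI impI)
    fix p q assume pq: "p < m - 1" "q < n - 1"
    define X where "X = (%i j. K (if i < Suc t then i else Suc p) (if j < Suc t then j else Suc q))"
    have X0: "X 0 0 ~= 0" using nz by (simp add: X_def)
    have "det (mat (Suc (Suc t)) (Suc (Suc t)) (%(i, j). X i j)) = 0"
      unfolding X_def by (rule Suc.prems(2)[rule_format]) (use pq in auto)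
    then have "det (mat (Suc t) (Suc t) (%(i, j). X (Suc i) (Suc j) - X (Suc i) 0 * X 0 (Suc j) / X 0 0)) = 0"
      unfolding det_schur_complement[of X, OF X0] using X0 by simp
    moreover have "X (Suc i) (Suc j) - X (Suc i) 0 * X 0 (Suc j) / X 0 0 = K' (if i < t then i else p) (if j < t then j else q)" for i j
      by (simp add: X_def K'_def)
    ultimately show "det (mat (Suc t) (Suc t) (%(i, j). K' (if i < t then i else p) (if j < t then j else q))) = 0" by simp
  qed
  from Suc.IH[OF 1 2] obtain L R where L: "\<forall>p i. p < i --> L p i = 0" and R: "\<forall>i q. q < i --> R i q = 0"
    and LR: "\<forall>i<t. L i i ~= 0 & R i i ~= 0" and K': "\<forall>p<m - 1. \<forall>q<n - 1. K' p q = (\<Sum>i<t. L p i * R i q)"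
    by (elim exE conjE) (rule that)
  define L' where "L' = (%p i. case i of 0 => K p 0 | Suc i' => (case p of 0 => 0 | Suc p' => L p' i'))"
  define R' where "R' = (%i q. case i of 0 => K 0 q / K 0 0 | Suc i' => (case q of 0 => 0 | Suc q' => R i' q'))"
  have "K p q = (\<Sum>i<Suc t. L' p i * R' i q)" if pq: "p < m" "q < n" for p q
  proof -
    have s: "(\<Sum>i<Suc t. L' p i * R' i q) = K p 0 * K 0 q / K 0 0 + (\<Sum>i<t. L' p (Suc i) * R' (Suc i) q)"
      unfolding sum.lessThan_Suc_shift by (simp add: L'_def R'_def)
    show ?thesis
    proof (cases "p = 0 \<or> q = 0")
      case True
      then show ?thesis unfolding s using nz by (auto simp: L'_def R'_def)
    next
      case False
      then obtain p' q' where p': "p = Suc p'" "q = Suc q'" by (metis not0_implies_Suc)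
      have "K' p' q' = (\<Sum>i<t. L p' i * R i q')" using K' pq p' by simp
      then have "K p q = K p 0 * K 0 q / K 0 0 + (\<Sum>i<t. L p' i * R i q')"
        unfolding K'_def p' by (simp add: diff_eq_eq)
      then show ?thesis unfolding s using p' by (simp add: L'_def R'_def)
    qed
  qed
  moreover have "\<forall>p i. p < i --> L' p i = 0" using L by (auto simp: L'_def split: nat.split)
  moreover have "\<forall>i q. q < i --> R' i q = 0" using R by (auto simp: R'_def split: nat.split)
  moreover have "\<forall>i<Suc t. L' i i ~= 0 & R' i i ~= 0" using LR nz by (auto simp: L'_def R'_def split: nat.split)
  ultimately show ?case by (intro exI[of _ L'] exI[of _ R'] conjI allI impI) simp_all
qed

text \<open>The minor for the last \<open>k\<close> rows and the first \<open>k\<close> columns, with the rows in reverse order. In this order the upper triangular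
group of the second block acts on the lower block of a matrix by lower triangular row operations.\<close>

definition corner_minor :: "nat => nat => complex mat => complex" where
  "corner_minor N k M = det (mat k k (%(i, j). M $$ (N - 1 - i, j)))"

text \<open>Its columns are the \<open>e\<^sub>j + e\<^bsub>N-1-j\<^esub>\<close> for \<open>j < t\<close>, and the \<open>e\<^sub>j\<close> for the other \<open>j\<close>. It has corner minors equal to \<open>1\<close>, while
those of the coordinate subspace of \<open>X(w)\<close> are not defined, as its first Pluecker coordinate is zero.\<close>

definition base_mat :: "nat => nat => nat => complex mat" where
  "base_mat N d t = mat N d (%(i, j). if i = j \<or> d \<le> i & j < t & i = N - 1 - j then 1 else 0)"

lemma base_mat_carrier [simp]: "base_mat N d t \<in> carrier_mat N d" by (simp add: base_mat_def)

lemma sum_reverse_tail: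
  fixes f :: "nat => complex"
  assumes "t \<le> N" "!!l. l < N - t ==> f l = 0"
  shows "(\<Sum>l<N. f l) = (\<Sum>q<t. f (N - 1 - q))"
proof -
  have "(\<Sum>l<N. f l) = (\<Sum>l\<in>{N - t..<N}. f l)"
    by (rule sum.mono_neutral_right) (use assms in auto)
  also have "\<dots> = (\<Sum>q<t. f (N - 1 - q))"
    by (rule sum.reindex_bij_witness[of _ "%q. N - 1 - q" "%l. N - 1 - l"]) (use assms(1) in auto)
  finally show ?thesis .
qed

lemma upper_triangular_GL:
  assumes "A \<in> carrier_mat N N" "!!i j. i < N ==> j < i ==> A $$ (i, j) = 0"
  shows "A \<in> carrier (GL N) \<longleftrightarrow> (\<forall>i<N. A $$ (i, i) ~= 0)"
proof -
  have "upper_triangular A" using assms by (auto simp: upper_triangular_def)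
  then have "det A = prod_list (diag_mat A)" by (rule det_upper_triangular[OF _ assms(1)])
  also have "\<dots> = (\<Prod>i = 0..<N. A $$ (i, i))" unfolding prod_list_diag_prod carrier_matD[OF assms(1)] ..
  finally have det: "det A = (\<Prod>i = 0..<N. A $$ (i, i))" .
  have "det A ~= 0 \<longleftrightarrow> (\<forall>i<N. A $$ (i, i) ~= 0)" unfolding det by auto
  then show ?thesis unfolding GL_iff using assms(1) by blast
qed

lemma block_borel_diag:
  assumes "A \<in> block_borel N d" "i < N" shows "A $$ (i, i) ~= 0"
proof -
  have G: "A \<in> carrier (GL N)" and z: "\<forall>i<N. \<forall>j<N. j < i \<or> i < d & d \<le> j --> A $$ (i, j) = 0"
    using assms(1) unfolding block_borel_iff by simp_all
  have c: "A \<in> carrier_mat N N" using G by (simp add: GL_iff)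
  have tri: "A $$ (i, j) = 0" if "i < N" "j < i" for i j using z that by simp
  show ?thesis using upper_triangular_GL[OF c tri] G assms(2) by simp
qed

lemma block_borelI:
  assumes A: "A \<in> carrier_mat N N" and z: "!!i j. i < N ==> j < N ==> j < i \<or> i < d & d \<le> j ==> A $$ (i, j) = 0"
    and nz: "!!i. i < N ==> A $$ (i, i) ~= 0"
  shows "A \<in> block_borel N d"
proof -
  have tri: "A $$ (i, j) = 0" if "i < N" "j < i" for i j
    by (rule z[OF that(1)]) (use that in simp_all)
  have "A \<in> carrier (GL N)" using upper_triangular_GL[OF A tri] nz by simp
  then show ?thesis unfolding block_borel_iff by (intro conjI allI impI z)
qed

text \<open>With \<open>B\<close> consisting of the blocks \<open>B\<^sub>1\<close> and \<open>B\<^sub>2\<close>, multiplication with \<open>B\<^sub>1\<^sup>-\<^sup>1\<close> on the right normalizes the first block of the image of the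
base point. Its lower block becomes a product of triangular matrices, with nonzero diagonal minors.\<close>

lemma orbit_normal_form:
  assumes B: "B \<in> block_borel N d" and dt: "t < d" "d + t < N"
  obtains M where "M \<in> carrier_mat N d" "\<forall>i<d. \<forall>j<d. M $$ (i, j) = (if i = j then 1 else 0)"
    "colspan M = mat_act B (colspan (base_mat N d t))" "\<forall>k\<le>t. corner_minor N k M ~= 0"
proof -
  let ?B = "inv\<^bsub>GL N\<^esub> B" and ?P = "base_mat N d t"
  have B': "?B \<in> block_borel N d" by (rule subgroup_GLD(4)[OF block_borel_subgroup B])
  have G: "B \<in> carrier (GL N)" using B unfolding block_borel_iff by blast
  have c: "B \<in> carrier_mat N N" "?B \<in> carrier_mat N N" using G GL_inv(1)[OF G] by (simp_all add: GL_iff)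
  have z: "B $$ (i, j) = 0" "?B $$ (i, j) = 0" if "i < N" "j < N" "j < i \<or> i < d & d \<le> j" for i j
    using B B' that unfolding block_borel_iff by blast+
  have diag: "B $$ (i, i) ~= 0" "?B $$ (i, i) ~= 0" if "i < N" for i
    using block_borel_diag[OF B that] block_borel_diag[OF B' that] by blast+
  define g where "g = mat d d (%(i, j). ?B $$ (i, j))"
  have gc: "g \<in> carrier_mat d d" by (simp add: g_def)
  have "upper_triangular g" using z(2) dt by (auto simp: g_def upper_triangular_def)
  then have "det g = (\<Prod>i = 0..<d. g $$ (i, i))" using det_upper_triangular[OF _ gc] gc by (simp add: prod_list_diag_prod)
  also have "\<dots> ~= 0" using diag(2) dt by (auto simp: g_def)
  finally have dg: "det g ~= 0" .
  define P where "P = ?P * g"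
  have Pc: "P \<in> carrier_mat N d" unfolding P_def by (rule mult_carrier_mat[OF base_mat_carrier gc])
  have P: "P $$ (i, j) = (if i < d then ?B $$ (i, j) else if N - 1 - i < t then ?B $$ (N - 1 - i, j) else 0)"
    if ij: "i < N" "j < d" for i j
  proof -
    have "P $$ (i, j) = (\<Sum>l<d. if l = (if i < d then i else N - 1 - i) then
        (if i < d \<or> N - 1 - i < t then ?B $$ (l, j) else 0) else 0)"
      unfolding P_def mult_entry[OF base_mat_carrier gc ij]
    proof (rule sum.cong[OF refl])
      fix l assume "l \<in> {..<d}"
      then have "?P $$ (i, l) = (if i = l \<or> d \<le> i & l < t & i = N - 1 - l then 1 else 0)" "g $$ (l, j) = ?B $$ (l, j)"
        using ij by (simp_all add: base_mat_def g_def)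
      moreover have "(i = l \<or> d \<le> i & l < t & i = N - 1 - l) \<longleftrightarrow>
          l = (if i < d then i else N - 1 - i) & (i < d \<or> N - 1 - i < t)"
        using \<open>l \<in> {..<d}\<close> ij dt by (cases "i < d") auto
      ultimately show "?P $$ (i, l) * g $$ (l, j) = (if l = (if i < d then i else N - 1 - i) then
          (if i < d \<or> N - 1 - i < t then ?B $$ (l, j) else 0) else 0)" by simp
    qed
    also have "\<dots> = (if (if i < d then i else N - 1 - i) < d then (if i < d \<or> N - 1 - i < t then
        ?B $$ (if i < d then i else N - 1 - i, j) else 0) else 0)"
      by (subst sum.delta) simp_all
    finally show ?thesis using dt by (cases "i < d") simp_all
  qed
  define M where "M = B * P"
  have Mc: "M \<in> carrier_mat N d" unfolding M_def by (rule mult_carrier_mat[OF c(1) Pc])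
  have top: "M $$ (i, j) = (if i = j then 1 else 0)" if ij: "i < d" "j < d" for i j
  proof -
    have ijN: "i < N" "j < N" using ij dt by simp_all
    have "M $$ (i, j) = (\<Sum>l<N. B $$ (i, l) * ?B $$ (l, j))"
      unfolding M_def mult_entry[OF c(1) Pc ijN(1) ij(2)]
    proof (rule sum.cong[OF refl])
      fix l assume "l \<in> {..<N}"
      then have l: "l < N" by simp
      show "B $$ (i, l) * P $$ (l, j) = B $$ (i, l) * ?B $$ (l, j)"
        using P[OF l ij(2)] z(1)[OF ijN(1) l] ij(1) by (cases "l < d") auto
    qed
    also have "\<dots> = (B * ?B) $$ (i, j)" by (rule mult_entry[OF c ijN, symmetric])
    finally show ?thesis unfolding GL_inv(2)[OF G] using ijN by simp
  qed
  have bot: "M $$ (N - 1 - p, j) = (\<Sum>q<t. B $$ (N - 1 - p, N - 1 - q) * ?B $$ (q, j))" if p: "p < N - d" "j < d" for p j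
  proof -
    have i: "N - 1 - p < N" "d \<le> N - 1 - p" using p by auto
    have "M $$ (N - 1 - p, j) = (\<Sum>l<N. B $$ (N - 1 - p, l) * P $$ (l, j))"
      unfolding M_def by (rule mult_entry[OF c(1) Pc i(1) p(2)])
    also have "\<dots> = (\<Sum>q<t. B $$ (N - 1 - p, N - 1 - q) * P $$ (N - 1 - q, j))"
    proof (rule sum_reverse_tail)
      fix l assume l: "l < N - t"
      show "B $$ (N - 1 - p, l) * P $$ (l, j) = 0"
      proof (cases "l < d")
        case True
        then have "B $$ (N - 1 - p, l) = 0" using z(1)[OF i(1), of l] i(2) dt by simp
        then show ?thesis by simp
      next
        case False
        have "\<not> N - 1 - l < t" using l by linarith
        then show ?thesis using P[of l j] l p(2) False by simp
      qed
    qed (use dt in simp)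
    also have "\<dots> = (\<Sum>q<t. B $$ (N - 1 - p, N - 1 - q) * ?B $$ (q, j))"
    proof (rule sum.cong[OF refl])
      fix q assume "q \<in> {..<t}"
      then have q: "N - 1 - q < N" "\<not> N - 1 - q < d" "N - 1 - (N - 1 - q) = q" "q < t" using dt by auto
      show "B $$ (N - 1 - p, N - 1 - q) * P $$ (N - 1 - q, j) = B $$ (N - 1 - p, N - 1 - q) * ?B $$ (q, j)"
        unfolding P[OF q(1) p(2)] q(3) using q(2,4) by simp
    qed
    finally show ?thesis .
  qed
  have minors: "corner_minor N k M ~= 0" if k: "k \<le> t" for k
  proof -
    define X where "X = mat k k (%(i, q). B $$ (N - 1 - i, N - 1 - q))"
    define Y where "Y = mat k k (%(q, j). ?B $$ (q, j))"
    have XY: "X \<in> carrier_mat k k" "Y \<in> carrier_mat k k" by (simp_all add: X_def Y_def)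
    have "mat k k (%(i, j). M $$ (N - 1 - i, j)) = X * Y"
    proof (rule eq_matI)
      fix i j assume "i < dim_row (X * Y)" "j < dim_col (X * Y)"
      then have ij: "i < k" "j < k" using XY by auto
      have ij': "i < N - d" "j < d" using ij k dt by auto
      have "M $$ (N - 1 - i, j) = (\<Sum>q<k. B $$ (N - 1 - i, N - 1 - q) * ?B $$ (q, j))"
        unfolding bot[OF ij']
      proof (rule sum.mono_neutral_right)
        show "\<forall>q\<in>{..<t} - {..<k}. B $$ (N - 1 - i, N - 1 - q) * ?B $$ (q, j) = 0"
        proof
          fix q assume "q \<in> {..<t} - {..<k}"
          then have "N - 1 - q < N - 1 - i" "N - 1 - i < N" "N - 1 - q < N" using ij dt by auto
          then show "B $$ (N - 1 - i, N - 1 - q) * ?B $$ (q, j) = 0" using z(1)[of "N - 1 - i" "N - 1 - q"] by simp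
        qed
      qed (use k in auto)
      then show "mat k k (%(i, j). M $$ (N - 1 - i, j)) $$ (i, j) = (X * Y) $$ (i, j)"
        unfolding mult_entry[OF XY ij] using ij by (simp add: X_def Y_def)
    qed (use XY in auto)
    then have "corner_minor N k M = det X * det Y" unfolding corner_minor_def using det_mult[OF XY] by simp
    moreover have "det X ~= 0"
    proof -
      have "X $$ (i, q) = 0" if "i < q" "q < k" for i q
      proof -
        have "N - 1 - q < N - 1 - i" "N - 1 - i < N" "N - 1 - q < N" using that k dt by auto
        then show ?thesis using z(1)[of "N - 1 - i" "N - 1 - q"] that by (simp add: X_def)
      qed
      then have "det X = prod_list (diag_mat X)" using det_lower_triangular[of k X] XY(1) by blast
      then show ?thesis using diag(1) dt k XY(1) by (auto simp: prod_list_diag_prod X_def)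
    qed
    moreover have "det Y ~= 0"
    proof -
      have "upper_triangular Y" using z(2) k dt by (auto simp: Y_def upper_triangular_def)
      then have "det Y = prod_list (diag_mat Y)" by (rule det_upper_triangular[OF _ XY(2)])
      then show ?thesis using diag(2) dt k XY(2) by (auto simp: prod_list_diag_prod Y_def)
    qed
    ultimately show ?thesis by simp
  qed
  have "M = (B * ?P) * g" unfolding M_def P_def by (rule assoc_mult_mat[OF c(1) base_mat_carrier gc, symmetric])
  then have "colspan M = colspan (B * ?P)"
    using colspan_mult[OF mult_carrier_mat[OF c(1) base_mat_carrier] gc dg] by simp
  then have e: "colspan M = mat_act B (colspan ?P)" unfolding mat_act_colspan[OF c(1) base_mat_carrier] .
  show ?thesis by (rule that[OF Mc _ e]) (simp_all add: top minors)
qed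

text \<open>The triangular factors of the lower block, extended by identity blocks to invertible triangular matrices, carry
  the base point to the given subspace.\<close>

lemma in_orbit_if_minors_nonzero:
  assumes M: "M \<in> carrier_mat N d" "\<forall>i<d. \<forall>j<d. M $$ (i, j) = (if i = j then 1 else 0)" "rank_le t (low d M)"
    and dt: "t < d" "d + t < N" and minors: "\<forall>k\<le>t. corner_minor N k M ~= 0"
  obtains B where "B \<in> block_borel N d" "colspan M = mat_act B (colspan (base_mat N d t))"
proof -
  define K where "K = (%p j. M $$ (N - 1 - p, j))"
  have 1: "\<forall>k\<le>t. det (mat k k (%(i, j). K i j)) ~= 0" using minors by (simp add: corner_minor_def K_def)
  have 2: "\<forall>p<N - d. \<forall>q<d. det (mat (Suc t) (Suc t) (%(i, j). K (if i < t then i else p) (if j < t then j else q))) = 0"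
  proof (intro allI impI)
    fix p q assume pq: "p < N - d" "q < d"
    let ?f = "%i. N - d - 1 - (if i < t then i else p)" and ?g = "%j. if j < t then j else q"
    have "minor (Suc t) (low d M) ?f ?g = 0"
      by (rule rank_le_imp_minors_zero[OF low_carrier[OF M(1)] M(3)]) (use pq dt in auto)
    moreover have "mat (Suc t) (Suc t) (%(i, j). low d M $$ (?f i, ?g j)) =
        mat (Suc t) (Suc t) (%(i, j). K (if i < t then i else p) (if j < t then j else q))"
    proof (rule eq_matI)
      fix i j assume "i < dim_row (mat (Suc t) (Suc t) (%(i, j). K (if i < t then i else p) (if j < t then j else q)))"
        "j < dim_col (mat (Suc t) (Suc t) (%(i, j). K (if i < t then i else p) (if j < t then j else q)))"
      then have ij: "i < Suc t" "j < Suc t" by simp_all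
      have l: "?f i < N - d" "?g j < d" using pq dt by auto
      have "d + ?f i = N - 1 - (if i < t then i else p)" using pq dt by auto
      then show "mat (Suc t) (Suc t) (%(i, j). low d M $$ (?f i, ?g j)) $$ (i, j) =
          mat (Suc t) (Suc t) (%(i, j). K (if i < t then i else p) (if j < t then j else q)) $$ (i, j)"
        using low_index[OF M(1) l] ij by (simp add: K_def)
    qed simp_all
    ultimately show "det (mat (Suc t) (Suc t) (%(i, j). K (if i < t then i else p) (if j < t then j else q))) = 0"
      unfolding minor_def by simp
  qed
  from triangular_factorization[OF 1 2] obtain L R where L: "\<forall>p i. p < i --> L p i = 0" and R: "\<forall>i q. q < i --> R i q = 0"
    and LR: "\<forall>i<t. L i i ~= 0 & R i i ~= 0" and K: "\<forall>p<N - d. \<forall>q<d. K p q = (\<Sum>i<t. L p i * R i q)"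
    by (elim exE conjE) (rule that)
  define C where "C = mat N N (%(i, j). if i < t & j < d then R i j else if i = j then 1 else 0)"
  define D where "D = mat N N (%(i, j). if N - 1 - j < t & d \<le> i then L (N - 1 - i) (N - 1 - j) else if i = j then 1 else 0)"
  have Cc: "C \<in> carrier_mat N N" and Dc: "D \<in> carrier_mat N N" by (simp_all add: C_def D_def)
  have C: "C \<in> block_borel N d"
  proof (rule block_borelI[OF Cc])
    show "C $$ (i, j) = 0" if "i < N" "j < N" "j < i \<or> i < d & d \<le> j" for i j
      using that R by (auto simp: C_def)
    show "C $$ (i, i) ~= 0" if "i < N" for i using that LR by (auto simp: C_def)
  qed
  have D: "D \<in> block_borel N d"
  proof (rule block_borelI[OF Dc])
    fix i j assume ij: "i < N" "j < N" "j < i \<or> i < d & d \<le> j"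
    show "D $$ (i, j) = 0"
    proof (cases "N - 1 - j < t & d \<le> i")
      case True
      then have "N - 1 - i < N - 1 - j" using ij by linarith
      then show ?thesis using ij L True by (simp add: D_def)
    next
      case False
      then show ?thesis using ij by (auto simp: D_def)
    qed
  next
    show "D $$ (i, i) ~= 0" if "i < N" for i using that LR by (auto simp: D_def)
  qed
  define Z where "Z = mat N d (%(i, j). if i < d then (if i = j then 1 else 0) else if N - 1 - i < t then R (N - 1 - i) j else 0)"
  have Zc: "Z \<in> carrier_mat N d" by (simp add: Z_def)
  have DZ: "D * Z = M"
  proof (rule eq_matI)
    fix i j assume "i < dim_row M" "j < dim_col M"
    then have ij: "i < N" "j < d" using M(1) by auto
    show "(D * Z) $$ (i, j) = M $$ (i, j)"
    proof (cases "i < d")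
      case True
      have "(D * Z) $$ (i, j) = (\<Sum>l<N. if l = i then Z $$ (i, j) else 0)"
        unfolding mult_entry[OF Dc Zc ij] by (rule sum.cong) (use True ij in \<open>auto simp: D_def\<close>)
      then show ?thesis using ij True M(2) by (simp add: Z_def)
    next
      case False
      define p where "p = N - 1 - i"
      have p: "p < N - d" "i = N - 1 - p" using False ij by (auto simp: p_def)
      have "(D * Z) $$ (i, j) = (\<Sum>l<N. D $$ (i, l) * Z $$ (l, j))" by (rule mult_entry[OF Dc Zc ij])
      also have "\<dots> = (\<Sum>q<t. D $$ (i, N - 1 - q) * Z $$ (N - 1 - q, j))"
      proof (rule sum_reverse_tail)
        fix l assume l: "l < N - t"
        then have nl: "\<not> N - 1 - l < t" by linarith
        show "D $$ (i, l) * Z $$ (l, j) = 0"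
        proof (cases "l < d")
          case True
          then have "D $$ (i, l) = 0" using nl False ij dt by (auto simp: D_def)
          then show ?thesis by simp
        next
          case False
          then have "Z $$ (l, j) = 0" using nl l ij by (simp add: Z_def)
          then show ?thesis by simp
        qed
      qed (use dt in simp)
      also have "\<dots> = (\<Sum>q<t. L p q * R q j)"
      proof (rule sum.cong[OF refl])
        fix q assume "q \<in> {..<t}"
        then have q: "N - 1 - q < N" "\<not> N - 1 - q < d" "N - 1 - (N - 1 - q) = q" "q < t" using dt by auto
        show "D $$ (i, N - 1 - q) * Z $$ (N - 1 - q, j) = L p q * R q j"
          using q ij False by (simp add: D_def Z_def p_def)
      qed
      also have "\<dots> = K p j" using K p(1) ij(2) by simp
      finally show ?thesis using p(2) by (simp add: K_def)
    qed
  qed (use Dc Zc M(1) in auto)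
  define g where "g = mat d d (%(i, j). C $$ (i, j))"
  have gc: "g \<in> carrier_mat d d" by (simp add: g_def)
  have "upper_triangular g" using R dt by (auto simp: g_def upper_triangular_def C_def)
  then have "det g = prod_list (diag_mat g)" by (rule det_upper_triangular[OF _ gc])
  then have dg: "det g ~= 0" using block_borel_diag[OF C] gc dt by (auto simp: prod_list_diag_prod g_def)
  have CZ: "C * Z = base_mat N d t * g"
  proof (rule eq_matI)
    fix i j assume "i < dim_row (base_mat N d t * g)" "j < dim_col (base_mat N d t * g)"
    then have ij: "i < N" "j < d" using gc by (auto simp: base_mat_def)
    have "(C * Z) $$ (i, j) = (\<Sum>l<N. if l = (if i < d then j else i) then (if i < d then C $$ (i, j) else Z $$ (i, j)) else 0)"
      unfolding mult_entry[OF Cc Zc ij] by (rule sum.cong) (use ij dt in \<open>auto simp: C_def Z_def\<close>)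
    also have "\<dots> = (if i < d then C $$ (i, j) else Z $$ (i, j))" using ij dt by (subst sum.delta) auto
    also have "\<dots> = (\<Sum>l<d. if l = (if i < d then i else N - 1 - i) then
        (if i < d \<or> N - 1 - i < t then g $$ (l, j) else 0) else 0)"
      using ij dt by (subst sum.delta) (auto simp: g_def Z_def C_def)
    also have "\<dots> = (base_mat N d t * g) $$ (i, j)"
      unfolding mult_entry[OF base_mat_carrier gc ij] by (rule sum.cong) (use ij dt in \<open>auto simp: base_mat_def\<close>)
    finally show "(C * Z) $$ (i, j) = (base_mat N d t * g) $$ (i, j)" .
  qed (use Cc Zc gc in \<open>auto simp: base_mat_def\<close>)
  note S = subgroup_GLD[OF block_borel_subgroup[of N d]]
  have CG: "C \<in> carrier (GL N)" using C S(1) by blast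
  have Ci: "inv\<^bsub>GL N\<^esub> C \<in> carrier_mat N N" using GL_inv(1)[OF CG] by (simp add: GL_iff)
  have DC: "D * inv\<^bsub>GL N\<^esub> C \<in> carrier_mat N N" by (rule mult_carrier_mat[OF Dc Ci])
  have "(D * inv\<^bsub>GL N\<^esub> C) * (C * Z) = D * (inv\<^bsub>GL N\<^esub> C * (C * Z))"
    by (rule assoc_mult_mat[OF Dc Ci mult_carrier_mat[OF Cc Zc]])
  also have "inv\<^bsub>GL N\<^esub> C * (C * Z) = inv\<^bsub>GL N\<^esub> C * C * Z" by (rule assoc_mult_mat[OF Ci Cc Zc, symmetric])
  also have "\<dots> = Z" unfolding GL_inv(3)[OF CG] by (rule left_mult_one_mat[OF Zc])
  finally have e: "(D * inv\<^bsub>GL N\<^esub> C) * (C * Z) = M" unfolding DZ .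
  have "mat_act (D * inv\<^bsub>GL N\<^esub> C) (colspan (base_mat N d t)) = mat_act (D * inv\<^bsub>GL N\<^esub> C) (colspan (base_mat N d t * g))"
    unfolding colspan_mult[OF base_mat_carrier gc dg] ..
  also have "\<dots> = colspan M" unfolding CZ[symmetric] mat_act_colspan[OF DC mult_carrier_mat[OF Cc Zc]] e ..
  finally show ?thesis using that[OF S(3)[OF D S(4)[OF C]]] by simp
qed

definition open_form :: "nat => nat => nat => (nat set => complex) => complex" where
  "open_form N d t x = x {..<d} * (\<Prod>k<t. corner_minor N (Suc k) (chart N d {..<d} x))"

lemma hom_poly_open_form:
  assumes "d \<le> N" "t \<le> d"
  shows "\<exists>k. hom_poly (plucker_index d N) k (open_form N d t)"
proof -
  have J: "{..<d} \<in> plucker_index d N" by (rule plucker_index_lessThan[OF assms(1)])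
  have ne: "plucker_index d N ~= {}" using J by blast
  have "hom_poly (plucker_index d N) (Suc k * 1) (%x. corner_minor N (Suc k) (chart N d {..<d} x))" if "k < t" for k
    unfolding corner_minor_def
    by (rule hom_poly_det[OF ne hom_poly_chart[OF assms(1) J]]) (use that assms in auto)
  then have "hom_poly (plucker_index d N) (\<Sum>k<t. Suc k * 1) (%x. \<Prod>k<t. corner_minor N (Suc k) (chart N d {..<d} x))"
    by (intro hom_poly_prod) simp_all
  from hom_poly.mult[OF hom_poly.coord[OF J] this] show ?thesis unfolding open_form_def by (rule exI)
qed

lemma open_form_normalized:
  assumes M: "M \<in> carrier_mat N d" "\<forall>i<d. \<forall>j<d. M $$ (i, j) = (if i = j then 1 else 0)" and dN: "d \<le> N"
  shows "open_form N d t (plk N d M) = (\<Prod>k<t. corner_minor N (Suc k) M)" "plk N d M {..<d} = 1" "full_col_rank M"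
proof -
  have J: "{..<d} \<in> plucker_index d N" by (rule plucker_index_lessThan[OF dN])
  have norm: "M $$ (pick {..<d} i, j) = (if i = j then 1 else 0)" if "i < d" "j < d" for i j
    using M(2) that by (simp add: pick_lessThan)
  show p: "plk N d M {..<d} = 1" by (rule plk_normalized[OF J norm])
  have "chart N d {..<d} (plk N d M) = 1 \<cdot>\<^sub>m M" by (rule chart_plk[OF M(1) J norm]) simp_all
  then have "chart N d {..<d} (plk N d M) = M" using M(1) by (intro eq_matI) auto
  then show "open_form N d t (plk N d M) = (\<Prod>k<t. corner_minor N (Suc k) M)" unfolding open_form_def p by simp
  show "full_col_rank M" by (rule plk_nonzero_full_col_rank[OF M(1), of "{..<d}"]) (simp add: p)
qed

lemma base_point_in_detvar:
  assumes "t < d" "d + t < N"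
  shows "colspan (base_mat N d t) \<in> detvar N d t"
proof -
  have n: "\<forall>i<d. \<forall>j<d. base_mat N d t $$ (i, j) = (if i = j then 1 else 0)" using assms by (auto simp: base_mat_def)
  have dN: "d \<le> N" using assms by simp
  define A where "A = mat (N - d) t (%(i, k). if d + i = N - 1 - k then 1 else (0 :: complex))"
  define B where "B = mat t d (%(k, j). if k = j then 1 else (0 :: complex))"
  have c: "A \<in> carrier_mat (N - d) t" "B \<in> carrier_mat t d" by (simp_all add: A_def B_def)
  note lc = low_carrier[OF base_mat_carrier[of N d t], of d]
  have "low d (base_mat N d t) = A * B"
  proof (rule eq_matI)
    fix i j assume "i < dim_row (A * B)" "j < dim_col (A * B)"
    then have ij: "i < N - d" "j < d" using c by auto
    have "(A * B) $$ (i, j) = (\<Sum>k<t. if k = j then A $$ (i, k) else 0)"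
      unfolding mult_entry[OF c ij] by (rule sum.cong) (use ij in \<open>auto simp: B_def\<close>)
    also have "\<dots> = (if j < t then A $$ (i, j) else 0)" by (subst sum.delta) auto
    finally show "low d (base_mat N d t) $$ (i, j) = (A * B) $$ (i, j)"
      unfolding low_index[OF base_mat_carrier ij] using ij by (auto simp: base_mat_def A_def)
  qed (use c lc in auto)
  then have "rank_le t (low d (base_mat N d t))"
    unfolding rank_le_def carrier_matD[OF lc] using c by blast
  then show ?thesis
    unfolding colspan_in_detvar_iff[OF base_mat_carrier open_form_normalized(3)[OF base_mat_carrier n dN]] .
qed

text \<open>Both inclusions use the representative that is the identity in the first \<open>d\<close> rows, for which \<open>open_form\<close> is the product of
the corner minors.\<close>

theorem borel_orbit:
  assumes d: "0 < d" and dt: "t < d" "d + t < N"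
  shows "(%B. mat_act B (colspan (base_mat N d t))) ` block_borel N d =
    {p \<in> detvar N d t. plucker N p \<in> nonzero_locus (plucker_index d N) (open_form N d t)}"
proof (rule subset_antisym; rule subsetI)
  have dN: "d \<le> N" using dt by simp
  have J: "{..<d} \<in> plucker_index d N" by (rule plucker_index_lessThan[OF dN])
  from hom_poly_open_form[OF dN, of t] dt obtain e where hom: "hom_poly (plucker_index d N) e (open_form N d t)" by auto
  have loc: "plucker N (colspan M) \<in> nonzero_locus (plucker_index d N) (open_form N d t) \<longleftrightarrow> open_form N d t (plk N d M) ~= 0"
    if "M \<in> carrier_mat N d" "full_col_rank M" for M
    unfolding plucker_colspan[OF that d] by (rule proj_point_in_nonzero_locus[OF hom proj_point_plk_in_proj_space[OF that]])
  {
    fix p assume "p \<in> (%B. mat_act B (colspan (base_mat N d t))) ` block_borel N d"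
    then obtain B where B: "B \<in> block_borel N d" "p = mat_act B (colspan (base_mat N d t))" by (elim imageE) (rule that)
    obtain M where M: "M \<in> carrier_mat N d" "\<forall>i<d. \<forall>j<d. M $$ (i, j) = (if i = j then 1 else 0)"
      "colspan M = mat_act B (colspan (base_mat N d t))" "\<forall>k\<le>t. corner_minor N k M ~= 0"
      by (rule orbit_normal_form[OF B(1) dt])
    have "B \<in> block_stab N d" using B(1) block_borel_sub block_diagonal_sub by blast
    then have "p \<in> detvar N d t" unfolding B(2) by (rule block_stab_acts_on_detvar[OF _ base_point_in_detvar[OF dt]])
    moreover have "open_form N d t (plk N d M) ~= 0" unfolding open_form_normalized(1)[OF M(1,2) dN] using M(4) by simp
    ultimately show "p \<in> {p \<in> detvar N d t. plucker N p \<in> nonzero_locus (plucker_index d N) (open_form N d t)}"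
      using loc[OF M(1) open_form_normalized(3)[OF M(1,2) dN]] M(3) B(2) by simp
  next
    fix p assume "p \<in> {p \<in> detvar N d t. plucker N p \<in> nonzero_locus (plucker_index d N) (open_form N d t)}"
    then have p: "p \<in> detvar N d t" "plucker N p \<in> nonzero_locus (plucker_index d N) (open_form N d t)" by simp_all
    obtain W where W: "W \<in> carrier_mat N d" "full_col_rank W" "rank_le t (low d W)" "p = colspan W" by (rule detvarE[OF p(1)])
    have "open_form N d t (plk N d W) ~= 0" using loc[OF W(1,2)] p(2) W(4) by simp
    then have "plk N d W {..<d} ~= 0" unfolding open_form_def by simp
    then obtain g where g: "g \<in> carrier_mat d d" "det g ~= 0"
      "!!i j. i < d ==> j < d ==> (W * g) $$ (pick {..<d} i, j) = (if i = j then 1 else 0)"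
      by (rule normalize_at[OF W(1)]) blast
    let ?M = "W * g"
    have Mc: "?M \<in> carrier_mat N d" by (rule mult_carrier_mat[OF W(1) g(1)])
    have top: "\<forall>i<d. \<forall>j<d. ?M $$ (i, j) = (if i = j then 1 else 0)" using g(3) pick_lessThan by metis
    have fr: "full_col_rank ?M" by (rule full_col_rank_mult[OF W(1) g(1,2) W(2)])
    have pM: "p = colspan ?M" unfolding W(4) colspan_mult[OF W(1) g(1,2)] ..
    have r: "rank_le t (low d ?M)" unfolding low_mult[OF W(1) g(1)] by (rule rank_le_mult[OF low_carrier[OF W(1)] g(1) W(3)])
    have "open_form N d t (plk N d ?M) ~= 0" using loc[OF Mc fr] p(2) pM by simp
    then have s: "corner_minor N (Suc k) ?M ~= 0" if "k < t" for k
      unfolding open_form_normalized(1)[OF Mc top dN] using that by simp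
    have "corner_minor N k ?M ~= 0" if "k \<le> t" for k
    proof (cases k)
      case 0
      then show ?thesis by (simp add: corner_minor_def det_dim_zero)
    next
      case (Suc k')
      then show ?thesis using s[of k'] that by simp
    qed
    then have minors: "\<forall>k\<le>t. corner_minor N k ?M ~= 0" by blast
    obtain B where "B \<in> block_borel N d" "colspan ?M = mat_act B (colspan (base_mat N d t))"
      by (rule in_orbit_if_minors_nonzero[OF Mc top r dt minors])
    then show "p \<in> (%B. mat_act B (colspan (base_mat N d t))) ` block_borel N d" unfolding pM by (intro image_eqI)
  }
qed

text \<open>This is irreducibility of the variety, in the form needed for closures of orbits.\<close>

lemma open_locus_dense:
  assumes d: "0 < d" "d \<le> N" and f: "hom_poly (plucker_index d N) k f"
    and p: "p \<in> plucker N ` detvar N d t" "p \<in> nonzero_locus (plucker_index d N) f"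
    and U: "openin (zariski_proj (plucker_index d N)) U" "q \<in> U" "q \<in> plucker N ` detvar N d t"
  obtains r where "r \<in> plucker N ` detvar N d t" "r \<in> nonzero_locus (plucker_index d N) f" "r \<in> U"
proof -
  obtain l g where g: "hom_poly (plucker_index d N) l g" "q \<in> nonzero_locus (plucker_index d N) g"
    "nonzero_locus (plucker_index d N) g \<subseteq> U" by (rule zariski_basis[OF U(1,2)])
  obtain r where r: "r \<in> plucker N ` detvar N d t" "r \<in> nonzero_locus (plucker_index d N) f" "r \<in> nonzero_locus (plucker_index d N) g"
    by (rule detvar_nonzero_loci_meet[OF d f g(1) p U(3) g(2)])
  show ?thesis by (rule that[OF r(1,2)]) (use r(3) g(3) in blast)
qed

section \<open>The Schubert variety and its stabilizer\<close>

lemma mat_act_mult: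
  assumes "A \<in> carrier_mat N N" "B \<in> carrier_mat N N" "M \<in> carrier_mat N d"
  shows "mat_act (A * B) (colspan M) = mat_act A (mat_act B (colspan M))"
  unfolding mat_act_colspan[OF assms(2,3)] mat_act_colspan[OF assms(1) mult_carrier_mat[OF assms(2,3)]]
    mat_act_colspan[OF mult_carrier_mat[OF assms(1,2)] assms(3)] assoc_mult_mat[OF assms] ..

lemma mat_act_one:
  assumes "M \<in> carrier_mat N d" shows "mat_act (1\<^sub>m N) (colspan M) = colspan M"
  unfolding mat_act_colspan[OF one_carrier_mat assms] left_mult_one_mat[OF assms] ..

lemma upper_triangular_group_eq: "upper_triangular_group N = coord_stab N (range lessThan)"
proof (rule subset_antisym; rule subsetI)
  fix A assume "A \<in> upper_triangular_group N"
  then have A: "A \<in> carrier (GL N)" "upper_triangular A" "A \<in> carrier_mat N N" by (auto simp: upper_triangular_group_def GL_iff)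
  show "A \<in> coord_stab N (range lessThan)"
    unfolding coord_stab_def using A(1) upper_triangularD[OF A(2)] A(3) by auto
next
  fix A assume "A \<in> coord_stab N (range lessThan)"
  then have A: "A \<in> carrier (GL N)" and z: "!!k i j. i < N ==> j < N ==> j < k ==> \<not> i < k ==> A $$ (i, j) = 0"
    unfolding coord_stab_def by auto
  have "A $$ (i, j) = 0" if "i < N" "j < i" for i j using z[of i j "Suc j"] that by simp
  then have "upper_triangular A" using A by (auto simp: upper_triangular_def GL_iff)
  then show "A \<in> upper_triangular_group N" using A by (simp add: upper_triangular_group_def)
qed

lemma upper_triangular_group_sub: "upper_triangular_group N \<subseteq> block_stab N d"
  unfolding upper_triangular_group_eq block_stab_def coord_stab_def by auto

text \<open>The unipotent matrix \<open>b\<close> maps \<open>e\<^bsub>N-1-j\<^esub>\<close> to \<open>e\<^bsub>N-1-j\<^esub> + e\<^sub>j\<close> for \<open>j < t\<close>.\<close>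

lemma coordinate_subspace_translate:
  assumes dt: "t < d" "d + t < N" and w: "w = [t + 1..<d + 1] @ [N - t + 1..<N + 1]"
  obtains b where "b \<in> upper_triangular_group N" "mat_act b (coordinate_subspace N w) = colspan (base_mat N d t)"
    "\<exists>V\<in>carrier_mat N d. coordinate_subspace N w = colspan V"
proof -
  define \<sigma> where "\<sigma> = (%j. if j < t then N - 1 - j else j)"
  define vs where "vs = map (%j. unit_vec N (\<sigma> j) :: complex vec) [0..<d]"
  define V where "V = mat_of_cols N vs"
  have len: "length vs = d" by (simp add: vs_def)
  have Vc: "V \<in> carrier_mat N d" unfolding V_def using mat_of_cols_carrier(1)[of N vs] len by simp
  have sN: "\<sigma> j < N" if "j < d" for j using that dt by (auto simp: \<sigma>_def)
  have V: "V $$ (i, j) = (if i = \<sigma> j then 1 else 0)" if "i < N" "j < d" for i j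
    unfolding V_def using that len sN[OF that(2)] by (simp add: mat_of_cols_index vs_def)
  have "\<sigma> ` {0..<d} = (%l. l - 1) ` set w"
  proof (rule subset_antisym; rule subsetI)
    fix x assume "x \<in> \<sigma> ` {0..<d}"
    then obtain j where j: "j < d" "x = \<sigma> j" by auto
    then have "Suc x \<in> set w" using dt unfolding w by (auto simp: \<sigma>_def)
    then show "x \<in> (%l. l - 1) ` set w" by (rule rev_image_eqI) simp
  next
    fix x assume "x \<in> (%l. l - 1) ` set w"
    then obtain l where l: "l \<in> set w" "x = l - 1" by auto
    show "x \<in> \<sigma> ` {0..<d}"
    proof (cases "x < d")
      case True
      then have "x \<ge> t" using l dt unfolding w by auto
      then have "x = \<sigma> x" by (simp add: \<sigma>_def)
      then show ?thesis using True by (intro image_eqI[of _ _ x]) auto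
    next
      case False
      then have x: "N - t \<le> x" "x < N" using l dt unfolding w by auto
      then have "x = \<sigma> (N - 1 - x)" "N - 1 - x < d" using dt by (auto simp: \<sigma>_def)
      then show ?thesis by (intro image_eqI[of _ _ "N - 1 - x"]) auto
    qed
  qed
  then have "(%l. unit_vec N l :: complex vec) ` (\<sigma> ` {0..<d}) = (%l. unit_vec N l) ` ((%l. l - 1) ` set w)" by simp
  then have setvs: "set vs = (%l. unit_vec N (l - 1)) ` set w" by (simp add: vs_def image_image)
  have sub: "set vs \<subseteq> carrier_vec N" by (auto simp: vs_def)
  have cs: "coordinate_subspace N w = colspan V"
    unfolding coordinate_subspace_def V_def span_cols[OF sub, symmetric] setvs ..
  define b where "b = mat N N (%(i, j). if i = j \<or> i < t & j = N - 1 - i then 1 else (0 :: complex))"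
  have bc: "b \<in> carrier_mat N N" by (simp add: b_def)
  have tri: "b $$ (i, j) = 0" if "i < N" "j < i" for i j using that dt by (auto simp: b_def)
  have "b \<in> carrier (GL N)" using upper_triangular_GL[OF bc tri] by (simp add: b_def)
  moreover have "upper_triangular b" using tri bc by (auto simp: upper_triangular_def)
  ultimately have bU: "b \<in> upper_triangular_group N" by (simp add: upper_triangular_group_def)
  have "b * V = base_mat N d t"
  proof (rule eq_matI)
    fix i j assume "i < dim_row (base_mat N d t)" "j < dim_col (base_mat N d t)"
    then have ij: "i < N" "j < d" by (auto simp: base_mat_def)
    have "(b * V) $$ (i, j) = (\<Sum>l<N. if l = \<sigma> j then b $$ (i, l) else 0)"
      unfolding mult_entry[OF bc Vc ij] by (rule sum.cong) (use V ij in auto)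
    also have "\<dots> = b $$ (i, \<sigma> j)" using sN[OF ij(2)] by (subst sum.delta) auto
    also have "\<dots> = base_mat N d t $$ (i, j)"
    proof (cases "j < t")
      case True
      have "i = j \<longleftrightarrow> i < t & N - 1 - j = N - 1 - i" using True ij dt by auto
      then show ?thesis using True ij dt sN[OF ij(2)] by (auto simp: b_def base_mat_def \<sigma>_def)
    next
      case False
      have "\<not> (i < t & j = N - 1 - i)" using ij dt by auto
      then show ?thesis using False ij dt by (auto simp: b_def base_mat_def \<sigma>_def)
    qed
    finally show "(b * V) $$ (i, j) = base_mat N d t $$ (i, j)" .
  qed (use bc Vc in \<open>auto simp: base_mat_def\<close>)
  then have "mat_act b (coordinate_subspace N w) = colspan (base_mat N d t)" unfolding cs mat_act_colspan[OF bc Vc] by simp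
  then show ?thesis using that[OF bU] cs Vc by blast
qed

lemma plucker_in_image_iff:
  assumes d: "0 < d" and p: "p \<in> grassmannian d N"
  shows "plucker N p \<in> plucker N ` detvar N d t \<longleftrightarrow> p \<in> detvar N d t" "plucker N p \<in> proj_space (plucker_index d N)"
proof -
  obtain M where M: "M \<in> carrier_mat N d" "full_col_rank M" "p = colspan M" using p unfolding grassmannian_iff by blast
  show "plucker N p \<in> proj_space (plucker_index d N)"
    unfolding M(3) plucker_colspan[OF M(1,2) d] by (rule proj_point_plk_in_proj_space[OF M(1,2)])
  show "plucker N p \<in> plucker N ` detvar N d t \<longleftrightarrow> p \<in> detvar N d t"
  proof
    assume "plucker N p \<in> plucker N ` detvar N d t"
    then obtain q where q: "q \<in> detvar N d t" "plucker N p = plucker N q" by (elim imageE) (rule that)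
    obtain W where W: "W \<in> carrier_mat N d" "full_col_rank W" "rank_le t (low d W)" "q = colspan W" by (rule detvarE[OF q(1)])
    have "p = q" unfolding M(3) W(4) by (rule plucker_inj[OF d M(1,2) W(1,2)]) (use q(2) M(3) W(4) in simp)
    then show "p \<in> detvar N d t" using q(1) by simp
  qed (rule imageI)
qed

text \<open>The determinantal variety is closed, and it contains the orbit of the upper triangular group because the rank of the lower block
does not change under this group. Conversely, this orbit contains the dense orbit of the smaller group.\<close>

theorem schubert_variety_eq_detvar:
  assumes d: "0 < d" and dt: "t < d" "d + t < N" and w: "w = [t + 1..<d + 1] @ [N - t + 1..<N + 1]"
  shows "schubert_variety N w = detvar N d t"
proof -
  let ?PI = "plucker_index d N" and ?T = "zariski_grassmannian d N" and ?P = "base_mat N d t"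
  have dN: "d \<le> N" using dt by simp
  have "length w = d" unfolding w length_append length_upt using dt by linarith
  obtain b where b: "b \<in> upper_triangular_group N" "mat_act b (coordinate_subspace N w) = colspan ?P"
    and "\<exists>V\<in>carrier_mat N d. coordinate_subspace N w = colspan V" by (rule coordinate_subspace_translate[OF dt w])
  then obtain V where V: "V \<in> carrier_mat N d" "coordinate_subspace N w = colspan V" by blast
  note S = subgroup_GLD[OF coord_stab_subgroup[of N "range lessThan", folded upper_triangular_group_eq]]
  let ?b = "inv\<^bsub>GL N\<^esub> b"
  have bG: "b \<in> carrier (GL N)" using S(1) b(1) by blast
  have bi: "?b \<in> upper_triangular_group N" by (rule S(4)[OF b(1)])
  have bc: "b \<in> carrier_mat N N" "?b \<in> carrier_mat N N" using bG GL_inv(1)[OF bG] by (simp_all add: GL_iff)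
  have "colspan V = mat_act (?b * b) (colspan V)" unfolding GL_inv(3)[OF bG] by (rule mat_act_one[OF V(1), symmetric])
  also have "\<dots> = mat_act ?b (colspan ?P)" unfolding mat_act_mult[OF bc(2,1) V(1)] using b(2) V(2) by simp
  finally have Vb: "colspan V = mat_act ?b (colspan ?P)" .
  have Vd: "colspan V \<in> detvar N d t"
    unfolding Vb by (rule block_stab_acts_on_detvar[OF _ base_point_in_detvar[OF dt]]) (use bi upper_triangular_group_sub in blast)
  let ?O = "(%c. mat_act c (colspan V)) ` upper_triangular_group N"
  have Osub: "?O \<subseteq> detvar N d t"
    by (rule image_subsetI, rule block_stab_acts_on_detvar[OF _ Vd]) (use upper_triangular_group_sub in blast)
  have orb: "(%B. mat_act B (colspan ?P)) ` block_borel N d \<subseteq> ?O"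
  proof (rule image_subsetI)
    fix B assume "B \<in> block_borel N d"
    then have B: "B \<in> upper_triangular_group N" using block_borel_upper by blast
    then have Bc: "B \<in> carrier_mat N N" using S(1) by (auto simp: GL_iff)
    have "mat_act B (colspan ?P) = mat_act (B * b) (colspan V)"
      unfolding mat_act_mult[OF Bc bc(1) V(1)] using b(2) V(2) by simp
    then show "mat_act B (colspan ?P) \<in> ?O" using S(3)[OF B b(1)] by (intro image_eqI)
  qed
  have topT: "topspace ?T = grassmannian d N"
    unfolding zariski_grassmannian_def topspace_pullback_topology topspace_zariski_proj
    using plucker_in_image_iff(2)[OF d] by blast
  have closed: "closedin ?T (detvar N d t)"
  proof -
    have "openin (zariski_proj ?PI) (proj_space ?PI - plucker N ` detvar N d t)"
      using plucker_image_detvar_closed[OF d dN, of t] unfolding closedin_def topspace_zariski_proj by (rule conjunct2)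
    moreover have "grassmannian d N - detvar N d t =
        plucker N -` (proj_space ?PI - plucker N ` detvar N d t) \<inter> grassmannian d N"
    proof (rule Set.set_eqI)
      fix p
      show "p \<in> grassmannian d N - detvar N d t \<longleftrightarrow>
          p \<in> plucker N -` (proj_space ?PI - plucker N ` detvar N d t) \<inter> grassmannian d N"
        unfolding Diff_iff Int_iff vimage_eq using plucker_in_image_iff(1)[OF d, of p N t] plucker_in_image_iff(2)[OF d, of p N] by (cases "p \<in> grassmannian d N") simp_all
    qed
    ultimately have "openin ?T (grassmannian d N - detvar N d t)"
      unfolding zariski_grassmannian_def openin_pullback_topology by (intro exI conjI)
    then show ?thesis unfolding closedin_def topT using detvar_subset_grassmannian by (intro conjI)
  qed
  have "?T closure_of ?O = detvar N d t"
  proof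
    show "?T closure_of ?O \<subseteq> detvar N d t" by (rule closure_of_minimal[OF Osub closed])
    show "detvar N d t \<subseteq> ?T closure_of ?O"
    proof
      fix p assume p: "p \<in> detvar N d t"
      have pG: "p \<in> grassmannian d N" using p detvar_subset_grassmannian by blast
      from hom_poly_open_form[OF dN, of t] dt obtain e where hom: "hom_poly ?PI e (open_form N d t)" by auto
      have "mat_act (1\<^sub>m N) (colspan ?P) \<in> (%B. mat_act B (colspan ?P)) ` block_borel N d"
        by (rule imageI) (rule subgroup_GLD(2)[OF block_borel_subgroup])
      then have base: "plucker N (mat_act (1\<^sub>m N) (colspan ?P)) \<in> plucker N ` detvar N d t"
        "plucker N (mat_act (1\<^sub>m N) (colspan ?P)) \<in> nonzero_locus ?PI (open_form N d t)"
        unfolding borel_orbit[OF d dt] by auto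
      have "\<exists>y. y \<in> ?O & y \<in> S" if S: "p \<in> S" "openin ?T S" for S
      proof -
        from S(2) obtain U where U: "openin (zariski_proj ?PI) U" "S = plucker N -` U \<inter> grassmannian d N"
          unfolding zariski_grassmannian_def openin_pullback_topology by (elim exE conjE) (rule that)
        have "plucker N p \<in> U" using S(1) U(2) by simp
        then obtain r where r: "r \<in> plucker N ` detvar N d t" "r \<in> nonzero_locus ?PI (open_form N d t)" "r \<in> U"
          by (rule open_locus_dense[OF d dN hom base U(1) _ imageI[OF p]])
        then obtain y where y: "y \<in> detvar N d t" "r = plucker N y" by (elim imageE) (rule that)
        have "y \<in> {p \<in> detvar N d t. plucker N p \<in> nonzero_locus ?PI (open_form N d t)}" using y r(2) by simp
        then have "y \<in> ?O" unfolding borel_orbit[OF d dt, symmetric] using orb by blast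
        moreover have "y \<in> S" unfolding U(2) using y r(3) detvar_subset_grassmannian by auto
        ultimately show ?thesis by blast
      qed
      then show "p \<in> ?T closure_of ?O" unfolding in_closure_of topT using pG by (intro conjI allI impI) simp_all
    qed
  qed
  then show ?thesis unfolding schubert_variety_def \<open>length w = d\<close> V(2) .
qed

lemma detvar_image:
  assumes A: "A \<in> block_stab N d"
  shows "mat_act A ` detvar N d t = detvar N d t"
proof
  show "mat_act A ` detvar N d t \<subseteq> detvar N d t" by (rule image_subsetI) (rule block_stab_acts_on_detvar[OF A])
  show "detvar N d t \<subseteq> mat_act A ` detvar N d t"
  proof
    fix p assume p: "p \<in> detvar N d t"
    obtain M where M: "M \<in> carrier_mat N d" "full_col_rank M" "rank_le t (low d M)" "p = colspan M" by (rule detvarE[OF p])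
    have G: "A \<in> carrier (GL N)" using A unfolding block_stab_iff by blast
    have c: "A \<in> carrier_mat N N" "inv\<^bsub>GL N\<^esub> A \<in> carrier_mat N N" using G GL_inv(1)[OF G] by (simp_all add: GL_iff)
    have "p = mat_act (A * inv\<^bsub>GL N\<^esub> A) p" unfolding GL_inv(2)[OF G] M(4) by (rule mat_act_one[OF M(1), symmetric])
    also have "\<dots> = mat_act A (mat_act (inv\<^bsub>GL N\<^esub> A) p)" unfolding M(4) by (rule mat_act_mult[OF c M(1)])
    finally have e: "p = mat_act A (mat_act (inv\<^bsub>GL N\<^esub> A) p)" .
    have "mat_act (inv\<^bsub>GL N\<^esub> A) p \<in> detvar N d t"
      by (rule block_stab_acts_on_detvar[OF subgroup_GLD(4)[OF block_groups(1) A] p])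
    with e show "p \<in> mat_act A ` detvar N d t" by (rule image_eqI)
  qed
qed

text \<open>If \<open>A\<close> moves \<open>e\<^bsub>j0\<^esub>\<close> out of the first block, then the minor condition fails for the image under \<open>A\<close> of
  the columns \<open>e\<^bsub>j0\<^esub>\<close> and \<open>A\<^sup>-\<^sup>1 e\<^sub>i\<close> for \<open>t\<close> further indices \<open>i\<close> in the second block. This matrix need not have full
  rank, but a polynomial that vanishes on all matrices of full rank vanishes on it, too.\<close>

lemma detvar_stabilizer:
  assumes dt: "t < d" "d + t < N" and A: "A \<in> carrier (GL N)" "mat_act A ` detvar N d t \<subseteq> detvar N d t"
  shows "A \<in> block_stab N d"
proof (rule ccontr)
  assume "A \<notin> block_stab N d"
  then obtain i0 j0 where ij0: "i0 < N" "j0 < N" "d \<le> i0" "j0 < d" "A $$ (i0, j0) ~= 0" using A(1) unfolding block_stab_iff by blast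
  let ?A = "inv\<^bsub>GL N\<^esub> A"
  have dN: "d \<le> N" using dt by simp
  have c: "A \<in> carrier_mat N N" "?A \<in> carrier_mat N N" using A(1) GL_inv(1)[OF A(1)] by (simp_all add: GL_iff)
  define h where "h = (%l. if l = 0 then i0 else if d + l \<le> i0 then d + l - 1 else d + l)"
  have h: "h l < N" "d \<le> h l" if "l \<le> t" for l using that dt ij0 by (auto simp: h_def)
  have h0: "h l = i0 \<longleftrightarrow> l = 0" if "l \<le> t" for l using ij0 by (auto simp: h_def)
  have hinj: "h l = h m \<longleftrightarrow> l = m" for l m using ij0 by (auto simp: h_def split: if_splits)
  define M where "M = mat N d (%(i, j). if j = 0 then if i = j0 then 1 else 0 else if j \<le> t then ?A $$ (i, h j) else 0)"
  have Mc: "M \<in> carrier_mat N d" by (simp add: M_def)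
  have "rank_le t (low d M)"
  proof -
    define X where "X = mat (N - d) t (%(i, k). M $$ (d + i, Suc k))"
    define Y where "Y = mat t d (%(k, j). if j = Suc k then 1 else (0 :: complex))"
    have XY: "X \<in> carrier_mat (N - d) t" "Y \<in> carrier_mat t d" by (simp_all add: X_def Y_def)
    note lc = low_carrier[OF Mc, of d]
    have "low d M = X * Y"
    proof (rule eq_matI)
      fix i j assume "i < dim_row (X * Y)" "j < dim_col (X * Y)"
      then have ij: "i < N - d" "j < d" using XY by auto
      have "(X * Y) $$ (i, j) = (\<Sum>k<t. if k = j - 1 then (if j = 0 then 0 else M $$ (d + i, j)) else 0)"
        unfolding mult_entry[OF XY ij] by (rule sum.cong) (use ij in \<open>auto simp: X_def Y_def\<close>)
      also have "\<dots> = (if j - 1 < t then (if j = 0 then 0 else M $$ (d + i, j)) else 0)" by (subst sum.delta) auto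
      also have "\<dots> = M $$ (d + i, j)" using ij ij0 dt by (auto simp: M_def)
      finally show "low d M $$ (i, j) = (X * Y) $$ (i, j)" unfolding low_index[OF Mc ij] by simp
    qed (use XY lc in auto)
    then show ?thesis unfolding rank_le_def carrier_matD[OF lc] using XY by blast
  qed
  then obtain y0 where y0: "M = MY N d t y0" by (rule rank_low_imp_MY[OF Mc])
  define f where "f = (%l. h l - d)"
  have f: "f l < N - d" "d + f l = h l" if "l < Suc t" for l using h[of l] that by (auto simp: f_def)
  have AM: "A * MY N d t y \<in> carrier_mat N d" for y by (rule mult_carrier_mat[OF c(1) MY_carrier])
  have "minor (Suc t) (low d (A * MY N d t y)) f id = 0" for y
  proof (rule poly_fun_zero_of_zero_on_full_rank[OF dN, of t "%y. minor (Suc t) (low d (A * MY N d t y)) f id" y])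
    have "poly_fun (yvars d (N - d) t) (%y. low d (A * MY N d t y) $$ (f i, id j))" if ij: "i < Suc t" "j < Suc t" for i j
    proof -
      have jd: "j < d" and hN: "h i < N" using ij dt h[of i] by simp_all
      have "low d (A * MY N d t y) $$ (f i, id j) = (\<Sum>l<N. A $$ (h i, l) * MY N d t y $$ (l, j))" for y
        using low_index[OF AM f(1)[OF ij(1)] jd] mult_entry[OF c(1) MY_carrier hN jd] f(2)[OF ij(1)] by simp
      moreover have "poly_fun (yvars d (N - d) t) (%y. \<Sum>l<N. A $$ (h i, l) * MY N d t y $$ (l, j))"
        by (intro poly_fun_sum poly_fun.mult poly_fun.const poly_fun_MY[OF dN _ jd]) simp
      ultimately show ?thesis by simp
    qed
    then show "poly_fun (yvars d (N - d) t) (%y. minor (Suc t) (low d (A * MY N d t y)) f id)"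
      unfolding minor_def by (rule poly_fun_det)
    fix y assume y: "full_col_rank (MY N d t y)"
    have "colspan (MY N d t y) \<in> detvar N d t" unfolding detvar_MY by (intro CollectI exI[of _ y] conjI refl y)
    then have "mat_act A (colspan (MY N d t y)) \<in> detvar N d t" using A(2) by blast
    then have "rank_le t (low d (A * MY N d t y))"
      unfolding mat_act_colspan[OF c(1) MY_carrier] colspan_in_detvar_iff[OF AM full_col_rank_GL[OF A(1) MY_carrier y]] .
    then show "minor (Suc t) (low d (A * MY N d t y)) f id = 0"
      by (rule rank_le_imp_minors_zero[OF low_carrier[OF AM]]) (use f dt in auto)
  qed
  from this[of y0] have zero: "minor (Suc t) (low d (A * M)) f id = 0" unfolding y0 .
  have AMc: "A * M \<in> carrier_mat N d" by (rule mult_carrier_mat[OF c(1) Mc])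
  define Z where "Z = mat (Suc t) (Suc t) (%(i, j). low d (A * M) $$ (f i, id j))"
  have Z: "Z $$ (r, s) = (if s = 0 then A $$ (h r, j0) else if r = s then 1 else 0)" if rs: "r < Suc t" "s < Suc t" for r s
  proof -
    have sd: "s < d" and hN: "h r < N" "h s < N" using rs dt h[of r] h[of s] by simp_all
    have "Z $$ (r, s) = (\<Sum>l<N. A $$ (h r, l) * M $$ (l, s))"
      using low_index[OF AMc f(1)[OF rs(1)] sd] mult_entry[OF c(1) Mc hN(1) sd] f(2)[OF rs(1)] rs by (simp add: Z_def)
    also have "\<dots> = (if s = 0 then A $$ (h r, j0) else if r = s then 1 else 0)"
    proof (cases "s = 0")
      case True
      have "(\<Sum>l<N. A $$ (h r, l) * M $$ (l, s)) = (\<Sum>l<N. if l = j0 then A $$ (h r, l) else 0)"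
        by (rule sum.cong) (use True sd in \<open>auto simp: M_def\<close>)
      then show ?thesis using True ij0(2) by simp
    next
      case False
      have "(\<Sum>l<N. A $$ (h r, l) * M $$ (l, s)) = (\<Sum>l<N. A $$ (h r, l) * ?A $$ (l, h s))"
        by (rule sum.cong) (use False sd rs in \<open>auto simp: M_def\<close>)
      also have "\<dots> = (A * ?A) $$ (h r, h s)" by (rule mult_entry[OF c hN, symmetric])
      finally show ?thesis unfolding GL_inv(2)[OF A(1)] using False hN hinj[of r s] by simp
    qed
    finally show ?thesis .
  qed
  have Zc: "Z \<in> carrier_mat (Suc t) (Suc t)" by (simp add: Z_def)
  have "Z $$ (i, j) = 0" if "i < j" "j < Suc t" for i j using Z[of i j] that by simp
  then have "det Z = prod_list (diag_mat Z)" using det_lower_triangular[of "Suc t" Z] Zc by blast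
  also have "\<dots> = (\<Prod>i = 0..<Suc t. Z $$ (i, i))" using Zc by (simp only: prod_list_diag_prod carrier_matD)
  also have "\<dots> ~= 0" using Z ij0(5) by (auto simp: h_def)
  finally show False using zero unfolding minor_def Z_def by blast
qed

theorem schubert_stabilizer_eq:
  assumes d: "0 < d" and dt: "t < d" "d + t < N" and w: "w = [t + 1..<d + 1] @ [N - t + 1..<N + 1]"
  shows "schubert_stabilizer N w = block_stab N d"
  unfolding schubert_stabilizer_def schubert_variety_eq_detvar[OF assms]
proof (rule subset_antisym; rule subsetI)
  fix A assume "A \<in> {A \<in> carrier (GL N). mat_act A ` detvar N d t = detvar N d t}"
  then show "A \<in> block_stab N d" by (intro detvar_stabilizer[OF dt]) simp_all
next
  fix A assume A: "A \<in> block_stab N d"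
  then have "A \<in> carrier (GL N)" unfolding block_stab_iff by blast
  then show "A \<in> {A \<in> carrier (GL N). mat_act A ` detvar N d t = detvar N d t}" using detvar_image[OF A] by simp
qed

section \<open>Algebraicity of the action\<close>

lemma semihom_single:
  assumes "a \<in> mat_polys N" "hom_poly I k h"
  shows "(%A x. a A * h x) \<in> semihom_polys N I k"
  unfolding semihom_polys_def
  by (rule CollectI, rule exI[of _ 1], rule exI[of _ "%_. a"], rule exI[of _ "%_. h"]) (simp add: assms)

lemma semihom_zero: "(%A x. 0) \<in> semihom_polys N I k"
  unfolding semihom_polys_def
  by (rule CollectI, rule exI[of _ 0], rule exI[of _ "%_ _. 0"], rule exI[of _ "%_ _. 0"]) simp

lemma semihomE:
  assumes "F \<in> semihom_polys N I k"
  obtains n a h where "F = (%A x. \<Sum>m<(n :: nat). a m A * h m x)" "\<forall>m<n. a m \<in> mat_polys N & hom_poly I k (h m)"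
  using assms unfolding semihom_polys_def by (elim CollectE exE conjE) (rule that)

lemma semihom_add:
  assumes "F \<in> semihom_polys N I k" "G \<in> semihom_polys N I k"
  shows "(%A x. F A x + G A x) \<in> semihom_polys N I k"
proof -
  obtain n a h where F: "F = (%A x. \<Sum>m<(n :: nat). a m A * h m x)" "\<forall>m<n. a m \<in> mat_polys N & hom_poly I k (h m)"
    by (rule semihomE[OF assms(1)])
  obtain n' a' h' where G: "G = (%A x. \<Sum>m<(n' :: nat). a' m A * h' m x)" "\<forall>m<n'. a' m \<in> mat_polys N & hom_poly I k (h' m)"
    by (rule semihomE[OF assms(2)])
  define b where "b = (%m. if m < n then a m else a' (m - n))"
  define g where "g = (%m. if m < n then h m else h' (m - n))"
  have "(\<Sum>m<n + n'. b m A * g m x) = (\<Sum>m<n. a m A * h m x) + (\<Sum>m<n'. a' m A * h' m x)" for A x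
  proof -
    have "(\<Sum>m<n + n'. b m A * g m x) = (\<Sum>m<n. b m A * g m x) + (\<Sum>m\<in>{n..<n + n'}. b m A * g m x)"
      by (simp add: lessThan_atLeast0 sum.atLeastLessThan_concat)
    also have "(\<Sum>m\<in>{n..<n + n'}. b m A * g m x) = (\<Sum>m<n'. a' m A * h' m x)"
      by (rule sum.reindex_bij_witness[of _ "%m. n + m" "%m. m - n"]) (auto simp: b_def g_def)
    also have "(\<Sum>m<n. b m A * g m x) = (\<Sum>m<n. a m A * h m x)" by (rule sum.cong) (auto simp: b_def g_def)
    finally show ?thesis .
  qed
  then have "(%A x. F A x + G A x) = (%A x. \<Sum>m<n + n'. b m A * g m x)" unfolding F(1) G(1) by simp
  moreover have "\<forall>m<n + n'. b m \<in> mat_polys N & hom_poly I k (g m)" using F(2) G(2) by (simp add: b_def g_def)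
  ultimately show ?thesis unfolding semihom_polys_def
    by (intro CollectI exI[of _ "n + n'"] exI[of _ b] exI[of _ g] conjI)
qed

lemma semihom_sum:
  "finite S ==> (!!s. s \<in> S ==> F s \<in> semihom_polys N I k) ==> (%A x. \<Sum>s\<in>S. F s A x) \<in> semihom_polys N I k"
proof (induction S rule: finite_induct)
  case empty
  show ?case using semihom_zero by simp
next
  case (insert s S)
  have "(%A x. F s A x + (\<Sum>s\<in>S. F s A x)) \<in> semihom_polys N I k"
    by (rule semihom_add[OF insert.prems insert.IH[OF insert.prems]]) simp_all
  then show ?case using insert.hyps by simp
qed

text \<open>The product of two sums is again a sum of products of the required form; it is indexed by pairs.\<close>

lemma semihom_mult:
  assumes "F \<in> semihom_polys N I k" "G \<in> semihom_polys N I l"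
  shows "(%A x. F A x * G A x) \<in> semihom_polys N I (k + l)"
proof -
  obtain n a h where F: "F = (%A x. \<Sum>m<(n :: nat). a m A * h m x)" "\<forall>m<n. a m \<in> mat_polys N & hom_poly I k (h m)"
    by (rule semihomE[OF assms(1)])
  obtain n' a' h' where G: "G = (%A x. \<Sum>m<(n' :: nat). a' m A * h' m x)" "\<forall>m<n'. a' m \<in> mat_polys N & hom_poly I l (h' m)"
    by (rule semihomE[OF assms(2)])
  have "(%A x. \<Sum>m<n. \<Sum>m'<n'. (a m A * a' m' A) * (h m x * h' m' x)) \<in> semihom_polys N I (k + l)"
  proof (intro semihom_sum)
    fix m m' assume "m \<in> {..<n}" "m' \<in> {..<n'}"
    then have "a m \<in> mat_polys N" "a' m' \<in> mat_polys N" "hom_poly I k (h m)" "hom_poly I l (h' m')" using F(2) G(2) by simp_all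
    then show "(%A x. (a m A * a' m' A) * (h m x * h' m' x)) \<in> semihom_polys N I (k + l)"
      by (intro semihom_single[OF mat_polys.mult hom_poly.mult])
  qed simp_all
  moreover have "(%A x. F A x * G A x) = (%A x. \<Sum>m<n. \<Sum>m'<n'. (a m A * a' m' A) * (h m x * h' m' x))"
    unfolding F(1) G(1) sum_product by (intro ext sum.cong refl) (simp only: mult_ac)
  ultimately show ?thesis by simp
qed

lemma semihom_prod:
  "finite S ==> (!!s. s \<in> S ==> F s \<in> semihom_polys N I 1) ==> (%A x. \<Prod>s\<in>S. F s A x) \<in> semihom_polys N I (card S)"
proof (induction S rule: finite_induct)
  case empty
  show ?case using semihom_single[OF mat_polys.const[of 1 N] hom_poly.const[of I 1]] by simp
next
  case (insert s S)
  have "(%A x. F s A x * (\<Prod>s\<in>S. F s A x)) \<in> semihom_polys N I (1 + card S)"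
    by (rule semihom_mult[OF insert.prems insert.IH[OF insert.prems]]) simp_all
  then show ?case using insert.hyps by simp
qed

lemma semihom_det:
  assumes "!!i j. i < n ==> j < n ==> (%A x. F A x i j) \<in> semihom_polys N I 1"
  shows "(%A x. det (mat n n (%(i, j). F A x i j))) \<in> semihom_polys N I n"
proof -
  have "det (mat n n (%(i, j). F A x i j)) =
      (\<Sum>p | p permutes {0..<n}. signof p * (\<Prod>i = 0..<n. F A x i (p i)))" for A x
    by (subst det_def'[of _ n]) (auto intro!: sum.cong prod.cong simp: permutes_in_image)
  moreover have "(%A x. \<Sum>p | p permutes {0..<n}. signof p * (\<Prod>i = 0..<n. F A x i (p i))) \<in> semihom_polys N I n"
  proof (rule semihom_sum)
    fix p assume "p \<in> {p. p permutes {0..<n}}"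
    then have p: "p i < n" if "i < n" for i using that permutes_in_image[of p "{0..<n}" i] by simp
    have "(%A x. \<Prod>i = 0..<n. F A x i (p i)) \<in> semihom_polys N I (card {0..<n})"
      by (rule semihom_prod) (use assms p in auto)
    from semihom_mult[OF semihom_single[OF mat_polys.const[of "signof p" N] hom_poly.const[of I 1]] this]
    show "(%A x. signof p * (\<Prod>i = 0..<n. F A x i (p i))) \<in> semihom_polys N I n" by simp
  qed (rule finite_permutations, simp)
  ultimately show ?thesis by simp
qed

definition act_form :: "nat => nat => nat set => complex mat => (nat set => complex) => nat set => complex" where
  "act_form N d J A x K = (if K \<in> plucker_index d N
     then x J * det (mat d d (%(i, j). \<Sum>l<N. A $$ (pick K i, l) * chart N d J x $$ (l, j))) else 0)"

lemma semihom_act_form: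
  assumes "d \<le> N" "J \<in> plucker_index d N" "K \<in> plucker_index d N"
  shows "(%A x. act_form N d J A x K) \<in> semihom_polys N (plucker_index d N) (1 + d)"
proof -
  have "(%A x. \<Sum>l<N. A $$ (pick K i, l) * chart N d J x $$ (l, j)) \<in> semihom_polys N (plucker_index d N) 1"
    if "i < d" "j < d" for i j
  proof (rule semihom_sum)
    fix l assume "l \<in> {..<N}"
    then show "(%A x. A $$ (pick K i, l) * chart N d J x $$ (l, j)) \<in> semihom_polys N (plucker_index d N) 1"
      by (intro semihom_single[OF mat_polys.entry hom_poly_chart[OF assms(1,2)]] pick_bij(2)[OF assms(3)] that) simp_all
  qed simp
  then have "(%A x. det (mat d d (%(i, j). \<Sum>l<N. A $$ (pick K i, l) * chart N d J x $$ (l, j)))) \<in>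
      semihom_polys N (plucker_index d N) d" by (rule semihom_det)
  from semihom_mult[OF semihom_single[OF mat_polys.const[of 1 N] hom_poly.coord[OF assms(2)]] this]
  show ?thesis unfolding act_form_def using assms(3) by simp
qed

lemma act_form_plk:
  assumes A: "A \<in> carrier_mat N N" and M: "M \<in> carrier_mat N d" and ch: "chart N d J x = c \<cdot>\<^sub>m M"
  shows "act_form N d J A x K = x J * c ^ d * plk N d (A * M) K"
proof (cases "K \<in> plucker_index d N")
  case True
  have AM: "A * M \<in> carrier_mat N d" by (rule mult_carrier_mat[OF A M])
  have "mat d d (%(i, j). \<Sum>l<N. A $$ (pick K i, l) * chart N d J x $$ (l, j)) =
      mat d d (%(i, j). (c \<cdot>\<^sub>m (A * M)) $$ (pick K i, j))"
  proof (rule eq_matI)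
    fix i j assume "i < dim_row (mat d d (%(i, j). (c \<cdot>\<^sub>m (A * M)) $$ (pick K i, j)))"
      "j < dim_col (mat d d (%(i, j). (c \<cdot>\<^sub>m (A * M)) $$ (pick K i, j)))"
    then have ij: "i < d" "j < d" by simp_all
    have iN: "pick K i < N" by (rule pick_bij(2)[OF True ij(1)])
    have "(\<Sum>l<N. A $$ (pick K i, l) * chart N d J x $$ (l, j)) = (\<Sum>l<N. c * (A $$ (pick K i, l) * M $$ (l, j)))"
      unfolding ch by (rule sum.cong) (use M ij in auto)
    also have "\<dots> = c * (A * M) $$ (pick K i, j)" unfolding mult_entry[OF A M iN ij(2)] by (rule sum_distrib_left[symmetric])
    finally show "mat d d (%(i, j). \<Sum>l<N. A $$ (pick K i, l) * chart N d J x $$ (l, j)) $$ (i, j) =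
        mat d d (%(i, j). (c \<cdot>\<^sub>m (A * M)) $$ (pick K i, j)) $$ (i, j)" using ij iN A M by simp
  qed simp_all
  then have "act_form N d J A x K = x J * plk N d (c \<cdot>\<^sub>m (A * M)) K"
    unfolding act_form_def plk_def using True by simp
  then show ?thesis unfolding plk_smult[OF AM True] by simp
qed (simp add: act_form_def plk_def)

text \<open>The normalized matrix of a point is polynomial in the Pluecker coordinates up to the factor
  \<open>x\<^sub>J\<close>, and the maximal minors of its product with \<open>A\<close> are polynomial in both. The extra factor \<open>x\<^sub>J\<close>
  makes the formula vanish where the chart is not valid.\<close>

lemma algebraic_action_detvar:
  assumes d: "0 < d" "d \<le> N" and G: "G \<subseteq> block_stab N d"
  shows "algebraic_action N G (plucker_index d N) (plucker N) mat_act (detvar N d t)"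
proof -
  let ?PI = "plucker_index d N"
  have c: "A \<in> carrier_mat N N" "A \<in> carrier (GL N)" if "A \<in> G" for A
    using that G block_stab_carrier unfolding block_stab_iff subset_iff by blast+
  have act_form: "x J ~= 0 & (\<exists>M'\<in>carrier_mat N d. full_col_rank M' & plucker N (mat_act A p) = proj_point (plk N d (A * M')) &
      full_col_rank (A * M') & (\<forall>K. act_form N d J A x K = x J * x J ^ d * plk N d (A * M') K))"
    if A: "A \<in> G" and p: "p \<in> detvar N d t" and x: "x \<in> plucker N p" and xJ: "x J ~= 0" for A p x J
  proof -
    obtain M where M: "M \<in> carrier_mat N d" "full_col_rank M" "rank_le t (low d M)" "p = colspan M" by (rule detvarE[OF p])
    have "x \<in> proj_point (plk N d M)" using x unfolding M(4) plucker_colspan[OF M(1,2) d(1)] .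
    then obtain c' where c': "c' ~= 0" "x = (%K. c' * plk N d M K)" by (rule proj_pointE)
    obtain M' where M': "M' \<in> carrier_mat N d" "colspan M' = colspan M" "chart N d J x = x J \<cdot>\<^sub>m M'"
      "x = (%K. x J * plk N d M' K)" by (rule chart_of_plk[OF M(1) c'(2) xJ])
    have "x J = x J * plk N d M' J" using fun_cong[OF M'(4), of J] .
    then have "plk N d M' J ~= 0" using xJ by auto
    then have fr: "full_col_rank M'" by (rule plk_nonzero_full_col_rank[OF M'(1)])
    have fr': "full_col_rank (A * M')" by (rule full_col_rank_GL[OF c(2)[OF A] M'(1) fr])
    have "plucker N (mat_act A p) = proj_point (plk N d (A * M'))"
      unfolding M(4) M'(2)[symmetric] mat_act_colspan[OF c(1)[OF A] M'(1)]
      by (rule plucker_colspan[OF mult_carrier_mat[OF c(1)[OF A] M'(1)] fr' d(1)])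
    then show ?thesis using xJ M'(1) fr fr' act_form_plk[OF c(1)[OF A] M'(1,3)]
      by (intro conjI bexI[of _ M'] allI)
  qed
  show ?thesis unfolding algebraic_action_def
  proof (intro conjI ballI)
    show "mat_act A p \<in> detvar N d t" if "A \<in> G" "p \<in> detvar N d t" for A p
      by (rule block_stab_acts_on_detvar[OF _ that(2)]) (use that(1) G in blast)
    show "mat_act (1\<^sub>m N) p = p" if "p \<in> detvar N d t" for p
      using that by (rule detvarE) (simp add: mat_act_one)
    show "mat_act (A * B) p = mat_act A (mat_act B p)" if "A \<in> G" "B \<in> G" "p \<in> detvar N d t" for A B p
      using that(3) by (rule detvarE) (simp add: mat_act_mult[OF c(1)[OF that(1)] c(1)[OF that(2)]])
    fix A0 p0 assume A0: "A0 \<in> G" and p0: "p0 \<in> detvar N d t"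
    obtain M where M: "M \<in> carrier_mat N d" "full_col_rank M" "rank_le t (low d M)" "p0 = colspan M" by (rule detvarE[OF p0])
    obtain J where J: "J \<in> ?PI" "plk N d M J ~= 0" by (rule full_col_rank_imp_plk[OF M(1,2)])
    have x0: "plk N d M \<in> plucker N p0"
      unfolding M(4) plucker_colspan[OF M(1,2) d(1)] by (rule proj_point_self)
    show "\<exists>k F. (\<forall>i\<in>?PI. (%A x. F A x i) \<in> semihom_polys N ?PI k) &
        (\<forall>i. i \<notin> ?PI --> (\<forall>A x. F A x i = 0)) &
        (\<exists>x\<in>plucker N p0. \<exists>i\<in>?PI. F A0 x i ~= 0) &
        (\<forall>A\<in>G. \<forall>p\<in>detvar N d t. \<forall>x\<in>plucker N p. (\<exists>i\<in>?PI. F A x i ~= 0) -->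
          plucker N (mat_act A p) = proj_point (F A x))"
    proof (rule exI[of _ "1 + d"], rule exI[of _ "act_form N d J"], intro conjI ballI allI impI)
      show "(%A x. act_form N d J A x K) \<in> semihom_polys N ?PI (1 + d)" if "K \<in> ?PI" for K
        by (rule semihom_act_form[OF d(2) J(1) that])
      show "act_form N d J A x K = 0" if "K \<notin> ?PI" for A x K using that by (simp add: act_form_def)
      from act_form[OF A0 p0 x0 J(2)] obtain M' where M': "M' \<in> carrier_mat N d" "full_col_rank (A0 * M')"
        "\<forall>K. act_form N d J A0 (plk N d M) K = plk N d M J * plk N d M J ^ d * plk N d (A0 * M') K"
        by (elim conjE bexE) (rule that)
      obtain K where "K \<in> ?PI" "plk N d (A0 * M') K ~= 0"
        by (rule full_col_rank_imp_plk[OF mult_carrier_mat[OF c(1)[OF A0] M'(1)] M'(2)])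
      then have "act_form N d J A0 (plk N d M) K ~= 0" "K \<in> ?PI" using M'(3) J(2) by simp_all
      then show "\<exists>x\<in>plucker N p0. \<exists>i\<in>?PI. act_form N d J A0 x i ~= 0" using x0 by (intro bexI)
      fix A p x assume A: "A \<in> G" and p: "p \<in> detvar N d t" and x: "x \<in> plucker N p"
        and nz: "\<exists>i\<in>?PI. act_form N d J A x i ~= 0"
      have xJ: "x J ~= 0" using nz by (auto simp: act_form_def)
      from act_form[OF A p x xJ] obtain M' where M': "plucker N (mat_act A p) = proj_point (plk N d (A * M'))"
        "\<forall>K. act_form N d J A x K = x J * x J ^ d * plk N d (A * M') K"
        by (elim conjE bexE) (rule that)
      have "act_form N d J A x = (%K. (x J * x J ^ d) * plk N d (A * M') K)" using M'(2) by (intro ext) simp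
      moreover have "x J * x J ^ d ~= 0" using xJ by simp
      ultimately show "plucker N (mat_act A p) = proj_point (act_form N d J A x)"
        unfolding M'(1) using proj_point_scale[of "x J * x J ^ d" "plk N d (A * M')"] by simp
    qed
  qed
qed

section \<open>Sphericality\<close>

theorem corollary4p1p5:
  fixes d N t :: nat and w :: "nat list"
  assumes "0 < d" and "d < N"
    and "1 \<le> t" and "t < min d (N - d)"
    and "w = [t + 1..<d + 1] @ [N - t + 1..<N + 1]"
  shows "spherical_variety N (levi_part N (schubert_stabilizer N w))
           (plucker_index d N) (plucker N) mat_act (schubert_variety N w)"
proof -
  let ?PI = "plucker_index d N" and ?e = "plucker N" and ?X = "detvar N d t" and ?p = "colspan (base_mat N d t)"
  have dt: "t < d" "d + t < N" and dN: "d \<le> N" using assms(2,4) by linarith+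
  note d = assms(1)
  let ?orb = "(%b. mat_act b ?p) ` block_borel N d"
  from hom_poly_open_form[OF dN, of t] dt obtain k where hom: "hom_poly ?PI k (open_form N d t)" by auto
  have orb: "?e ` ?orb = ?e ` ?X \<inter> nonzero_locus ?PI (open_form N d t)"
    unfolding borel_orbit[OF d dt] by auto
  have base: "?e (mat_act (1\<^sub>m N) ?p) \<in> ?e ` ?orb"
    by (intro imageI) (rule subgroup_GLD(2)[OF block_borel_subgroup])
  have XP: "?e ` ?X \<subseteq> topspace (zariski_proj ?PI)" by (rule closedin_subset[OF plucker_image_detvar_closed[OF d dN]])
  let ?T = "subtopology (zariski_proj ?PI) (?e ` ?X)"
  have open_orb: "openin ?T (?e ` ?orb)"
    unfolding orb by (rule openin_subtopology_Int2[OF openin_nonzero_locus[OF hom]])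
  have dense: "?T closure_of (?e ` ?orb) = ?e ` ?X"
  proof
    show "?T closure_of (?e ` ?orb) \<subseteq> ?e ` ?X"
      using closure_of_subset_topspace[of ?T] XP by (simp add: topspace_subtopology)
    show "?e ` ?X \<subseteq> ?T closure_of (?e ` ?orb)"
    proof
      fix q assume q: "q \<in> ?e ` ?X"
      have "\<exists>y. y \<in> ?e ` ?orb & y \<in> S" if S: "q \<in> S" "openin ?T S" for S
      proof -
        from S(2) obtain U where U: "openin (zariski_proj ?PI) U" "S = U \<inter> ?e ` ?X"
          unfolding openin_subtopology by (elim exE conjE) (rule that)
        have qU: "q \<in> U" using S(1) U(2) by simp
        have b: "?e (mat_act (1\<^sub>m N) ?p) \<in> ?e ` ?X" "?e (mat_act (1\<^sub>m N) ?p) \<in> nonzero_locus ?PI (open_form N d t)"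
          using base unfolding orb by simp_all
        obtain r where "r \<in> ?e ` ?X" "r \<in> nonzero_locus ?PI (open_form N d t)" "r \<in> U"
          by (rule open_locus_dense[OF d dN hom b U(1) qU q])
        then show ?thesis unfolding orb U(2) by (intro exI[of _ r] conjI IntI)
      qed
      then show "q \<in> ?T closure_of (?e ` ?orb)"
        unfolding in_closure_of using q XP by (intro conjI allI impI) (auto simp: topspace_subtopology)
    qed
  qed
  have "\<exists>B. borel_subgroup N (block_diagonal N d) B &
      (\<exists>p\<in>?X. let orb = (%b. mat_act b p) ` B; T = subtopology (zariski_proj ?PI) (?e ` ?X)
        in openin T (?e ` orb) & T closure_of (?e ` orb) = ?e ` ?X)"
    by (rule exI[of _ "block_borel N d"], rule conjI[OF block_borel_borel], rule bexI[OF _ base_point_in_detvar[OF dt]])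
      (unfold Let_def, rule conjI[OF open_orb dense])
  then show ?thesis
    unfolding spherical_variety_def schubert_variety_eq_detvar[OF d dt assms(5)] schubert_stabilizer_eq[OF d dt assms(5)]
      levi_part_block_stab
    by (intro conjI block_diagonal_reductive plucker_inj_on_detvar[OF d] plucker_image_detvar_variety[OF d dN]
        algebraic_action_detvar[OF d dN block_diagonal_sub] plucker_image_detvar_normal[OF d dN])
qed

end
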